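(* For any real number $a$ and all $t\geq 0$, we have, quasi-surely, $$|B_{t}-a|=|a|+\int_{0}^{t}\mathrm{sgn}(B_{s}-a)\,dB_{s}+L^{a}_{t},$$ where $$L^{a}_{t}=\lim_{\varepsilon\rightarrow0}\frac{1}{2\varepsilon}\int_{0}^{t}1_{(a-\varepsilon, a+\varepsilon)}(B_{s})\,d\langle B \rangle_{s},$$ the limit existing in $\mathbb{L}^{2}$, and $L^{a}=(L^a_t)_{t\ge 0}$ is an increasing process. ($L^a$ is called the local time of the $G$-Brownian motion $B$ at $a$.)
   Context: Setting. Fix reals $0\le\underline\sigma\le\overline\sigma$ and put $G(\alpha)=\frac12(\overline\sigma^2\alpha^+-\underline\sigma^2\alpha^-)$, $\alpha\in\mathbb{R}$. Let $\Omega=C_0(\mathbb{R}^+)$ be the space of real continuous functions $\omega$ on $[0,\infty)$ with $\omega_0=0$, with the topology of locally uniform convergence and Borel $\sigma$-algebra $\mathcal{B}(\Omega)$; $B_t(\omega)=\omega_t$ is the coordinate process; $\Omega_t=\{\omega_{\cdot\wedge t}:\omega\in\Omega\}$; $L_b(\Omega_t)$ is the space of bounded real $\mathcal{B}(\Omega_t)$-measurable functions. $\hat{\mathbb{E}}$ is Peng's $G$-expectation: the sublinear expectation (monotone, constant preserving, subadditive, positively homogeneous), defined on cylinder functions $\varphi(\omega_{t_1},\dots,\omega_{t_d})$ with $\varphi$ bounded Lipschitz and on their completion, under which $B$ is a $G$-Brownian motion, i.e. $B_0=0$, and for all $t,s\ge0$ the increment $B_{t+s}-B_t$ is $G$-normally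 distributed $\mathcal{N}(0,[\underline\sigma^2s,\overline\sigma^2s])$ and independent from $(B_{t_1},\dots,B_{t_n})$ for all $0\le t_1\le\dots\le t_n\le t$. Here $\xi\sim\mathcal{N}(0,[\underline\sigma^2,\overline\sigma^2])$ means that for every bounded Lipschitz $\varphi$, $u(t,x)=\hat{\mathbb{E}}[\varphi(x+\sqrt t\,\xi)]$ is the unique viscosity solution of $\partial_tu=G(\partial^2_{xx}u)$, $u(0,\cdot)=\varphi$; and $Y$ is independent from $X$ if $\hat{\mathbb{E}}[\varphi(X,Y)]=\hat{\mathbb{E}}[\hat{\mathbb{E}}[\varphi(x,Y)]_{x=X}]$ for all bounded Lipschitz $\varphi$. There is a weakly compact family $\mathcal{P}$ of probability measures on $(\Omega,\mathcal{B}(\Omega))$ with $\hat{\mathbb{E}}[\cdot]=\sup_{P\in\mathcal{P}}E_P[\cdot]$; this formula is used for all measurable functions. A set $A\in\mathcal B(\Omega)$ is polar if $\hat c(A):=\sup_{P\in\mathcal{P}}P(A)=0$; "quasi-surely" (q.s.) means outside a polar set. $\mathbb{L}^p$ is the space of (q.s. classes of) measurable $X$ with $\|X\|_p=\hat{\mathbb{E}}[|X|^p]^{1/p}<\infty$. $\langle B\rangle_t=\lim\sum_i(B_{t_{i+1}}-B_{t_i})^2=B_t^2-2\int_0^tB_sdB_s$ (limit in $\mathbb{L}^2$ along partitions of $[0,t]$ with mesh tending to $0$) is the quadratic variation process, continuous and increasing q.s. Stochastic integral. $M_{b,0}(0,T)$ is the set of processes $\eta_t=\sum_{j=0}^{n-1}\xi_j1_{[t_j,t_{j+1})}(t)$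 with $0=t_0<\dots<t_n=T$, $\xi_j\in L_b(\Omega_{t_j})$; for such $\eta$, $\int_0^T\eta_sdB_s=\sum_j\xi_j(B_{t_{j+1}}-B_{t_j})$. $\widetilde M_*^2(0,T)$ is the completion of $M_{b,0}(0,T)$ under the norm $(\hat{\mathbb{E}}[\int_0^T|\eta_t|^2d\langle B\rangle_t])^{1/2}$. The map $\eta\mapsto\int_0^T\eta_sdB_s$ extends continuously to $\widetilde M_*^2(0,T)$ with values in $\mathbb{L}^2$. For every $a$ and $T$, the process $\mathrm{sgn}(B_\cdot-a)$ belongs to $\widetilde M_*^2(0,T)$, so that the stochastic integral in the claim is defined. Convention: $\mathrm{sgn}(x)=1$ for $x>0$, $0$ for $x=0$, $-1$ for $x<0$. *)

theory Defs
  imports "HOL-Probability.Probability"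
begin

section \<open>The path space\<close>

text \<open>Continuous functions on the half line that vanish at 0; they are extended by 0 to negative
  times, so that each path is represented by exactly one function on the real line.\<close>

typedef cpath = "{\<omega> :: real \<Rightarrow> real. continuous_on {0..} \<omega> \<and> (\<forall>t\<le>0. \<omega> t = 0)}"
  by (rule exI[of _ "\<lambda>_. 0"]) simp

setup_lifting type_definition_cpath

definition B :: "real \<Rightarrow> cpath \<Rightarrow> real" where
  "B t \<omega> = Rep_cpath \<omega> t"

text \<open>The topology of locally uniform convergence; \<open>borel\<close> at type \<open>cpath\<close> is its Borel
  sigma-algebra.\<close>

instantiation cpath :: topological_space
begin

definition open_cpath :: "cpath set \<Rightarrow> bool" where
  "open_cpath U \<longleftrightarrow>
     (\<forall>\<omega>\<in>U. \<exists>T. \<exists>e>0. {\<omega>'. \<forall>t\<in>{0..T}. \<bar>B t \<omega>' - B t \<omega>\<bar> < e} \<subseteq> U)"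

instance
proof
  show "open (UNIV :: cpath set)"
    by (auto simp: open_cpath_def intro: exI[of _ 1])
next
  fix S T :: "cpath set"
  assume S: "open S" and T: "open T"
  show "open (S \<inter> T)"
    unfolding open_cpath_def
  proof
    fix \<omega> assume \<omega>: "\<omega> \<in> S \<inter> T"
    from \<omega> S obtain T1 e1 where 1: "e1 > 0"
      "{\<omega>'. \<forall>t\<in>{0..T1}. \<bar>B t \<omega>' - B t \<omega>\<bar> < e1} \<subseteq> S"
      unfolding open_cpath_def by blast
    from \<omega> T obtain T2 e2 where 2: "e2 > 0"
      "{\<omega>'. \<forall>t\<in>{0..T2}. \<bar>B t \<omega>' - B t \<omega>\<bar> < e2} \<subseteq> T"
      unfolding open_cpath_def by blast
    have "{\<omega>'. \<forall>t\<in>{0..max T1 T2}. \<bar>B t \<omega>' - B t \<omega>\<bar> < min e1 e2} \<subseteq> S \<inter> T"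
      using 1(2) 2(2) by (force simp: subset_iff)
    moreover have "min e1 e2 > 0"
      using 1(1) 2(1) by simp
    ultimately show "\<exists>T'. \<exists>e>0. {\<omega>'. \<forall>t\<in>{0..T'}. \<bar>B t \<omega>' - B t \<omega>\<bar> < e} \<subseteq> S \<inter> T"
      by blast
  qed
next
  fix K :: "cpath set set"
  assume K: "\<forall>S\<in>K. open S"
  show "open (\<Union>K)"
    unfolding open_cpath_def
  proof
    fix \<omega> assume "\<omega> \<in> \<Union>K"
    then obtain S where S: "S \<in> K" "\<omega> \<in> S" by blast
    with K obtain T e where "e > 0" "{\<omega>'. \<forall>t\<in>{0..T}. \<bar>B t \<omega>' - B t \<omega>\<bar> < e} \<subseteq> S"
      unfolding open_cpath_def by blast
    with S show "\<exists>T. \<exists>e>0. {\<omega>'. \<forall>t\<in>{0..T}. \<bar>B t \<omega>' - B t \<omega>\<bar> < e} \<subseteq> \<Union>K"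
      by (meson Sup_upper order_trans)
  qed
qed

end

lift_definition stopped :: "real \<Rightarrow> cpath \<Rightarrow> cpath" is "\<lambda>t \<omega> s. \<omega> (min s t)"
proof (intro conjI allI impI)
  fix t :: real and \<omega> :: "real \<Rightarrow> real"
  assume \<omega>: "continuous_on {0..} \<omega> \<and> (\<forall>t\<le>0. \<omega> t = 0)"
  show "\<omega> (min s t) = 0" if "s \<le> 0" for s
    using \<omega> that by (simp add: min_le_iff_disj)
  show "continuous_on {0..} (\<lambda>s. \<omega> (min s t))"
  proof (cases "t \<ge> 0")
    case True
    show ?thesis
      by (rule continuous_on_compose2[where g = \<omega> and t = "{0..}"])
        (use \<omega> True in \<open>auto intro!: continuous_intros\<close>)
  next
    case False
    then have "\<omega> (min s t) = 0" for s
      using \<omega> by (simp add: min_le_iff_disj)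
    then show ?thesis by simp
  qed
qed

definition Omega_upto :: "real \<Rightarrow> cpath set" where
  "Omega_upto t = range (stopped t)"

text \<open>A measurable function on \<open>Omega_upto t\<close> is regarded as a function of the whole path via
  stopping at \<open>t\<close>.\<close>

definition L_b :: "real \<Rightarrow> (cpath \<Rightarrow> real) set" where
  "L_b t = {X. bounded (range X) \<and>
     (\<exists>Y \<in> borel_measurable (restrict_space borel (Omega_upto t)). \<forall>\<omega>. X \<omega> = Y (stopped t \<omega>))}"


section \<open>G-expectation\<close>

definition G_fun :: "real \<Rightarrow> real \<Rightarrow> real \<Rightarrow> real" where
  "G_fun vl vu \<alpha> = (vu * max \<alpha> 0 - vl * max (- \<alpha>) 0) / 2"

definition bounded_Lipschitz :: "(real \<Rightarrow> real) \<Rightarrow> bool" where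
  "bounded_Lipschitz \<phi> \<longleftrightarrow> bounded (range \<phi>) \<and> (\<exists>C. C-lipschitz_on UNIV \<phi>)"

text \<open>Bounded Lipschitz functions of \<open>d\<close> real variables, the arguments being the values
  of a sequence at the indices below \<open>d\<close>. The Lipschitz condition forces \<open>\<phi>\<close> to depend on
  these coordinates only.\<close>

definition bounded_Lipschitz_n :: "nat \<Rightarrow> ((nat \<Rightarrow> real) \<Rightarrow> real) \<Rightarrow> bool" where
  "bounded_Lipschitz_n d \<phi> \<longleftrightarrow> bounded (range \<phi>) \<and>
     (\<exists>C. \<forall>x y. \<bar>\<phi> x - \<phi> y\<bar> \<le> C * (\<Sum>i<d. \<bar>x i - y i\<bar>))"

definition cylinder_functions :: "(cpath \<Rightarrow> real) set" where
  "cylinder_functions =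
     {(\<lambda>\<omega>. \<phi> (\<lambda>i. B (\<tau> i) \<omega>)) | \<phi> \<tau>. \<exists>d. bounded_Lipschitz_n d \<phi> \<and> (\<forall>i<d. 0 \<le> \<tau> i)}"

definition sublinear_expectation_on :: "('w \<Rightarrow> real) set \<Rightarrow> (('w \<Rightarrow> real) \<Rightarrow> real) \<Rightarrow> bool" where
  "sublinear_expectation_on H E \<longleftrightarrow>
     (\<forall>X\<in>H. \<forall>Y\<in>H. (\<forall>\<omega>. X \<omega> \<le> Y \<omega>) \<longrightarrow> E X \<le> E Y) \<and>
     (\<forall>c. E (\<lambda>_. c) = c) \<and>
     (\<forall>X\<in>H. \<forall>Y\<in>H. E (\<lambda>\<omega>. X \<omega> + Y \<omega>) \<le> E X + E Y) \<and>
     (\<forall>X\<in>H. \<forall>l\<ge>0. E (\<lambda>\<omega>. l * X \<omega>) = l * E X)"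

text \<open>Test functions with continuous derivatives up to order one in time and two in space on the
  open half plane, together with these derivatives.\<close>

definition C12 ::
  "(real \<Rightarrow> real \<Rightarrow> real) \<Rightarrow> (real \<Rightarrow> real \<Rightarrow> real) \<Rightarrow> (real \<Rightarrow> real \<Rightarrow> real) \<Rightarrow> (real \<Rightarrow> real \<Rightarrow> real) \<Rightarrow> bool"
where
  "C12 \<psi> \<psi>t \<psi>x \<psi>xx \<longleftrightarrow>
     (\<forall>t>0. \<forall>x. ((\<lambda>s. \<psi> s x) has_real_derivative \<psi>t t x) (at t) \<and>
                (\<psi> t has_real_derivative \<psi>x t x) (at x) \<and>
                (\<psi>x t has_real_derivative \<psi>xx t x) (at x)) \<and>
     (\<forall>f\<in>{\<psi>, \<psi>t, \<psi>x, \<psi>xx}. continuous_on ({0<..} \<times> UNIV) (\<lambda>(t, x). f t x))"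

definition viscosity_subsolution :: "(real \<Rightarrow> real) \<Rightarrow> (real \<Rightarrow> real \<Rightarrow> real) \<Rightarrow> bool" where
  "viscosity_subsolution G u \<longleftrightarrow>
     (\<forall>t>0. \<forall>x \<psi> \<psi>t \<psi>x \<psi>xx.
        C12 \<psi> \<psi>t \<psi>x \<psi>xx \<and>
        (\<forall>\<^sub>F (s, y) in nhds (t, x). u s y - \<psi> s y \<le> u t x - \<psi> t x) \<longrightarrow>
        \<psi>t t x \<le> G (\<psi>xx t x))"

definition viscosity_supersolution :: "(real \<Rightarrow> real) \<Rightarrow> (real \<Rightarrow> real \<Rightarrow> real) \<Rightarrow> bool" where
  "viscosity_supersolution G u \<longleftrightarrow>
     (\<forall>t>0. \<forall>x \<psi> \<psi>t \<psi>x \<psi>xx.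
        C12 \<psi> \<psi>t \<psi>x \<psi>xx \<and>
        (\<forall>\<^sub>F (s, y) in nhds (t, x). u s y - \<psi> s y \<ge> u t x - \<psi> t x) \<longrightarrow>
        \<psi>t t x \<ge> G (\<psi>xx t x))"

definition viscosity_solution ::
  "(real \<Rightarrow> real) \<Rightarrow> (real \<Rightarrow> real) \<Rightarrow> (real \<Rightarrow> real \<Rightarrow> real) \<Rightarrow> bool" where
  "viscosity_solution G \<phi> u \<longleftrightarrow>
     continuous_on ({0..} \<times> UNIV) (\<lambda>(t, x). u t x) \<and> (\<forall>x. u 0 x = \<phi> x) \<and>
     viscosity_subsolution G u \<and> viscosity_supersolution G u"

text \<open>Uniqueness is understood among bounded solutions: without a growth restriction it fails
  already for the classical heat equation.\<close>

definition unique_viscosity_solution ::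
  "(real \<Rightarrow> real) \<Rightarrow> (real \<Rightarrow> real) \<Rightarrow> (real \<Rightarrow> real \<Rightarrow> real) \<Rightarrow> bool" where
  "unique_viscosity_solution G \<phi> u \<longleftrightarrow>
     viscosity_solution G \<phi> u \<and>
     (\<forall>v. viscosity_solution G \<phi> v \<and> (\<exists>C. \<forall>t\<ge>0. \<forall>x. \<bar>v t x\<bar> \<le> C) \<longrightarrow>
        (\<forall>t\<ge>0. \<forall>x. v t x = u t x))"

text \<open>The parameters \<open>vl\<close> and \<open>vu\<close> are the lower and upper variance.\<close>

definition G_normal :: "(('w \<Rightarrow> real) \<Rightarrow> real) \<Rightarrow> ('w \<Rightarrow> real) \<Rightarrow> real \<Rightarrow> real \<Rightarrow> bool" where
  "G_normal E \<xi> vl vu \<longleftrightarrow>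
     (\<forall>\<phi>. bounded_Lipschitz \<phi> \<longrightarrow>
        unique_viscosity_solution (G_fun vl vu) \<phi> (\<lambda>t x. E (\<lambda>\<omega>. \<phi> (x + sqrt t * \<xi> \<omega>))))"

text \<open>\<open>Y\<close> is independent from the vector \<open>(X 0, \<dots>, X (n - 1))\<close>; the last argument of the
  test function has index \<open>n\<close>.\<close>

definition independent_from ::
  "(('w \<Rightarrow> real) \<Rightarrow> real) \<Rightarrow> ('w \<Rightarrow> real) \<Rightarrow> nat \<Rightarrow> (nat \<Rightarrow> 'w \<Rightarrow> real) \<Rightarrow> bool" where
  "independent_from E Y n X \<longleftrightarrow>
     (\<forall>\<phi>. bounded_Lipschitz_n (Suc n) \<phi> \<longrightarrow>
        E (\<lambda>\<omega>. \<phi> ((\<lambda>i. X i \<omega>)(n := Y \<omega>))) =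
        E (\<lambda>\<omega>. E (\<lambda>\<omega>'. \<phi> ((\<lambda>i. X i \<omega>)(n := Y \<omega>')))))"

definition G_Brownian_motion ::
  "real \<Rightarrow> real \<Rightarrow> (('w \<Rightarrow> real) \<Rightarrow> real) \<Rightarrow> (real \<Rightarrow> 'w \<Rightarrow> real) \<Rightarrow> bool" where
  "G_Brownian_motion \<sigma>l \<sigma>u E W \<longleftrightarrow>
     (\<forall>\<omega>. W 0 \<omega> = 0) \<and>
     (\<forall>t\<ge>0. \<forall>s\<ge>0.
        G_normal E (\<lambda>\<omega>. W (t + s) \<omega> - W t \<omega>) (\<sigma>l\<^sup>2 * s) (\<sigma>u\<^sup>2 * s) \<and>
        (\<forall>n \<tau>. (\<forall>i<n. 0 \<le> \<tau> i \<and> \<tau> i \<le> t) \<and> mono_on {..<n} \<tau> \<longrightarrow>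
           independent_from E (\<lambda>\<omega>. W (t + s) \<omega> - W t \<omega>) n (\<lambda>i. W (\<tau> i))))"

definition G_expectation :: "real \<Rightarrow> real \<Rightarrow> ((cpath \<Rightarrow> real) \<Rightarrow> real) \<Rightarrow> bool" where
  "G_expectation \<sigma>l \<sigma>u E \<longleftrightarrow>
     sublinear_expectation_on cylinder_functions E \<and> G_Brownian_motion \<sigma>l \<sigma>u E B"


section \<open>Representing families of probability measures\<close>

definition borel_probs :: "'a::topological_space measure set" where
  "borel_probs = {P. prob_space P \<and> sets P = sets borel}"

text \<open>The topology of weak convergence, i.e. the coarsest one on \<open>borel_probs\<close> that makes the
  integrals of all bounded continuous functions continuous.\<close>

definition weak_topology :: "'a::topological_space measure topology" where
  "weak_topology = topology_generated_by
     {{P \<in> borel_probs. (\<integral>\<omega>. f \<omega> \<partial>P) \<in> U} | f U.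
        continuous_on UNIV (f :: 'a \<Rightarrow> real) \<and> bounded (range f) \<and> open U}"

definition represents :: "cpath measure set \<Rightarrow> ((cpath \<Rightarrow> real) \<Rightarrow> real) \<Rightarrow> bool" where
  "represents \<P> E \<longleftrightarrow>
     \<P> \<noteq> {} \<and> \<P> \<subseteq> borel_probs \<and> compactin weak_topology \<P> \<and>
     (\<forall>X\<in>cylinder_functions. E X = (SUP P\<in>\<P>. \<integral>\<omega>. X \<omega> \<partial>P))"

text \<open>The upper expectation of nonnegative functions; for signed functions it is only needed on
  cylinder functions, see \<open>represents\<close>.\<close>

definition upper_expectation :: "cpath measure set \<Rightarrow> (cpath \<Rightarrow> ennreal) \<Rightarrow> ennreal" where
  "upper_expectation \<P> X = (SUP P\<in>\<P>. \<integral>\<^sup>+\<omega>. X \<omega> \<partial>P)"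

definition polar :: "cpath measure set \<Rightarrow> cpath set \<Rightarrow> bool" where
  "polar \<P> A \<longleftrightarrow> A \<in> sets borel \<and> (SUP P\<in>\<P>. emeasure P A) = 0"

definition quasi_surely :: "cpath measure set \<Rightarrow> (cpath \<Rightarrow> bool) \<Rightarrow> bool" where
  "quasi_surely \<P> \<Phi> \<longleftrightarrow> (\<exists>N. polar \<P> N \<and> (\<forall>\<omega>. \<omega> \<notin> N \<longrightarrow> \<Phi> \<omega>))"

text \<open>The square of the norm of \<open>L2\<close>. Elements of \<open>L2\<close> are considered up to
  quasi-sure equality, so only a quasi-sure version has to be measurable.\<close>

definition L2_norm_sq :: "cpath measure set \<Rightarrow> (cpath \<Rightarrow> real) \<Rightarrow> ennreal" where
  "L2_norm_sq \<P> X = upper_expectation \<P> (\<lambda>\<omega>. ennreal (\<bar>X \<omega>\<bar>\<^sup>2))"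

definition L2 :: "cpath measure set \<Rightarrow> (cpath \<Rightarrow> real) set" where
  "L2 \<P> = {X. (\<exists>Y\<in>borel_measurable borel. quasi_surely \<P> (\<lambda>\<omega>. X \<omega> = Y \<omega>)) \<and> L2_norm_sq \<P> X < \<infinity>}"

definition L2_tendsto ::
  "cpath measure set \<Rightarrow> ('i \<Rightarrow> cpath \<Rightarrow> real) \<Rightarrow> (cpath \<Rightarrow> real) \<Rightarrow> 'i filter \<Rightarrow> bool" where
  "L2_tendsto \<P> X Y F \<longleftrightarrow>
     (\<forall>\<^sub>F i in F. X i \<in> L2 \<P>) \<and> Y \<in> L2 \<P> \<and>
     ((\<lambda>i. L2_norm_sq \<P> (\<lambda>\<omega>. X i \<omega> - Y \<omega>)) \<longlongrightarrow> 0) F"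


section \<open>Quadratic variation and stochastic integral\<close>

definition partition_of :: "real \<Rightarrow> nat \<Rightarrow> (nat \<Rightarrow> real) \<Rightarrow> bool" where
  "partition_of T n \<tau> \<longleftrightarrow> \<tau> 0 = 0 \<and> \<tau> n = T \<and> (\<forall>j<n. \<tau> j < \<tau> (Suc j))"

text \<open>\<open>Q\<close> is a version of the quadratic variation process of \<open>B\<close>.\<close>

definition quadratic_variation :: "cpath measure set \<Rightarrow> (real \<Rightarrow> cpath \<Rightarrow> real) \<Rightarrow> bool" where
  "quadratic_variation \<P> Q \<longleftrightarrow>
     (\<forall>t\<ge>0. Q t \<in> L2 \<P> \<and>
        (\<forall>e>0. \<exists>\<delta>>0. \<forall>n \<tau>. partition_of t n \<tau> \<and> (\<forall>j<n. \<tau> (Suc j) - \<tau> j < \<delta>) \<longrightarrow>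
           L2_norm_sq \<P> (\<lambda>\<omega>. (\<Sum>j<n. (B (\<tau> (Suc j)) \<omega> - B (\<tau> j) \<omega>)\<^sup>2) - Q t \<omega>) < e)) \<and>
     quasi_surely \<P> (\<lambda>\<omega>. continuous_on {0..} (\<lambda>t. Q t \<omega>) \<and> mono_on {0..} (\<lambda>t. Q t \<omega>))"

text \<open>The Lebesgue-Stieltjes measure of a path of \<open>Q\<close>. Freezing the path at negative times puts
  no mass on the negative half line and no atom at 0.\<close>

definition dQ :: "(real \<Rightarrow> cpath \<Rightarrow> real) \<Rightarrow> cpath \<Rightarrow> real measure" where
  "dQ Q \<omega> = interval_measure (\<lambda>s. Q (max 0 s) \<omega>)"

text \<open>The space \<open>M_{b,0}(0,T)\<close> is described through the data \<open>(n, \<tau>, \<xi>)\<close> of its elements.\<close>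

definition simple_data :: "real \<Rightarrow> nat \<Rightarrow> (nat \<Rightarrow> real) \<Rightarrow> (nat \<Rightarrow> cpath \<Rightarrow> real) \<Rightarrow> bool" where
  "simple_data T n \<tau> \<xi> \<longleftrightarrow> partition_of T n \<tau> \<and> (\<forall>j<n. \<xi> j \<in> L_b (\<tau> j))"

definition simple_process ::
  "nat \<Rightarrow> (nat \<Rightarrow> real) \<Rightarrow> (nat \<Rightarrow> cpath \<Rightarrow> real) \<Rightarrow> real \<Rightarrow> cpath \<Rightarrow> real" where
  "simple_process n \<tau> \<xi> t \<omega> = (\<Sum>j<n. \<xi> j \<omega> * indicator {\<tau> j..<\<tau> (Suc j)} t)"

definition simple_integral ::
  "nat \<Rightarrow> (nat \<Rightarrow> real) \<Rightarrow> (nat \<Rightarrow> cpath \<Rightarrow> real) \<Rightarrow> cpath \<Rightarrow> real" where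
  "simple_integral n \<tau> \<xi> \<omega> = (\<Sum>j<n. \<xi> j \<omega> * (B (\<tau> (Suc j)) \<omega> - B (\<tau> j) \<omega>))"

definition M2_norm_sq ::
  "cpath measure set \<Rightarrow> (real \<Rightarrow> cpath \<Rightarrow> real) \<Rightarrow> real \<Rightarrow> (real \<Rightarrow> cpath \<Rightarrow> real) \<Rightarrow> ennreal" where
  "M2_norm_sq \<P> Q T \<eta> =
     upper_expectation \<P> (\<lambda>\<omega>. \<integral>\<^sup>+t\<in>{0..T}. ennreal (\<bar>\<eta> t \<omega>\<bar>\<^sup>2) \<partial>dQ Q \<omega>)"

definition approximates ::
  "cpath measure set \<Rightarrow> (real \<Rightarrow> cpath \<Rightarrow> real) \<Rightarrow> real \<Rightarrow> (real \<Rightarrow> cpath \<Rightarrow> real) \<Rightarrow>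
   (nat \<Rightarrow> nat) \<Rightarrow> (nat \<Rightarrow> nat \<Rightarrow> real) \<Rightarrow> (nat \<Rightarrow> nat \<Rightarrow> cpath \<Rightarrow> real) \<Rightarrow> bool" where
  "approximates \<P> Q T \<eta> n \<tau> \<xi> \<longleftrightarrow>
     (\<forall>k. simple_data T (n k) (\<tau> k) (\<xi> k)) \<and>
     (\<lambda>k. M2_norm_sq \<P> Q T (\<lambda>t \<omega>. simple_process (n k) (\<tau> k) (\<xi> k) t \<omega> - \<eta> t \<omega>)) \<longlonglongrightarrow> 0"

text \<open>The processes that belong to the completion of \<open>M_{b,0}(0,T)\<close>.\<close>

definition M2_star ::
  "cpath measure set \<Rightarrow> (real \<Rightarrow> cpath \<Rightarrow> real) \<Rightarrow> real \<Rightarrow> (real \<Rightarrow> cpath \<Rightarrow> real) set" where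
  "M2_star \<P> Q T = {\<eta>. \<exists>n \<tau> \<xi>. approximates \<P> Q T \<eta> n \<tau> \<xi>}"

text \<open>\<open>I\<close> represents, up to quasi-sure equality, the value at \<open>\<eta>\<close> of the continuous extension of \<open>simple_integral\<close>
  to the completion.\<close>

definition has_stochastic_integral ::
  "cpath measure set \<Rightarrow> (real \<Rightarrow> cpath \<Rightarrow> real) \<Rightarrow> real \<Rightarrow> (real \<Rightarrow> cpath \<Rightarrow> real) \<Rightarrow>
   (cpath \<Rightarrow> real) \<Rightarrow> bool" where
  "has_stochastic_integral \<P> Q T \<eta> I \<longleftrightarrow>
     \<eta> \<in> M2_star \<P> Q T \<and>
     (\<forall>n \<tau> \<xi>. approximates \<P> Q T \<eta> n \<tau> \<xi> \<longrightarrow>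
        L2_tendsto \<P> (\<lambda>k. simple_integral (n k) (\<tau> k) (\<xi> k)) I sequentially)"

definition stochastic_integral ::
  "cpath measure set \<Rightarrow> (real \<Rightarrow> cpath \<Rightarrow> real) \<Rightarrow> real \<Rightarrow> (real \<Rightarrow> cpath \<Rightarrow> real) \<Rightarrow>
   cpath \<Rightarrow> real" where
  "stochastic_integral \<P> Q T \<eta> = (SOME I. has_stochastic_integral \<P> Q T \<eta> I)"

end

theory Submission
  imports Defs
begin

text \<open>Under each measure \<open>P\<close> of the representing family, \<open>B\<close> is a martingale whose increments
  over time \<open>s\<close> have conditional variance at most \<open>\<sigma>u\<^sup>2 s\<close>; both facts come from bounding the viscosity
  solution of the G-heat equation by quadratic supersolutions. All estimates are made under a single \<open>P\<close> with
  constants that depend only on \<open>\<sigma>u\<close> and \<open>t\<close>, hence hold for the supremum over \<open>P\<close>.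

  Ito's formula for a \<open>C\<^sup>1\<close> smoothing \<open>f\<close> of \<open>\<bar>x - a\<bar>\<close> at scale \<open>\<epsilon>\<close>, with \<open>\<bar>f'\<bar> \<le> 1\<close> and \<open>f''\<close> equal to
  \<open>1 / \<epsilon>\<close> on \<open>(a - \<epsilon>, a + \<epsilon>)\<close> and to \<open>0\<close> elsewhere, bounds the mean of the time that \<open>B\<close> spends in this
  interval, measured by the quadratic variation, by a multiple of \<open>\<epsilon>\<close>; no density estimate is needed, so the
  degenerate case \<open>\<sigma>l = 0\<close> is covered. Since \<open>f'(B)\<close> and \<open>sgn (B - a)\<close> differ only during that time, the
  stochastic integrals converge as \<open>\<epsilon>\<close> tends to 0, and the remaining term of Ito's formula converges to the
  local time.\<close>

section \<open>Paths and adapted random variables\<close>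

text \<open>The measures of the family may be mutually singular, so limits taken under each of them
  separately do not fit together into one random variable. The local time is therefore defined path
  by path, as an upper limit along the fixed scales 16^-k, and each measure only certifies that this
  upper limit is a limit. Likewise the given quadratic variation, determined only up to polar sets,
  is exchanged for a version all of whose paths are continuous and increasing.

  Ito's formula by Taylor expansion wants a Lipschitz second derivative, but f'' jumps at a -
  \<epsilon> and a + \<epsilon>. A second smoothing at a scale \<delta> removes the jumps, and the
  isometry survives \<delta> tending to 0 because its bound involves only f'.

  No stochastic integral is constructed. The candidate is |B_t - a| - |a| - L_t, what Tanaka's
  formula leaves; its squared distance to every simple integral is at most a constant times that of
  the integrands. For the smoothed functions the same kind of estimate, taken against the zero
  process, bounds the martingale part in mean square, and this is the source of the occupation
  bound.\<close>

lemma B_nonpos: "t \<le> 0 \<Longrightarrow> B t \<omega> = 0"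
  unfolding B_def using Rep_cpath[of \<omega>] by auto

lemma continuous_B: "continuous_on A (\<lambda>t. B t \<omega>)"
proof -
  have "continuous_on ({..0} \<union> {0..}) (\<lambda>t. B t \<omega>)"
  proof (rule continuous_on_closed_Un)
    show "continuous_on {..0} (\<lambda>t. B t \<omega>)"
      by (subst continuous_on_cong[OF refl, of _ _ "\<lambda>_. 0"]) (auto simp: B_nonpos)
    show "continuous_on {0..} (\<lambda>t. B t \<omega>)"
      unfolding B_def using Rep_cpath[of \<omega>] by auto
  qed auto
  moreover have "{..0} \<union> {0..} = (UNIV :: real set)" by auto
  ultimately show ?thesis using continuous_on_subset by (metis top_greatest)
qed

lemma B_stopped: "B r (stopped s \<omega>) = B (min r s) \<omega>"
  unfolding B_def by transfer simp

lemma cpath_eqI: "(\<And>t. B t \<omega> = B t \<omega>') \<Longrightarrow> \<omega> = \<omega>'"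
  unfolding B_def by (metis Rep_cpath_inject ext)

lemma stopped_stopped: "stopped s (stopped t \<omega>) = stopped (min s t) \<omega>"
  by (rule cpath_eqI) (simp add: B_stopped min.assoc)

lemma open_B_vimage:
  assumes "open U" shows "open (B t -` U)"
  unfolding open_cpath_def
proof
  fix \<omega> assume "\<omega> \<in> B t -` U"
  then obtain e where e: "e > 0" "\<And>y. \<bar>y - B t \<omega>\<bar> < e \<Longrightarrow> y \<in> U"
    using assms unfolding open_dist dist_real_def by auto
  show "\<exists>T. \<exists>e>0. {\<omega>'. \<forall>t\<in>{0..T}. \<bar>B t \<omega>' - B t \<omega>\<bar> < e} \<subseteq> B t -` U"
  proof (cases "t \<ge> 0")
    case True
    then show ?thesis using e by (intro exI[of _ t] exI[of _ e]) auto
  next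
    case False
    then have "B t \<omega>' = 0" for \<omega>' by (simp add: B_nonpos)
    then have "\<omega>' \<in> B t -` U" for \<omega>' using e(1) e(2)[of "B t \<omega>'"] by simp
    then show ?thesis using e(1) by blast
  qed
qed

lemma continuous_on_B: "continuous_on UNIV (B t)"
  by (simp add: continuous_on_open_vimage open_B_vimage)

lemma measurable_B [measurable]: "B t \<in> borel_measurable borel"
  by (rule borel_measurable_continuous_onI[OF continuous_on_B])

lemma continuous_on_stopped: "continuous_on UNIV (stopped s)"
proof -
  have "open (stopped s -` U)" if U: "open U" for U
    unfolding open_cpath_def
  proof
    fix \<omega> assume "\<omega> \<in> stopped s -` U"
    then obtain T e where e: "e > 0"
      and *: "{\<omega>'. \<forall>t\<in>{0..T}. \<bar>B t \<omega>' - B t (stopped s \<omega>)\<bar> < e} \<subseteq> U"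
      using U unfolding open_cpath_def by auto
    have "\<bar>B t (stopped s \<omega>') - B t (stopped s \<omega>)\<bar> < e"
      if "\<forall>t\<in>{0..T}. \<bar>B t \<omega>' - B t \<omega>\<bar> < e" "t \<in> {0..T}" for \<omega>' t
    proof (cases "min t s \<ge> 0")
      case True then show ?thesis using that by (auto simp: B_stopped)
    next
      case False then have "min t s \<le> 0" by linarith
      then show ?thesis using e by (simp add: B_stopped B_nonpos del: min_le_iff_disj)
    qed
    then have "{\<omega>'. \<forall>t\<in>{0..T}. \<bar>B t \<omega>' - B t \<omega>\<bar> < e} \<subseteq> stopped s -` U"
      using * by blast
    then show "\<exists>T. \<exists>e>0. {\<omega>'. \<forall>t\<in>{0..T}. \<bar>B t \<omega>' - B t \<omega>\<bar> < e} \<subseteq> stopped s -` U"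
      using e by blast
  qed
  then show ?thesis by (simp add: continuous_on_open_vimage)
qed

lemma measurable_stopped [measurable]: "stopped s \<in> borel \<rightarrow>\<^sub>M borel"
  by (rule borel_measurable_continuous_onI[OF continuous_on_stopped])

text \<open>Rounded times take countably many values. Path continuity then reduces joint
  measurability, and later the choice of a good version of the quadratic variation, to fixed
  times.\<close>

lemma floor_grid_tendsto: "(\<lambda>n. of_int \<lfloor>of_nat (Suc n) * s\<rfloor> / of_nat (Suc n)) \<longlonglongrightarrow> (s::real)"
proof (rule real_tendsto_sandwich)
  show "\<forall>\<^sub>F n in sequentially. s - 1 / of_nat (Suc n) \<le> of_int \<lfloor>of_nat (Suc n) * s\<rfloor> / of_nat (Suc n)"
  proof (rule always_eventually, rule allI)
    fix n
    have "(of_nat (Suc n) * s - 1) / of_nat (Suc n) \<le> of_int \<lfloor>of_nat (Suc n) * s\<rfloor> / of_nat (Suc n)"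
      by (rule divide_right_mono) linarith+
    then show "s - 1 / of_nat (Suc n) \<le> of_int \<lfloor>of_nat (Suc n) * s\<rfloor> / of_nat (Suc n)"
      by (simp only: diff_divide_distrib) simp
  qed
  show "\<forall>\<^sub>F n in sequentially. of_int \<lfloor>of_nat (Suc n) * s\<rfloor> / of_nat (Suc n) \<le> s"
  proof (rule always_eventually, rule allI)
    fix n
    have "of_int \<lfloor>of_nat (Suc n) * s\<rfloor> \<le> of_nat (Suc n) * s" by linarith
    then show "of_int \<lfloor>of_nat (Suc n) * s\<rfloor> / of_nat (Suc n) \<le> s"
      by (simp add: field_simps)
  qed
  have "(\<lambda>n. s - 1 / of_nat (Suc n)) \<longlonglongrightarrow> s - 0"
    using LIMSEQ_Suc[OF lim_1_over_n] by (intro tendsto_diff tendsto_const) auto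
  then show "(\<lambda>n. s - 1 / of_nat (Suc n)) \<longlonglongrightarrow> s" by simp
qed auto

lemma measurable_B_pair [measurable]: "(\<lambda>(\<omega>, s). B s \<omega>) \<in> borel_measurable (borel \<Otimes>\<^sub>M borel)"
proof (rule borel_measurable_LIMSEQ_real)
  fix p :: "cpath \<times> real"
  have "continuous_on UNIV (\<lambda>t. B t (fst p))" by (rule continuous_B)
  then show "(\<lambda>n. B (of_int \<lfloor>of_nat (Suc n) * snd p\<rfloor> / of_nat (Suc n)) (fst p)) \<longlonglongrightarrow> (case p of (\<omega>, s) \<Rightarrow> B s \<omega>)"
    unfolding split_beta by (rule continuous_on_tendsto_compose) (use floor_grid_tendsto in auto)
next
  fix n
  show "(\<lambda>p :: cpath \<times> real. B (of_int \<lfloor>of_nat (Suc n) * snd p\<rfloor> / of_nat (Suc n)) (fst p)) \<in> borel_measurable (borel \<Otimes>\<^sub>M borel)"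
  proof (rule measurable_compose_countable[where f="\<lambda>i p. B (of_int i / of_nat (Suc n)) (fst p)"])
    show "(\<lambda>p :: cpath \<times> real. B (real_of_int i / real (Suc n)) (fst p)) \<in> borel_measurable (borel \<Otimes>\<^sub>M borel)" for i
      by (rule measurable_compose[OF measurable_fst measurable_B])
    have "(\<lambda>p :: cpath \<times> real. real (Suc n) * snd p) \<in> borel_measurable (borel \<Otimes>\<^sub>M borel)"
      by (intro borel_measurable_times measurable_const measurable_snd) auto
    then show "(\<lambda>p :: cpath \<times> real. \<lfloor>real (Suc n) * snd p\<rfloor>) \<in> borel \<Otimes>\<^sub>M borel \<rightarrow>\<^sub>M count_space UNIV"
      by (rule measurable_compose[OF _ measurable_real_floor])
  qed
qed

lemma measurable_B_pair':
  assumes [measurable]: "f \<in> M \<rightarrow>\<^sub>M borel" "g \<in> M \<rightarrow>\<^sub>M borel"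
  shows "(\<lambda>x. B (f x) (g x)) \<in> borel_measurable M"
proof -
  have "(\<lambda>x. (\<lambda>(\<omega>, s). B s \<omega>) (g x, f x)) \<in> borel_measurable M"
    by (rule measurable_compose[OF _ measurable_B_pair]) measurable
  then show ?thesis by simp
qed

text \<open>Adaptedness is encoded as Borel measurability together with invariance under stopping,
  so that no filtration of sub-sigma-algebras is carried along and closure properties are checked
  path by path.\<close>

definition adapted :: "real \<Rightarrow> (cpath \<Rightarrow> real) \<Rightarrow> bool" where
  "adapted s X \<longleftrightarrow> X \<in> borel_measurable borel \<and> (\<forall>\<omega>. X (stopped s \<omega>) = X \<omega>)"

lemma adapted_measurable: "adapted s X \<Longrightarrow> X \<in> borel_measurable borel"
  by (simp add: adapted_def)

lemma adapted_mono: "adapted s X \<Longrightarrow> s \<le> t \<Longrightarrow> adapted t X"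
  unfolding adapted_def by (metis min.absorb1 stopped_stopped)

lemma adapted_B: "r \<le> s \<Longrightarrow> adapted s (B r)"
  unfolding adapted_def by (auto simp: B_stopped min.absorb1)

lemma adapted_const: "adapted s (\<lambda>_. c)"
  by (simp add: adapted_def)

lemma adapted_compose: "adapted s X \<Longrightarrow> h \<in> borel_measurable borel \<Longrightarrow> adapted s (\<lambda>\<omega>. h (X \<omega>))"
  by (auto simp: adapted_def)

lemma adapted_mult: "adapted s X \<Longrightarrow> adapted s Y \<Longrightarrow> adapted s (\<lambda>\<omega>. X \<omega> * Y \<omega>)"
  by (auto simp: adapted_def)

lemma adapted_diff: "adapted s X \<Longrightarrow> adapted s Y \<Longrightarrow> adapted s (\<lambda>\<omega>. X \<omega> - Y \<omega>)"
  by (auto simp: adapted_def)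

text \<open>Stopping is idempotent, so a function that factors through \<open>stopped t\<close> is
  invariant under it; conversely an invariant function is its own factor on the stopped
  paths.\<close>

lemma L_b_iff: "X \<in> L_b t \<longleftrightarrow> bounded (range X) \<and> adapted t X"
proof safe
  assume X: "X \<in> L_b t"
  then show "bounded (range X)" by (simp add: L_b_def)
  from X obtain Y where Y: "Y \<in> borel_measurable (restrict_space borel (Omega_upto t))"
    and XY: "\<And>\<omega>. X \<omega> = Y (stopped t \<omega>)" by (auto simp: L_b_def)
  have "stopped t \<in> borel \<rightarrow>\<^sub>M restrict_space borel (Omega_upto t)"
    by (rule measurable_restrict_space2) (auto simp: Omega_upto_def)
  from measurable_compose[OF this Y] have "X \<in> borel_measurable borel"
    using XY by (simp cong: measurable_cong)
  then show "adapted t X" by (auto simp: adapted_def XY stopped_stopped)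
next
  assume b: "bounded (range X)" and a: "adapted t X"
  have "X \<in> borel_measurable (restrict_space borel (Omega_upto t))"
    using a by (intro measurable_restrict_space1) (simp add: adapted_def)
  then show "X \<in> L_b t" using a b unfolding L_b_def adapted_def
    by (auto intro!: bexI[of _ X])
qed

section \<open>Moment bounds from the G-heat equation\<close>

text \<open>The parabola moved upwards at a speed above G(2\<alpha>) = \<alpha> * vu is a strict
  supersolution. If \<open>u\<close> exceeded it somewhere, the difference would have a positive
  global maximum at a positive time, where the subsolution property with this very test function
  contradicts the speed.\<close>

lemma viscosity_strict_quadratic_bound:
  fixes u :: "real \<Rightarrow> real \<Rightarrow> real"
  assumes cont: "continuous_on ({0..} \<times> UNIV) (\<lambda>(t, x). u t x)"
    and bd: "\<And>t x. t \<ge> 0 \<Longrightarrow> u t x \<le> C"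
    and sub: "viscosity_subsolution (G_fun vl vu) u"
    and init: "\<And>x. u 0 x \<le> \<alpha> * x\<^sup>2 + \<beta> * x + \<gamma>"
    and \<alpha>: "\<alpha> > 0" and vu: "vu \<ge> 0" and \<eta>: "\<eta> > 0" and t0: "t0 \<ge> 0"
  shows "u t0 x0 \<le> \<alpha> * x0\<^sup>2 + \<beta> * x0 + \<gamma> + (\<alpha> * vu + \<eta>) * t0"
proof (rule ccontr)
  define q where "q x = \<alpha> * x\<^sup>2 + \<beta> * x + \<gamma>" for x
  \<comment> \<open>The term \<open>\<eta> t\<close> makes the supersolution strict and lets \<open>u - \<psi>\<close> attain its maximum on the whole half plane.\<close>
  define \<psi> where "\<psi> t x = q x + (\<alpha> * vu + \<eta>) * t" for t x
  assume "\<not> ?thesis"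
  then have pos: "u t0 x0 - \<psi> t0 x0 > 0" by (simp add: \<psi>_def q_def)
  \<comment> \<open>\<open>m\<close> is the minimum of \<open>q\<close>, found by completing the
    square.\<close>
  define m where "m = \<gamma> - \<beta>\<^sup>2 / (4 * \<alpha>)"
  have q_m: "q x \<ge> m" for x
  proof -
    have "q x - m = \<alpha> * (x + \<beta> / (2 * \<alpha>))\<^sup>2"
      using \<alpha> by (simp add: q_def m_def field_simps power2_eq_square)
    moreover have "\<dots> \<ge> 0" using \<alpha> by simp
    ultimately show ?thesis by simp
  qed
  \<comment> \<open>Beyond \<open>R0\<close> the square dominates the linear term and the constants,
    and \<open>q\<close> alone is at least \<open>C\<close>; the 1 in the maximum lets \<bar>x\<bar>
    \<ge> 1 absorb the constants.\<close>
  define R0 where "R0 = max 1 ((\<bar>\<beta>\<bar> + \<bar>\<gamma>\<bar> + \<bar>C\<bar>) / \<alpha> + 1)"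
  have q_C: "q x \<ge> C" if x: "\<bar>x\<bar> \<ge> R0" for x
  proof -
    have x1: "\<bar>x\<bar> \<ge> 1" using x by (simp add: R0_def)
    have "\<bar>x\<bar> \<ge> (\<bar>\<beta>\<bar> + \<bar>\<gamma>\<bar> + \<bar>C\<bar>) / \<alpha>" using x by (simp add: R0_def)
    then have "\<alpha> * \<bar>x\<bar> \<ge> \<bar>\<beta>\<bar> + \<bar>\<gamma>\<bar> + \<bar>C\<bar>" using \<alpha> by (simp add: field_simps)
    then have "\<bar>x\<bar> * (\<alpha> * \<bar>x\<bar> - \<bar>\<beta>\<bar>) \<ge> 1 * (\<bar>\<gamma>\<bar> + \<bar>C\<bar>)"
      using x1 by (intro mult_mono) auto
    moreover have "\<beta> * x \<ge> - (\<bar>\<beta>\<bar> * \<bar>x\<bar>)" by (metis abs_ge_minus_self abs_mult minus_le_iff)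
    moreover have "x\<^sup>2 = \<bar>x\<bar> * \<bar>x\<bar>" by (simp add: power2_eq_square)
    then have "q x = \<bar>x\<bar> * (\<alpha> * \<bar>x\<bar> - \<bar>\<beta>\<bar>) + (\<bar>\<beta>\<bar> * \<bar>x\<bar> + \<beta> * x) + \<gamma>"
      unfolding q_def by (simp only:) (simp only: algebra_simps)
    moreover have "- \<bar>\<gamma>\<bar> \<le> \<gamma>" "C \<le> \<bar>C\<bar>" by auto
    ultimately show ?thesis by (smt (verit))
  qed
  \<comment> \<open>After time \<open>T\<close> the term \<eta> t is at least \<open>C - m\<close>,
    so \<open>\<psi>\<close> lies above \<open>u\<close> for every \<open>x\<close>.\<close>
  define T where "T = max t0 ((C - m) / \<eta>)"
  define R where "R = max \<bar>x0\<bar> R0"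
  define K where "K = {0..T} \<times> {-R..R}"
  have "continuous_on K (\<lambda>z. u (fst z) (snd z))"
    using continuous_on_subset[OF cont, of K] by (simp add: K_def split_beta Sigma_mono)
  then have "continuous_on K (\<lambda>z. u (fst z) (snd z) - \<psi> (fst z) (snd z))"
    unfolding \<psi>_def q_def by (intro continuous_intros)
  moreover have "compact K" unfolding K_def by (intro compact_Times compact_Icc)
  moreover have K0: "(t0, x0) \<in> K" using t0 by (auto simp: K_def T_def R_def)
  ultimately obtain z where z: "z \<in> K"
    and zmax: "\<And>z'. z' \<in> K \<Longrightarrow> u (fst z') (snd z') - \<psi> (fst z') (snd z') \<le> u (fst z) (snd z) - \<psi> (fst z) (snd z)"
    using continuous_attains_sup[of K "\<lambda>z. u (fst z) (snd z) - \<psi> (fst z) (snd z)"] by blast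
  obtain t1 x1 where [simp]: "z = (t1, x1)" by (cases z)
  have t1: "t1 \<ge> 0" using z by (simp add: K_def)
  have pos1: "u t1 x1 - \<psi> t1 x1 > 0" using zmax[OF K0] pos by simp
  have glob: "u t x - \<psi> t x \<le> u t1 x1 - \<psi> t1 x1" if t: "t \<ge> 0" for t x
  proof (cases "(t, x) \<in> K")
    case True then show ?thesis using zmax[of "(t, x)"] by simp
  next
    case False
    then consider "t > T" | "\<bar>x\<bar> > R" using t by (auto simp: K_def)
    then have "\<psi> t x \<ge> C"
    proof cases
      case 1
      then have "t \<ge> (C - m) / \<eta>" by (simp add: T_def)
      then have "\<eta> * t \<ge> C - m" using \<eta> by (simp add: field_simps)
      moreover have "\<alpha> * vu * t \<ge> 0" using \<alpha> vu t by simp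
      ultimately show ?thesis using q_m[of x] by (simp add: \<psi>_def algebra_simps)
    next
      case 2
      then have "q x \<ge> C" by (intro q_C) (simp add: R_def)
      moreover have "(\<alpha> * vu + \<eta>) * t \<ge> 0" using \<alpha> vu \<eta> t by simp
      ultimately show ?thesis by (simp add: \<psi>_def)
    qed
    then show ?thesis using bd[OF t, of x] pos1 by linarith
  qed
  \<comment> \<open>The initial bound says that \<open>u - \<psi>\<close> is at most 0 at time 0,
    which keeps the positive maximum away from the boundary.\<close>
  have "t1 \<noteq> 0"
    using pos1 init[of x1] by (auto simp: \<psi>_def q_def)
  then have t1: "t1 > 0" using t1 by simp
  have C12: "C12 \<psi> (\<lambda>_ _. \<alpha> * vu + \<eta>) (\<lambda>_ x. 2 * \<alpha> * x + \<beta>) (\<lambda>_ _. 2 * \<alpha>)"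
    unfolding C12_def \<psi>_def[abs_def] q_def
    by (auto intro!: derivative_eq_intros continuous_intros simp: split_beta)
  have "\<forall>\<^sub>F z in nhds (t1, x1). (0::real) < fst z"
  proof -
    have "open ({0::real<..} \<times> (UNIV :: real set))" by (intro open_Times) auto
    then show ?thesis using t1 eventually_nhds_in_open[of "{0::real<..} \<times> UNIV" "(t1, x1)"]
      by (auto elim!: eventually_mono)
  qed
  then have "\<forall>\<^sub>F (s, y) in nhds (t1, x1). u s y - \<psi> s y \<le> u t1 x1 - \<psi> t1 x1"
    by eventually_elim (use glob in auto)
  with C12 sub t1 have "\<alpha> * vu + \<eta> \<le> G_fun vl vu (2 * \<alpha>)"
    unfolding viscosity_subsolution_def by blast
  then show False using \<alpha> \<eta> by (simp add: G_fun_def mult.commute)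
qed

lemma viscosity_quadratic_bound:
  fixes u :: "real \<Rightarrow> real \<Rightarrow> real"
  assumes cont: "continuous_on ({0..} \<times> UNIV) (\<lambda>(t, x). u t x)"
    and bd: "\<And>t x. t \<ge> 0 \<Longrightarrow> u t x \<le> C"
    and sub: "viscosity_subsolution (G_fun vl vu) u"
    and init: "\<And>x. u 0 x \<le> \<alpha> * x\<^sup>2 + \<beta> * x + \<gamma>"
    and \<alpha>: "\<alpha> > 0" and vu: "vu \<ge> 0" and t0: "t0 \<ge> 0"
  shows "u t0 x0 \<le> \<alpha> * x0\<^sup>2 + \<beta> * x0 + \<gamma> + \<alpha> * vu * t0"
proof (rule field_le_epsilon)
  fix e :: real assume e: "e > 0"
  \<comment> \<open>The slack e / (t0 + 1) keeps the accumulated error below \<open>e\<close> at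
    time \<open>t0\<close> and is defined also for t0 = 0.\<close>
  have "u t0 x0 \<le> \<alpha> * x0\<^sup>2 + \<beta> * x0 + \<gamma> + (\<alpha> * vu + e / (t0 + 1)) * t0"
    by (rule viscosity_strict_quadratic_bound[OF cont bd sub init \<alpha> vu _ t0]) (use e t0 in auto)
  moreover have "e / (t0 + 1) * t0 \<le> e"
    using e t0 by (simp add: field_simps)
  ultimately show "u t0 x0 \<le> \<alpha> * x0\<^sup>2 + \<beta> * x0 + \<gamma> + \<alpha> * vu * t0 + e"
    by (simp add: algebra_simps)
qed

section \<open>Bounded Lipschitz test functions and cylinder functions\<close>

lemma bounded_Lipschitz_nI:
  assumes "\<And>x. \<bar>\<phi> x\<bar> \<le> M" "\<And>x y. \<bar>\<phi> x - \<phi> y\<bar> \<le> C * (\<Sum>i<d. \<bar>x i - y i\<bar>)"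
  shows "bounded_Lipschitz_n d \<phi>"
  unfolding bounded_Lipschitz_n_def using assms by (auto simp: bounded_iff)

lemma bounded_Lipschitz_nE:
  assumes "bounded_Lipschitz_n d \<phi>"
  obtains M C where "M \<ge> 0" "C \<ge> 0" "\<And>x. \<bar>\<phi> x\<bar> \<le> M" "\<And>x y. \<bar>\<phi> x - \<phi> y\<bar> \<le> C * (\<Sum>i<d. \<bar>x i - y i\<bar>)"
proof -
  from assms obtain M C where M: "\<And>x. \<bar>\<phi> x\<bar> \<le> M" and C: "\<And>x y. \<bar>\<phi> x - \<phi> y\<bar> \<le> C * (\<Sum>i<d. \<bar>x i - y i\<bar>)"
    unfolding bounded_Lipschitz_n_def by (auto simp: bounded_iff)
  have "M \<ge> 0" using M[of undefined] by linarith
  moreover have "\<bar>\<phi> x - \<phi> y\<bar> \<le> max C 0 * (\<Sum>i<d. \<bar>x i - y i\<bar>)" for x y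
    by (rule order_trans[OF C]) (auto intro!: mult_right_mono sum_nonneg)
  ultimately show ?thesis using M that[of M "max C 0"] by auto
qed

lemma bounded_LipschitzE:
  assumes "bounded_Lipschitz \<phi>"
  obtains M C where "M \<ge> 0" "C \<ge> 0" "\<And>x. \<bar>\<phi> x\<bar> \<le> M" "\<And>x y. \<bar>\<phi> x - \<phi> y\<bar> \<le> C * \<bar>x - y\<bar>"
proof -
  from assms obtain M C where M: "\<And>x. \<bar>\<phi> x\<bar> \<le> M" and C: "C-lipschitz_on UNIV \<phi>"
    unfolding bounded_Lipschitz_def by (auto simp: bounded_iff)
  have "M \<ge> 0" using M[of undefined] by linarith
  with M C that[of M C] show ?thesis
    by (auto simp: lipschitz_on_def dist_real_def)
qed

lemma bounded_LipschitzI: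
  assumes "\<And>x. \<bar>\<phi> x\<bar> \<le> M" "C \<ge> 0" "\<And>x y. \<bar>\<phi> x - \<phi> y\<bar> \<le> C * \<bar>x - y\<bar>"
  shows "bounded_Lipschitz \<phi>"
  unfolding bounded_Lipschitz_def using assms
  by (auto simp: bounded_iff lipschitz_on_def dist_real_def)

lemma bounded_Lipschitz_n_mult:
  assumes "bounded_Lipschitz_n d f" "bounded_Lipschitz_n d g"
  shows "bounded_Lipschitz_n d (\<lambda>x. f x * g x)"
proof -
  obtain M C where f: "M \<ge> 0" "C \<ge> 0" "\<And>x. \<bar>f x\<bar> \<le> M" "\<And>x y. \<bar>f x - f y\<bar> \<le> C * (\<Sum>i<d. \<bar>x i - y i\<bar>)"
    using assms(1) by (rule bounded_Lipschitz_nE) blast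
  obtain M' C' where g: "M' \<ge> 0" "C' \<ge> 0" "\<And>x. \<bar>g x\<bar> \<le> M'" "\<And>x y. \<bar>g x - g y\<bar> \<le> C' * (\<Sum>i<d. \<bar>x i - y i\<bar>)"
    using assms(2) by (rule bounded_Lipschitz_nE) blast
  show ?thesis
  proof (rule bounded_Lipschitz_nI)
    show "\<bar>f x * g x\<bar> \<le> M * M'" for x
      using f g by (auto simp: abs_mult intro!: mult_mono)
    fix x y :: "nat \<Rightarrow> real"
    let ?S = "\<Sum>i<d. \<bar>x i - y i\<bar>"
    have "f x * g x - f y * g y = f x * (g x - g y) + (f x - f y) * g y"
      by (simp add: algebra_simps)
    then have "\<bar>f x * g x - f y * g y\<bar> \<le> \<bar>f x\<bar> * \<bar>g x - g y\<bar> + \<bar>f x - f y\<bar> * \<bar>g y\<bar>"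
      by (metis abs_mult abs_triangle_ineq)
    also have "\<dots> \<le> M * (C' * ?S) + (C * ?S) * M'"
      using f g by (intro add_mono mult_mono) (auto intro!: mult_nonneg_nonneg sum_nonneg)
    finally show "\<bar>f x * g x - f y * g y\<bar> \<le> (M * C' + C * M') * ?S"
      by (simp add: algebra_simps)
  qed
qed

lemma bounded_Lipschitz_n_mono:
  assumes "bounded_Lipschitz_n d f" "d \<le> e"
  shows "bounded_Lipschitz_n e f"
proof -
  obtain M C where f: "M \<ge> 0" "C \<ge> 0" "\<And>x. \<bar>f x\<bar> \<le> M" "\<And>x y. \<bar>f x - f y\<bar> \<le> C * (\<Sum>i<d. \<bar>x i - y i\<bar>)"
    using assms(1) by (rule bounded_Lipschitz_nE) blast
  show ?thesis
  proof (rule bounded_Lipschitz_nI[OF f(3)])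
    fix x y :: "nat \<Rightarrow> real"
    have "(\<Sum>i<d. \<bar>x i - y i\<bar>) \<le> (\<Sum>i<e. \<bar>x i - y i\<bar>)"
      using assms(2) by (intro sum_mono2) auto
    then show "\<bar>f x - f y\<bar> \<le> C * (\<Sum>i<e. \<bar>x i - y i\<bar>)"
      using f(4)[of x y] f(2) by (meson mult_left_mono order_trans)
  qed
qed

lemma bounded_Lipschitz_n_compose:
  assumes "bounded_Lipschitz \<phi>" "\<And>x y. \<bar>l x - l y\<bar> \<le> K * (\<Sum>i<d. \<bar>x i - y i\<bar>)"
  shows "bounded_Lipschitz_n d (\<lambda>x. \<phi> (l x))"
proof -
  obtain M C where f: "M \<ge> 0" "C \<ge> 0" "\<And>x. \<bar>\<phi> x\<bar> \<le> M" "\<And>x y. \<bar>\<phi> x - \<phi> y\<bar> \<le> C * \<bar>x - y\<bar>"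
    using assms(1) by (rule bounded_LipschitzE) blast
  show ?thesis
  proof (rule bounded_Lipschitz_nI[OF f(3)])
    show "\<bar>\<phi> (l x) - \<phi> (l y)\<bar> \<le> C * K * (\<Sum>i<d. \<bar>x i - y i\<bar>)" for x y
      unfolding mult.assoc by (rule order_trans[OF f(4)]) (intro mult_left_mono assms(2) f(2))
  qed
qed

text \<open>Coordinates from \<open>d\<close> on are invisible to \<open>f\<close>, so the sequence
  may be altered there; this is how an increment is appended to a vector of past values.\<close>

lemma bounded_Lipschitz_n_cong:
  assumes "bounded_Lipschitz_n d f" "\<And>i. i < d \<Longrightarrow> x i = y i"
  shows "f x = f y"
proof -
  obtain M C where f: "\<And>x y. \<bar>f x - f y\<bar> \<le> C * (\<Sum>i<d. \<bar>x i - y i\<bar>)"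
    using assms(1) by (rule bounded_Lipschitz_nE) blast
  show ?thesis using f[of x y] assms(2) by simp
qed

lemma bounded_Lipschitz_n_const: "bounded_Lipschitz_n d (\<lambda>_. c)"
  by (rule bounded_Lipschitz_nI[of _ "\<bar>c\<bar>" 0]) auto

lemma bounded_Lipschitz_diff_const: "bounded_Lipschitz \<phi> \<Longrightarrow> bounded_Lipschitz (\<lambda>x. \<phi> x - c)"
proof (erule bounded_LipschitzE)
  fix M C assume *: "0 \<le> M" "0 \<le> C" "\<And>x. \<bar>\<phi> x\<bar> \<le> M" "\<And>x y. \<bar>\<phi> x - \<phi> y\<bar> \<le> C * \<bar>x - y\<bar>"
  have "\<bar>\<phi> x - c\<bar> \<le> M + \<bar>c\<bar>" for x using *(3)[of x] by linarith
  then show ?thesis by (rule bounded_LipschitzI[OF _ *(2)]) (use *(4) in auto)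
qed

lemma cylinderI:
  "bounded_Lipschitz_n d \<phi> \<Longrightarrow> (\<And>i. i < d \<Longrightarrow> 0 \<le> \<tau> i) \<Longrightarrow> (\<lambda>\<omega>. \<phi> (\<lambda>i. B (\<tau> i) \<omega>)) \<in> cylinder_functions"
  unfolding cylinder_functions_def by blast

lemma cylinder_const: "(\<lambda>_. c) \<in> cylinder_functions"
  using cylinderI[OF bounded_Lipschitz_n_const, of 0] by auto

lemma cylinder_increment:
  assumes "bounded_Lipschitz \<phi>" "0 \<le> t" "0 \<le> s"
  shows "(\<lambda>\<omega>. \<phi> (x + c * (B (t + s) \<omega> - B t \<omega>))) \<in> cylinder_functions"
proof -
  have "bounded_Lipschitz_n 2 (\<lambda>y. \<phi> (x + c * (y 1 - y 0)))"
  proof (rule bounded_Lipschitz_n_compose[OF assms(1), of _ "\<bar>c\<bar>"])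
    fix u v :: "nat \<Rightarrow> real"
    have "(x + c * (u 1 - u 0)) - (x + c * (v 1 - v 0)) = c * ((u 1 - v 1) - (u 0 - v 0))"
      by (simp add: algebra_simps)
    then have "\<bar>(x + c * (u 1 - u 0)) - (x + c * (v 1 - v 0))\<bar> = \<bar>c\<bar> * \<bar>(u 1 - v 1) - (u 0 - v 0)\<bar>"
      by (simp add: abs_mult)
    also have "\<dots> \<le> \<bar>c\<bar> * (\<Sum>i<2. \<bar>u i - v i\<bar>)"
      by (intro mult_left_mono) (auto simp: numeral_2_eq_2)
    finally show "\<bar>(x + c * (u 1 - u 0)) - (x + c * (v 1 - v 0))\<bar> \<le> \<bar>c\<bar> * (\<Sum>i<2. \<bar>u i - v i\<bar>)" .
  qed
  from cylinderI[OF this, of "\<lambda>i. if i = 0 then t else t + s"] show ?thesis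
    using assms by simp
qed

section \<open>Increments under the sublinear expectation\<close>

lemma
  assumes "G_expectation \<sigma>l \<sigma>u E"
  shows G_mono: "X \<in> cylinder_functions \<Longrightarrow> Y \<in> cylinder_functions \<Longrightarrow> (\<And>\<omega>. X \<omega> \<le> Y \<omega>) \<Longrightarrow> E X \<le> E Y"
    and G_const: "E (\<lambda>_. c) = c"
    and G_subadd: "X \<in> cylinder_functions \<Longrightarrow> Y \<in> cylinder_functions \<Longrightarrow> E (\<lambda>\<omega>. X \<omega> + Y \<omega>) \<le> E X + E Y"
    and G_scale: "X \<in> cylinder_functions \<Longrightarrow> l \<ge> 0 \<Longrightarrow> E (\<lambda>\<omega>. l * X \<omega>) = l * E X"
  using assms unfolding G_expectation_def sublinear_expectation_on_def by auto

text \<open>The expectation is the value at time 1 and point 0 of the viscosity solution with upper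
  variance \<open>\<sigma>u\<^sup>2 * s\<close>. At the point 0 the linear term \<beta> x vanishes,
  and this is what will make the increments centred.\<close>

lemma G_increment_le:
  assumes G: "G_expectation \<sigma>l \<sigma>u E" and t: "0 \<le> t" and s: "0 \<le> s"
    and \<phi>: "bounded_Lipschitz \<phi>" and le: "\<And>x. \<phi> x \<le> \<alpha> * x\<^sup>2 + \<beta> * x + \<gamma>" and \<alpha>: "\<alpha> > 0"
  shows "E (\<lambda>\<omega>. \<phi> (B (t + s) \<omega> - B t \<omega>)) \<le> \<gamma> + \<alpha> * (\<sigma>u\<^sup>2 * s)"
proof -
  define u where "u r x = E (\<lambda>\<omega>. \<phi> (x + sqrt r * (B (t + s) \<omega> - B t \<omega>)))" for r x
  have v: "viscosity_solution (G_fun (\<sigma>l\<^sup>2 * s) (\<sigma>u\<^sup>2 * s)) \<phi> u"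
    using G t s \<phi> unfolding G_expectation_def G_Brownian_motion_def G_normal_def unique_viscosity_solution_def u_def
    by blast
  obtain M where M: "\<And>x. \<bar>\<phi> x\<bar> \<le> M" using \<phi> by (rule bounded_LipschitzE) blast
  have "u r x \<le> E (\<lambda>_. M)" for r x unfolding u_def
    by (rule G_mono[OF G cylinder_increment[OF \<phi> t s] cylinder_const]) (use M in \<open>auto simp: abs_le_iff\<close>)
  then have ub: "u r x \<le> M" for r x by (simp add: G_const[OF G])
  have init: "u 0 x \<le> \<alpha> * x\<^sup>2 + \<beta> * x + \<gamma>" for x
    using v le[of x] by (simp add: viscosity_solution_def)
  have "u 1 0 \<le> \<alpha> * 0\<^sup>2 + \<beta> * 0 + \<gamma> + \<alpha> * (\<sigma>u\<^sup>2 * s) * 1"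
    by (rule viscosity_quadratic_bound[of u M "\<sigma>l\<^sup>2 * s"])
       (use v ub s \<alpha> init in \<open>auto simp: viscosity_solution_def\<close>)
  then show ?thesis by (simp add: u_def)
qed

text \<open>Freezing the past turns the inner expectation into g times E(\<phi> - c) by positive
  homogeneity, which is where g \<ge> 0 enters; subadditivity gives E(\<phi> - c) \<le> 0.\<close>

lemma G_product_le:
  assumes G: "G_expectation \<sigma>l \<sigma>u E" and t: "0 \<le> t" and s: "0 \<le> s"
    and g: "bounded_Lipschitz_n n g" and g0: "\<And>x. g x \<ge> 0"
    and \<tau>: "\<And>i. i < n \<Longrightarrow> 0 \<le> \<tau> i \<and> \<tau> i \<le> t" "mono_on {..<n} \<tau>"
    and \<phi>: "bounded_Lipschitz \<phi>" and c: "E (\<lambda>\<omega>. \<phi> (B (t + s) \<omega> - B t \<omega>)) \<le> c"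
  shows "(\<lambda>\<omega>. g (\<lambda>i. B (\<tau> i) \<omega>) * (\<phi> (B (t + s) \<omega> - B t \<omega>) - c)) \<in> cylinder_functions" (is "?X \<in> _")
    and "E (\<lambda>\<omega>. g (\<lambda>i. B (\<tau> i) \<omega>) * (\<phi> (B (t + s) \<omega> - B t \<omega>) - c)) \<le> 0"
proof -
  define \<phi>' where "\<phi>' x = \<phi> x - c" for x
  have \<phi>': "bounded_Lipschitz \<phi>'" unfolding \<phi>'_def by (rule bounded_Lipschitz_diff_const[OF \<phi>])
  \<comment> \<open>As a function of path values the product needs the two times \<open>t\<close>
    and \<open>t + s\<close>, placed at the indices \<open>n\<close> and \<open>n + 1\<close>. In
    the independence property the increment itself sits at index \<open>n\<close>, which leads to
    \<open>\<Phi>\<close> below.\<close>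
  have "bounded_Lipschitz_n (n + 2) (\<lambda>y. g y * \<phi>' (y (n + 1) - y n))"
  proof (intro bounded_Lipschitz_n_mult bounded_Lipschitz_n_mono[OF g] bounded_Lipschitz_n_compose[OF \<phi>', of _ 1])
    fix u v :: "nat \<Rightarrow> real"
    show "\<bar>(u (n + 1) - u n) - (v (n + 1) - v n)\<bar> \<le> 1 * (\<Sum>i<n+2. \<bar>u i - v i\<bar>)"
      by (simp, rule order_trans[of _ "0 + \<bar>u n - v n\<bar> + \<bar>u (Suc n) - v (Suc n)\<bar>"])
         (auto intro!: add_right_mono sum_nonneg)
  qed simp
  from cylinderI[OF this, of "\<tau>(n := t, n + 1 := t + s)"]
  have "(\<lambda>\<omega>. g (\<lambda>i. B ((\<tau>(n := t, n + 1 := t + s)) i) \<omega>) * \<phi>' (B (t + s) \<omega> - B t \<omega>)) \<in> cylinder_functions"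
    using \<tau> t s by auto
  moreover have "g (\<lambda>i. B ((\<tau>(n := t, n + 1 := t + s)) i) \<omega>) = g (\<lambda>i. B (\<tau> i) \<omega>)" for \<omega>
    by (rule bounded_Lipschitz_n_cong[OF g]) simp
  ultimately show "?X \<in> cylinder_functions" by (simp add: \<phi>'_def)
  have cyl: "(\<lambda>\<omega>. \<phi> (B (t + s) \<omega> - B t \<omega>)) \<in> cylinder_functions"
      "(\<lambda>\<omega>. \<phi>' (B (t + s) \<omega> - B t \<omega>)) \<in> cylinder_functions"
    using cylinder_increment[OF \<phi> t s, of 0 1] cylinder_increment[OF \<phi>' t s, of 0 1] by simp_all
  define e where "e = E (\<lambda>\<omega>. \<phi>' (B (t + s) \<omega> - B t \<omega>))"
  have "e \<le> E (\<lambda>\<omega>. \<phi> (B (t + s) \<omega> - B t \<omega>)) + E (\<lambda>_. - c)"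
    unfolding e_def \<phi>'_def using G_subadd[OF G cyl(1) cylinder_const[of "- c"]] by simp
  then have e: "e \<le> 0" using c by (simp add: G_const[OF G])
  define \<Phi> where "\<Phi> y = g y * \<phi>' (y n)" for y
  have \<Phi>: "bounded_Lipschitz_n (Suc n) \<Phi>"
    unfolding \<Phi>_def
  proof (intro bounded_Lipschitz_n_mult bounded_Lipschitz_n_mono[OF g] bounded_Lipschitz_n_compose[OF \<phi>', of _ 1])
    fix u v :: "nat \<Rightarrow> real"
    show "\<bar>u n - v n\<bar> \<le> 1 * (\<Sum>i<Suc n. \<bar>u i - v i\<bar>)"
      by (simp add: sum_nonneg)
  qed simp
  have ind: "independent_from E (\<lambda>\<omega>. B (t + s) \<omega> - B t \<omega>) n (\<lambda>i. B (\<tau> i))"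
    using G t s \<tau> unfolding G_expectation_def G_Brownian_motion_def by blast
  have gg: "g ((\<lambda>i. B (\<tau> i) \<omega>)(n := y)) = g (\<lambda>i. B (\<tau> i) \<omega>)" for \<omega> y
    by (rule bounded_Lipschitz_n_cong[OF g]) simp
  have "E ?X = E (\<lambda>\<omega>. \<Phi> ((\<lambda>i. B (\<tau> i) \<omega>)(n := B (t + s) \<omega> - B t \<omega>)))"
    by (simp add: \<Phi>_def gg \<phi>'_def)
  also have "\<dots> = E (\<lambda>\<omega>. E (\<lambda>\<omega>'. \<Phi> ((\<lambda>i. B (\<tau> i) \<omega>)(n := B (t + s) \<omega>' - B t \<omega>'))))"
    using ind \<Phi> unfolding independent_from_def by blast
  also have "\<dots> = E (\<lambda>\<omega>. g (\<lambda>i. B (\<tau> i) \<omega>) * e)"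
    by (simp add: \<Phi>_def gg G_scale[OF G cyl(2) g0] e_def)
  also have "\<dots> \<le> E (\<lambda>_. 0)"
  proof (rule G_mono[OF G])
    have "bounded_Lipschitz_n n (\<lambda>x. g x * e)"
      by (intro bounded_Lipschitz_n_mult g bounded_Lipschitz_n_const)
    from cylinderI[OF this, of \<tau>] \<tau> show "(\<lambda>\<omega>. g (\<lambda>i. B (\<tau> i) \<omega>) * e) \<in> cylinder_functions" by auto
    show "g (\<lambda>i. B (\<tau> i) \<omega>) * e \<le> 0" for \<omega>
      using g0 e by (simp add: mult_nonneg_nonpos)
  qed (rule cylinder_const)
  finally show "E ?X \<le> 0" by (simp add: G_const[OF G])
qed

section \<open>Cylinder functions under the representing measures\<close>

lemma cylinder_measurable:
  assumes "X \<in> cylinder_functions"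
  shows "X \<in> borel_measurable borel" "\<exists>M. \<forall>\<omega>. \<bar>X \<omega>\<bar> \<le> M"
proof -
  from assms obtain \<phi> \<tau> d where X: "X = (\<lambda>\<omega>. \<phi> (\<lambda>i. B (\<tau> i) \<omega>))" and \<phi>: "bounded_Lipschitz_n d \<phi>"
    unfolding cylinder_functions_def by auto
  obtain M C where f: "\<And>x. \<bar>\<phi> x\<bar> \<le> M" "C \<ge> 0" "\<And>x y. \<bar>\<phi> x - \<phi> y\<bar> \<le> C * (\<Sum>i<d. \<bar>x i - y i\<bar>)"
    using \<phi> by (rule bounded_Lipschitz_nE) blast
  show "\<exists>M. \<forall>\<omega>. \<bar>X \<omega>\<bar> \<le> M" using f X by auto
  have "continuous_on UNIV X"
    unfolding continuous_on_def
  proof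
    fix \<omega>
    have "((\<lambda>\<omega>'. C * (\<Sum>i<d. \<bar>B (\<tau> i) \<omega>' - B (\<tau> i) \<omega>\<bar>)) \<longlongrightarrow> C * (\<Sum>i<d. \<bar>B (\<tau> i) \<omega> - B (\<tau> i) \<omega>\<bar>)) (at \<omega>)"
      using continuous_on_B by (intro tendsto_intros) (auto simp: continuous_on_def)
    then have lim: "((\<lambda>\<omega>'. C * (\<Sum>i<d. \<bar>B (\<tau> i) \<omega>' - B (\<tau> i) \<omega>\<bar>)) \<longlongrightarrow> 0) (at \<omega>)" by simp
    have "((\<lambda>\<omega>'. X \<omega>' - X \<omega>) \<longlongrightarrow> 0) (at \<omega>)"
      by (rule Lim_null_comparison[OF _ lim]) (use f X in auto)
    then show "(X \<longlongrightarrow> X \<omega>) (at \<omega>)" by (simp add: LIM_zero_iff)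
  qed
  then show "X \<in> borel_measurable borel" by (rule borel_measurable_continuous_onI)
qed

lemma represents_prob:
  assumes "represents \<P> E" "P \<in> \<P>"
  shows "prob_space P" "sets P = sets borel"
  using assms by (auto simp: represents_def borel_probs_def)

lemma cylinder_integrable:
  assumes "prob_space P" "sets P = sets borel" "X \<in> cylinder_functions"
  shows "integrable P X"
proof -
  interpret prob_space P by fact
  obtain M where "\<And>\<omega>. \<bar>X \<omega>\<bar> \<le> M" using cylinder_measurable(2)[OF assms(3)] by auto
  then show ?thesis
    using cylinder_measurable(1)[OF assms(3)]
    by (intro integrable_const_bound[of _ M]) (auto simp: measurable_cong_sets[OF assms(2) refl])
qed

text \<open>The supremum is taken in the reals, where it dominates its members only if they are
  bounded above; a bound on the cylinder function provides this.\<close>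

lemma represents_le:
  assumes R: "represents \<P> E" and P: "P \<in> \<P>" and X: "X \<in> cylinder_functions"
  shows "(\<integral>\<omega>. X \<omega> \<partial>P) \<le> E X"
proof -
  obtain M where M: "\<And>\<omega>. \<bar>X \<omega>\<bar> \<le> M" using cylinder_measurable(2)[OF X] by auto
  have "(\<integral>\<omega>. X \<omega> \<partial>P') \<le> M" if "P' \<in> \<P>" for P'
  proof -
    interpret prob_space P' using R that by (rule represents_prob)
    have "(\<integral>\<omega>. X \<omega> \<partial>P') \<le> (\<integral>\<omega>. M \<partial>P')"
      using M by (intro integral_mono cylinder_integrable represents_prob[OF R that] X cylinder_const)
        (auto simp: abs_le_iff)
    then show ?thesis by (simp add: prob_space)
  qed
  then have "bdd_above ((\<lambda>P. \<integral>\<omega>. X \<omega> \<partial>P) ` \<P>)" by (auto simp: bdd_above_def)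
  then have "(\<integral>\<omega>. X \<omega> \<partial>P) \<le> (SUP P\<in>\<P>. \<integral>\<omega>. X \<omega> \<partial>P)" using P by (rule cSUP_upper2) simp
  then show ?thesis using R X by (auto simp: represents_def)
qed

section \<open>The martingale property under each measure\<close>

text \<open>Fatou's lemma in the form in which moment bounds pass to a limit: extended values,
  almost sure convergence, and no dominating function to be found.\<close>

lemma nn_integral_le_LIMSEQ:
  fixes F :: "'a \<Rightarrow> ennreal"
  assumes [measurable]: "\<And>n. f n \<in> borel_measurable M"
    and lim: "AE x in M. (\<lambda>n. f n x) \<longlonglongrightarrow> F x"
    and le: "\<And>n. (\<integral>\<^sup>+x. f n x \<partial>M) \<le> C n" and C: "C \<longlonglongrightarrow> c"
  shows "(\<integral>\<^sup>+x. F x \<partial>M) \<le> c"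
proof -
  have "(\<integral>\<^sup>+x. F x \<partial>M) = (\<integral>\<^sup>+x. liminf (\<lambda>n. f n x) \<partial>M)"
    using lim by (intro nn_integral_cong_AE) (auto elim!: eventually_mono dest!: lim_imp_Liminf[OF sequentially_bot])
  also have "\<dots> \<le> liminf (\<lambda>n. \<integral>\<^sup>+x. f n x \<partial>M)"
    by (rule nn_integral_liminf) measurable
  also have "\<dots> \<le> liminf C"
    using le by (intro Liminf_mono always_eventually) auto
  also have "\<dots> = c" using C by (intro lim_imp_Liminf) auto
  finally show ?thesis .
qed

lemma enn2real_inj: "x \<noteq> \<infinity> \<Longrightarrow> y \<noteq> \<infinity> \<Longrightarrow> enn2real x = enn2real y \<Longrightarrow> x = y"
  by (metis ennreal_enn2real infinity_ennreal_def less_top)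

text \<open>Bernstein interpolation through finitely many values turns a bounded functional that is Lipschitz for
  the uniform norm on \<open>[0, s]\<close> into cylinder functions that converge to it.\<close>

lift_definition interp :: "real \<Rightarrow> nat \<Rightarrow> (nat \<Rightarrow> real) \<Rightarrow> cpath" is
  "\<lambda>s n x r. \<Sum>k=1..n. x k * Bernstein n k (max 0 (min 1 (r * inverse (max 0 s))))"
proof (intro conjI allI impI)
  fix s n r and x :: "nat \<Rightarrow> real" assume "(r::real) \<le> 0"
  then have "r * inverse (max 0 s) \<le> 0" by (intro mult_nonpos_nonneg) auto
  then show "(\<Sum>k=1..n. x k * Bernstein n k (max 0 (min 1 (r * inverse (max 0 s))))) = 0"
    by (intro sum.neutral) (auto simp: Bernstein_def max_def min_def)
next
  show "continuous_on {0..} (\<lambda>r. \<Sum>k=1..n. x k * Bernstein n k (max 0 (min 1 (r * inverse (max 0 s)))))" for s n x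
    unfolding Bernstein_def by (intro continuous_intros)
qed

lemma B_interp: "B r (interp s n x) = (\<Sum>k=1..n. x k * Bernstein n k (max 0 (min 1 (r * inverse (max 0 s)))))"
  unfolding B_def by transfer simp

lemma Bernstein_le_1:
  assumes "0 \<le> y" "y \<le> 1" "k \<le> n" shows "Bernstein n k y \<le> 1"
proof -
  have "Bernstein n k y \<le> (\<Sum>k\<le>n. Bernstein n k y)"
    by (rule member_le_sum) (use assms Bernstein_nonneg in auto)
  then show ?thesis by simp
qed

text \<open>Bernstein weights lie between 0 and 1 on the unit interval, so the map from values to
  paths is Lipschitz uniformly in time. This turns path functionals into bounded Lipschitz functions
  of finitely many values.\<close>

lemma interp_Lipschitz: "\<bar>B r (interp s n x) - B r (interp s n y)\<bar> \<le> (\<Sum>k<Suc n. \<bar>x k - y k\<bar>)"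
proof -
  let ?b = "\<lambda>k. Bernstein n k (max 0 (min 1 (r * inverse (max 0 s))))"
  have "\<bar>B r (interp s n x) - B r (interp s n y)\<bar> = \<bar>\<Sum>k=1..n. (x k - y k) * ?b k\<bar>"
    by (simp add: B_interp sum_subtractf[symmetric] left_diff_distrib)
  also have "\<dots> \<le> (\<Sum>k=1..n. \<bar>(x k - y k) * ?b k\<bar>)" by (rule sum_abs)
  also have "\<dots> \<le> (\<Sum>k=1..n. \<bar>x k - y k\<bar>)"
  proof (rule sum_mono)
    fix k assume "k \<in> {1..n}"
    then have "0 \<le> ?b k" "?b k \<le> 1" by (auto intro!: Bernstein_nonneg Bernstein_le_1)
    then show "\<bar>(x k - y k) * ?b k\<bar> \<le> \<bar>x k - y k\<bar>"
      by (simp add: abs_mult mult_left_le)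
  qed
  also have "\<dots> \<le> (\<Sum>k<Suc n. \<bar>x k - y k\<bar>)" by (rule sum_mono2) auto
  finally show ?thesis .
qed

lemma interp_close:
  assumes s: "s \<ge> 0" and e: "e > 0"
  shows "\<exists>N. \<forall>n\<ge>N. \<forall>r\<in>{0..s}. \<bar>B r \<omega> - B r (interp s n (\<lambda>k. B (s * k / n) \<omega>))\<bar> < e"
proof -
  have "continuous_on {0..1} (\<lambda>y. B (s * y) \<omega>)"
    by (rule continuous_on_compose2[OF continuous_B[of UNIV]]) (auto intro!: continuous_intros)
  from Bernstein_Weierstrass[OF this e] obtain N where
    N: "\<And>n y. N \<le> n \<Longrightarrow> y \<in> {0..1} \<Longrightarrow> \<bar>B (s * y) \<omega> - (\<Sum>k\<le>n. B (s * (k / n)) \<omega> * Bernstein n k y)\<bar> < e"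
    by blast
  show ?thesis
  proof (intro exI[of _ N] allI impI ballI)
    fix n r assume n: "N \<le> n" and r: "r \<in> {0..s}"
    \<comment> \<open>The convention inverse 0 = 0 makes \<open>y\<close> equal to 0 on the
      degenerate interval s = 0.\<close>
    define y where "y = r * inverse (max 0 s)"
    have y: "y \<in> {0..1}" using r s by (cases "s = 0") (auto simp: y_def field_simps)
    have sy: "s * y = r" using r s by (cases "s = 0") (auto simp: y_def)
    \<comment> \<open>The term k = 0 vanishes since paths start at 0; for this reason
      \<open>interp\<close> can omit it and stay in the path space.\<close>
    have "(\<Sum>k\<le>n. B (s * (k / n)) \<omega> * Bernstein n k y) = (\<Sum>k=1..n. B (s * (k / n)) \<omega> * Bernstein n k y)"
      by (rule sum.mono_neutral_right) (auto simp: B_nonpos not_less_eq_eq)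
    also have "\<dots> = B r (interp s n (\<lambda>k. B (s * k / n) \<omega>))"
      using y by (simp add: B_interp y_def)
    finally show "\<bar>B r \<omega> - B r (interp s n (\<lambda>k. B (s * k / n) \<omega>))\<bar> < e"
      using N[OF n y] by (simp add: sy)
  qed
qed

section \<open>Bounded Lipschitz truncations of the square and of the identity\<close>

definition trunc_sq :: "nat \<Rightarrow> real \<Rightarrow> real" where
  "trunc_sq N x = (min \<bar>x\<bar> (real N))\<^sup>2"

lemma trunc_sq_le: "trunc_sq N x \<le> x\<^sup>2"
  unfolding trunc_sq_def by (auto intro!: power2_le_imp_le simp: abs_le_square_iff[symmetric])

lemma trunc_sq_nonneg: "0 \<le> trunc_sq N x"
  by (simp add: trunc_sq_def)

lemma trunc_sq_tendsto: "(\<lambda>N. trunc_sq N x) \<longlonglongrightarrow> x\<^sup>2"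
proof (rule tendsto_eventually)
  obtain N0 where "\<bar>x\<bar> \<le> real N0" using real_arch_simple by blast
  then show "\<forall>\<^sub>F N in sequentially. trunc_sq N x = x\<^sup>2"
    by (intro eventually_sequentiallyI[of N0]) (auto simp: trunc_sq_def min_def)
qed

lemma bounded_Lipschitz_trunc_sq: "bounded_Lipschitz (trunc_sq N)"
proof (rule bounded_LipschitzI[of _ "(real N)\<^sup>2" "2 * real N"])
  show "\<bar>trunc_sq N x\<bar> \<le> (real N)\<^sup>2" for x
    by (auto simp: trunc_sq_def intro!: power_mono)
  fix x y
  let ?a = "min \<bar>x\<bar> (real N)" and ?b = "min \<bar>y\<bar> (real N)"
  have "\<bar>trunc_sq N x - trunc_sq N y\<bar> = \<bar>?a + ?b\<bar> * \<bar>?a - ?b\<bar>"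
    unfolding trunc_sq_def abs_mult[symmetric] by (simp add: power2_eq_square algebra_simps)
  also have "\<dots> \<le> 2 * real N * \<bar>x - y\<bar>"
    by (intro mult_mono) auto
  finally show "\<bar>trunc_sq N x - trunc_sq N y\<bar> \<le> 2 * real N * \<bar>x - y\<bar>" .
qed simp

lemma bounded_Lipschitz_clip: "bounded_Lipschitz (\<lambda>x. c * max (- real N) (min (real N) x))"
proof (rule bounded_LipschitzI[of _ "\<bar>c\<bar> * real N" "\<bar>c\<bar>"])
  show "\<bar>c * max (- real N) (min (real N) x)\<bar> \<le> \<bar>c\<bar> * real N" for x
    unfolding abs_mult by (intro mult_left_mono) auto
  show "\<bar>c * max (- real N) (min (real N) x) - c * max (- real N) (min (real N) y)\<bar> \<le> \<bar>c\<bar> * \<bar>x - y\<bar>" for x y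
    unfolding right_diff_distrib[symmetric] abs_mult by (intro mult_left_mono) auto
qed simp

text \<open>Clipping raises values below -N, so the clipped identity is not below x everywhere; the
  term x^2 / N compensates this. Its coefficient 1/N makes the resulting variance error vanish as N
  grows.\<close>

lemma clip_le_quadratic:
  assumes "N > 0" "c = 1 \<or> c = - 1"
  shows "c * max (- real N) (min (real N) x) \<le> 1 / real N * x\<^sup>2 + c * x + 0"
proof -
  have N: "real N > 0" using assms by simp
  have 1: "max (- real N) (min (real N) y) \<le> 1 / real N * y\<^sup>2 + y" for y
  proof (cases "y < - real N")
    case True
    have "y * (y + real N) \<ge> 0" using True N by (intro mult_nonpos_nonpos) auto
    then have "y * (y + real N) + real N * real N \<ge> 0" by (intro add_nonneg_nonneg) auto
    then have "y * y + real N * y + real N * real N \<ge> 0" by (simp add: algebra_simps)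
    then have "- real N \<le> 1 / real N * y\<^sup>2 + y"
      using N by (simp add: field_simps power2_eq_square)
    then show ?thesis using True by simp
  next
    case False
    then have "max (- real N) (min (real N) y) \<le> y" by auto
    moreover have "1 / real N * y\<^sup>2 \<ge> 0" by simp
    ultimately show ?thesis by linarith
  qed
  have 2: "max (- real N) (min (real N) (- x)) = - max (- real N) (min (real N) x)"
    using N by (auto simp: max_def min_def)
  show ?thesis using assms(2) 1[of x] 1[of "- x"] 2 by auto
qed

text \<open>Interface between the sublinear expectation and the analysis under one measure. The
  bound \<open>product_moment\<close> is the conditional variance bound in the one instance that the
  oscillation estimate requires.\<close>

locale martingale_law = prob_space P for P :: "cpath measure" +
  fixes V :: real
  assumes sets_P [measurable_cong]: "sets P = sets borel"
    and V_nonneg: "0 \<le> V"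
    and second_moment: "0 \<le> s \<Longrightarrow> s \<le> t \<Longrightarrow> (\<integral>\<^sup>+\<omega>. ennreal ((B t \<omega> - B s \<omega>)\<^sup>2) \<partial>P) \<le> ennreal (V * (t - s))"
    and product_moment: "0 \<le> u \<Longrightarrow> u \<le> s \<Longrightarrow> s \<le> t \<Longrightarrow>
      (\<integral>\<^sup>+\<omega>. ennreal ((B s \<omega> - B u \<omega>)\<^sup>2 * (B t \<omega> - B s \<omega>)\<^sup>2) \<partial>P) \<le> ennreal (V * (s - u) * (V * (t - s)))"
    and martingale: "0 \<le> s \<Longrightarrow> s \<le> t \<Longrightarrow> adapted s X \<Longrightarrow> integrable P (\<lambda>\<omega>. X \<omega> * (B t \<omega> - B s \<omega>)) \<Longrightarrow>
      (\<integral>\<omega>. X \<omega> * (B t \<omega> - B s \<omega>) \<partial>P) = 0"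

section \<open>From the G-expectation to the martingale law of one measure\<close>

context
  fixes \<sigma>l \<sigma>u :: real and E \<P> and P :: "cpath measure"
  assumes G: "G_expectation \<sigma>l \<sigma>u E" and R: "represents \<P> E" and P: "P \<in> \<P>"
begin

interpretation prob_space P by (rule represents_prob[OF R P])

lemma sets_law [measurable_cong]: "sets P = sets borel"
  by (rule represents_prob[OF R P])

text \<open>An upper expectation that is at most 0 bounds the integral under each measure, and under
  one measure linearity separates the constant from the bracket.\<close>

lemma law_product_le:
  assumes t: "0 \<le> t" and s: "0 \<le> s"
    and g: "bounded_Lipschitz_n n g" and g0: "\<And>x. g x \<ge> 0"
    and \<tau>: "\<And>i. i < n \<Longrightarrow> 0 \<le> \<tau> i \<and> \<tau> i \<le> t" "mono_on {..<n} \<tau>"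
    and \<phi>: "bounded_Lipschitz \<phi>" and le: "\<And>x. \<phi> x \<le> \<alpha> * x\<^sup>2 + \<beta> * x + 0" and \<alpha>: "\<alpha> > 0"
  shows "(\<integral>\<omega>. g (\<lambda>i. B (\<tau> i) \<omega>) * \<phi> (B (t + s) \<omega> - B t \<omega>) \<partial>P)
           \<le> \<alpha> * (\<sigma>u\<^sup>2 * s) * (\<integral>\<omega>. g (\<lambda>i. B (\<tau> i) \<omega>) \<partial>P)"
    and "integrable P (\<lambda>\<omega>. g (\<lambda>i. B (\<tau> i) \<omega>))"
    and "integrable P (\<lambda>\<omega>. g (\<lambda>i. B (\<tau> i) \<omega>) * \<phi> (B (t + s) \<omega> - B t \<omega>))"
proof -
  let ?c = "\<alpha> * (\<sigma>u\<^sup>2 * s)"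
  have c: "E (\<lambda>\<omega>. \<phi> (B (t + s) \<omega> - B t \<omega>)) \<le> ?c"
    using G_increment_le[OF G t s \<phi> le \<alpha>] by simp
  note 1 = G_product_le[OF G t s g g0 \<tau> \<phi> c]
  have "(\<integral>\<omega>. g (\<lambda>i. B (\<tau> i) \<omega>) * (\<phi> (B (t + s) \<omega> - B t \<omega>) - ?c) \<partial>P) \<le> 0"
    using represents_le[OF R P 1(1)] 1(2) by simp
  moreover have "(\<lambda>\<omega>. g (\<lambda>i. B (\<tau> i) \<omega>)) \<in> cylinder_functions"
    using cylinderI[OF g, of \<tau>] \<tau> by auto
  then show 2: "integrable P (\<lambda>\<omega>. g (\<lambda>i. B (\<tau> i) \<omega>))"
    by (intro cylinder_integrable represents_prob[OF R P])
  have 3: "integrable P (\<lambda>\<omega>. g (\<lambda>i. B (\<tau> i) \<omega>) * (\<phi> (B (t + s) \<omega> - B t \<omega>) - ?c))"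
    by (intro cylinder_integrable represents_prob[OF R P] 1(1))
  have "integrable P (\<lambda>\<omega>. g (\<lambda>i. B (\<tau> i) \<omega>) * (\<phi> (B (t + s) \<omega> - B t \<omega>) - ?c) + ?c * g (\<lambda>i. B (\<tau> i) \<omega>))"
    using 2 3 by (intro Bochner_Integration.integrable_add integrable_mult_right)
  then show 4: "integrable P (\<lambda>\<omega>. g (\<lambda>i. B (\<tau> i) \<omega>) * \<phi> (B (t + s) \<omega> - B t \<omega>))"
    by (simp add: algebra_simps)
  have "(\<integral>\<omega>. g (\<lambda>i. B (\<tau> i) \<omega>) * (\<phi> (B (t + s) \<omega> - B t \<omega>) - ?c) \<partial>P)
      = (\<integral>\<omega>. g (\<lambda>i. B (\<tau> i) \<omega>) * \<phi> (B (t + s) \<omega> - B t \<omega>) \<partial>P) - ?c * (\<integral>\<omega>. g (\<lambda>i. B (\<tau> i) \<omega>) \<partial>P)"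
  proof -
    have "(\<integral>\<omega>. g (\<lambda>i. B (\<tau> i) \<omega>) * (\<phi> (B (t + s) \<omega> - B t \<omega>) - ?c) \<partial>P)
       = (\<integral>\<omega>. g (\<lambda>i. B (\<tau> i) \<omega>) * \<phi> (B (t + s) \<omega> - B t \<omega>) - ?c * g (\<lambda>i. B (\<tau> i) \<omega>) \<partial>P)"
      by (simp add: algebra_simps)
    also have "\<dots> = (\<integral>\<omega>. g (\<lambda>i. B (\<tau> i) \<omega>) * \<phi> (B (t + s) \<omega> - B t \<omega>) \<partial>P) - (\<integral>\<omega>. ?c * g (\<lambda>i. B (\<tau> i) \<omega>) \<partial>P)"
      using 2 4 by (intro Bochner_Integration.integral_diff integrable_mult_right)
    finally show ?thesis by simp
  qed
  ultimately show "(\<integral>\<omega>. g (\<lambda>i. B (\<tau> i) \<omega>) * \<phi> (B (t + s) \<omega> - B t \<omega>) \<partial>P)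
           \<le> \<alpha> * (\<sigma>u\<^sup>2 * s) * (\<integral>\<omega>. g (\<lambda>i. B (\<tau> i) \<omega>) \<partial>P)" by simp
qed

lemma law_trunc_sq_le:
  assumes t: "0 \<le> t" and s: "0 \<le> s"
  shows "(\<integral>\<omega>. trunc_sq N (B (t + s) \<omega> - B t \<omega>) \<partial>P) \<le> \<sigma>u\<^sup>2 * s"
    and "integrable P (\<lambda>\<omega>. trunc_sq N (B (t + s) \<omega> - B t \<omega>))"
  using law_product_le[OF t s bounded_Lipschitz_n_const[of 0 1] _ _ _ bounded_Lipschitz_trunc_sq, of undefined N 1 0]
    trunc_sq_le[of N] by (auto simp: prob_space mono_on_def)

lemma law_second_moment:
  assumes s: "0 \<le> s" and t: "s \<le> t"
  shows "(\<integral>\<^sup>+\<omega>. ennreal ((B t \<omega> - B s \<omega>)\<^sup>2) \<partial>P) \<le> ennreal (\<sigma>u\<^sup>2 * (t - s))"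
proof (rule nn_integral_le_LIMSEQ[OF _ _ _ tendsto_const])
  show "(\<lambda>\<omega>. ennreal (trunc_sq N (B t \<omega> - B s \<omega>))) \<in> borel_measurable P" for N
    unfolding trunc_sq_def by measurable
  show "AE \<omega> in P. (\<lambda>N. ennreal (trunc_sq N (B t \<omega> - B s \<omega>))) \<longlonglongrightarrow> ennreal ((B t \<omega> - B s \<omega>)\<^sup>2)"
    by (intro AE_I2 tendsto_ennrealI trunc_sq_tendsto)
  show "(\<integral>\<^sup>+\<omega>. ennreal (trunc_sq N (B t \<omega> - B s \<omega>)) \<partial>P) \<le> ennreal (\<sigma>u\<^sup>2 * (t - s))" for N
    using law_trunc_sq_le[OF s, of "t - s" N] t
    by (subst nn_integral_eq_integral) (auto simp: trunc_sq_nonneg intro!: ennreal_leI)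
qed

lemma law_product_moment:
  assumes u: "0 \<le> u" and s: "u \<le> s" and t: "s \<le> t"
  shows "(\<integral>\<^sup>+\<omega>. ennreal ((B s \<omega> - B u \<omega>)\<^sup>2 * (B t \<omega> - B s \<omega>)\<^sup>2) \<partial>P) \<le> ennreal (\<sigma>u\<^sup>2 * (s - u) * (\<sigma>u\<^sup>2 * (t - s)))"
proof (rule nn_integral_le_LIMSEQ[OF _ _ _ tendsto_const])
  let ?g = "\<lambda>N \<omega>. trunc_sq N (B s \<omega> - B u \<omega>)" and ?f = "\<lambda>N \<omega>. trunc_sq N (B t \<omega> - B s \<omega>)"
  show "(\<lambda>\<omega>. ennreal (?g N \<omega> * ?f N \<omega>)) \<in> borel_measurable P" for N
    unfolding trunc_sq_def by measurable
  show "AE \<omega> in P. (\<lambda>N. ennreal (?g N \<omega> * ?f N \<omega>)) \<longlonglongrightarrow> ennreal ((B s \<omega> - B u \<omega>)\<^sup>2 * (B t \<omega> - B s \<omega>)\<^sup>2)"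
    by (intro AE_I2 tendsto_ennrealI tendsto_mult trunc_sq_tendsto)
  fix N
  \<comment> \<open>The earlier increment, squared and truncated, plays the role of the weight
    \<open>g\<close>; it depends on the values at the two times \<open>u\<close> and
    \<open>s\<close>.\<close>
  have L: "bounded_Lipschitz_n 2 (\<lambda>y. trunc_sq N (y 1 - y 0))"
    by (rule bounded_Lipschitz_n_compose[OF bounded_Lipschitz_trunc_sq, of _ 1]) (simp add: numeral_2_eq_2)
  define \<tau> :: "nat \<Rightarrow> real" where "\<tau> i = (if i = 0 then u else s)" for i
  have \<tau>: "\<And>i. i < 2 \<Longrightarrow> 0 \<le> \<tau> i \<and> \<tau> i \<le> s" "mono_on {..<2} \<tau>"
    using u s by (auto simp: \<tau>_def mono_on_def)
  have s': "0 \<le> s" "0 \<le> t - s" using u s t by auto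
  have le: "trunc_sq N x \<le> 1 * x\<^sup>2 + 0 * x + 0" for x using trunc_sq_le[of N x] by simp
  note 1 = law_product_le[OF s' L trunc_sq_nonneg \<tau> bounded_Lipschitz_trunc_sq le zero_less_one]
  have 2: "integrable P (\<lambda>\<omega>. ?g N \<omega> * ?f N \<omega>)"
    using 1(3) by (simp add: \<tau>_def)
  have "(\<integral>\<omega>. ?g N \<omega> * ?f N \<omega> \<partial>P) \<le> \<sigma>u\<^sup>2 * (t - s) * (\<integral>\<omega>. ?g N \<omega> \<partial>P)"
    using 1(1) by (simp add: \<tau>_def)
  also have "\<sigma>u\<^sup>2 * (t - s) * (\<integral>\<omega>. ?g N \<omega> \<partial>P) \<le> \<sigma>u\<^sup>2 * (t - s) * (\<sigma>u\<^sup>2 * (s - u))"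
    using law_trunc_sq_le(1)[OF u, of "s - u" N] s t by (intro mult_left_mono) auto
  finally have "(\<integral>\<omega>. ?g N \<omega> * ?f N \<omega> \<partial>P) \<le> \<sigma>u\<^sup>2 * (s - u) * (\<sigma>u\<^sup>2 * (t - s))" by (simp add: ac_simps)
  then show "(\<integral>\<^sup>+\<omega>. ennreal (?g N \<omega> * ?f N \<omega>) \<partial>P) \<le> ennreal (\<sigma>u\<^sup>2 * (s - u) * (\<sigma>u\<^sup>2 * (t - s)))"
    using 2 by (subst nn_integral_eq_integral) (auto simp: trunc_sq_nonneg intro!: ennreal_leI)
qed

lemma law_increment_integrable:
  assumes s: "0 \<le> s" and t: "s \<le> t"
  shows "integrable P (\<lambda>\<omega>. B t \<omega> - B s \<omega>)"
proof (rule square_integrable_imp_integrable)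
  show "integrable P (\<lambda>\<omega>. (B t \<omega> - B s \<omega>)\<^sup>2)"
    by (rule integrableI_bounded)
      (use law_second_moment[OF s t] in \<open>auto intro: le_less_trans ennreal_less_top\<close>)
qed measurable

text \<open>The one-sided bound applies to the clipped increment and to its negative, each with
  \<alpha> = 1/N. As N grows both signs give an integral at most 0, hence 0.\<close>

lemma law_martingale_cylinder:
  assumes s: "0 \<le> s" and t: "s \<le> t"
    and g: "bounded_Lipschitz_n n g" and g0: "\<And>x. g x \<ge> 0"
    and \<tau>: "\<And>i. i < n \<Longrightarrow> 0 \<le> \<tau> i \<and> \<tau> i \<le> s" "mono_on {..<n} \<tau>"
  shows "(\<integral>\<omega>. g (\<lambda>i. B (\<tau> i) \<omega>) * (B t \<omega> - B s \<omega>) \<partial>P) = 0"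
proof -
  define X where "X \<omega> = g (\<lambda>i. B (\<tau> i) \<omega>)" for \<omega>
  define c where "c N x = max (- real N) (min (real N) x)" for N x
  have X: "X \<in> cylinder_functions" unfolding X_def by (rule cylinderI[OF g]) (use \<tau> in auto)
  note [measurable] = cylinder_measurable(1)[OF X]
  obtain M where M: "\<And>\<omega>. \<bar>X \<omega>\<bar> \<le> M" using cylinder_measurable(2)[OF X] by auto
  have lim: "(\<lambda>N. \<integral>\<omega>. X \<omega> * (e * c (Suc N) (B t \<omega> - B s \<omega>)) \<partial>P) \<longlonglongrightarrow> (\<integral>\<omega>. X \<omega> * (e * (B t \<omega> - B s \<omega>)) \<partial>P)" for e :: real
  proof (rule integral_dominated_convergence[where w="\<lambda>\<omega>. M * (\<bar>e\<bar> * \<bar>B t \<omega> - B s \<omega>\<bar>)"])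
    show "integrable P (\<lambda>\<omega>. M * (\<bar>e\<bar> * \<bar>B t \<omega> - B s \<omega>\<bar>))"
      by (intro integrable_mult_right integrable_abs law_increment_integrable s t)
    show "AE \<omega> in P. (\<lambda>N. X \<omega> * (e * c (Suc N) (B t \<omega> - B s \<omega>))) \<longlonglongrightarrow> X \<omega> * (e * (B t \<omega> - B s \<omega>))"
    proof (intro AE_I2 tendsto_mult tendsto_const tendsto_eventually)
      fix \<omega>
      obtain N0 where "\<bar>B t \<omega> - B s \<omega>\<bar> \<le> real N0" using real_arch_simple by blast
      then show "\<forall>\<^sub>F N in sequentially. c (Suc N) (B t \<omega> - B s \<omega>) = B t \<omega> - B s \<omega>"
        by (intro eventually_sequentiallyI[of N0]) (auto simp: c_def max_def min_def)
    qed
    show "AE \<omega> in P. norm (X \<omega> * (e * c (Suc N) (B t \<omega> - B s \<omega>))) \<le> M * (\<bar>e\<bar> * \<bar>B t \<omega> - B s \<omega>\<bar>)" for N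
      using M unfolding real_norm_def abs_mult c_def
      by (intro AE_I2 mult_mono M mult_left_mono) (auto intro: order_trans[OF abs_ge_zero])
  qed (simp_all add: c_def)
  have le: "(\<integral>\<omega>. X \<omega> * (e * (B t \<omega> - B s \<omega>)) \<partial>P) \<le> 0" if e: "e = 1 \<or> e = - 1" for e :: real
  proof (rule LIMSEQ_le[OF lim])
    have "(\<lambda>N. 1 / real (Suc N) * (\<sigma>u\<^sup>2 * (t - s)) * (\<integral>\<omega>. X \<omega> \<partial>P)) \<longlonglongrightarrow> 0 * (\<sigma>u\<^sup>2 * (t - s)) * (\<integral>\<omega>. X \<omega> \<partial>P)"
      using LIMSEQ_Suc[OF lim_1_over_n] by (intro tendsto_mult tendsto_const)
    then show "(\<lambda>N. 1 / real (Suc N) * (\<sigma>u\<^sup>2 * (t - s)) * (\<integral>\<omega>. X \<omega> \<partial>P)) \<longlonglongrightarrow> 0" by simp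
    have "(\<integral>\<omega>. X \<omega> * (e * c (Suc N) (B t \<omega> - B s \<omega>)) \<partial>P) \<le> 1 / real (Suc N) * (\<sigma>u\<^sup>2 * (t - s)) * (\<integral>\<omega>. X \<omega> \<partial>P)" for N
      unfolding X_def c_def
      using law_product_le(1)[OF s _ g g0 \<tau> bounded_Lipschitz_clip clip_le_quadratic, of "t - s" "Suc N" e] t e by simp
    then show "\<exists>N. \<forall>n\<ge>N. (\<integral>\<omega>. X \<omega> * (e * c (Suc n) (B t \<omega> - B s \<omega>)) \<partial>P) \<le> 1 / real (Suc n) * (\<sigma>u\<^sup>2 * (t - s)) * (\<integral>\<omega>. X \<omega> \<partial>P)"
      by blast
  qed
  have "(\<integral>\<omega>. X \<omega> * (- 1 * (B t \<omega> - B s \<omega>)) \<partial>P) = - (\<integral>\<omega>. X \<omega> * (B t \<omega> - B s \<omega>) \<partial>P)"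
    by (simp only: mult_minus1 mult_minus_right integral_minus)
  then show ?thesis using le[of 1] le[of "- 1"] by (simp add: X_def)
qed

text \<open>The Lipschitz condition in the uniform norm on [0, s] makes the values at the
  interpolated paths converge, and it also makes these values bounded Lipschitz functions of
  finitely many coordinates.\<close>

lemma law_martingale_Lipschitz:
  assumes s: "0 \<le> s" and t: "s \<le> t"
    and f0: "\<And>\<omega>. 0 \<le> f \<omega>" and fM: "\<And>\<omega>. f \<omega> \<le> M" and K: "0 \<le> K"
    and L: "\<And>\<omega> \<omega>' d. (\<And>r. r \<in> {0..s} \<Longrightarrow> \<bar>B r \<omega> - B r \<omega>'\<bar> \<le> d) \<Longrightarrow> \<bar>f \<omega> - f \<omega>'\<bar> \<le> K * d"
  shows "(\<integral>\<omega>. f \<omega> * (B t \<omega> - B s \<omega>) \<partial>P) = 0" "f \<in> borel_measurable borel"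
proof -
  define fn where "fn n \<omega> = f (interp s n (\<lambda>k. B (s * real k / real n) \<omega>))" for n \<omega>
  have conv: "(\<lambda>n. fn n \<omega>) \<longlonglongrightarrow> f \<omega>" for \<omega>
  proof (rule LIMSEQ_I)
    fix r :: real assume r: "r > 0"
    then have "r / (K + 1) > 0" using K by simp
    from interp_close[OF s this, of \<omega>] obtain N where
      N: "\<And>n q. n \<ge> N \<Longrightarrow> q \<in> {0..s} \<Longrightarrow> \<bar>B q \<omega> - B q (interp s n (\<lambda>k. B (s * k / n) \<omega>))\<bar> < r / (K + 1)" by blast
    have "norm (fn n \<omega> - f \<omega>) < r" if "n \<ge> N" for n
    proof -
      have "\<bar>f \<omega> - fn n \<omega>\<bar> \<le> K * (r / (K + 1))"
        unfolding fn_def by (rule L) (use N[OF that] in \<open>auto intro: less_imp_le\<close>)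
      also have "\<dots> < r" using r K by (simp add: field_simps)
      finally show ?thesis by (simp add: abs_minus_commute)
    qed
    then show "\<exists>N. \<forall>n\<ge>N. norm (fn n \<omega> - f \<omega>) < r" by blast
  qed
  have BL: "bounded_Lipschitz_n (Suc n) (\<lambda>x. f (interp s n x))" for n
  proof (rule bounded_Lipschitz_nI)
    show "\<bar>f (interp s n x)\<bar> \<le> M" for x using f0 fM by simp
    show "\<bar>f (interp s n x) - f (interp s n y)\<bar> \<le> K * (\<Sum>i<Suc n. \<bar>x i - y i\<bar>)" for x y
      by (rule L) (rule interp_Lipschitz)
  qed
  have \<tau>: "0 \<le> s * real i / real n \<and> s * real i / real n \<le> s" if "i < Suc n" for i n
  proof (cases "n = 0")
    case False
    have "s * real i \<le> s * real n" using s that by (intro mult_left_mono) auto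
    then show ?thesis using False s by (simp add: field_simps)
  qed (use s in simp)
  have mono: "mono_on {..<Suc n} (\<lambda>i. s * real i / real n)" for n
    unfolding mono_on_def using s by (auto intro!: divide_right_mono mult_left_mono)
  have fn [measurable]: "fn n \<in> borel_measurable borel" for n
    unfolding fn_def by (rule cylinder_measurable(1)[OF cylinderI[OF BL]]) (use \<tau> in blast)
  show [measurable]: "f \<in> borel_measurable borel"
    by (rule borel_measurable_LIMSEQ_real[OF conv fn])
  have "(\<lambda>n. \<integral>\<omega>. fn n \<omega> * (B t \<omega> - B s \<omega>) \<partial>P) \<longlonglongrightarrow> (\<integral>\<omega>. f \<omega> * (B t \<omega> - B s \<omega>) \<partial>P)"
  proof (rule integral_dominated_convergence[where w="\<lambda>\<omega>. M * \<bar>B t \<omega> - B s \<omega>\<bar>"])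
    show "integrable P (\<lambda>\<omega>. M * \<bar>B t \<omega> - B s \<omega>\<bar>)"
      by (intro integrable_mult_right integrable_abs law_increment_integrable s t)
    show "AE \<omega> in P. (\<lambda>N. fn N \<omega> * (B t \<omega> - B s \<omega>)) \<longlonglongrightarrow> f \<omega> * (B t \<omega> - B s \<omega>)"
      by (intro AE_I2 tendsto_mult tendsto_const conv)
    show "AE \<omega> in P. norm (fn N \<omega> * (B t \<omega> - B s \<omega>)) \<le> M * \<bar>B t \<omega> - B s \<omega>\<bar>" for N
      using f0 fM by (auto simp: fn_def abs_mult intro!: mult_right_mono)
  qed simp_all
  moreover have "(\<integral>\<omega>. fn n \<omega> * (B t \<omega> - B s \<omega>) \<partial>P) = 0" for n
    unfolding fn_def by (rule law_martingale_cylinder[OF s t BL f0 \<tau> mono])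
  ultimately show "(\<integral>\<omega>. f \<omega> * (B t \<omega> - B s \<omega>) \<partial>P) = 0"
    by (simp add: LIMSEQ_const_iff)
qed

text \<open>The functions max(0, 1 - k D) decrease to the indicator, where D is the uniform distance
  on [0, s] to the paths whose stopped version lies in \<open>C\<close>; they are Lipschitz with
  constant k.\<close>

lemma law_martingale_closed:
  assumes s: "0 \<le> s" and t: "s \<le> t" and C: "closed C"
  shows "(\<integral>\<omega>. indicator C (stopped s \<omega>) * (B t \<omega> - B s \<omega>) \<partial>P) = 0"
proof (cases "stopped s -` C = {}")
  case True
  then have "indicator C (stopped s \<omega>) = (0::real)" for \<omega> by (auto simp: indicator_def)
  then show ?thesis by simp
next
  case False
  define F where "F = stopped s -` C"
  have [measurable]: "C \<in> sets borel" using C by auto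
  have ne: "F \<noteq> {}" using False by (simp add: F_def)
  define N where "N \<omega> \<omega>' = (SUP r\<in>{0..s}. \<bar>B r \<omega> - B r \<omega>'\<bar>)" for \<omega> \<omega>'
  define D where "D \<omega> = (INF \<omega>'\<in>F. N \<omega> \<omega>')" for \<omega>
  have bdd: "bdd_above ((\<lambda>r. \<bar>B r \<omega> - B r \<omega>'\<bar>) ` {0..s})" for \<omega> \<omega>'
    by (intro bounded_imp_bdd_above compact_imp_bounded compact_continuous_image continuous_intros continuous_B) auto
  have N_ge: "\<bar>B r \<omega> - B r \<omega>'\<bar> \<le> N \<omega> \<omega>'" if "r \<in> {0..s}" for r \<omega> \<omega>'
    unfolding N_def by (rule cSUP_upper[OF that bdd])
  have N0: "0 \<le> N \<omega> \<omega>'" for \<omega> \<omega>' using N_ge[of 0 \<omega> \<omega>'] s by auto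
  have bddD: "bdd_below (N \<omega> ` F)" for \<omega> using N0 by (auto simp: bdd_below_def)
  have D0: "0 \<le> D \<omega>" for \<omega> unfolding D_def using ne N0 by (intro cINF_greatest) auto
  have D_le: "D \<omega> \<le> D \<omega>' + d" if d: "\<And>r. r \<in> {0..s} \<Longrightarrow> \<bar>B r \<omega> - B r \<omega>'\<bar> \<le> d" for \<omega> \<omega>' d
  proof -
    have "D \<omega> - d \<le> N \<omega>' \<omega>''" if "\<omega>'' \<in> F" for \<omega>''
    proof -
      have "N \<omega> \<omega>'' \<le> N \<omega>' \<omega>'' + d"
        unfolding N_def[of \<omega>]
      proof (rule cSUP_least)
        show "{0..s} \<noteq> {}" using s by auto
        fix r assume r: "r \<in> {0..s}"
        show "\<bar>B r \<omega> - B r \<omega>''\<bar> \<le> N \<omega>' \<omega>'' + d"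
          using d[OF r] N_ge[OF r, of \<omega>' \<omega>''] by linarith
      qed
      moreover have "D \<omega> \<le> N \<omega> \<omega>''" unfolding D_def by (rule cINF_lower[OF bddD that])
      ultimately show ?thesis by simp
    qed
    then have "D \<omega> - d \<le> D \<omega>'" unfolding D_def[of \<omega>'] using ne by (intro cINF_greatest)
    then show ?thesis by simp
  qed
  \<comment> \<open>A stopped path is constant after \<open>s\<close>, so uniform closeness on
    [0, s] controls stopped paths at all times. This lets closedness of \<open>C\<close> in the
    locally uniform topology turn distance 0 into membership.\<close>
  have D_F: "D \<omega> = 0 \<longleftrightarrow> \<omega> \<in> F" for \<omega>
  proof
    assume "\<omega> \<in> F"
    then have "D \<omega> \<le> N \<omega> \<omega>" unfolding D_def by (rule cINF_lower[OF bddD])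
    also have "\<dots> = 0" using s by (simp add: N_def)
    finally show "D \<omega> = 0" using D0[of \<omega>] by simp
  next
    assume D: "D \<omega> = 0"
    show "\<omega> \<in> F"
    proof (rule ccontr)
      assume "\<omega> \<notin> F"
      then have "stopped s \<omega> \<in> - C" by (simp add: F_def)
      moreover have "open (- C)" by (rule open_Compl[OF C])
      ultimately obtain T e where e: "e > 0"
        and *: "{\<omega>'. \<forall>t\<in>{0..T}. \<bar>B t \<omega>' - B t (stopped s \<omega>)\<bar> < e} \<subseteq> - C"
        unfolding open_cpath_def by blast
      have "\<exists>\<omega>'\<in>F. N \<omega> \<omega>' < e"
        using D e ne bddD[of \<omega>] unfolding D_def by (metis cINF_less_iff)
      then obtain \<omega>' where \<omega>': "\<omega>' \<in> F" "N \<omega> \<omega>' < e" by blast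
      have "\<bar>B t (stopped s \<omega>') - B t (stopped s \<omega>)\<bar> < e" if "t \<in> {0..T}" for t
        using N_ge[of "min t s" \<omega> \<omega>'] that s \<omega>'(2) by (simp add: B_stopped abs_minus_commute)
      then have "stopped s \<omega>' \<in> - C" using * by blast
      with \<omega>'(1) show False by (simp add: F_def)
    qed
  qed
  define f where "f k \<omega> = max 0 (1 - real k * D \<omega>)" for k \<omega>
  have fL: "\<bar>f k \<omega> - f k \<omega>'\<bar> \<le> real k * d" if d: "\<And>r. r \<in> {0..s} \<Longrightarrow> \<bar>B r \<omega> - B r \<omega>'\<bar> \<le> d" for k \<omega> \<omega>' d
  proof -
    have "D \<omega> \<le> D \<omega>' + d" by (rule D_le[OF d])
    moreover have "D \<omega>' \<le> D \<omega> + d" by (rule D_le) (use d in \<open>simp add: abs_minus_commute\<close>)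
    ultimately have "\<bar>D \<omega> - D \<omega>'\<bar> \<le> d" by linarith
    then have "real k * \<bar>D \<omega> - D \<omega>'\<bar> \<le> real k * d" by (intro mult_left_mono) auto
    moreover have "\<bar>f k \<omega> - f k \<omega>'\<bar> \<le> \<bar>real k * (D \<omega> - D \<omega>')\<bar>" by (simp add: f_def right_diff_distrib)
    ultimately show ?thesis by (simp add: abs_mult)
  qed
  have f01: "0 \<le> f k \<omega>" "f k \<omega> \<le> 1" for k \<omega> using D0 by (auto simp: f_def)
  note F = law_martingale_Lipschitz[OF s t f01 of_nat_0_le_iff fL]
  note [measurable] = F(2)
  have f_lim: "(\<lambda>k. f k \<omega>) \<longlonglongrightarrow> indicator C (stopped s \<omega>)" for \<omega>
  proof (rule tendsto_eventually)
    show "\<forall>\<^sub>F k in sequentially. f k \<omega> = indicator C (stopped s \<omega>)"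
    proof (cases "\<omega> \<in> F")
      case True
      then show ?thesis using D_F[of \<omega>] by (simp add: f_def F_def)
    next
      case False
      then have "D \<omega> > 0" using D_F[of \<omega>] D0[of \<omega>] by linarith
      then obtain k0 where k0: "1 < real k0 * D \<omega>" using reals_Archimedean3 by blast
      have "f k \<omega> = 0" if "k \<ge> k0" for k
        using k0 mult_right_mono[of "real k0" "real k" "D \<omega>"] that D0[of \<omega>] by (auto simp: f_def max_def)
      then show ?thesis using False by (intro eventually_sequentiallyI[of k0]) (auto simp: F_def)
    qed
  qed
  have "(\<lambda>n. \<integral>\<omega>. f n \<omega> * (B t \<omega> - B s \<omega>) \<partial>P) \<longlonglongrightarrow> (\<integral>\<omega>. indicator C (stopped s \<omega>) * (B t \<omega> - B s \<omega>) \<partial>P)"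
  proof (rule integral_dominated_convergence[where w="\<lambda>\<omega>. \<bar>B t \<omega> - B s \<omega>\<bar>"])
    show "integrable P (\<lambda>\<omega>. \<bar>B t \<omega> - B s \<omega>\<bar>)"
      by (intro integrable_abs law_increment_integrable s t)
    show "AE \<omega> in P. (\<lambda>N. f N \<omega> * (B t \<omega> - B s \<omega>)) \<longlonglongrightarrow> indicator C (stopped s \<omega>) * (B t \<omega> - B s \<omega>)"
      by (intro AE_I2 tendsto_mult tendsto_const f_lim)
    show "AE \<omega> in P. norm (f N \<omega> * (B t \<omega> - B s \<omega>)) \<le> \<bar>B t \<omega> - B s \<omega>\<bar>" for N
      using f01 by (auto simp: abs_mult intro!: mult_left_le_one_le)
  qed measurable
  then show ?thesis using F(1) by (simp add: LIMSEQ_const_iff)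
qed

text \<open>The positive and the negative part of the increment, used as densities and pushed
  forward by stopping, give two finite measures that agree on closed sets. Closed sets are stable
  under intersection and generate the Borel sets, so the measures coincide, and with them all
  integrals of nonnegative functions of the stopped path.\<close>

lemma law_martingale_nn:
  assumes s: "0 \<le> s" and t: "s \<le> t"
    and Y: "Y \<in> borel_measurable borel" and st: "\<And>\<omega>. Y (stopped s \<omega>) = Y \<omega>"
  shows "(\<integral>\<^sup>+\<omega>. Y \<omega> * ennreal (B t \<omega> - B s \<omega>) \<partial>P) = (\<integral>\<^sup>+\<omega>. Y \<omega> * ennreal (B s \<omega> - B t \<omega>) \<partial>P)"
proof -
  let ?D = "\<lambda>\<omega>. B t \<omega> - B s \<omega>"
  \<comment> \<open>The coercion \<open>ennreal\<close> cuts negative values to 0, so e = 1 and e =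
    -1 select the positive and the negative part of the increment.\<close>
  define \<mu> where "\<mu> e = distr (density P (\<lambda>\<omega>. ennreal (e * ?D \<omega>))) borel (stopped s)" for e :: real
  have em: "(\<integral>\<^sup>+\<omega>. Z \<omega> \<partial>\<mu> e) = (\<integral>\<^sup>+\<omega>. Z (stopped s \<omega>) * ennreal (e * ?D \<omega>) \<partial>P)"
    if [measurable]: "Z \<in> borel_measurable borel" for Z e
    unfolding \<mu>_def by (subst nn_integral_distr) (simp_all add: nn_integral_density mult.commute)
  have ind: "emeasure (\<mu> e) C = (\<integral>\<^sup>+\<omega>. indicator C (stopped s \<omega>) * ennreal (e * ?D \<omega>) \<partial>P)"
    if "C \<in> sets borel" for C e
    using em[of "indicator C" e] that by (simp add: \<mu>_def)
  have int: "integrable P ?D" by (rule law_increment_integrable[OF s t])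
  have closed: "emeasure (\<mu> 1) C = emeasure (\<mu> (- 1)) C" "emeasure (\<mu> 1) C \<noteq> \<infinity>" if C: "closed C" for C
  proof -
    have [measurable]: "C \<in> sets borel" using C by auto
    let ?X = "\<lambda>\<omega>. indicator C (stopped s \<omega>) * ?D \<omega>"
    have I: "integrable P ?X" by (rule Bochner_Integration.integrable_bound[OF int]) (auto simp: indicator_def)
    have *: "emeasure (\<mu> 1) C = (\<integral>\<^sup>+\<omega>. ennreal (?X \<omega>) \<partial>P)" "emeasure (\<mu> (- 1)) C = (\<integral>\<^sup>+\<omega>. ennreal (- ?X \<omega>) \<partial>P)"
      unfolding ind[OF \<open>C \<in> sets borel\<close>] by (auto intro!: nn_integral_cong simp: indicator_def)
    have fin: "(\<integral>\<^sup>+\<omega>. ennreal (?X \<omega>) \<partial>P) \<noteq> \<infinity>" "(\<integral>\<^sup>+\<omega>. ennreal (- ?X \<omega>) \<partial>P) \<noteq> \<infinity>"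
      using I unfolding real_integrable_def by auto
    have "enn2real (\<integral>\<^sup>+\<omega>. ennreal (?X \<omega>) \<partial>P) = enn2real (\<integral>\<^sup>+\<omega>. ennreal (- ?X \<omega>) \<partial>P)"
      using real_lebesgue_integral_def[OF I] law_martingale_closed[OF s t C] by simp
    then show "emeasure (\<mu> 1) C = emeasure (\<mu> (- 1)) C"
      using fin unfolding * by (rule enn2real_inj[rotated 2])
    show "emeasure (\<mu> 1) C \<noteq> \<infinity>" using fin unfolding * by simp
  qed
  have "\<mu> 1 = \<mu> (- 1)"
  proof (rule measure_eqI_generator_eq[where E="Collect closed" and \<Omega>=UNIV and A="\<lambda>_. UNIV"])
    show "Int_stable (Collect closed :: cpath set set)" by (auto simp: Int_stable_def)
    have "sets (borel :: cpath measure) = sigma_sets UNIV (Collect closed)"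
      by (subst borel_eq_closed) simp
    then show "sets (\<mu> 1) = sigma_sets UNIV (Collect closed)" "sets (\<mu> (- 1)) = sigma_sets UNIV (Collect closed)"
      by (simp_all add: \<mu>_def)
  qed (use closed in auto)
  with em[OF Y, of 1] em[OF Y, of "- 1"] show ?thesis by (simp add: st)
qed

text \<open>For nonnegative X the equality of the integrals against both parts of the increment says
  that the mean vanishes. A general X is split into its positive and negative parts, both dominated
  by \<bar>X\<bar>.\<close>

lemma law_martingale:
  assumes s: "0 \<le> s" and t: "s \<le> t" and X: "adapted s X"
    and int: "integrable P (\<lambda>\<omega>. X \<omega> * (B t \<omega> - B s \<omega>))"
  shows "(\<integral>\<omega>. X \<omega> * (B t \<omega> - B s \<omega>) \<partial>P) = 0"
proof -
  let ?D = "\<lambda>\<omega>. B t \<omega> - B s \<omega>"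
  have [measurable]: "X \<in> borel_measurable borel" using X by (rule adapted_measurable)
  have st: "X (stopped s \<omega>) = X \<omega>" for \<omega> using X by (simp add: adapted_def)
  have zero: "(\<integral>\<omega>. Y \<omega> * ?D \<omega> \<partial>P) = 0"
    if Y [measurable]: "Y \<in> borel_measurable borel" and sY: "\<And>\<omega>. Y (stopped s \<omega>) = Y \<omega>" and Y0: "\<And>\<omega>. 0 \<le> Y \<omega>"
      and I: "integrable P (\<lambda>\<omega>. Y \<omega> * ?D \<omega>)" for Y :: "cpath \<Rightarrow> real"
  proof -
    have "(\<integral>\<^sup>+\<omega>. ennreal (Y \<omega> * ?D \<omega>) \<partial>P) = (\<integral>\<^sup>+\<omega>. ennreal (Y \<omega>) * ennreal (?D \<omega>) \<partial>P)"
      using Y0 by (simp add: ennreal_mult')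
    also have "\<dots> = (\<integral>\<^sup>+\<omega>. ennreal (Y \<omega>) * ennreal (B s \<omega> - B t \<omega>) \<partial>P)"
      by (rule law_martingale_nn[OF s t]) (simp_all add: sY)
    also have "\<dots> = (\<integral>\<^sup>+\<omega>. ennreal (- (Y \<omega> * ?D \<omega>)) \<partial>P)"
      using Y0 by (simp add: ennreal_mult'[symmetric] algebra_simps)
    finally show ?thesis using real_lebesgue_integral_def[OF I] by simp
  qed
  have I: "integrable P (\<lambda>\<omega>. max 0 (e * X \<omega>) * ?D \<omega>)" if "\<bar>e\<bar> = 1" for e :: real
  proof (rule Bochner_Integration.integrable_bound[OF int])
    have "max 0 (e * X \<omega>) \<le> \<bar>X \<omega>\<bar>" for \<omega>
      using that abs_ge_self[of "e * X \<omega>"] by (simp add: abs_mult)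
    then show "AE \<omega> in P. norm (max 0 (e * X \<omega>) * ?D \<omega>) \<le> norm (X \<omega> * ?D \<omega>)"
      by (auto simp: abs_mult intro!: mult_right_mono)
  qed measurable
  have "(\<integral>\<omega>. X \<omega> * ?D \<omega> \<partial>P) = (\<integral>\<omega>. max 0 (1 * X \<omega>) * ?D \<omega> - max 0 (- 1 * X \<omega>) * ?D \<omega> \<partial>P)"
    by (rule Bochner_Integration.integral_cong) (auto simp: max_def)
  also have "\<dots> = (\<integral>\<omega>. max 0 (1 * X \<omega>) * ?D \<omega> \<partial>P) - (\<integral>\<omega>. max 0 (- 1 * X \<omega>) * ?D \<omega> \<partial>P)"
    by (intro Bochner_Integration.integral_diff I) auto
  also have "\<dots> = 0"
    using zero[OF _ _ _ I[of 1]] zero[OF _ _ _ I[of "- 1"]] by (simp add: st)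
  finally show ?thesis .
qed

lemma represents_martingale_law: "martingale_law P (\<sigma>u\<^sup>2)"
  by unfold_locales
    (use law_second_moment law_product_moment law_martingale in \<open>auto simp: sets_law\<close>)

end

context martingale_law
begin

lemma measurable_P [simp]: "measurable P N = measurable borel N"
  by (rule measurable_cong_sets[OF sets_P refl])

lemma measurable_ident_P [measurable]: "(\<lambda>\<omega>. \<omega>) \<in> P \<rightarrow>\<^sub>M borel"
  by simp

end

section \<open>Increasing processes\<close>

text \<open>The path properties are demanded for every path and not just quasi-surely, so that each
  path has a measure \<open>dQ\<close> with known interval masses and no atoms at nonnegative
  times.\<close>

locale increasing_process =
  fixes Q :: "real \<Rightarrow> cpath \<Rightarrow> real"
  assumes Q_measurable [measurable]: "Q t \<in> borel_measurable borel"
    and Q_continuous: "continuous_on UNIV (\<lambda>t. Q (max 0 t) \<omega>)"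
    and Q_mono: "0 \<le> s \<Longrightarrow> s \<le> t \<Longrightarrow> Q s \<omega> \<le> Q t \<omega>"
    and Q_0: "Q 0 \<omega> = 0"
begin

lemma Q_nonneg: "0 \<le> t \<Longrightarrow> 0 \<le> Q t \<omega>"
  using Q_mono[of 0 t \<omega>] by (simp add: Q_0)

lemma sets_dQ [simp, measurable_cong]: "sets (dQ Q \<omega>) = sets borel"
  by (simp add: dQ_def)

lemma space_dQ [simp]: "space (dQ Q \<omega>) = UNIV"
  by (simp add: dQ_def)

lemma emeasure_dQ_Icc:
  assumes "0 \<le> s" "s \<le> t"
  shows "emeasure (dQ Q \<omega>) {s..t} = ennreal (Q t \<omega> - Q s \<omega>)"
  unfolding dQ_def using assms
  by (subst emeasure_interval_measure_Icc) (auto intro!: Q_mono Q_continuous)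

lemma emeasure_dQ_singleton: "0 \<le> t \<Longrightarrow> emeasure (dQ Q \<omega>) {t} = 0"
  using emeasure_dQ_Icc[of t t \<omega>] by simp

lemma emeasure_dQ_Ico:
  assumes "0 \<le> s" "s \<le> t"
  shows "emeasure (dQ Q \<omega>) {s..<t} = ennreal (Q t \<omega> - Q s \<omega>)"
proof -
  have "emeasure (dQ Q \<omega>) ({s..<t} \<union> {t}) = emeasure (dQ Q \<omega>) {s..<t} + emeasure (dQ Q \<omega>) {t}"
    by (rule plus_emeasure[symmetric]) auto
  moreover have "{s..<t} \<union> {t} = {s..t}" using assms by auto
  ultimately show ?thesis using assms emeasure_dQ_Icc[OF assms] emeasure_dQ_singleton[of t] by simp
qed

lemma measure_dQ_Int:
  assumes "0 \<le> u" "u \<le> v" "0 \<le> u'" "u' \<le> v'"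
  shows "measure (dQ Q \<omega>) ({u..<v} \<inter> {u'..<v'}) =
      (if max u u' \<le> min v v' then Q (min v v') \<omega> - Q (max u u') \<omega> else 0)"
proof -
  have "{u..<v} \<inter> {u'..<v'} = {max u u'..<min v v'}" by auto
  then show ?thesis using assms
    by (auto simp: measure_def emeasure_dQ_Ico Q_mono)
qed

text \<open>Path integrals are later integrated over paths, so they must be measurable. The kernel
  is tested on the half lines {..a}, where its mass is \<open>Q\<close> at a fixed time up to a
  scaling factor.\<close>

lemma measurable_nn_integral_dQ:
  assumes H: "(\<lambda>(\<omega>, s). H \<omega> s) \<in> borel_measurable (borel \<Otimes>\<^sub>M borel)"
    and t: "0 \<le> t"
  shows "(\<lambda>\<omega>. \<integral>\<^sup>+s\<in>{0..t}. H \<omega> s \<partial>dQ Q \<omega>) \<in> borel_measurable borel"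
proof -
  \<comment> \<open>The measures are scaled to subprobability measures, for which kernel measurability is available.\<close>
  define c where "c \<omega> = ennreal (1 / (1 + Q t \<omega>))" for \<omega>
  define K where "K \<omega> = density (dQ Q \<omega>) (\<lambda>s. c \<omega> * indicator {0..t} s)" for \<omega>
  have emK: "emeasure (K \<omega>) A = c \<omega> * emeasure (dQ Q \<omega>) ({0..t} \<inter> A)" if "A \<in> sets borel" for \<omega> A
  proof -
    have "emeasure (K \<omega>) A = (\<integral>\<^sup>+s. c \<omega> * indicator ({0..t} \<inter> A) s \<partial>dQ Q \<omega>)"
      unfolding K_def using that by (subst emeasure_density) (auto simp: indicator_inter_arith mult.assoc)
    also have "\<dots> = c \<omega> * emeasure (dQ Q \<omega>) ({0..t} \<inter> A)"
      using that by (subst nn_integral_cmult_indicator) auto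
    finally show ?thesis .
  qed
  have "K \<in> measurable borel (subprob_algebra borel)"
  proof (rule measurable_subprob_algebra_generated[where \<Omega>=UNIV and G="range (\<lambda>a. {..a})"])
    show "sets borel = sigma_sets UNIV (range (\<lambda>a::real. {..a}))"
      by (subst borel_eq_atMost) simp
    show "Int_stable (range (\<lambda>a::real. {..a}))"
      by (auto simp: Int_stable_def)
    show "sets (K \<omega>) = sets borel" for \<omega> by (simp add: K_def)
    show "subprob_space (K \<omega>)" for \<omega>
    proof
      have "emeasure (K \<omega>) (space (K \<omega>)) = ennreal (1 / (1 + Q t \<omega>)) * ennreal (Q t \<omega>)"
        using emK[of UNIV \<omega>] emeasure_dQ_Icc[OF _ t, of \<omega>] by (simp add: K_def c_def Q_0)
      also have "\<dots> = ennreal (Q t \<omega> / (1 + Q t \<omega>))"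
        using Q_nonneg[OF t, of \<omega>] by (simp add: ennreal_mult[symmetric])
      also have "\<dots> \<le> 1" using Q_nonneg[OF t, of \<omega>] by simp
      finally show "emeasure (K \<omega>) (space (K \<omega>)) \<le> 1" .
    qed (simp add: K_def)
    have M: "(\<lambda>\<omega>. emeasure (K \<omega>) {..a}) \<in> borel_measurable borel" for a
    proof -
      have "emeasure (K \<omega>) {..a} = (if a < 0 then 0 else c \<omega> * ennreal (Q (min a t) \<omega>))" for \<omega>
      proof -
        have "{0..t} \<inter> {..a} = (if a < 0 then {} else {0..min a t})" by auto
        then show ?thesis using emK[of "{..a}" \<omega>] emeasure_dQ_Icc[of 0 "min a t" \<omega>] t by (simp add: Q_0)
      qed
      moreover have "(\<lambda>\<omega>. if a < 0 then 0 else c \<omega> * ennreal (Q (min a t) \<omega>)) \<in> borel_measurable borel"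
        unfolding c_def by measurable
      ultimately show ?thesis by simp
    qed
    then show "\<And>A. A \<in> range (\<lambda>a. {..a}) \<Longrightarrow> (\<lambda>\<omega>. emeasure (K \<omega>) A) \<in> borel_measurable borel" by auto
    have "emeasure (K \<omega>) UNIV = emeasure (K \<omega>) {..t}" for \<omega>
      using emK[of UNIV \<omega>] emK[of "{..t}" \<omega>] by (simp add: Int_absorb2 Int_absorb1 subset_eq)
    then show "(\<lambda>\<omega>. emeasure (K \<omega>) UNIV) \<in> borel_measurable borel" using M by simp
  qed auto
  from nn_integral_measurable_subprob_algebra2[OF H this]
  have [measurable]: "(\<lambda>\<omega>. integral\<^sup>N (K \<omega>) (H \<omega>)) \<in> borel_measurable borel" .
  have [measurable]: "H \<omega> \<in> borel_measurable borel" for \<omega>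
    using measurable_Pair2[OF H, of \<omega>] by simp
  have "(\<integral>\<^sup>+s\<in>{0..t}. H \<omega> s \<partial>dQ Q \<omega>) = ennreal (1 + Q t \<omega>) * integral\<^sup>N (K \<omega>) (H \<omega>)" for \<omega>
  proof -
    have "integral\<^sup>N (K \<omega>) (H \<omega>) = (\<integral>\<^sup>+s. c \<omega> * (H \<omega> s * indicator {0..t} s) \<partial>dQ Q \<omega>)"
      unfolding K_def by (subst nn_integral_density) (auto simp: ac_simps)
    also have "\<dots> = c \<omega> * (\<integral>\<^sup>+s\<in>{0..t}. H \<omega> s \<partial>dQ Q \<omega>)"
      by (rule nn_integral_cmult) simp
    finally have "ennreal (1 + Q t \<omega>) * integral\<^sup>N (K \<omega>) (H \<omega>) = (ennreal (1 + Q t \<omega>) * c \<omega>) * (\<integral>\<^sup>+s\<in>{0..t}. H \<omega> s \<partial>dQ Q \<omega>)"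
      by (simp add: mult.assoc)
    moreover have "ennreal (1 + Q t \<omega>) * c \<omega> = 1"
      using Q_nonneg[OF t, of \<omega>] by (simp add: c_def ennreal_mult[symmetric] del: ennreal_plus)
    ultimately show ?thesis by simp
  qed
  then show ?thesis by simp
qed

end

section \<open>Quadratic variation under one measure\<close>

lemma sum_lessThan_add: "(\<Sum>j<m + n. f j) = (\<Sum>j<m. f j) + (\<Sum>j<n. f (m + j :: nat))" for f :: "nat \<Rightarrow> 'a :: comm_monoid_add"
  by (induction n) (simp_all add: add.assoc)

lemma ennreal_square_add_le: "ennreal ((x + y)\<^sup>2) \<le> 2 * ennreal (x\<^sup>2) + 2 * ennreal (y\<^sup>2)"
proof -
  have "(x + y)\<^sup>2 \<le> 2 * x\<^sup>2 + 2 * y\<^sup>2"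
    using sum_squares_bound[of x y] by (simp add: power2_sum)
  then have "ennreal ((x + y)\<^sup>2) \<le> ennreal (2 * x\<^sup>2 + 2 * y\<^sup>2)" by (rule ennreal_leI)
  also have "\<dots> = 2 * ennreal (x\<^sup>2) + 2 * ennreal (y\<^sup>2)"
    by (simp add: ennreal_mult ennreal_numeral)
  finally show ?thesis .
qed

lemma nn_integral_square_add_le:
  assumes [measurable]: "X \<in> borel_measurable M" "Y \<in> borel_measurable M"
  shows "(\<integral>\<^sup>+x. ennreal ((X x + Y x)\<^sup>2) \<partial>M) \<le> 2 * (\<integral>\<^sup>+x. ennreal ((X x)\<^sup>2) \<partial>M) + 2 * (\<integral>\<^sup>+x. ennreal ((Y x)\<^sup>2) \<partial>M)"
proof -
  have "(\<integral>\<^sup>+x. ennreal ((X x + Y x)\<^sup>2) \<partial>M) \<le> (\<integral>\<^sup>+x. 2 * ennreal ((X x)\<^sup>2) + 2 * ennreal ((Y x)\<^sup>2) \<partial>M)"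
    by (intro nn_integral_mono ennreal_square_add_le)
  also have "\<dots> = 2 * (\<integral>\<^sup>+x. ennreal ((X x)\<^sup>2) \<partial>M) + 2 * (\<integral>\<^sup>+x. ennreal ((Y x)\<^sup>2) \<partial>M)"
    by (simp add: nn_integral_add nn_integral_cmult)
  finally show ?thesis .
qed

lemma integrable_mult_bounded:
  fixes X f g :: "'a \<Rightarrow> real"
  assumes [measurable]: "X \<in> borel_measurable M" "f \<in> borel_measurable M" "g \<in> borel_measurable M"
    and b: "\<And>x. \<bar>X x\<bar> \<le> C" and f: "integrable M (\<lambda>x. (f x)\<^sup>2)" and g: "integrable M (\<lambda>x. (g x)\<^sup>2)"
  shows "integrable M (\<lambda>x. X x * (f x * g x))"
proof (rule Bochner_Integration.integrable_bound)
  show "integrable M (\<lambda>x. C * ((f x)\<^sup>2 + (g x)\<^sup>2))"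
    using f g by (intro integrable_mult_right Bochner_Integration.integrable_add)
  have "\<bar>X x * (f x * g x)\<bar> \<le> C * ((f x)\<^sup>2 + (g x)\<^sup>2)" for x
  proof -
    have "\<bar>f x * g x\<bar> \<le> (f x)\<^sup>2 + (g x)\<^sup>2"
    proof -
      have "2 * \<bar>f x\<bar> * \<bar>g x\<bar> \<le> (f x)\<^sup>2 + (g x)\<^sup>2"
        using sum_squares_bound[of "\<bar>f x\<bar>" "\<bar>g x\<bar>"] by simp
      moreover have "0 \<le> \<bar>f x\<bar> * \<bar>g x\<bar>" by simp
      ultimately show ?thesis unfolding abs_mult by linarith
    qed
    then show ?thesis using b[of x] unfolding abs_mult[of "X x"] by (intro mult_mono) (auto intro: order_trans[OF abs_ge_zero])
  qed
  then show "AE x in M. norm (X x * (f x * g x)) \<le> norm (C * ((f x)\<^sup>2 + (g x)\<^sup>2))"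
    by (auto intro: order_trans[OF _ abs_ge_self])
qed measurable

definition sq_sum :: "nat \<Rightarrow> real \<Rightarrow> real \<Rightarrow> cpath \<Rightarrow> real" where
  "sq_sum n s t \<omega> = (\<Sum>j<n. (B (s + (t - s) * real (Suc j) / real n) \<omega> - B (s + (t - s) * real j / real n) \<omega>)\<^sup>2)"

lemma measurable_sq_sum [measurable]: "sq_sum n s t \<in> borel_measurable borel"
  unfolding sq_sum_def by measurable

locale quadratic_variation_law = martingale_law + increasing_process +
  assumes Q_lim: "0 \<le> t \<Longrightarrow> 0 < e \<Longrightarrow> \<exists>\<delta>>0. \<forall>n \<tau>. partition_of t n \<tau> \<and> (\<forall>j<n. \<tau> (Suc j) - \<tau> j < \<delta>) \<longrightarrow>
      (\<integral>\<^sup>+\<omega>. ennreal (((\<Sum>j<n. (B (\<tau> (Suc j)) \<omega> - B (\<tau> j) \<omega>)\<^sup>2) - Q t \<omega>)\<^sup>2) \<partial>P) < e"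
begin

lemma increment_sq_integrable:
  assumes s: "0 \<le> s" and t: "s \<le> t"
  shows "integrable P (\<lambda>\<omega>. (B t \<omega> - B s \<omega>)\<^sup>2)"
proof (rule integrableI_bounded)
  show "(\<lambda>\<omega>. (B t \<omega> - B s \<omega>)\<^sup>2) \<in> borel_measurable P" by measurable
  show "(\<integral>\<^sup>+\<omega>. ennreal (norm ((B t \<omega> - B s \<omega>)\<^sup>2)) \<partial>P) < \<infinity>"
    using second_moment[OF s t] by (auto intro: le_less_trans ennreal_less_top)
qed

lemma increment_mult_integrable:
  assumes "0 \<le> s" "s \<le> t" "0 \<le> u" "u \<le> v" "X \<in> borel_measurable borel" "\<And>\<omega>. \<bar>X \<omega>\<bar> \<le> C"
  shows "integrable P (\<lambda>\<omega>. X \<omega> * ((B t \<omega> - B s \<omega>) * (B v \<omega> - B u \<omega>)))"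
  by (rule integrable_mult_bounded[where C=C])
    (use assms in \<open>auto intro!: increment_sq_integrable simp: measurable_cong_sets[OF sets_P refl]\<close>)

lemma martingale_product:
  assumes "0 \<le> a" "a \<le> b" "b \<le> s" "s \<le> t" and X: "adapted s X" and b: "\<And>\<omega>. \<bar>X \<omega>\<bar> \<le> C"
  shows "(\<integral>\<omega>. X \<omega> * ((B b \<omega> - B a \<omega>) * (B t \<omega> - B s \<omega>)) \<partial>P) = 0"
proof -
  have "adapted s (\<lambda>\<omega>. X \<omega> * (B b \<omega> - B a \<omega>))"
    using assms by (intro adapted_mult adapted_diff adapted_B) auto
  from martingale[OF _ _ this, of t] show ?thesis
    using increment_mult_integrable[of a b s t X C] adapted_measurable[OF X] assms by (simp add: mult.assoc)
qed

text \<open>The defining limit concerns partitions that start at 0. For s > 0 a partition of [0, s]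
  is prolonged to one of [0, t], and the two sums of squares are subtracted.\<close>

lemma sq_sum_tendsto:
  assumes s: "0 \<le> s" and t: "s \<le> t"
  shows "(\<lambda>n. \<integral>\<^sup>+\<omega>. ennreal ((sq_sum (Suc n) s t \<omega> - (Q t \<omega> - Q s \<omega>))\<^sup>2) \<partial>P) \<longlonglongrightarrow> 0"
proof -
  have small: "\<exists>N. \<forall>n\<ge>N. l / real (Suc n) < \<delta>" if "\<delta> > 0" for l \<delta> :: real
  proof -
    have "(\<lambda>n. l / real (Suc n)) \<longlonglongrightarrow> 0"
      using LIMSEQ_Suc[OF lim_const_over_n[of l]] by simp
    from order_tendstoD(2)[OF this that] show ?thesis by (simp add: eventually_sequentially)
  qed
  consider "s = t" | "s = 0" "s < t" | "0 < s" "s < t" using s t by linarith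
  then show ?thesis
  proof cases
    case 1
    then show ?thesis by (simp add: sq_sum_def)
  next
    case 2
    show ?thesis
      unfolding order_tendsto_iff
    proof (intro conjI allI impI)
      fix e :: ennreal assume "0 < e"
      obtain \<delta> where \<delta>: "\<delta> > 0" "\<And>n \<tau>. partition_of t n \<tau> \<Longrightarrow> (\<forall>j<n. \<tau> (Suc j) - \<tau> j < \<delta>) \<Longrightarrow>
        (\<integral>\<^sup>+\<omega>. ennreal (((\<Sum>j<n. (B (\<tau> (Suc j)) \<omega> - B (\<tau> j) \<omega>)\<^sup>2) - Q t \<omega>)\<^sup>2) \<partial>P) < e"
        using Q_lim[of t, OF _ \<open>0 < e\<close>] 2 by auto
      obtain N where N: "\<And>n. n \<ge> N \<Longrightarrow> t / real (Suc n) < \<delta>" using small[OF \<delta>(1)] by blast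
      show "\<forall>\<^sub>F n in sequentially. (\<integral>\<^sup>+\<omega>. ennreal ((sq_sum (Suc n) s t \<omega> - (Q t \<omega> - Q s \<omega>))\<^sup>2) \<partial>P) < e"
      proof (rule eventually_sequentiallyI[of N])
        fix n assume n: "N \<le> n"
        have "partition_of t (Suc n) (\<lambda>j. t * real j / real (Suc n))"
          using 2 by (auto simp: partition_of_def intro!: divide_strict_right_mono mult_strict_left_mono)
        moreover have "\<forall>j<Suc n. t * real (Suc j) / real (Suc n) - t * real j / real (Suc n) < \<delta>"
          using N[OF n] by (simp add: algebra_simps flip: diff_divide_distrib)
        ultimately show "(\<integral>\<^sup>+\<omega>. ennreal ((sq_sum (Suc n) s t \<omega> - (Q t \<omega> - Q s \<omega>))\<^sup>2) \<partial>P) < e"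
          using \<delta>(2)[of "Suc n" "\<lambda>j. t * real j / real (Suc n)"] 2 by (simp add: sq_sum_def Q_0)
      qed
    qed auto
  next
    case 3
    show ?thesis
      unfolding order_tendsto_iff
    proof (intro conjI allI impI)
      fix e :: ennreal assume e: "0 < e"
      \<comment> \<open>Four copies of \<open>e'\<close> arise from (x + y)^2 \<le> 2 x^2 + 2 y^2.
        As \<open>e\<close> may be infinite, a finite value below it is chosen before
        dividing.\<close>
      obtain e' where e': "0 < e'" "2 * e' + 2 * e' < e"
      proof -
        obtain y where y: "0 < y" "y < e" using dense[OF e] by blast
        then obtain r where "y = ennreal r" by (cases y) auto
        then have r: "0 < ennreal r" "ennreal r < e" using y by auto
        have "r > 0" using r by simp
        show ?thesis
        proof (rule that[of "ennreal (r / 4)"])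
          have "2 * ennreal (r / 4) = ennreal (r / 2)"
            using ennreal_mult'[of 2 "r / 4"] by simp
          moreover have "ennreal (r / 2) + ennreal (r / 2) = ennreal r"
            using \<open>r > 0\<close> by (simp flip: ennreal_plus)
          ultimately have "2 * ennreal (r / 4) + 2 * ennreal (r / 4) = ennreal r" by simp
          then show "2 * ennreal (r / 4) + 2 * ennreal (r / 4) < e" using r by simp
        qed (use \<open>r > 0\<close> in simp)
      qed
      have s0: "0 \<le> s" "0 \<le> t" using 3 by auto
      obtain \<delta> where \<delta>: "\<delta> > 0" "\<And>n \<tau>. partition_of t n \<tau> \<Longrightarrow> (\<forall>j<n. \<tau> (Suc j) - \<tau> j < \<delta>) \<Longrightarrow>
        (\<integral>\<^sup>+\<omega>. ennreal (((\<Sum>j<n. (B (\<tau> (Suc j)) \<omega> - B (\<tau> j) \<omega>)\<^sup>2) - Q t \<omega>)\<^sup>2) \<partial>P) < e'"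
        using Q_lim[OF s0(2) e'(1)] by auto
      obtain \<delta>' where \<delta>': "\<delta>' > 0" "\<And>n \<tau>. partition_of s n \<tau> \<Longrightarrow> (\<forall>j<n. \<tau> (Suc j) - \<tau> j < \<delta>') \<Longrightarrow>
        (\<integral>\<^sup>+\<omega>. ennreal (((\<Sum>j<n. (B (\<tau> (Suc j)) \<omega> - B (\<tau> j) \<omega>)\<^sup>2) - Q s \<omega>)\<^sup>2) \<partial>P) < e'"
        using Q_lim[OF s0(1) e'(1)] by auto
      obtain N where N: "\<And>n. n \<ge> N \<Longrightarrow> max s (t - s) / real (Suc n) < min \<delta> \<delta>'"
        using small[of "min \<delta> \<delta>'" "max s (t - s)"] \<delta>(1) \<delta>'(1) unfolding min_less_iff_conj by blast
      show "\<forall>\<^sub>F n in sequentially. (\<integral>\<^sup>+\<omega>. ennreal ((sq_sum (Suc n) s t \<omega> - (Q t \<omega> - Q s \<omega>))\<^sup>2) \<partial>P) < e"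
      proof (rule eventually_sequentiallyI[of N])
        fix n assume n: "N \<le> n"
        let ?n = "Suc n"
        define \<tau> where "\<tau> j = (if j \<le> ?n then s * real j / real ?n else s + (t - s) * real (j - ?n) / real ?n)" for j
        have mesh: "s / real ?n < \<delta>" "s / real ?n < \<delta>'" "(t - s) / real ?n < \<delta>"
          using N[OF n] divide_right_mono[of s "max s (t - s)" "real ?n"] divide_right_mono[of "t - s" "max s (t - s)" "real ?n"] by auto
        have \<tau>1: "\<tau> (Suc j) - \<tau> j = s / real ?n" if "j < ?n" for j
          using that by (simp add: \<tau>_def distrib_left flip: diff_divide_distrib)
        have \<tau>2: "\<tau> (?n + j) = s + (t - s) * real j / real ?n" for j
          using 3 by (simp add: \<tau>_def)
        have \<tau>3: "\<tau> (Suc j) - \<tau> j = (t - s) / real ?n" if "j \<ge> ?n" for j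
          using \<tau>2[of "j - ?n"] \<tau>2[of "Suc j - ?n"] that by (simp add: field_simps of_nat_diff)
        have pos: "0 < s / real ?n" "0 < (t - s) / real ?n" using 3 by auto
        have inc: "\<tau> (Suc j) - \<tau> j = s / real ?n \<or> \<tau> (Suc j) - \<tau> j = (t - s) / real ?n" for j
          using \<tau>1 \<tau>3 by (meson not_less)
        have incr: "\<tau> j < \<tau> (Suc j)" for j using inc[of j] pos by linarith
        have "\<tau> 0 = 0" "\<tau> ?n = s" "\<tau> (?n + ?n) = t" using \<tau>2[of ?n] by (simp_all add: \<tau>_def)
        then have P1: "partition_of s ?n \<tau>" and P2: "partition_of t (?n + ?n) \<tau>"
          unfolding partition_of_def using incr by blast+
        define S1 where "S1 \<omega> = (\<Sum>j<?n. (B (\<tau> (Suc j)) \<omega> - B (\<tau> j) \<omega>)\<^sup>2)" for \<omega>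
        define S2 where "S2 \<omega> = (\<Sum>j<?n+?n. (B (\<tau> (Suc j)) \<omega> - B (\<tau> j) \<omega>)\<^sup>2)" for \<omega>
        have [measurable]: "S1 \<in> borel_measurable borel" "S2 \<in> borel_measurable borel"
          unfolding S1_def S2_def by measurable
        have sq: "sq_sum ?n s t \<omega> = S2 \<omega> - S1 \<omega>" for \<omega>
        proof -
          have "S2 \<omega> = S1 \<omega> + (\<Sum>j<?n. (B (\<tau> (Suc (?n + j))) \<omega> - B (\<tau> (?n + j)) \<omega>)\<^sup>2)"
            unfolding S1_def S2_def by (rule sum_lessThan_add)
          then show ?thesis
            unfolding sq_sum_def \<tau>2[symmetric] add_Suc_right by simp
        qed
        have "(\<integral>\<^sup>+\<omega>. ennreal ((sq_sum ?n s t \<omega> - (Q t \<omega> - Q s \<omega>))\<^sup>2) \<partial>P)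
           = (\<integral>\<^sup>+\<omega>. ennreal (((S2 \<omega> - Q t \<omega>) + (Q s \<omega> - S1 \<omega>))\<^sup>2) \<partial>P)"
          by (simp add: sq algebra_simps)
        also have "\<dots> \<le> 2 * (\<integral>\<^sup>+\<omega>. ennreal ((S2 \<omega> - Q t \<omega>)\<^sup>2) \<partial>P) + 2 * (\<integral>\<^sup>+\<omega>. ennreal ((Q s \<omega> - S1 \<omega>)\<^sup>2) \<partial>P)"
          by (rule nn_integral_square_add_le) measurable
        also have "\<dots> \<le> 2 * e' + 2 * e'"
        proof (intro add_mono mult_left_mono)
          show "(\<integral>\<^sup>+\<omega>. ennreal ((S2 \<omega> - Q t \<omega>)\<^sup>2) \<partial>P) \<le> e'"
            unfolding S2_def by (rule less_imp_le[OF \<delta>(2)[OF P2]], intro allI impI) (use inc mesh in \<open>metis (no_types)\<close>)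
          show "(\<integral>\<^sup>+\<omega>. ennreal ((Q s \<omega> - S1 \<omega>)\<^sup>2) \<partial>P) \<le> e'"
            using \<delta>'(2)[OF P1] \<tau>1 mesh by (simp add: S1_def power2_commute)
        qed auto
        also note e'(2)
        finally show "(\<integral>\<^sup>+\<omega>. ennreal ((sq_sum ?n s t \<omega> - (Q t \<omega> - Q s \<omega>))\<^sup>2) \<partial>P) < e" .
      qed
    qed auto
  qed
qed

end

text \<open>The arithmetic-geometric inequality with a free weight \<open>d\<close> takes the place
  of the Cauchy-Schwarz inequality: a weight adapted to the scale turns bounds on second moments
  into bounds on first moments.\<close>

lemma ennreal_abs_le_square:
  fixes d z :: real
  assumes d: "0 < d"
  shows "ennreal \<bar>z\<bar> \<le> ennreal d + ennreal (1 / d) * ennreal (z\<^sup>2)"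
proof -
  have "2 * d * \<bar>z\<bar> \<le> d\<^sup>2 + z\<^sup>2" using sum_squares_bound[of d "\<bar>z\<bar>"] by simp
  moreover have "0 \<le> d * \<bar>z\<bar>" using d by simp
  ultimately have "d * \<bar>z\<bar> \<le> d\<^sup>2 + z\<^sup>2" by linarith
  then have "\<bar>z\<bar> \<le> d + 1 / d * z\<^sup>2" using d by (simp add: field_simps power2_eq_square)
  then show ?thesis using d by (auto simp flip: ennreal_mult ennreal_plus intro!: ennreal_leI)
qed

lemma (in prob_space) L2_imp_L1_tendsto:
  fixes Y :: "nat \<Rightarrow> 'a \<Rightarrow> real"
  assumes Y [measurable]: "\<And>n. Y n \<in> borel_measurable M"
    and lim: "(\<lambda>n. \<integral>\<^sup>+x. ennreal ((Y n x)\<^sup>2) \<partial>M) \<longlonglongrightarrow> 0"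
  shows "(\<lambda>n. \<integral>\<^sup>+x. ennreal \<bar>Y n x\<bar> \<partial>M) \<longlonglongrightarrow> 0"
  unfolding order_tendsto_iff
proof (intro conjI allI impI)
  fix e :: ennreal assume "0 < e"
  then obtain y where y: "0 < y" "y < e" using dense by blast
  then obtain r where r: "y = ennreal r" "r > 0" by (cases y) auto
  define d where "d = r / 2"
  have d: "d > 0" using r by (simp add: d_def)
  have "(\<lambda>n. ennreal (1 / d) * (\<integral>\<^sup>+x. ennreal ((Y n x)\<^sup>2) \<partial>M)) \<longlonglongrightarrow> ennreal (1 / d) * 0"
    by (intro ennreal_tendsto_cmult lim) simp
  then have "\<forall>\<^sub>F n in sequentially. ennreal (1 / d) * (\<integral>\<^sup>+x. ennreal ((Y n x)\<^sup>2) \<partial>M) < ennreal d"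
    by (rule order_tendstoD) (use d in simp)
  then show "\<forall>\<^sub>F n in sequentially. (\<integral>\<^sup>+x. ennreal \<bar>Y n x\<bar> \<partial>M) < e"
  proof eventually_elim
    case (elim n)
    have "ennreal \<bar>Y n x\<bar> \<le> ennreal d + ennreal (1 / d) * ennreal ((Y n x)\<^sup>2)" for x
      by (rule ennreal_abs_le_square[OF d])
    then have "(\<integral>\<^sup>+x. ennreal \<bar>Y n x\<bar> \<partial>M) \<le> (\<integral>\<^sup>+x. ennreal d + ennreal (1 / d) * ennreal ((Y n x)\<^sup>2) \<partial>M)"
      by (intro nn_integral_mono)
    also have "\<dots> = ennreal d + ennreal (1 / d) * (\<integral>\<^sup>+x. ennreal ((Y n x)\<^sup>2) \<partial>M)"
      by (simp add: nn_integral_add nn_integral_cmult emeasure_space_1)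
    also have "\<dots> \<le> ennreal d + ennreal d" using elim by (intro add_left_mono) simp
    also have "\<dots> = ennreal r" using d by (simp add: d_def flip: ennreal_plus)
    also have "\<dots> < e" using y r by simp
    finally show ?case .
  qed
qed auto

section \<open>Bounded adapted coefficients and step functions\<close>

lemma L_bE:
  assumes "X \<in> L_b s"
  obtains C where "C \<ge> 0" "\<And>\<omega>. \<bar>X \<omega>\<bar> \<le> C" "adapted s X" "X \<in> borel_measurable borel"
proof -
  from assms obtain C where "\<And>\<omega>. \<bar>X \<omega>\<bar> \<le> C" "adapted s X" unfolding L_b_iff bounded_iff by auto
  moreover from this have "C \<ge> 0" by (metis abs_ge_zero order_trans)
  ultimately show ?thesis using that adapted_measurable by blast
qed

lemma L_bI: "adapted s X \<Longrightarrow> (\<And>\<omega>. \<bar>X \<omega>\<bar> \<le> C) \<Longrightarrow> X \<in> L_b s"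
  unfolding L_b_iff bounded_iff by auto

lemma L_b_mult:
  assumes "X \<in> L_b s" "Y \<in> L_b s" shows "(\<lambda>\<omega>. X \<omega> * Y \<omega>) \<in> L_b s"
proof -
  obtain C where X: "C \<ge> 0" "\<And>\<omega>. \<bar>X \<omega>\<bar> \<le> C" "adapted s X" using assms(1) by (rule L_bE) blast
  obtain C' where Y: "C' \<ge> 0" "\<And>\<omega>. \<bar>Y \<omega>\<bar> \<le> C'" "adapted s Y" using assms(2) by (rule L_bE) blast
  show ?thesis by (rule L_bI[of _ _ "C * C'"]) (use X Y in \<open>auto simp: abs_mult adapted_mult intro!: mult_mono\<close>)
qed

lemma L_b_mono: "X \<in> L_b s \<Longrightarrow> s \<le> t \<Longrightarrow> X \<in> L_b t"
  by (simp add: L_b_iff) (blast intro: adapted_mono)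

text \<open>The cells partition the half-open interval, and the one that contains \<open>s\<close>
  is found by rounding down its relative position; step functions on a grid thus become compositions
  with the floor function.\<close>

lemma grid_sum:
  fixes f :: "nat \<Rightarrow> real"
  assumes s: "s \<in> {u..<v}" and N: "N > 0"
  defines "k \<equiv> nat \<lfloor>real N * ((s - u) / (v - u))\<rfloor>"
  shows "(\<Sum>i<N. f i * indicator {u + (v - u) * real i / real N..<u + (v - u) * real (Suc i) / real N} s) = f k"
    and "k < N" "real k = of_int \<lfloor>real N * ((s - u) / (v - u))\<rfloor>"
proof -
  have uv: "v - u > 0" using s by auto
  define y where "y = (s - u) / (v - u)"
  have y: "0 \<le> y" "y < 1" using s uv by (auto simp: y_def)
  have Ny: "0 \<le> real N * y" "real N * y < real N" using y N by auto
  show k: "real k = of_int \<lfloor>real N * ((s - u) / (v - u))\<rfloor>" unfolding k_def using Ny by (simp add: y_def)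
  then have k': "real k \<le> real N * y" "real N * y < real k + 1" unfolding y_def by linarith+
  have "real k < real N" using k' Ny by linarith
  then show kN: "k < N" by simp
  have ge: "u + (v - u) * z / real N \<le> s \<longleftrightarrow> z \<le> real N * y" for z
  proof -
    have "s = u + (v - u) * y" using uv by (simp add: y_def)
    moreover have "u + (v - u) * z / real N \<le> u + (v - u) * y \<longleftrightarrow> (v - u) * (z / real N) \<le> (v - u) * y" by simp
    ultimately show ?thesis using uv N by (simp add: pos_divide_le_eq mult.commute)
  qed
  have "indicator {u + (v - u) * real i / real N..<u + (v - u) * real (Suc i) / real N} s = (if i = k then 1 else (0::real))" for i
  proof -
    have "s \<in> {u + (v - u) * real i / real N..<u + (v - u) * real (Suc i) / real N} \<longleftrightarrow> real i \<le> real N * y \<and> \<not> real (Suc i) \<le> real N * y"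
      using ge[of "real i"] ge[of "real (Suc i)"] by auto
    also have "\<dots> \<longleftrightarrow> i = k"
      using k' by auto
    finally show ?thesis by (simp add: indicator_def)
  qed
  then have "(\<Sum>i<N. f i * indicator {u + (v - u) * real i / real N..<u + (v - u) * real (Suc i) / real N} s) = (\<Sum>i<N. if i = k then f i else 0)"
    by (intro sum.cong) auto
  also have "\<dots> = f k" using kN by simp
  finally show "(\<Sum>i<N. f i * indicator {u + (v - u) * real i / real N..<u + (v - u) * real (Suc i) / real N} s) = f k" .
qed

context quadratic_variation_law
begin

text \<open>Discrete Ito formula for the square: the second sum is a discrete integral of the past
  increment against B, whose mean will vanish.\<close>

lemma sq_sum_telescope:
  "(B (s + (t - s) * real k / real n) \<omega> - B s \<omega>)\<^sup>2 =
     (\<Sum>j<k. (B (s + (t - s) * real (Suc j) / real n) \<omega> - B (s + (t - s) * real j / real n) \<omega>)\<^sup>2)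
     + 2 * (\<Sum>j<k. (B (s + (t - s) * real j / real n) \<omega> - B s \<omega>) *
            (B (s + (t - s) * real (Suc j) / real n) \<omega> - B (s + (t - s) * real j / real n) \<omega>))"
proof (induction k)
  case (Suc k)
  show ?case using Suc.IH unfolding sum.lessThan_Suc by (simp add: power2_eq_square algebra_simps del: of_nat_Suc)
qed simp

lemma grid_point_le:
  assumes "s \<le> t" "j < n"
  shows "s \<le> s + (t - s) * real j / real n"
    "s + (t - s) * real j / real n \<le> s + (t - s) * real (Suc j) / real n"
    "s + (t - s) * real (Suc j) / real n \<le> t"
proof -
  show "s \<le> s + (t - s) * real j / real n" using assms by simp
  show "s + (t - s) * real j / real n \<le> s + (t - s) * real (Suc j) / real n"
    using assms by (intro add_left_mono divide_right_mono mult_left_mono) auto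
  have "(t - s) * real (Suc j) \<le> (t - s) * real n" using assms by (intro mult_left_mono) auto
  then have "(t - s) * real (Suc j) / real n \<le> t - s" using assms(2) by (simp add: pos_divide_le_eq)
  then show "s + (t - s) * real (Suc j) / real n \<le> t" by simp
qed

lemma sq_sum_expectation:
  assumes s: "0 \<le> s" "s \<le> t" and X: "X \<in> L_b s" and n: "n > 0"
  shows "integrable P (\<lambda>\<omega>. X \<omega> * sq_sum n s t \<omega>)"
    and "(\<integral>\<omega>. X \<omega> * (B t \<omega> - B s \<omega>)\<^sup>2 \<partial>P) = (\<integral>\<omega>. X \<omega> * sq_sum n s t \<omega> \<partial>P)"
proof -
  obtain C where C: "C \<ge> 0" "\<And>\<omega>. \<bar>X \<omega>\<bar> \<le> C" "adapted s X" "X \<in> borel_measurable borel" using X by (rule L_bE) blast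
  let ?p = "\<lambda>j. s + (t - s) * real j / real n"
  let ?d = "\<lambda>j \<omega>. B (?p (Suc j)) \<omega> - B (?p j) \<omega>"
  have p: "s \<le> ?p j" "?p j \<le> ?p (Suc j)" "?p (Suc j) \<le> t" if "j < n" for j
    using grid_point_le[OF s(2) that] by auto
  have "integrable P (\<lambda>\<omega>. \<Sum>j<n. X \<omega> * (?d j \<omega> * ?d j \<omega>))"
    by (rule Bochner_Integration.integrable_sum, rule increment_mult_integrable[where C=C])
      (use p s C in \<open>auto intro: order_trans\<close>)
  then show I1: "integrable P (\<lambda>\<omega>. X \<omega> * sq_sum n s t \<omega>)"
    by (simp add: sq_sum_def sum_distrib_left power2_eq_square)
  have I2: "integrable P (\<lambda>\<omega>. X \<omega> * ((B (?p j) \<omega> - B s \<omega>) * ?d j \<omega>))" if "j \<in> {..<n}" for j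
    by (rule increment_mult_integrable[where C=C]) (use p[of j] that s C in \<open>auto intro: order_trans\<close>)
  have Z: "(\<integral>\<omega>. X \<omega> * ((B (?p j) \<omega> - B s \<omega>) * ?d j \<omega>) \<partial>P) = 0" if "j \<in> {..<n}" for j
    by (rule martingale_product[where C=C]) (use p[of j] that s C in \<open>auto intro: adapted_mono\<close>)
  have "(\<integral>\<omega>. X \<omega> * (B t \<omega> - B s \<omega>)\<^sup>2 \<partial>P)
     = (\<integral>\<omega>. X \<omega> * sq_sum n s t \<omega> + 2 * (\<Sum>j<n. X \<omega> * ((B (?p j) \<omega> - B s \<omega>) * ?d j \<omega>)) \<partial>P)"
  proof (rule Bochner_Integration.integral_cong[OF refl])
    fix \<omega>
    have "(B t \<omega> - B s \<omega>)\<^sup>2 = sq_sum n s t \<omega> + 2 * (\<Sum>j<n. (B (?p j) \<omega> - B s \<omega>) * ?d j \<omega>)"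
      using sq_sum_telescope[of s t n n \<omega>] n by (simp add: sq_sum_def)
    then show "X \<omega> * (B t \<omega> - B s \<omega>)\<^sup>2 = X \<omega> * sq_sum n s t \<omega> + 2 * (\<Sum>j<n. X \<omega> * ((B (?p j) \<omega> - B s \<omega>) * ?d j \<omega>))"
      by (simp add: distrib_left sum_distrib_left mult.left_commute del: of_nat_Suc)
  qed
  also have "\<dots> = (\<integral>\<omega>. X \<omega> * sq_sum n s t \<omega> \<partial>P) + 2 * (\<Sum>j<n. \<integral>\<omega>. X \<omega> * ((B (?p j) \<omega> - B s \<omega>) * ?d j \<omega>) \<partial>P)"
    using I1 I2 by (subst Bochner_Integration.integral_add)
      (auto intro!: Bochner_Integration.integrable_sum integrable_mult_right simp: Bochner_Integration.integral_sum simp del: of_nat_Suc)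
  also have "\<dots> = (\<integral>\<omega>. X \<omega> * sq_sum n s t \<omega> \<partial>P)" using Z by simp
  finally show "(\<integral>\<omega>. X \<omega> * (B t \<omega> - B s \<omega>)\<^sup>2 \<partial>P) = (\<integral>\<omega>. X \<omega> * sq_sum n s t \<omega> \<partial>P)" .
qed

lemma one_in_L_b: "(\<lambda>_. 1) \<in> L_b s"
  by (rule L_bI[of _ _ 1]) (auto simp: adapted_const)

text \<open>Sums of squares are integrable by the second moment bound, and for some n they differ
  from the increment of \<open>Q\<close> by a square integrable function.\<close>

lemma Q_increment_integrable:
  assumes s: "0 \<le> s" "s \<le> t"
  shows "integrable P (\<lambda>\<omega>. Q t \<omega> - Q s \<omega>)"
proof -
  have "\<forall>\<^sub>F n in sequentially. (\<integral>\<^sup>+\<omega>. ennreal ((sq_sum (Suc n) s t \<omega> - (Q t \<omega> - Q s \<omega>))\<^sup>2) \<partial>P) < \<infinity>"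
    by (rule order_tendstoD[OF sq_sum_tendsto[OF s]]) simp
  then obtain n where n: "(\<integral>\<^sup>+\<omega>. ennreal ((sq_sum (Suc n) s t \<omega> - (Q t \<omega> - Q s \<omega>))\<^sup>2) \<partial>P) < \<infinity>"
    using eventually_happens'[OF sequentially_bot] by blast
  have "integrable P (\<lambda>\<omega>. sq_sum (Suc n) s t \<omega> - (Q t \<omega> - Q s \<omega>))"
  proof (rule square_integrable_imp_integrable)
    show "integrable P (\<lambda>\<omega>. (sq_sum (Suc n) s t \<omega> - (Q t \<omega> - Q s \<omega>))\<^sup>2)"
      using n by (intro integrableI_bounded) auto
  qed measurable
  moreover have "integrable P (sq_sum (Suc n) s t)"
    using sq_sum_expectation(1)[OF s one_in_L_b, of "Suc n"] by simp
  ultimately have "integrable P (\<lambda>\<omega>. sq_sum (Suc n) s t \<omega> - (sq_sum (Suc n) s t \<omega> - (Q t \<omega> - Q s \<omega>)))"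
    by (rule Bochner_Integration.integrable_diff[rotated])
  then show ?thesis by simp
qed

lemma Q_mult_integrable:
  assumes s: "0 \<le> s" "s \<le> t" and X: "X \<in> L_b r"
  shows "integrable P (\<lambda>\<omega>. X \<omega> * (Q t \<omega> - Q s \<omega>))"
proof -
  obtain C where C: "C \<ge> 0" "\<And>\<omega>. \<bar>X \<omega>\<bar> \<le> C" "X \<in> borel_measurable borel" using X by (rule L_bE) blast
  note [measurable] = C(3)
  show ?thesis
  proof (rule Bochner_Integration.integrable_bound)
    show "integrable P (\<lambda>\<omega>. C * (Q t \<omega> - Q s \<omega>))"
      by (intro integrable_mult_right Q_increment_integrable s)
    show "AE \<omega> in P. norm (X \<omega> * (Q t \<omega> - Q s \<omega>)) \<le> norm (C * (Q t \<omega> - Q s \<omega>))"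
      using C by (auto simp: abs_mult intro!: mult_right_mono)
  qed simp
qed

text \<open>The martingale property of B^2 - Q. The identity is exact with the sum of squares in
  place of the increment of \<open>Q\<close>, and these sums converge in mean.\<close>

lemma Q_expectation:
  assumes s: "0 \<le> s" "s \<le> t" and X: "X \<in> L_b s"
  shows "(\<integral>\<omega>. X \<omega> * (B t \<omega> - B s \<omega>)\<^sup>2 \<partial>P) = (\<integral>\<omega>. X \<omega> * (Q t \<omega> - Q s \<omega>) \<partial>P)" (is "?a = ?b")
proof -
  obtain C where C: "C \<ge> 0" "\<And>\<omega>. \<bar>X \<omega>\<bar> \<le> C" "X \<in> borel_measurable borel" using X by (rule L_bE) blast
  note [measurable] = C(3)
  let ?Y = "\<lambda>n \<omega>. sq_sum (Suc n) s t \<omega> - (Q t \<omega> - Q s \<omega>)"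
  have lim: "(\<lambda>n. \<integral>\<^sup>+\<omega>. ennreal \<bar>?Y n \<omega>\<bar> \<partial>P) \<longlonglongrightarrow> 0"
    by (rule L2_imp_L1_tendsto[OF _ sq_sum_tendsto[OF s]]) simp
  have le: "ennreal \<bar>?a - ?b\<bar> \<le> ennreal C * (\<integral>\<^sup>+\<omega>. ennreal \<bar>?Y n \<omega>\<bar> \<partial>P)" for n
  proof -
    note I = sq_sum_expectation[OF s X, of "Suc n"] Q_mult_integrable[OF s X]
    have "?a - ?b = (\<integral>\<omega>. X \<omega> * ?Y n \<omega> \<partial>P)"
      using I by (simp add: right_diff_distrib[of "X _"])
    moreover have "integrable P (\<lambda>\<omega>. X \<omega> * ?Y n \<omega>)"
      using I by (simp add: right_diff_distrib[of "X _" "sq_sum _ _ _ _"])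
    ultimately have "ennreal \<bar>?a - ?b\<bar> \<le> (\<integral>\<^sup>+\<omega>. ennreal \<bar>X \<omega> * ?Y n \<omega>\<bar> \<partial>P)"
      using integral_norm_bound_ennreal[of P "\<lambda>\<omega>. X \<omega> * ?Y n \<omega>"] by simp
    also have "\<dots> \<le> (\<integral>\<^sup>+\<omega>. ennreal C * ennreal \<bar>?Y n \<omega>\<bar> \<partial>P)"
      using C by (intro nn_integral_mono) (auto simp: abs_mult simp flip: ennreal_mult intro!: ennreal_leI mult_right_mono)
    also have "\<dots> = ennreal C * (\<integral>\<^sup>+\<omega>. ennreal \<bar>?Y n \<omega>\<bar> \<partial>P)"
      by (rule nn_integral_cmult) simp
    finally show ?thesis .
  qed
  have "(\<lambda>n. ennreal C * (\<integral>\<^sup>+\<omega>. ennreal \<bar>?Y n \<omega>\<bar> \<partial>P)) \<longlonglongrightarrow> ennreal C * 0"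
    by (intro ennreal_tendsto_cmult lim) simp
  from LIMSEQ_le_const[OF this, of "ennreal \<bar>?a - ?b\<bar>"] le have "ennreal \<bar>?a - ?b\<bar> \<le> 0" by auto
  then show ?thesis by simp
qed

lemma Q_nn_le:
  assumes s: "0 \<le> s" "s \<le> t" and X: "adapted s X" and X0: "\<And>\<omega>. 0 \<le> X \<omega>"
  shows "(\<integral>\<^sup>+\<omega>. ennreal (X \<omega> * (Q t \<omega> - Q s \<omega>)) \<partial>P) \<le> (\<integral>\<^sup>+\<omega>. ennreal (X \<omega> * (B t \<omega> - B s \<omega>)\<^sup>2) \<partial>P)"
proof (rule nn_integral_le_LIMSEQ[OF _ _ _ tendsto_const])
  note [measurable] = adapted_measurable[OF X]
  let ?X = "\<lambda>N \<omega>. min (X \<omega>) (real N)"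
  show "(\<lambda>\<omega>. ennreal (?X N \<omega> * (Q t \<omega> - Q s \<omega>))) \<in> borel_measurable P" for N by simp
  show "AE \<omega> in P. (\<lambda>N. ennreal (?X N \<omega> * (Q t \<omega> - Q s \<omega>))) \<longlonglongrightarrow> ennreal (X \<omega> * (Q t \<omega> - Q s \<omega>))"
  proof (intro AE_I2 tendsto_ennrealI tendsto_mult tendsto_const tendsto_eventually)
    fix \<omega>
    obtain N0 where "X \<omega> \<le> real N0" using real_arch_simple by blast
    then show "\<forall>\<^sub>F N in sequentially. ?X N \<omega> = X \<omega>"
      by (intro eventually_sequentiallyI[of N0]) auto
  qed
  fix N
  have L: "?X N \<in> L_b s"
    by (rule L_bI[of _ _ "real N"], rule adapted_compose[OF X]) (use X0 in auto)
  obtain C where C: "C \<ge> 0" "\<And>\<omega>. \<bar>?X N \<omega>\<bar> \<le> C" using L by (rule L_bE) blast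
  have "(\<integral>\<^sup>+\<omega>. ennreal (?X N \<omega> * (Q t \<omega> - Q s \<omega>)) \<partial>P) = ennreal (\<integral>\<omega>. ?X N \<omega> * (Q t \<omega> - Q s \<omega>) \<partial>P)"
    using Q_mult_integrable[OF s L] X0 Q_mono[OF s] by (intro nn_integral_eq_integral) auto
  also have "\<dots> = ennreal (\<integral>\<omega>. ?X N \<omega> * (B t \<omega> - B s \<omega>)\<^sup>2 \<partial>P)"
    by (simp add: Q_expectation[OF s L])
  also have "\<dots> = (\<integral>\<^sup>+\<omega>. ennreal (?X N \<omega> * (B t \<omega> - B s \<omega>)\<^sup>2) \<partial>P)"
    using increment_mult_integrable[OF s s, of "?X N" C] C X0
    by (intro nn_integral_eq_integral[symmetric]) (auto simp: power2_eq_square)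
  also have "\<dots> \<le> (\<integral>\<^sup>+\<omega>. ennreal (X \<omega> * (B t \<omega> - B s \<omega>)\<^sup>2) \<partial>P)"
    by (intro nn_integral_mono ennreal_leI mult_right_mono) auto
  finally show "(\<integral>\<^sup>+\<omega>. ennreal (?X N \<omega> * (Q t \<omega> - Q s \<omega>)) \<partial>P) \<le> (\<integral>\<^sup>+\<omega>. ennreal (X \<omega> * (B t \<omega> - B s \<omega>)\<^sup>2) \<partial>P)" .
qed

lemma Q_mean_le:
  assumes t: "0 \<le> t" shows "(\<integral>\<^sup>+\<omega>. ennreal (Q t \<omega>) \<partial>P) \<le> ennreal (V * t)"
  using Q_nn_le[OF order_refl t adapted_const[of 0 1]] second_moment[OF order_refl t]
  by (simp add: Q_0)

text \<open>The longer increment exceeds the shorter one by an increment over a later interval,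
  which is orthogonal to it; by symmetry p \<le> q may be assumed.\<close>

lemma increment_covariance:
  assumes r: "0 \<le> r" "r \<le> p" "r \<le> q" and X: "X \<in> L_b r"
  shows "(\<integral>\<omega>. X \<omega> * ((B p \<omega> - B r \<omega>) * (B q \<omega> - B r \<omega>)) \<partial>P) = (\<integral>\<omega>. X \<omega> * (Q (min p q) \<omega> - Q r \<omega>) \<partial>P)"
  using r
proof (induction p q rule: linorder_wlog)
  case (le p q)
  obtain C where C: "C \<ge> 0" "\<And>\<omega>. \<bar>X \<omega>\<bar> \<le> C" "adapted r X" "X \<in> borel_measurable borel" using X by (rule L_bE) blast
  have "(\<integral>\<omega>. X \<omega> * ((B p \<omega> - B r \<omega>) * (B q \<omega> - B r \<omega>)) \<partial>P)
     = (\<integral>\<omega>. X \<omega> * ((B p \<omega> - B r \<omega>) * (B p \<omega> - B r \<omega>)) + X \<omega> * ((B p \<omega> - B r \<omega>) * (B q \<omega> - B p \<omega>)) \<partial>P)"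
    by (intro Bochner_Integration.integral_cong) (auto simp: algebra_simps)
  also have "\<dots> = (\<integral>\<omega>. X \<omega> * ((B p \<omega> - B r \<omega>) * (B p \<omega> - B r \<omega>)) \<partial>P) + (\<integral>\<omega>. X \<omega> * ((B p \<omega> - B r \<omega>) * (B q \<omega> - B p \<omega>)) \<partial>P)"
    by (rule Bochner_Integration.integral_add; rule increment_mult_integrable[where C=C]) (use le C in auto)
  also have "(\<integral>\<omega>. X \<omega> * ((B p \<omega> - B r \<omega>) * (B q \<omega> - B p \<omega>)) \<partial>P) = 0"
    by (rule martingale_product[where C=C]) (use le C in \<open>auto intro: adapted_mono\<close>)
  also have "(\<integral>\<omega>. X \<omega> * ((B p \<omega> - B r \<omega>) * (B p \<omega> - B r \<omega>)) \<partial>P) = (\<integral>\<omega>. X \<omega> * (Q p \<omega> - Q r \<omega>) \<partial>P)"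
    using Q_expectation[of r p X] le X by (simp add: power2_eq_square)
  finally show ?case using le by (simp add: min_def)
next
  case (sym p q)
  then show ?case by (simp add: mult.commute[of "B p _ - _"] min.commute)
qed

text \<open>Polarized isometry. Only the parts of both increments after the later left end point are
  correlated, and their weighted covariance is the weighted mean of the mass that \<open>dQ\<close>
  gives to the intersection.\<close>

lemma two_intervals:
  assumes u: "0 \<le> u" "u \<le> v" "0 \<le> u'" "u' \<le> v'" and X: "X \<in> L_b u" and Y: "Y \<in> L_b u'"
  shows "integrable P (\<lambda>\<omega>. (X \<omega> * (B v \<omega> - B u \<omega>)) * (Y \<omega> * (B v' \<omega> - B u' \<omega>)))"
    and "integrable P (\<lambda>\<omega>. X \<omega> * Y \<omega> * measure (dQ Q \<omega>) ({u..<v} \<inter> {u'..<v'}))"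
    and "(\<integral>\<omega>. (X \<omega> * (B v \<omega> - B u \<omega>)) * (Y \<omega> * (B v' \<omega> - B u' \<omega>)) \<partial>P)
       = (\<integral>\<omega>. X \<omega> * Y \<omega> * measure (dQ Q \<omega>) ({u..<v} \<inter> {u'..<v'}) \<partial>P)" (is "?E u v u' v' X Y")
proof -
  have *: "?E u v u' v' X Y"
    if u: "0 \<le> u" "u \<le> v" "0 \<le> u'" "u' \<le> v'" and X: "X \<in> L_b u" and Y: "Y \<in> L_b u'" and le: "u \<le> u'"
    for u v u' v' X Y
  proof -
    define Z where "Z \<omega> = X \<omega> * Y \<omega>" for \<omega>
    have Z: "Z \<in> L_b u'" unfolding Z_def by (intro L_b_mult L_b_mono[OF X le] Y)
    obtain C where C: "C \<ge> 0" "\<And>\<omega>. \<bar>Z \<omega>\<bar> \<le> C" "adapted u' Z" "Z \<in> borel_measurable borel" using Z by (rule L_bE) blast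
    have "(\<integral>\<omega>. Z \<omega> * ((B v \<omega> - B u \<omega>) * (B v' \<omega> - B u' \<omega>)) \<partial>P) = (\<integral>\<omega>. Z \<omega> * measure (dQ Q \<omega>) ({u..<v} \<inter> {u'..<v'}) \<partial>P)"
    proof (cases "v \<le> u'")
      case True
      have "{u..<v} \<inter> {u'..<v'} = {}" using True by auto
      then have "(\<integral>\<omega>. Z \<omega> * measure (dQ Q \<omega>) ({u..<v} \<inter> {u'..<v'}) \<partial>P) = 0"
        by (simp del: Int_atLeastLessThan)
      moreover have "(\<integral>\<omega>. Z \<omega> * ((B v \<omega> - B u \<omega>) * (B v' \<omega> - B u' \<omega>)) \<partial>P) = 0"
        by (rule martingale_product[where C=C]) (use u C True in auto)
      ultimately show ?thesis by simp
    next
      case False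
      have "(\<integral>\<omega>. Z \<omega> * ((B v \<omega> - B u \<omega>) * (B v' \<omega> - B u' \<omega>)) \<partial>P)
        = (\<integral>\<omega>. Z \<omega> * ((B u' \<omega> - B u \<omega>) * (B v' \<omega> - B u' \<omega>)) + Z \<omega> * ((B v \<omega> - B u' \<omega>) * (B v' \<omega> - B u' \<omega>)) \<partial>P)"
        by (intro Bochner_Integration.integral_cong) (auto simp: algebra_simps)
      also have "\<dots> = (\<integral>\<omega>. Z \<omega> * ((B u' \<omega> - B u \<omega>) * (B v' \<omega> - B u' \<omega>)) \<partial>P) + (\<integral>\<omega>. Z \<omega> * ((B v \<omega> - B u' \<omega>) * (B v' \<omega> - B u' \<omega>)) \<partial>P)"
        by (rule Bochner_Integration.integral_add; rule increment_mult_integrable[where C=C]) (use u le False C in auto)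
      also have "(\<integral>\<omega>. Z \<omega> * ((B u' \<omega> - B u \<omega>) * (B v' \<omega> - B u' \<omega>)) \<partial>P) = 0"
        by (rule martingale_product[where C=C]) (use u C le in auto)
      also have "(\<integral>\<omega>. Z \<omega> * ((B v \<omega> - B u' \<omega>) * (B v' \<omega> - B u' \<omega>)) \<partial>P) = (\<integral>\<omega>. Z \<omega> * (Q (min v v') \<omega> - Q u' \<omega>) \<partial>P)"
        using increment_covariance[of u' v v' Z] u False Z by simp
      finally show ?thesis using u le False by (simp add: measure_dQ_Int max_absorb2 del: Int_atLeastLessThan)
    qed
    then show ?thesis by (simp add: Z_def mult_ac)
  qed
  obtain C where C: "C \<ge> 0" "\<And>\<omega>. \<bar>X \<omega>\<bar> \<le> C" "X \<in> borel_measurable borel" using X by (rule L_bE) blast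
  obtain C' where C': "C' \<ge> 0" "\<And>\<omega>. \<bar>Y \<omega>\<bar> \<le> C'" "Y \<in> borel_measurable borel" using Y by (rule L_bE) blast
  have "integrable P (\<lambda>\<omega>. (X \<omega> * Y \<omega>) * ((B v \<omega> - B u \<omega>) * (B v' \<omega> - B u' \<omega>)))"
    by (rule increment_mult_integrable[where C="C * C'"]) (use C C' u in \<open>auto simp: abs_mult intro!: mult_mono\<close>)
  then show "integrable P (\<lambda>\<omega>. (X \<omega> * (B v \<omega> - B u \<omega>)) * (Y \<omega> * (B v' \<omega> - B u' \<omega>)))"
    by (simp add: mult_ac)
  have XY: "(\<lambda>\<omega>. X \<omega> * Y \<omega>) \<in> L_b (max u u')"
    by (intro L_b_mult L_b_mono[OF X] L_b_mono[OF Y]) auto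
  show "integrable P (\<lambda>\<omega>. X \<omega> * Y \<omega> * measure (dQ Q \<omega>) ({u..<v} \<inter> {u'..<v'}))"
    using Q_mult_integrable[OF _ _ XY, of "max u u'" "min v v'"] u
    by (cases "u' \<le> v \<and> u \<le> v'") (auto simp: measure_dQ_Int le_max_iff_disj simp del: Int_atLeastLessThan)
  show "?E u v u' v' X Y"
  proof (cases "u \<le> u'")
    case True then show ?thesis by (intro * u X Y)
  next
    case False
    then have "?E u' v' u v Y X" by (intro * u X Y) auto
    then show ?thesis by (simp add: mult_ac Int_commute)
  qed
qed

text \<open>The intervals are allowed to overlap, so that two simple processes over different
  partitions can be subtracted without a common refinement. Both sides expand into double sums that
  agree term by term.\<close>

theorem simple_isometry:
  assumes A: "finite A" and u: "\<And>i. i \<in> A \<Longrightarrow> 0 \<le> u i \<and> u i \<le> v i \<and> v i \<le> T" and \<xi>: "\<And>i. i \<in> A \<Longrightarrow> \<xi> i \<in> L_b (u i)"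
  shows "(\<integral>\<^sup>+\<omega>. ennreal ((\<Sum>i\<in>A. \<xi> i \<omega> * (B (v i) \<omega> - B (u i) \<omega>))\<^sup>2) \<partial>P)
     = (\<integral>\<^sup>+\<omega>. (\<integral>\<^sup>+s\<in>{0..T}. ennreal ((\<Sum>i\<in>A. \<xi> i \<omega> * indicator {u i..<v i} s)\<^sup>2) \<partial>dQ Q \<omega>) \<partial>P)"
proof -
  define m where "m i j \<omega> = measure (dQ Q \<omega>) ({u i..<v i} \<inter> {u j..<v j})" for i j \<omega>
  let ?b = "\<lambda>i \<omega>. \<xi> i \<omega> * (B (v i) \<omega> - B (u i) \<omega>)"
  define Z where "Z \<omega> = (\<Sum>i\<in>A. \<Sum>j\<in>A. \<xi> i \<omega> * \<xi> j \<omega> * m i j \<omega>)" for \<omega>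
  have two: "integrable P (\<lambda>\<omega>. ?b i \<omega> * ?b j \<omega>)" "integrable P (\<lambda>\<omega>. \<xi> i \<omega> * \<xi> j \<omega> * m i j \<omega>)"
     "(\<integral>\<omega>. ?b i \<omega> * ?b j \<omega> \<partial>P) = (\<integral>\<omega>. \<xi> i \<omega> * \<xi> j \<omega> * m i j \<omega> \<partial>P)" if "i \<in> A" "j \<in> A" for i j
    unfolding m_def using two_intervals[of "u i" "v i" "u j" "v j" "\<xi> i" "\<xi> j"] u \<xi> that by auto
  have inner: "(\<integral>\<^sup>+s\<in>{0..T}. ennreal ((\<Sum>i\<in>A. \<xi> i \<omega> * indicator {u i..<v i} s)\<^sup>2) \<partial>dQ Q \<omega>) = ennreal (Z \<omega>)"
    and Z0: "Z \<omega> \<ge> 0" for \<omega>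
  proof -
    let ?f = "\<lambda>s. (\<Sum>i\<in>A. \<xi> i \<omega> * indicator {u i..<v i} s)\<^sup>2 :: real"
    have f: "?f s = (\<Sum>i\<in>A. \<Sum>j\<in>A. \<xi> i \<omega> * \<xi> j \<omega> * indicator ({u i..<v i} \<inter> {u j..<v j}) s)" for s
      by (simp add: power2_eq_square sum_product indicator_inter_arith mult_ac del: Int_atLeastLessThan)
    have fin: "emeasure (dQ Q \<omega>) ({u i..<v i} \<inter> {u j..<v j}) < \<infinity>" if "i \<in> A" "j \<in> A" for i j
    proof -
      have "emeasure (dQ Q \<omega>) ({u i..<v i} \<inter> {u j..<v j}) \<le> emeasure (dQ Q \<omega>) {u i..<v i}"
        by (rule emeasure_mono) auto
      also have "\<dots> < \<infinity>" using u[OF that(1)] by (simp add: emeasure_dQ_Ico)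
      finally show ?thesis .
    qed
    have int: "integrable (dQ Q \<omega>) (\<lambda>s. \<xi> i \<omega> * \<xi> j \<omega> * indicator ({u i..<v i} \<inter> {u j..<v j}) s)" if "i \<in> A" "j \<in> A" for i j
      using fin[OF that] by (intro integrable_mult_right integrable_real_indicator) auto
    have int_f: "integrable (dQ Q \<omega>) ?f" unfolding f by (intro Bochner_Integration.integrable_sum int)
    have "(\<integral>s. ?f s \<partial>dQ Q \<omega>) = Z \<omega>"
      unfolding f Z_def m_def using int
      by (simp add: Bochner_Integration.integral_sum Bochner_Integration.integrable_sum del: Int_atLeastLessThan)
    moreover have "(\<integral>s. ?f s \<partial>dQ Q \<omega>) \<ge> 0" by (rule Bochner_Integration.integral_nonneg) simp
    ultimately show Z0: "Z \<omega> \<ge> 0" by simp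
    have "ennreal (?f s) * indicator {0..T} s = ennreal (?f s)" for s
    proof (cases "s \<in> {0..T}")
      case False
      then have "indicator {u i..<v i} s = (0::real)" if "i \<in> A" for i using u[OF that] by (auto simp: indicator_def)
      then show ?thesis by simp
    qed simp
    then show "(\<integral>\<^sup>+s\<in>{0..T}. ennreal (?f s) \<partial>dQ Q \<omega>) = ennreal (Z \<omega>)"
      using int_f \<open>(\<integral>s. ?f s \<partial>dQ Q \<omega>) = Z \<omega>\<close> by (simp add: nn_integral_eq_integral)
  qed
  have sq: "(\<Sum>i\<in>A. ?b i \<omega>)\<^sup>2 = (\<Sum>i\<in>A. \<Sum>j\<in>A. ?b i \<omega> * ?b j \<omega>)" for \<omega>
    by (simp add: power2_eq_square sum_product)
  have I1: "integrable P (\<lambda>\<omega>. (\<Sum>i\<in>A. ?b i \<omega>)\<^sup>2)" unfolding sq by (intro Bochner_Integration.integrable_sum two)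
  have I2: "integrable P Z" unfolding Z_def by (intro Bochner_Integration.integrable_sum two)
  have "(\<integral>\<omega>. (\<Sum>i\<in>A. ?b i \<omega>)\<^sup>2 \<partial>P) = (\<Sum>i\<in>A. \<Sum>j\<in>A. \<integral>\<omega>. ?b i \<omega> * ?b j \<omega> \<partial>P)"
    unfolding sq using two(1)
    by (simp add: Bochner_Integration.integral_sum Bochner_Integration.integrable_sum)
  also have "\<dots> = (\<Sum>i\<in>A. \<Sum>j\<in>A. \<integral>\<omega>. \<xi> i \<omega> * \<xi> j \<omega> * m i j \<omega> \<partial>P)"
    using two(3) by simp
  also have "\<dots> = (\<integral>\<omega>. Z \<omega> \<partial>P)"
    unfolding Z_def using two(2)
    by (simp add: Bochner_Integration.integral_sum Bochner_Integration.integrable_sum)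
  finally show ?thesis
    unfolding inner using I1 I2 Z0 by (simp add: nn_integral_eq_integral)
qed

lemma oscillation_measurable:
  assumes "0 \<le> u" "u \<le> v"
  shows "(\<lambda>\<omega>. \<integral>\<^sup>+s\<in>{u..<v}. ennreal ((B s \<omega> - B u \<omega>)\<^sup>2) \<partial>dQ Q \<omega>) \<in> borel_measurable borel"
proof -
  have "(\<lambda>\<omega>. \<integral>\<^sup>+s\<in>{0..v}. ennreal ((B s \<omega> - B u \<omega>)\<^sup>2) * indicator {u..<v} s \<partial>dQ Q \<omega>) \<in> borel_measurable borel"
    using assms by (intro measurable_nn_integral_dQ) (auto simp: split_beta intro!: measurable_B_pair' borel_measurable_power borel_measurable_diff measurable_compose[OF _ measurable_ennreal])
  moreover have "ennreal ((B s \<omega> - B u \<omega>)\<^sup>2) * indicator {u..<v} s * indicator {0..v} s = ennreal ((B s \<omega> - B u \<omega>)\<^sup>2) * indicator {u..<v} s" for s \<omega>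
    using assms by (auto simp: indicator_def)
  ultimately show ?thesis by simp
qed

text \<open>On a grid the squared oscillation at a left end point is adapted, so increments of
  \<open>Q\<close> may be replaced by squared increments of B, to which
  \<open>product_moment\<close> applies; a cell contributes at most V^2 (v - u) times its length.
  Fatou's lemma removes the grid, for the integral along the path and then for the mean.\<close>

lemma oscillation_estimate:
  assumes u: "0 \<le> u" "u \<le> v"
  shows "(\<integral>\<^sup>+\<omega>. (\<integral>\<^sup>+s\<in>{u..<v}. ennreal ((B s \<omega> - B u \<omega>)\<^sup>2) \<partial>dQ Q \<omega>) \<partial>P) \<le> ennreal (V\<^sup>2 * (v - u)\<^sup>2)"
proof (cases "u = v")
  case False
  then have uv: "u < v" using u by simp
  define p where "p n i = u + (v - u) * real i / real (Suc n)" for n i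
  have p: "u \<le> p n i" "p n i \<le> p n (Suc i)" "p n (Suc i) \<le> v" if "i < Suc n" for n i
    using grid_point_le[OF u(2) that] by (auto simp: p_def)
  have pd: "p n (Suc i) - p n i = (v - u) / real (Suc n)" for n i
    by (simp add: p_def distrib_left flip: diff_divide_distrib)
  define b where "b n \<omega> s = (\<Sum>i<Suc n. (B (p n i) \<omega> - B u \<omega>)\<^sup>2 * indicator {p n i..<p n (Suc i)} s)" for n \<omega> and s :: real
  define g where "g n \<omega> = (\<Sum>i<Suc n. (B (p n i) \<omega> - B u \<omega>)\<^sup>2 * (Q (p n (Suc i)) \<omega> - Q (p n i) \<omega>))" for n \<omega>
  have Qp: "0 \<le> Q (p n (Suc i)) \<omega> - Q (p n i) \<omega>" if "i < Suc n" for n i \<omega>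
    using Q_mono[of "p n i" "p n (Suc i)" \<omega>] p[OF that] u by simp
  have int_b: "(\<integral>\<^sup>+s. ennreal (b n \<omega> s) \<partial>dQ Q \<omega>) = ennreal (g n \<omega>)" for n \<omega>
  proof -
    have "(\<integral>\<^sup>+s. ennreal (b n \<omega> s) \<partial>dQ Q \<omega>) = (\<integral>\<^sup>+s. (\<Sum>i<Suc n. ennreal ((B (p n i) \<omega> - B u \<omega>)\<^sup>2) * indicator {p n i..<p n (Suc i)} s) \<partial>dQ Q \<omega>)"
      unfolding b_def by (intro nn_integral_cong) (simp add: sum_ennreal[symmetric] ennreal_mult ennreal_indicator del: sum_ennreal sum.lessThan_Suc)
    also have "\<dots> = (\<Sum>i<Suc n. ennreal ((B (p n i) \<omega> - B u \<omega>)\<^sup>2) * emeasure (dQ Q \<omega>) {p n i..<p n (Suc i)})"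
      by (subst nn_integral_sum) (simp_all add: nn_integral_cmult_indicator del: sum.lessThan_Suc)
    also have "\<dots> = (\<Sum>i<Suc n. ennreal ((B (p n i) \<omega> - B u \<omega>)\<^sup>2 * (Q (p n (Suc i)) \<omega> - Q (p n i) \<omega>)))"
    proof (rule sum.cong[OF refl])
      fix i assume "i \<in> {..<Suc n}"
      then have i: "i < Suc n" by simp
      show "ennreal ((B (p n i) \<omega> - B u \<omega>)\<^sup>2) * emeasure (dQ Q \<omega>) {p n i..<p n (Suc i)} = ennreal ((B (p n i) \<omega> - B u \<omega>)\<^sup>2 * (Q (p n (Suc i)) \<omega> - Q (p n i) \<omega>))"
        using p[OF i] u Qp[OF i, of \<omega>] by (simp add: emeasure_dQ_Ico ennreal_mult)
    qed
    also have "\<dots> = ennreal (g n \<omega>)"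
      unfolding g_def by (rule sum_ennreal) (use Qp in auto)
    finally show ?thesis .
  qed
  have b_lim: "(\<lambda>n. b n \<omega> s) \<longlonglongrightarrow> (B s \<omega> - B u \<omega>)\<^sup>2" if s: "s \<in> {u..<v}" for \<omega> s
  proof -
    define y where "y = (s - u) / (v - u)"
    have "b n \<omega> s = (B (u + (v - u) * (of_int \<lfloor>real (Suc n) * y\<rfloor> / real (Suc n))) \<omega> - B u \<omega>)\<^sup>2" for n
      using grid_sum(1)[OF s, of "Suc n" "\<lambda>i. (B (p n i) \<omega> - B u \<omega>)\<^sup>2"] grid_sum(3)[OF s, of "Suc n"] unfolding b_def p_def y_def by simp
    moreover have "(\<lambda>n. (B (u + (v - u) * (of_int \<lfloor>real (Suc n) * y\<rfloor> / real (Suc n))) \<omega> - B u \<omega>)\<^sup>2) \<longlonglongrightarrow> (B (u + (v - u) * y) \<omega> - B u \<omega>)\<^sup>2"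
      by (intro tendsto_intros continuous_on_tendsto_compose[OF continuous_B[of UNIV \<omega>]] floor_grid_tendsto) auto
    moreover have "u + (v - u) * y = s" using uv by (simp add: y_def)
    ultimately show ?thesis by simp
  qed
  have [measurable]: "(\<lambda>s. ennreal (b n \<omega> s)) \<in> borel_measurable borel" for n \<omega>
    unfolding b_def by measurable
  have G_le: "(\<integral>\<^sup>+s\<in>{u..<v}. ennreal ((B s \<omega> - B u \<omega>)\<^sup>2) \<partial>dQ Q \<omega>) \<le> liminf (\<lambda>n. ennreal (g n \<omega>))" for \<omega>
  proof -
    have "(\<integral>\<^sup>+s\<in>{u..<v}. ennreal ((B s \<omega> - B u \<omega>)\<^sup>2) \<partial>dQ Q \<omega>) \<le> (\<integral>\<^sup>+s. liminf (\<lambda>n. ennreal (b n \<omega> s)) \<partial>dQ Q \<omega>)"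
    proof (rule nn_integral_mono)
      fix s
      show "ennreal ((B s \<omega> - B u \<omega>)\<^sup>2) * indicator {u..<v} s \<le> liminf (\<lambda>n. ennreal (b n \<omega> s))"
        using lim_imp_Liminf[OF sequentially_bot tendsto_ennrealI[OF b_lim[of s \<omega>]]] by (auto simp: indicator_def)
    qed
    also have "\<dots> \<le> liminf (\<lambda>n. \<integral>\<^sup>+s. ennreal (b n \<omega> s) \<partial>dQ Q \<omega>)"
      by (rule nn_integral_liminf) simp
    finally show ?thesis by (simp add: int_b)
  qed
  have g_le: "(\<integral>\<^sup>+\<omega>. ennreal (g n \<omega>) \<partial>P) \<le> ennreal (V\<^sup>2 * (v - u)\<^sup>2)" for n
  proof -
    let ?X = "\<lambda>i \<omega>. (B (p n i) \<omega> - B u \<omega>)\<^sup>2"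
    have "(\<integral>\<^sup>+\<omega>. ennreal (g n \<omega>) \<partial>P) = (\<integral>\<^sup>+\<omega>. (\<Sum>i<Suc n. ennreal (?X i \<omega> * (Q (p n (Suc i)) \<omega> - Q (p n i) \<omega>))) \<partial>P)"
      unfolding g_def using Qp by (intro nn_integral_cong sum_ennreal[symmetric]) auto
    also have "\<dots> = (\<Sum>i<Suc n. \<integral>\<^sup>+\<omega>. ennreal (?X i \<omega> * (Q (p n (Suc i)) \<omega> - Q (p n i) \<omega>)) \<partial>P)"
      by (rule nn_integral_sum) simp
    also have "\<dots> \<le> (\<Sum>i<Suc n. ennreal (V\<^sup>2 * (v - u) * ((v - u) / real (Suc n))))"
    proof (rule sum_mono)
      fix i assume "i \<in> {..<Suc n}"
      then have i: "i < Suc n" by simp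
      have "(\<integral>\<^sup>+\<omega>. ennreal (?X i \<omega> * (Q (p n (Suc i)) \<omega> - Q (p n i) \<omega>)) \<partial>P) \<le> (\<integral>\<^sup>+\<omega>. ennreal (?X i \<omega> * (B (p n (Suc i)) \<omega> - B (p n i) \<omega>)\<^sup>2) \<partial>P)"
        using p[OF i] u by (intro Q_nn_le adapted_compose[of _ _ "\<lambda>x. x\<^sup>2"] adapted_diff adapted_B) auto
      also have "\<dots> \<le> ennreal (V * (p n i - u) * (V * (p n (Suc i) - p n i)))"
        using p[OF i] u by (intro product_moment) auto
      also have "\<dots> \<le> ennreal (V\<^sup>2 * (v - u) * ((v - u) / real (Suc n)))"
      proof (rule ennreal_leI)
        have "V * (p n i - u) * (V * (p n (Suc i) - p n i)) = V\<^sup>2 * ((p n i - u) * ((v - u) / real (Suc n)))"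
          unfolding pd by (simp add: power2_eq_square del: of_nat_Suc)
        also have "\<dots> \<le> V\<^sup>2 * ((v - u) * ((v - u) / real (Suc n)))"
          using p[OF i] uv by (intro mult_left_mono mult_right_mono) auto
        finally show "V * (p n i - u) * (V * (p n (Suc i) - p n i)) \<le> V\<^sup>2 * (v - u) * ((v - u) / real (Suc n))"
          by (simp only: mult.assoc)
      qed
      finally show "(\<integral>\<^sup>+\<omega>. ennreal (?X i \<omega> * (Q (p n (Suc i)) \<omega> - Q (p n i) \<omega>)) \<partial>P) \<le> ennreal (V\<^sup>2 * (v - u) * ((v - u) / real (Suc n)))" .
    qed
    also have "\<dots> = ennreal (real (Suc n) * (V\<^sup>2 * (v - u) * ((v - u) / real (Suc n))))"
      by (simp only: sum_constant card_lessThan ennreal_of_nat_eq_real_of_nat ennreal_mult'[OF of_nat_0_le_iff])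
    also have "real (Suc n) * (V\<^sup>2 * (v - u) * ((v - u) / real (Suc n))) = V\<^sup>2 * (v - u)\<^sup>2"
      by (simp add: power2_eq_square del: of_nat_Suc)
    finally show ?thesis .
  qed
  have "(\<integral>\<^sup>+\<omega>. (\<integral>\<^sup>+s\<in>{u..<v}. ennreal ((B s \<omega> - B u \<omega>)\<^sup>2) \<partial>dQ Q \<omega>) \<partial>P) \<le> (\<integral>\<^sup>+\<omega>. liminf (\<lambda>n. ennreal (g n \<omega>)) \<partial>P)"
    by (intro nn_integral_mono G_le)
  also have "\<dots> \<le> liminf (\<lambda>n. \<integral>\<^sup>+\<omega>. ennreal (g n \<omega>) \<partial>P)"
    by (rule nn_integral_liminf) (simp add: g_def)
  also have "\<dots> \<le> liminf (\<lambda>n::nat. ennreal (V\<^sup>2 * (v - u)\<^sup>2))"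
    by (intro Liminf_mono always_eventually allI g_le)
  also have "\<dots> = ennreal (V\<^sup>2 * (v - u)\<^sup>2)" by (simp add: Liminf_const)
  finally show ?thesis .
qed simp

text \<open>A cell of length T/N contributes at most K^2 V^2 (T/N)^2 by the oscillation estimate,
  and there are N of them.\<close>

lemma grid_approximation:
  assumes T: "0 < T" and N: "0 < N" and K: "0 \<le> K" and h: "\<And>x y. \<bar>h x - h y\<bar> \<le> K * \<bar>x - y\<bar>"
    and [measurable]: "h \<in> borel_measurable borel"
  shows "(\<integral>\<^sup>+\<omega>. (\<integral>\<^sup>+s\<in>{0..T}. ennreal ((simple_process N (\<lambda>i. T * real i / real N) (\<lambda>i \<omega>. h (B (T * real i / real N) \<omega>)) s \<omega> - h (B s \<omega>))\<^sup>2) \<partial>dQ Q \<omega>) \<partial>P)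
     \<le> ennreal (K\<^sup>2 * V\<^sup>2 * T\<^sup>2 / real N)"
proof -
  define p where "p i = T * real i / real N" for i
  have p: "0 \<le> p i" "p i \<le> p (Suc i)" for i
    using T by (auto simp: p_def intro!: divide_right_mono mult_left_mono)
  have pd: "p (Suc i) - p i = T / real N" for i
    by (simp add: p_def distrib_left flip: diff_divide_distrib)
  let ?osc = "\<lambda>i \<omega>. \<integral>\<^sup>+s\<in>{p i..<p (Suc i)}. ennreal ((B s \<omega> - B (p i) \<omega>)\<^sup>2) \<partial>dQ Q \<omega>"
  let ?\<eta> = "\<lambda>s \<omega>. simple_process N p (\<lambda>i \<omega>. h (B (p i) \<omega>)) s \<omega>"
  have inner: "(\<integral>\<^sup>+s\<in>{0..T}. ennreal ((?\<eta> s \<omega> - h (B s \<omega>))\<^sup>2) \<partial>dQ Q \<omega>) \<le> (\<Sum>i<N. ennreal (K\<^sup>2) * ?osc i \<omega>)" for \<omega>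
  proof -
    have [measurable]: "(\<lambda>s. B s \<omega>) \<in> borel_measurable borel"
      by (rule borel_measurable_continuous_onI[OF continuous_B])
    \<comment> \<open>The half-open cells miss the end point \<open>T\<close>, which carries no
      mass.\<close>
    have "AE s in dQ Q \<omega>. s \<noteq> T"
      by (rule AE_I[of _ _ "{T}"]) (use T in \<open>auto simp: emeasure_dQ_singleton\<close>)
    then have "(\<integral>\<^sup>+s\<in>{0..T}. ennreal ((?\<eta> s \<omega> - h (B s \<omega>))\<^sup>2) \<partial>dQ Q \<omega>)
       \<le> (\<integral>\<^sup>+s. (\<Sum>i<N. ennreal (K\<^sup>2) * (ennreal ((B s \<omega> - B (p i) \<omega>)\<^sup>2) * indicator {p i..<p (Suc i)} s)) \<partial>dQ Q \<omega>)"
    proof (intro nn_integral_mono_AE, eventually_elim)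
      fix s assume sT: "s \<noteq> T"
      show "ennreal ((?\<eta> s \<omega> - h (B s \<omega>))\<^sup>2) * indicator {0..T} s
        \<le> (\<Sum>i<N. ennreal (K\<^sup>2) * (ennreal ((B s \<omega> - B (p i) \<omega>)\<^sup>2) * indicator {p i..<p (Suc i)} s))"
      proof (cases "s \<in> {0..<T}")
        case True
        define k where "k = nat \<lfloor>real N * ((s - 0) / (T - 0))\<rfloor>"
        have k: "k < N" unfolding k_def by (rule grid_sum(2)[OF True N])
        have gs: "(\<Sum>i<N. f i * indicator {p i..<p (Suc i)} s) = f k" for f :: "nat \<Rightarrow> real"
          using grid_sum(1)[OF True N, of f] by (simp add: p_def k_def)
        \<comment> \<open>Evaluating the step function formula on unit vectors shows that
          \<open>s\<close> lies in the cell \<open>k\<close> and in no other.\<close>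
        have ind: "indicator {p i..<p (Suc i)} s = (if i = k then 1 else (0::real))" if "i < N" for i
          using gs[of "\<lambda>j. if j = i then 1 else 0"] that by (simp add: if_distrib[of "\<lambda>x. x * _"] sum.delta cong: if_cong)
        have "?\<eta> s \<omega> = h (B (p k) \<omega>)" unfolding simple_process_def by (rule gs)
        moreover have "(h (B (p k) \<omega>) - h (B s \<omega>))\<^sup>2 \<le> K\<^sup>2 * (B s \<omega> - B (p k) \<omega>)\<^sup>2"
          using power_mono[OF h[of "B (p k) \<omega>" "B s \<omega>"], of 2] by (simp add: power_mult_distrib power2_commute)
        ultimately have "ennreal ((?\<eta> s \<omega> - h (B s \<omega>))\<^sup>2) * indicator {0..T} s \<le> ennreal (K\<^sup>2) * (ennreal ((B s \<omega> - B (p k) \<omega>)\<^sup>2) * indicator {p k..<p (Suc k)} s)"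
          using True ind[OF k] by (simp add: indicator_def ennreal_leI flip: ennreal_mult split: if_splits)
        also have "\<dots> \<le> (\<Sum>i<N. ennreal (K\<^sup>2) * (ennreal ((B s \<omega> - B (p i) \<omega>)\<^sup>2) * indicator {p i..<p (Suc i)} s))"
          by (rule member_le_sum) (use k in auto)
        finally show ?thesis .
      qed (use sT in auto)
    qed
    also have "\<dots> = (\<Sum>i<N. ennreal (K\<^sup>2) * ?osc i \<omega>)"
      by (subst nn_integral_sum) (simp_all add: nn_integral_cmult)
    finally show ?thesis .
  qed
  have [measurable]: "?osc i \<in> borel_measurable borel" for i
    by (rule oscillation_measurable) (use p in auto)
  have "(\<integral>\<^sup>+\<omega>. (\<integral>\<^sup>+s\<in>{0..T}. ennreal ((?\<eta> s \<omega> - h (B s \<omega>))\<^sup>2) \<partial>dQ Q \<omega>) \<partial>P) \<le> (\<integral>\<^sup>+\<omega>. (\<Sum>i<N. ennreal (K\<^sup>2) * ?osc i \<omega>) \<partial>P)"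
    by (intro nn_integral_mono inner)
  also have "\<dots> = (\<Sum>i<N. ennreal (K\<^sup>2) * (\<integral>\<^sup>+\<omega>. ?osc i \<omega> \<partial>P))"
    by (subst nn_integral_sum) (simp_all add: nn_integral_cmult)
  also have "\<dots> \<le> (\<Sum>i<N. ennreal (K\<^sup>2) * ennreal (V\<^sup>2 * (T / real N)\<^sup>2))"
    using oscillation_estimate[OF p] unfolding pd by (intro sum_mono mult_left_mono) auto
  also have "\<dots> = ennreal (real N * (K\<^sup>2 * (V\<^sup>2 * (T / real N)\<^sup>2)))"
    by (simp add: ennreal_mult ennreal_of_nat_eq_real_of_nat)
  also have "real N * (K\<^sup>2 * (V\<^sup>2 * (T / real N)\<^sup>2)) = K\<^sup>2 * V\<^sup>2 * T\<^sup>2 / real N"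
    using N by (simp add: power2_eq_square field_simps)
  finally show ?thesis by (simp add: p_def)
qed

end

section \<open>Ito's formula\<close>

lemma Taylor_second_order:
  fixes f h g :: "real \<Rightarrow> real"
  assumes f: "\<And>x. (f has_real_derivative h x) (at x)" and h: "\<And>x. (h has_real_derivative g x) (at x)"
    and g: "\<And>x y. \<bar>g x - g y\<bar> \<le> K * \<bar>x - y\<bar>" and K: "0 \<le> K"
  shows "\<bar>f y - f x - h x * (y - x) - g x / 2 * (y - x)\<^sup>2\<bar> \<le> K / 2 * \<bar>y - x\<bar> * (y - x)\<^sup>2"
proof (cases "x = y")
  case False
  define diff where "diff m = (if m = 0 then f else if m = 1 then h else g)" for m :: nat
  have D: "\<forall>m t. m < 2 \<and> min x y \<le> t \<and> t \<le> max x y \<longrightarrow> DERIV (diff m) t :> diff (Suc m) t"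
    using f h by (auto simp: diff_def less_2_cases_iff)
  obtain t where t: "if y < x then y < t \<and> t < x else x < t \<and> t < y"
    and ft: "f y = (\<Sum>m<2. diff m x / fact m * (y - x) ^ m) + diff 2 t / fact 2 * (y - x) ^ 2"
    using Taylor[of 2 diff f "min x y" "max x y" x y, OF _ _ D] False by (auto simp: diff_def)
  have "f y = f x + h x * (y - x) + g t / 2 * (y - x)\<^sup>2"
    using ft by (simp add: diff_def numeral_2_eq_2)
  then have "f y - f x - h x * (y - x) - g x / 2 * (y - x)\<^sup>2 = (g t - g x) / 2 * (y - x)\<^sup>2"
    by (simp add: diff_divide_distrib left_diff_distrib)
  then have "\<bar>f y - f x - h x * (y - x) - g x / 2 * (y - x)\<^sup>2\<bar> = \<bar>g t - g x\<bar> / 2 * (y - x)\<^sup>2"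
    by (simp only: abs_mult) simp
  also have "\<dots> \<le> K * \<bar>y - x\<bar> / 2 * (y - x)\<^sup>2"
  proof (intro mult_right_mono divide_right_mono)
    have "\<bar>t - x\<bar> \<le> \<bar>y - x\<bar>" using t by (auto split: if_splits)
    then show "\<bar>g t - g x\<bar> \<le> K * \<bar>y - x\<bar>" using g[of t x] K by (meson mult_left_mono order_trans)
  qed auto
  finally show ?thesis by simp
qed simp

section \<open>Uniform grids and Riemann sums\<close>

definition grid :: "real \<Rightarrow> nat \<Rightarrow> nat \<Rightarrow> real" where
  "grid T N i = T * real i / real N"

lemma grid_mono: "0 \<le> T \<Longrightarrow> i \<le> j \<Longrightarrow> grid T N i \<le> grid T N j"
  unfolding grid_def by (intro divide_right_mono mult_left_mono) auto

lemma grid_nonneg: "0 \<le> T \<Longrightarrow> 0 \<le> grid T N i"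
  by (simp add: grid_def)

lemma grid_0 [simp]: "grid T N 0 = 0"
  by (simp add: grid_def)

lemma grid_N: "0 < N \<Longrightarrow> grid T N N = T"
  by (simp add: grid_def)

lemma grid_Suc: "grid T N (Suc i) - grid T N i = T / real N"
  by (simp add: grid_def distrib_left flip: diff_divide_distrib)

lemma partition_of_grid: "0 < T \<Longrightarrow> 0 < N \<Longrightarrow> partition_of T N (grid T N)"
  unfolding partition_of_def by (auto simp: grid_def intro!: divide_strict_right_mono mult_strict_left_mono)

lemma grid_refine:
  assumes "0 < m" "0 < n"
  shows "grid T m j + (grid T m (Suc j) - grid T m j) * real i / real n = grid T (n * m) (n * j + i)"
  unfolding grid_Suc using assms by (simp add: grid_def field_simps)

lemma grid_indicator:
  assumes s: "s \<in> {0..<T}" and N: "0 < N"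
  shows "\<exists>k<N. s \<in> {grid T N k..<grid T N (Suc k)} \<and> (\<forall>f :: nat \<Rightarrow> real. (\<Sum>i<N. f i * indicator {grid T N i..<grid T N (Suc i)} s) = f k)"
proof -
  define k where "k = nat \<lfloor>real N * ((s - 0) / (T - 0))\<rfloor>"
  have k: "k < N" unfolding k_def by (rule grid_sum(2)[OF s N])
  have gs: "(\<Sum>i<N. f i * indicator {grid T N i..<grid T N (Suc i)} s) = f k" for f :: "nat \<Rightarrow> real"
    using grid_sum(1)[OF s N, of f] by (simp add: grid_def k_def)
  have "(\<Sum>i<N. (if i = k then 1 else 0) * indicator {grid T N i..<grid T N (Suc i)} s) = (indicator {grid T N k..<grid T N (Suc k)} s :: real)"
    using k by (simp add: if_distrib[of "\<lambda>x. x * _"] sum.delta cong: if_cong)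
  then have "s \<in> {grid T N k..<grid T N (Suc k)}"
    using gs[of "\<lambda>i. if i = k then 1 else 0"] by (simp add: indicator_def split: if_splits)
  then show ?thesis using k gs by blast
qed

text \<open>The total error of the sums of squares over n subcells of each of the m coarse cells. In
  the pathwise Ito formula it is the one term that continuity of the path does not control; it
  becomes small in mean, as n grows for fixed m.\<close>

definition grid_discrepancy :: "(real \<Rightarrow> cpath \<Rightarrow> real) \<Rightarrow> real \<Rightarrow> nat \<Rightarrow> nat \<Rightarrow> cpath \<Rightarrow> real" where
  "grid_discrepancy Q T m n \<omega> = (\<Sum>j<m. \<bar>sq_sum n (grid T m j) (grid T m (Suc j)) \<omega> - (Q (grid T m (Suc j)) \<omega> - Q (grid T m j) \<omega>)\<bar>)"

context increasing_process
begin

lemma AE_dQ_neq: "0 \<le> T \<Longrightarrow> AE s in dQ Q \<omega>. s \<noteq> T"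
  by (rule AE_I[of _ _ "{T}"]) (auto simp: emeasure_dQ_singleton)

lemma integrable_dQ:
  fixes H :: "real \<Rightarrow> real"
  assumes [measurable]: "H \<in> borel_measurable borel" and b: "\<And>s. \<bar>H s\<bar> \<le> C" and T: "0 \<le> T"
  shows "integrable (dQ Q \<omega>) (\<lambda>s. indicator {0..T} s * H s)"
proof (rule Bochner_Integration.integrable_bound)
  show "integrable (dQ Q \<omega>) (\<lambda>s. C * indicator {0..T} s)"
    using T by (intro integrable_mult_right integrable_real_indicator) (auto simp: emeasure_dQ_Icc)
  show "AE s in dQ Q \<omega>. norm (indicator {0..T} s * H s) \<le> norm (C * indicator {0..T} s)"
    using b by (auto simp: indicator_def abs_mult intro: order_trans[OF _ abs_ge_self])
qed simp

lemma sum_Q_grid: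
  assumes "0 < m" shows "(\<Sum>j<m. Q (grid T m (Suc j)) \<omega> - Q (grid T m j) \<omega>) = Q T \<omega>"
  using sum_lessThan_telescope[of "\<lambda>j. Q (grid T m j) \<omega>" m] assms by (simp add: grid_N Q_0)

text \<open>Since \<open>w\<close> bounds the oscillation of the path over one cell, the integrand
  differs from its step version by at most K w, and the total mass on [0, T] is Q T.\<close>

lemma Riemann_sum_error:
  assumes T: "0 < T" and m: "0 < m" and K: "0 \<le> K" and g: "\<And>x y. \<bar>g x - g y\<bar> \<le> K * \<bar>x - y\<bar>"
    and C: "\<And>x. \<bar>g x\<bar> \<le> C" and [measurable]: "g \<in> borel_measurable borel"
    and w: "\<And>x y. x \<in> {0..T} \<Longrightarrow> y \<in> {0..T} \<Longrightarrow> \<bar>x - y\<bar> \<le> T / real m \<Longrightarrow> \<bar>B x \<omega> - B y \<omega>\<bar> \<le> w"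
  shows "\<bar>(\<Sum>j<m. g (B (grid T m j) \<omega>) * (Q (grid T m (Suc j)) \<omega> - Q (grid T m j) \<omega>)) - (LINT s:{0..T}|dQ Q \<omega>. g (B s \<omega>))\<bar> \<le> K * w * Q T \<omega>"
proof -
  let ?c = "grid T m"
  let ?st = "\<lambda>s. \<Sum>j<m. g (B (?c j) \<omega>) * indicator {?c j..<?c (Suc j)} s"
  have T0: "0 \<le> T" using T by simp
  have int_st: "integrable (dQ Q \<omega>) ?st"
    using T grid_nonneg[OF T0] grid_mono[OF T0]
    by (intro Bochner_Integration.integrable_sum integrable_mult_right integrable_real_indicator)
      (auto simp: emeasure_dQ_Ico)
  have "(\<integral>s. ?st s \<partial>dQ Q \<omega>) = (\<Sum>j<m. g (B (?c j) \<omega>) * measure (dQ Q \<omega>) {?c j..<?c (Suc j)})"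
    using grid_nonneg[OF T0] grid_mono[OF T0]
    by (subst Bochner_Integration.integral_sum)
       (auto intro!: integrable_mult_right integrable_real_indicator simp: emeasure_dQ_Ico)
  also have "\<dots> = (\<Sum>j<m. g (B (?c j) \<omega>) * (Q (?c (Suc j)) \<omega> - Q (?c j) \<omega>))"
    using grid_nonneg[OF T0] grid_mono[OF T0] by (intro sum.cong refl) (auto simp: measure_def emeasure_dQ_Ico Q_mono)
  finally have 1: "(\<integral>s. ?st s \<partial>dQ Q \<omega>) = (\<Sum>j<m. g (B (?c j) \<omega>) * (Q (?c (Suc j)) \<omega> - Q (?c j) \<omega>))" .
  have int_g: "integrable (dQ Q \<omega>) (\<lambda>s. indicator {0..T} s * g (B s \<omega>))"
    by (rule integrable_dQ[of _ C]) (use C T in auto)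
  have int_c: "integrable (dQ Q \<omega>) (\<lambda>s. indicator {0..T} s * (K * w))"
    by (rule integrable_dQ[of _ "\<bar>K * w\<bar>"]) (use T in auto)
  have "\<bar>(\<integral>s. ?st s \<partial>dQ Q \<omega>) - (LINT s:{0..T}|dQ Q \<omega>. g (B s \<omega>))\<bar> = \<bar>\<integral>s. ?st s - indicator {0..T} s * g (B s \<omega>) \<partial>dQ Q \<omega>\<bar>"
    using int_st int_g by (simp add: set_lebesgue_integral_def)
  also have "\<dots> \<le> (\<integral>s. \<bar>?st s - indicator {0..T} s * g (B s \<omega>)\<bar> \<partial>dQ Q \<omega>)"
    by (rule integral_abs_bound)
  also have "\<dots> \<le> (\<integral>s. indicator {0..T} s * (K * w) \<partial>dQ Q \<omega>)"
  proof (rule integral_mono_AE)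
    show "AE s in dQ Q \<omega>. \<bar>?st s - indicator {0..T} s * g (B s \<omega>)\<bar> \<le> indicator {0..T} s * (K * w)"
      using AE_dQ_neq[OF T0]
    proof eventually_elim
      fix s assume "s \<noteq> T"
      then consider "s \<in> {0..<T}" | "s \<notin> {0..T}" by force
      then show "\<bar>?st s - indicator {0..T} s * g (B s \<omega>)\<bar> \<le> indicator {0..T} s * (K * w)"
      proof cases
        case 1
        obtain k where k: "k < m" "s \<in> {?c k..<?c (Suc k)}"
          and kf: "\<forall>f :: nat \<Rightarrow> real. (\<Sum>i<m. f i * indicator {?c i..<?c (Suc i)} s) = f k"
          using grid_indicator[OF 1 m] by (elim exE conjE) (rule that; assumption)
        have k3: "?st s = g (B (?c k) \<omega>)" by (rule kf[rule_format])
        have "\<bar>?c k - s\<bar> \<le> T / real m" using k(2) grid_Suc[of T m k] by auto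
        moreover have "?c k \<in> {0..T}" using grid_nonneg[OF T0] k(2) 1 by auto
        ultimately have "\<bar>B (?c k) \<omega> - B s \<omega>\<bar> \<le> w" using 1 by (intro w) auto
        then have "\<bar>g (B (?c k) \<omega>) - g (B s \<omega>)\<bar> \<le> K * w" using g K by (meson mult_left_mono order_trans)
        then show ?thesis using 1 k3 by (simp del: sum.lessThan_Suc)
      next
        case 2
        have "indicator {?c j..<?c (Suc j)} s = (0::real)" if "j < m" for j
        proof -
          have "grid T m (Suc j) \<le> T" using grid_mono[OF T0, of "Suc j" m m] that grid_N[OF m, of T] by simp
          then have "s \<notin> {grid T m j..<grid T m (Suc j)}" using 2 grid_nonneg[OF T0, of m j] by auto
          then show ?thesis by simp
        qed
        then have "?st s = 0" by simp
        then show ?thesis using 2 by simp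
      qed
    qed
  qed (use int_st int_g int_c in auto)
  also have "\<dots> = K * w * Q T \<omega>"
    using T0 emeasure_dQ_Icc[OF order_refl T0, of \<omega>] Q_nonneg[OF T0] by (simp add: measure_def Q_0)
  finally show ?thesis unfolding 1 .
qed

text \<open>Pathwise argument of Foellmer: each of the \<open>m\<close> coarse intervals is cut into \<open>n\<close> pieces. The second
  derivative is frozen on the coarse intervals, where the sums of squares approximate the increments of \<open>Q\<close>.\<close>

lemma Ito_error:
  assumes f: "\<And>x. (f has_real_derivative h x) (at x)" and h: "\<And>x. (h has_real_derivative g x) (at x)"
    and T: "0 < T" and m: "0 < m" and n: "0 < n"
    and K: "0 \<le> K" and g: "\<And>x y. \<bar>g x - g y\<bar> \<le> K * \<bar>x - y\<bar>"
    and C: "\<And>x. \<bar>g x\<bar> \<le> C" and gm: "g \<in> borel_measurable borel"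
    and w: "\<And>x y. x \<in> {0..T} \<Longrightarrow> y \<in> {0..T} \<Longrightarrow> \<bar>x - y\<bar> \<le> T / real m \<Longrightarrow> \<bar>B x \<omega> - B y \<omega>\<bar> \<le> w"
  shows "\<bar>f (B T \<omega>) - f 0 - simple_integral (n * m) (grid T (n * m)) (\<lambda>k \<omega>. h (B (grid T (n * m) k) \<omega>)) \<omega>
       - 1 / 2 * (LINT s:{0..T}|dQ Q \<omega>. g (B s \<omega>))\<bar>
      \<le> K * w * (Q T \<omega> + grid_discrepancy Q T m n \<omega>) + C / 2 * grid_discrepancy Q T m n \<omega> + K * w / 2 * Q T \<omega>"
proof -
  let ?p = "grid T (n * m)" and ?c = "grid T m"
  let ?Z = "grid_discrepancy Q T m n \<omega>"
  have T0: "0 \<le> T" using T by simp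
  have nm: "0 < n * m" using m n by simp
  define d where "d k = B (?p (Suc k)) \<omega> - B (?p k) \<omega>" for k
  define \<rho> where "\<rho> k = f (B (?p (Suc k)) \<omega>) - f (B (?p k) \<omega>) - h (B (?p k) \<omega>) * d k" for k
  define sq where "sq j = sq_sum n (?c j) (?c (Suc j)) \<omega>" for j
  have w0: "0 \<le> w" using w[of 0 0] T by simp
  have sq: "sq j = (\<Sum>i<n. (d (n * j + i))\<^sup>2)" for j
    unfolding sq_def sq_sum_def d_def using grid_refine[OF m n, of T j] by (simp add: add.commute del: of_nat_Suc add_Suc_right flip: add_Suc_right)
  have group: "(\<Sum>k<n * m. F k) = (\<Sum>j<m. \<Sum>i<n. F (n * j + i))" for F :: "nat \<Rightarrow> real"
  proof -
    have "sum F {n * j..<n * j + n} = (\<Sum>i<n. F (n * j + i))" for j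
      using sum.shift_bounds_nat_ivl[of F 0 "n * j" n] by (simp add: add.commute lessThan_atLeast0)
    then show ?thesis using sum.nat_group[of F n m] by (simp add: mult.commute)
  qed
  have pT: "?p k \<in> {0..T}" if "k \<le> n * m" for k
    using grid_nonneg[OF T0] grid_mono[OF T0 that, of "n * m"] grid_N[OF nm, of T] by auto
  \<comment> \<open>Half of K w comes from the Taylor remainder on the fine cell, the other half
    from moving the second derivative from the left end point of the fine cell to that of the coarse
    cell.\<close>
  have step: "\<bar>\<rho> (n * j + i) - g (B (?c j) \<omega>) / 2 * (d (n * j + i))\<^sup>2\<bar> \<le> K * w * (d (n * j + i))\<^sup>2" if j: "j < m" and i: "i < n" for i j
  proof -
    let ?k = "n * j + i"
    have k: "?k < n * m"
    proof -
      have "n * j + i < n * Suc j" using i by simp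
      also have "\<dots> \<le> n * m" using j by (intro mult_le_mono2) auto
      finally show ?thesis .
    qed
    have "T / real (n * m) \<le> T / real m" using T m n by (simp add: field_simps)
    then have "\<bar>?p (Suc ?k) - ?p ?k\<bar> \<le> T / real m" unfolding grid_Suc using T by simp
    then have dw: "\<bar>d ?k\<bar> \<le> w" unfolding d_def using k by (intro w pT) auto
    have "?p ?k - ?c j = (T / real m) * (real i / real n)"
      using grid_refine[OF m n, of T j i] by (simp add: grid_Suc)
    moreover have "0 \<le> (T / real m) * (real i / real n)" using T by simp
    moreover have "(T / real m) * (real i / real n) \<le> (T / real m) * 1"
      by (rule mult_left_mono) (use T i in auto)
    ultimately have "\<bar>?p ?k - ?c j\<bar> \<le> T / real m" by simp
    moreover have "?c j \<in> {0..T}" using grid_nonneg[OF T0] grid_mono[OF T0, of j m m] grid_N[OF m, of T] j by auto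
    ultimately have "\<bar>B (?p ?k) \<omega> - B (?c j) \<omega>\<bar> \<le> w" using k by (intro w pT) auto
    then have gw: "\<bar>g (B (?p ?k) \<omega>) - g (B (?c j) \<omega>)\<bar> \<le> K * w" using g K by (meson mult_left_mono order_trans)
    have "\<bar>\<rho> ?k - g (B (?p ?k) \<omega>) / 2 * (d ?k)\<^sup>2\<bar> \<le> K / 2 * \<bar>d ?k\<bar> * (d ?k)\<^sup>2"
      unfolding \<rho>_def d_def by (rule Taylor_second_order[OF f h g K])
    also have "\<dots> \<le> K / 2 * w * (d ?k)\<^sup>2"
      using K dw by (intro mult_right_mono mult_left_mono) auto
    finally have 1: "\<bar>\<rho> ?k - g (B (?p ?k) \<omega>) / 2 * (d ?k)\<^sup>2\<bar> \<le> K / 2 * w * (d ?k)\<^sup>2" .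
    have "\<bar>g (B (?p ?k) \<omega>) / 2 * (d ?k)\<^sup>2 - g (B (?c j) \<omega>) / 2 * (d ?k)\<^sup>2\<bar> = \<bar>g (B (?p ?k) \<omega>) - g (B (?c j) \<omega>)\<bar> / 2 * (d ?k)\<^sup>2"
      by (simp add: abs_mult flip: left_diff_distrib diff_divide_distrib)
    also have "\<dots> \<le> K * w / 2 * (d ?k)\<^sup>2" using gw by (intro mult_right_mono divide_right_mono) auto
    finally have 2: "\<bar>g (B (?p ?k) \<omega>) / 2 * (d ?k)\<^sup>2 - g (B (?c j) \<omega>) / 2 * (d ?k)\<^sup>2\<bar> \<le> K * w / 2 * (d ?k)\<^sup>2" .
    have "K / 2 * w * (d ?k)\<^sup>2 + K * w / 2 * (d ?k)\<^sup>2 = K * w * (d ?k)\<^sup>2" by simp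
    then show ?thesis using 1 2 by linarith
  qed
  have fsum: "(\<Sum>k<n * m. f (B (?p (Suc k)) \<omega>) - f (B (?p k) \<omega>)) = f (B T \<omega>) - f 0"
    using sum_lessThan_telescope[of "\<lambda>k. f (B (?p k) \<omega>)" "n * m"] by (simp add: grid_N[OF nm] B_nonpos)
  have "f (B T \<omega>) - f 0 - simple_integral (n * m) ?p (\<lambda>k \<omega>. h (B (?p k) \<omega>)) \<omega> = (\<Sum>k<n * m. \<rho> k)"
    unfolding fsum[symmetric] simple_integral_def \<rho>_def d_def by (simp add: sum_subtractf)
  also have "\<dots> = (\<Sum>j<m. \<Sum>i<n. \<rho> (n * j + i))" by (rule group)
  finally have R: "f (B T \<omega>) - f 0 - simple_integral (n * m) ?p (\<lambda>k \<omega>. h (B (?p k) \<omega>)) \<omega> = (\<Sum>j<m. \<Sum>i<n. \<rho> (n * j + i))" .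
  have Z: "(\<Sum>j<m. \<bar>sq j - (Q (?c (Suc j)) \<omega> - Q (?c j) \<omega>)\<bar>) = ?Z" by (simp add: grid_discrepancy_def sq_def)
  \<comment> \<open>Along a given path the sum of squares is known only through its distance to the
    increments of \<open>Q\<close>.\<close>
  have sqsum: "(\<Sum>j<m. sq j) \<le> Q T \<omega> + ?Z"
  proof -
    have "(\<Sum>j<m. sq j) \<le> (\<Sum>j<m. (Q (?c (Suc j)) \<omega> - Q (?c j) \<omega>) + \<bar>sq j - (Q (?c (Suc j)) \<omega> - Q (?c j) \<omega>)\<bar>)"
      by (intro sum_mono) (smt (verit) abs_ge_self)
    then show ?thesis unfolding sum.distrib Z sum_Q_grid[OF m] .
  qed
  have A: "\<bar>(\<Sum>j<m. \<Sum>i<n. \<rho> (n * j + i)) - (\<Sum>j<m. g (B (?c j) \<omega>) / 2 * sq j)\<bar> \<le> K * w * (Q T \<omega> + ?Z)"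
  proof -
    have E: "(\<Sum>j<m. \<Sum>i<n. \<rho> (n * j + i)) - (\<Sum>j<m. g (B (?c j) \<omega>) / 2 * sq j)
      = (\<Sum>j<m. \<Sum>i<n. \<rho> (n * j + i) - g (B (?c j) \<omega>) / 2 * (d (n * j + i))\<^sup>2)"
      by (simp add: sq sum_subtractf sum_distrib_left)
    have "\<bar>(\<Sum>j<m. \<Sum>i<n. \<rho> (n * j + i)) - (\<Sum>j<m. g (B (?c j) \<omega>) / 2 * sq j)\<bar>
        \<le> (\<Sum>j<m. \<Sum>i<n. \<bar>\<rho> (n * j + i) - g (B (?c j) \<omega>) / 2 * (d (n * j + i))\<^sup>2\<bar>)"
      unfolding E by (rule order_trans[OF sum_abs sum_mono[OF sum_abs]])
    also have "\<dots> \<le> (\<Sum>j<m. \<Sum>i<n. K * w * (d (n * j + i))\<^sup>2)"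
      by (intro sum_mono step) auto
    also have "\<dots> = K * w * (\<Sum>j<m. sq j)" by (simp add: sq sum_distrib_left)
    also have "\<dots> \<le> K * w * (Q T \<omega> + ?Z)" using K w0 by (intro mult_left_mono sqsum) auto
    finally show ?thesis .
  qed
  have Bd: "\<bar>(\<Sum>j<m. g (B (?c j) \<omega>) / 2 * sq j) - (\<Sum>j<m. g (B (?c j) \<omega>) / 2 * (Q (?c (Suc j)) \<omega> - Q (?c j) \<omega>))\<bar> \<le> C / 2 * ?Z"
  proof -
    have E: "(\<Sum>j<m. g (B (?c j) \<omega>) / 2 * sq j) - (\<Sum>j<m. g (B (?c j) \<omega>) / 2 * (Q (?c (Suc j)) \<omega> - Q (?c j) \<omega>))
       = (\<Sum>j<m. g (B (?c j) \<omega>) / 2 * (sq j - (Q (?c (Suc j)) \<omega> - Q (?c j) \<omega>)))"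
      by (simp add: sum_subtractf right_diff_distrib)
    have "\<bar>(\<Sum>j<m. g (B (?c j) \<omega>) / 2 * sq j) - (\<Sum>j<m. g (B (?c j) \<omega>) / 2 * (Q (?c (Suc j)) \<omega> - Q (?c j) \<omega>))\<bar>
        \<le> (\<Sum>j<m. \<bar>g (B (?c j) \<omega>) / 2 * (sq j - (Q (?c (Suc j)) \<omega> - Q (?c j) \<omega>))\<bar>)"
      unfolding E by (rule sum_abs)
    also have "\<dots> \<le> (\<Sum>j<m. C / 2 * \<bar>sq j - (Q (?c (Suc j)) \<omega> - Q (?c j) \<omega>)\<bar>)"
      unfolding abs_mult using C by (intro sum_mono mult_right_mono) auto
    also have "\<dots> = C / 2 * ?Z" by (simp only: Z flip: sum_distrib_left)
    finally show ?thesis .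
  qed
  define S1 where "S1 = (\<Sum>j<m. \<Sum>i<n. \<rho> (n * j + i))"
  define S2 where "S2 = (\<Sum>j<m. g (B (?c j) \<omega>) / 2 * sq j)"
  define S3 where "S3 = (\<Sum>j<m. g (B (?c j) \<omega>) * (Q (?c (Suc j)) \<omega> - Q (?c j) \<omega>))"
  define LI where "LI = (LINT s:{0..T}|dQ Q \<omega>. g (B s \<omega>))"
  have S3: "(\<Sum>j<m. g (B (?c j) \<omega>) / 2 * (Q (?c (Suc j)) \<omega> - Q (?c j) \<omega>)) = S3 / 2"
    by (simp add: S3_def sum_divide_distrib)
  have "\<bar>S3 - LI\<bar> \<le> K * w * Q T \<omega>"
    unfolding S3_def LI_def by (rule Riemann_sum_error[OF T m K g C gm w])
  moreover have "\<bar>S3 / 2 - LI / 2\<bar> = \<bar>S3 - LI\<bar> / 2" by (simp flip: diff_divide_distrib)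
  ultimately have "\<bar>S3 / 2 - LI / 2\<bar> \<le> K * w / 2 * Q T \<omega>" by simp
  then show ?thesis using A Bd unfolding R S3 S1_def[symmetric] S2_def[symmetric] LI_def[symmetric] by linarith
qed

end

context quadratic_variation_law
begin

lemma exists_fine_grid:
  assumes T: "0 < T" and e: "(0::real) < e"
  shows "\<exists>n>0. (\<integral>\<^sup>+\<omega>. ennreal (grid_discrepancy Q T m n \<omega>) \<partial>P) < ennreal e"
proof -
  have T0: "0 \<le> T" using T by simp
  let ?Y = "\<lambda>j n \<omega>. sq_sum (Suc n) (grid T m j) (grid T m (Suc j)) \<omega> - (Q (grid T m (Suc j)) \<omega> - Q (grid T m j) \<omega>)"
  have "(\<lambda>n. \<integral>\<^sup>+\<omega>. ennreal \<bar>?Y j n \<omega>\<bar> \<partial>P) \<longlonglongrightarrow> 0" for j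
    by (rule L2_imp_L1_tendsto[OF _ sq_sum_tendsto]) (auto simp: grid_nonneg T0 intro: grid_mono)
  then have "(\<lambda>n. \<Sum>j<m. \<integral>\<^sup>+\<omega>. ennreal \<bar>?Y j n \<omega>\<bar> \<partial>P) \<longlonglongrightarrow> (\<Sum>j<m. 0)"
    by (intro tendsto_sum)
  then have "\<forall>\<^sub>F n in sequentially. (\<Sum>j<m. \<integral>\<^sup>+\<omega>. ennreal \<bar>?Y j n \<omega>\<bar> \<partial>P) < ennreal e"
    by (rule order_tendstoD) (use e in simp)
  then obtain n where n: "(\<Sum>j<m. \<integral>\<^sup>+\<omega>. ennreal \<bar>?Y j n \<omega>\<bar> \<partial>P) < ennreal e"
    using eventually_happens'[OF sequentially_bot] by blast
  have "(\<integral>\<^sup>+\<omega>. ennreal (grid_discrepancy Q T m (Suc n) \<omega>) \<partial>P) = (\<integral>\<^sup>+\<omega>. (\<Sum>j<m. ennreal \<bar>?Y j n \<omega>\<bar>) \<partial>P)"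
    unfolding grid_discrepancy_def by (simp add: sum_ennreal)
  also have "\<dots> = (\<Sum>j<m. \<integral>\<^sup>+\<omega>. ennreal \<bar>?Y j n \<omega>\<bar> \<partial>P)"
    by (rule nn_integral_sum) simp
  finally show ?thesis using n by (intro exI[of _ "Suc n"]) simp
qed

lemma grid_discrepancy_nonneg: "0 \<le> grid_discrepancy Q T m n \<omega>"
  unfolding grid_discrepancy_def by (intro sum_nonneg) auto

lemma measurable_grid_discrepancy [measurable]: "grid_discrepancy Q T m n \<in> borel_measurable borel"
  unfolding grid_discrepancy_def by measurable

text \<open>For each coarse grid of m cells a refinement with mean discrepancy below 1/m is chosen,
  and convergence in mean gives an almost surely convergent subsequence. The condition k < m k
  records that the meshes still shrink along it.\<close>

lemma AE_fine_grids:
  assumes T: "0 < T"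
  shows "\<exists>m n :: nat \<Rightarrow> nat. (\<forall>k. k < m k \<and> 0 < n k) \<and> (AE \<omega> in P. (\<lambda>k. grid_discrepancy Q T (m k) (n k) \<omega>) \<longlonglongrightarrow> 0)"
proof -
  have "\<forall>m. \<exists>n>0. (\<integral>\<^sup>+\<omega>. ennreal (grid_discrepancy Q T (Suc m) n \<omega>) \<partial>P) < ennreal (1 / real (Suc m))"
    using exists_fine_grid[OF T] by simp
  then obtain n where n: "\<And>m. 0 < n m" "\<And>m. (\<integral>\<^sup>+\<omega>. ennreal (grid_discrepancy Q T (Suc m) (n m) \<omega>) \<partial>P) < ennreal (1 / real (Suc m))"
    by metis
  let ?Z = "\<lambda>m. grid_discrepancy Q T (Suc m) (n m)"
  have int: "integrable P (?Z m)" for m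
  proof (rule integrableI_bounded)
    have "(\<integral>\<^sup>+\<omega>. ennreal (norm (?Z m \<omega>)) \<partial>P) = (\<integral>\<^sup>+\<omega>. ennreal (?Z m \<omega>) \<partial>P)"
      by (simp add: grid_discrepancy_nonneg)
    also have "\<dots> < \<infinity>" using n(2)[of m] by (rule order.strict_trans) simp
    finally show "(\<integral>\<^sup>+\<omega>. ennreal (norm (?Z m \<omega>)) \<partial>P) < \<infinity>" .
  qed simp
  have le: "(\<integral>\<omega>. norm (?Z m \<omega>) \<partial>P) \<le> 1 / real (Suc m)" for m
  proof -
    have "ennreal (\<integral>\<omega>. norm (?Z m \<omega>) \<partial>P) = (\<integral>\<^sup>+\<omega>. ennreal (?Z m \<omega>) \<partial>P)"
      using int[of m] by (subst nn_integral_eq_integral) (auto simp: grid_discrepancy_nonneg)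
    then have "ennreal (\<integral>\<omega>. norm (?Z m \<omega>) \<partial>P) \<le> ennreal (1 / real (Suc m))" using n(2)[of m] by simp
    then show ?thesis by (simp add: ennreal_le_iff)
  qed
  have "(\<lambda>m. \<integral>\<omega>. norm (?Z m \<omega>) \<partial>P) \<longlonglongrightarrow> 0"
  proof (rule real_tendsto_sandwich[OF _ _ tendsto_const])
    show "\<forall>\<^sub>F m in sequentially. 0 \<le> (\<integral>\<omega>. norm (?Z m \<omega>) \<partial>P)" by simp
    show "\<forall>\<^sub>F m in sequentially. (\<integral>\<omega>. norm (?Z m \<omega>) \<partial>P) \<le> 1 / real (Suc m)" using le by simp
    show "(\<lambda>m. 1 / real (Suc m)) \<longlonglongrightarrow> 0" using LIMSEQ_Suc[OF lim_1_over_n] by simp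
  qed
  from tendsto_L1_AE_subseq[OF int this] obtain r where r: "strict_mono r" "AE \<omega> in P. (\<lambda>k. ?Z (r k) \<omega>) \<longlonglongrightarrow> 0" by blast
  have "k < Suc (r k)" for k using seq_suble[OF r(1), of k] by simp
  then show ?thesis using r(2) n(1) by (intro exI[of _ "\<lambda>k. Suc (r k)"] exI[of _ "\<lambda>k. n (r k)"]) auto
qed

text \<open>Uniform continuity of each path makes its oscillation over a coarse cell small, and the
  discrepancy tends to 0 along the chosen grids, so the error bound of the pathwise formula
  vanishes.\<close>

lemma Ito_limit:
  assumes f: "\<And>x. (f has_real_derivative h x) (at x)" and h: "\<And>x. (h has_real_derivative g x) (at x)"
    and T: "0 < T" and K: "0 \<le> K" and g: "\<And>x y. \<bar>g x - g y\<bar> \<le> K * \<bar>x - y\<bar>"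
    and C: "\<And>x. \<bar>g x\<bar> \<le> C" and gm: "g \<in> borel_measurable borel"
  shows "\<exists>N :: nat \<Rightarrow> nat. (\<forall>k. k < N k) \<and>
    (AE \<omega> in P. (\<lambda>k. simple_integral (N k) (grid T (N k)) (\<lambda>i \<omega>. h (B (grid T (N k) i) \<omega>)) \<omega>)
        \<longlonglongrightarrow> f (B T \<omega>) - f 0 - 1 / 2 * (LINT s:{0..T}|dQ Q \<omega>. g (B s \<omega>)))"
proof -
  obtain m n where mn: "\<And>k. k < m k" "\<And>k. 0 < n k" and Z: "AE \<omega> in P. (\<lambda>k. grid_discrepancy Q T (m k) (n k) \<omega>) \<longlonglongrightarrow> 0"
    using AE_fine_grids[OF T] by blast
  have N: "k < n k * m k" for k
    using mn(1)[of k] mn(2)[of k] by (metis One_nat_def Suc_leI mult.commute mult_le_mono2 mult_1_right order_less_le_trans)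
  have "AE \<omega> in P. (\<lambda>k. simple_integral (n k * m k) (grid T (n k * m k)) (\<lambda>i \<omega>. h (B (grid T (n k * m k) i) \<omega>)) \<omega>)
        \<longlonglongrightarrow> f (B T \<omega>) - f 0 - 1 / 2 * (LINT s:{0..T}|dQ Q \<omega>. g (B s \<omega>))"
    using Z
  proof eventually_elim
    fix \<omega> assume Z: "(\<lambda>k. grid_discrepancy Q T (m k) (n k) \<omega>) \<longlonglongrightarrow> 0"
    let ?S = "\<lambda>k. simple_integral (n k * m k) (grid T (n k * m k)) (\<lambda>i \<omega>. h (B (grid T (n k * m k) i) \<omega>)) \<omega>"
    let ?Z = "\<lambda>k. grid_discrepancy Q T (m k) (n k) \<omega>"
    define M where "M = f (B T \<omega>) - f 0 - 1 / 2 * (LINT s:{0..T}|dQ Q \<omega>. g (B s \<omega>))"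
    \<comment> \<open>\<open>c\<close> collects the coefficients of the oscillation \<open>w\<close>
      in the error bound once the discrepancy is at most 1.\<close>
    define c where "c = K * (Q T \<omega> + 1) + K / 2 * Q T \<omega>"
    have c: "0 \<le> c" using K Q_nonneg[of T \<omega>] T by (simp add: c_def)
    have C0: "0 \<le> C" using C[of 0] by simp
    have "uniformly_continuous_on {0..T} (\<lambda>t. B t \<omega>)"
      by (rule compact_uniformly_continuous[OF continuous_B]) simp
    then have uc: "\<exists>d>0. \<forall>x\<in>{0..T}. \<forall>y\<in>{0..T}. \<bar>x - y\<bar> < d \<longrightarrow> \<bar>B x \<omega> - B y \<omega>\<bar> < e" if "e > 0" for e
      using that unfolding uniformly_continuous_on_def dist_real_def by (metis abs_minus_commute)
    have "?S \<longlonglongrightarrow> M"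
    proof (rule LIMSEQ_I)
      fix e :: real assume e: "0 < e"
      \<comment> \<open>Half of \<open>e\<close> is reserved for the oscillation and half for the
        discrepancy; adding 1 in the denominators covers c = 0 and C = 0.\<close>
      define w where "w = e / (2 * (c + 1))"
      have w: "0 < w" using e c by (simp add: w_def)
      obtain d where d: "d > 0" "\<And>x y. x \<in> {0..T} \<Longrightarrow> y \<in> {0..T} \<Longrightarrow> \<bar>x - y\<bar> < d \<Longrightarrow> \<bar>B x \<omega> - B y \<omega>\<bar> < w"
        using uc[OF w] by blast
      have "\<forall>\<^sub>F k in sequentially. T / real (Suc k) < d"
        using LIMSEQ_Suc[OF lim_const_over_n[of T]] d(1) by (intro order_tendstoD) auto
      moreover have "\<forall>\<^sub>F k in sequentially. ?Z k < min 1 (e / (C + 1))"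
        using Z e C0 by (intro order_tendstoD) auto
      ultimately have "\<forall>\<^sub>F k in sequentially. norm (?S k - M) < e"
      proof eventually_elim
        case (elim k)
        have "T / real (m k) \<le> T / real (Suc k)" using mn(1)[of k] T by (intro divide_left_mono) auto
        then have osc: "\<bar>B x \<omega> - B y \<omega>\<bar> \<le> w" if "x \<in> {0..T}" "y \<in> {0..T}" "\<bar>x - y\<bar> \<le> T / real (m k)" for x y
          using d(2)[OF that(1,2)] that(3) elim(1) by (intro less_imp_le) linarith
        have "\<bar>f (B T \<omega>) - f 0 - ?S k - 1 / 2 * (LINT s:{0..T}|dQ Q \<omega>. g (B s \<omega>))\<bar>
          \<le> K * w * (Q T \<omega> + ?Z k) + C / 2 * ?Z k + K * w / 2 * Q T \<omega>"
          using mn(1)[of k] by (intro Ito_error[OF f h T _ mn(2) K g C gm osc]) auto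
        also have "\<dots> \<le> K * w * (Q T \<omega> + 1) + C / 2 * ?Z k + K * w / 2 * Q T \<omega>"
          using K w elim(2) C0 by (intro add_mono mult_left_mono) auto
        also have "\<dots> = w * c + C / 2 * ?Z k" by (simp add: c_def algebra_simps)
        also have "\<dots> < e"
        proof -
          have "w * c < e / 2" using c e by (simp add: w_def field_simps)
          moreover have "C / 2 * ?Z k \<le> e / 2"
          proof -
            have "C * ?Z k \<le> C * (e / (C + 1))" using elim(2) C0 by (intro mult_left_mono) auto
            also have "\<dots> \<le> e" using C0 e by (simp add: field_simps)
            finally show ?thesis by simp
          qed
          ultimately show ?thesis by simp
        qed
        finally show "norm (?S k - M) < e" unfolding M_def by (simp add: abs_minus_commute algebra_simps)
      qed
      then show "\<exists>no. \<forall>k\<ge>no. norm (?S k - M) < e" by (simp add: eventually_sequentially)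
    qed
    then show "?S \<longlonglongrightarrow> f (B T \<omega>) - f 0 - 1 / 2 * (LINT s:{0..T}|dQ Q \<omega>. g (B s \<omega>))" by (simp add: M_def)
  qed
  then show ?thesis using N by (intro exI[of _ "\<lambda>k. n k * m k"]) blast
qed

end

subsection \<open>The isometry for compensated processes\<close>

definition jointly_measurable :: "(real \<Rightarrow> cpath \<Rightarrow> real) \<Rightarrow> bool" where
  "jointly_measurable \<eta> \<longleftrightarrow> (\<lambda>(\<omega>, s). \<eta> s \<omega>) \<in> borel_measurable (borel \<Otimes>\<^sub>M borel)"

text \<open>The random quantity whose upper expectation is the squared norm
  \<open>M2_norm_sq\<close> of the difference.\<close>

definition sq_dist :: "(real \<Rightarrow> cpath \<Rightarrow> real) \<Rightarrow> real \<Rightarrow> (real \<Rightarrow> cpath \<Rightarrow> real) \<Rightarrow> (real \<Rightarrow> cpath \<Rightarrow> real) \<Rightarrow> cpath \<Rightarrow> ennreal" where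
  "sq_dist Q T \<eta> \<zeta> \<omega> = (\<integral>\<^sup>+s\<in>{0..T}. ennreal ((\<eta> s \<omega> - \<zeta> s \<omega>)\<^sup>2) \<partial>dQ Q \<omega>)"

lemma sq_dist_commute: "sq_dist Q T \<eta> \<zeta> = sq_dist Q T \<zeta> \<eta>"
  by (simp add: sq_dist_def fun_eq_iff power2_commute)

lemma jointly_measurable_B: "h \<in> borel_measurable borel \<Longrightarrow> jointly_measurable (\<lambda>s \<omega>. h (B s \<omega>))"
  unfolding jointly_measurable_def split_beta
  by (rule measurable_compose[OF measurable_B_pair']) auto

lemma jointly_measurable_path:
  assumes "jointly_measurable \<eta>" shows "(\<lambda>s. \<eta> s \<omega>) \<in> borel_measurable borel"
  using measurable_Pair2[OF assms[unfolded jointly_measurable_def], of \<omega>] by simp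

lemma partition_of_mono:
  assumes "partition_of T n \<tau>" "i \<le> j" "j \<le> n" shows "\<tau> i \<le> \<tau> j"
  using assms(2,3)
proof (induction j rule: dec_induct)
  case (step k)
  then have "\<tau> k < \<tau> (Suc k)" using assms(1) by (simp add: partition_of_def)
  then show ?case using step by simp
qed simp

lemma partition_of_bounds:
  assumes "partition_of T n \<tau>" "j < n"
  shows "0 \<le> \<tau> j \<and> \<tau> j \<le> \<tau> (Suc j) \<and> \<tau> (Suc j) \<le> T"
  using partition_of_mono[OF assms(1), of 0 j] partition_of_mono[OF assms(1), of j "Suc j"]
    partition_of_mono[OF assms(1), of "Suc j" n] assms by (simp add: partition_of_def)

lemma simple_data_bounds:
  assumes "simple_data T n \<tau> \<xi>" "j < n"
  shows "0 \<le> \<tau> j \<and> \<tau> j \<le> \<tau> (Suc j) \<and> \<tau> (Suc j) \<le> T" "\<xi> j \<in> L_b (\<tau> j)"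
  using assms partition_of_bounds by (auto simp: simple_data_def)

lemma jointly_measurable_simple:
  assumes "simple_data T n \<tau> \<xi>" shows "jointly_measurable (simple_process n \<tau> \<xi>)"
  unfolding jointly_measurable_def simple_process_def split_beta
proof (rule borel_measurable_sum)
  fix j assume "j \<in> {..<n}"
  then have "\<xi> j \<in> L_b (\<tau> j)" using simple_data_bounds(2)[OF assms] by simp
  then have [measurable]: "\<xi> j \<in> borel_measurable borel" by (rule L_bE) blast
  show "(\<lambda>x. \<xi> j (fst x) * indicator {\<tau> j..<\<tau> (Suc j)} (snd x)) \<in> borel_measurable (borel \<Otimes>\<^sub>M borel)"
    by (intro borel_measurable_times measurable_compose[OF measurable_fst] measurable_compose[OF measurable_snd]) auto
qed

lemma measurable_simple_integral:
  assumes "simple_data T n \<tau> \<xi>" shows "simple_integral n \<tau> \<xi> \<in> borel_measurable borel"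
  unfolding simple_integral_def
proof (rule borel_measurable_sum)
  fix j assume "j \<in> {..<n}"
  then have "\<xi> j \<in> L_b (\<tau> j)" using simple_data_bounds(2)[OF assms] by simp
  then have [measurable]: "\<xi> j \<in> borel_measurable borel" by (rule L_bE) blast
  show "(\<lambda>\<omega>. \<xi> j \<omega> * (B (\<tau> (Suc j)) \<omega> - B (\<tau> j) \<omega>)) \<in> borel_measurable borel" by measurable
qed

lemma simple_data_grid:
  assumes "0 < T" "0 < N" "h \<in> borel_measurable borel" "\<And>x. \<bar>h x\<bar> \<le> H"
  shows "simple_data T N (grid T N) (\<lambda>i \<omega>. h (B (grid T N i) \<omega>))"
  unfolding simple_data_def
proof (intro conjI allI impI partition_of_grid assms)
  fix i
  have "adapted (grid T N i) (\<lambda>\<omega>. h (B (grid T N i) \<omega>))"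
    by (rule adapted_compose[OF adapted_B[OF order_refl] assms(3)])
  then show "(\<lambda>\<omega>. h (B (grid T N i) \<omega>)) \<in> L_b (grid T N i)"
    by (rule L_bI) (rule assms(4))
qed

context increasing_process
begin

lemma measurable_sq_dist:
  assumes "jointly_measurable \<eta>" "jointly_measurable \<zeta>" "0 \<le> T"
  shows "sq_dist Q T \<eta> \<zeta> \<in> borel_measurable borel"
proof -
  have "(\<lambda>(\<omega>, s). ennreal ((\<eta> s \<omega> - \<zeta> s \<omega>)\<^sup>2)) \<in> borel_measurable (borel \<Otimes>\<^sub>M borel)"
    using assms(1,2) unfolding jointly_measurable_def split_beta by measurable
  from measurable_nn_integral_dQ[OF this assms(3)] show ?thesis
    by (simp add: sq_dist_def[abs_def])
qed

lemma sq_dist_triangle: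
  assumes "jointly_measurable \<eta>" "jointly_measurable \<zeta>" "jointly_measurable \<theta>"
  shows "sq_dist Q T \<eta> \<theta> \<omega> \<le> 2 * sq_dist Q T \<eta> \<zeta> \<omega> + 2 * sq_dist Q T \<zeta> \<theta> \<omega>"
proof -
  note [measurable] = jointly_measurable_path[OF assms(1)] jointly_measurable_path[OF assms(2)] jointly_measurable_path[OF assms(3)]
  have "sq_dist Q T \<eta> \<theta> \<omega> \<le> (\<integral>\<^sup>+s. 2 * (ennreal ((\<eta> s \<omega> - \<zeta> s \<omega>)\<^sup>2) * indicator {0..T} s) + 2 * (ennreal ((\<zeta> s \<omega> - \<theta> s \<omega>)\<^sup>2) * indicator {0..T} s) \<partial>dQ Q \<omega>)"
    unfolding sq_dist_def
  proof (rule nn_integral_mono)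
    fix s
    have "ennreal ((\<eta> s \<omega> - \<theta> s \<omega>)\<^sup>2) \<le> 2 * ennreal ((\<eta> s \<omega> - \<zeta> s \<omega>)\<^sup>2) + 2 * ennreal ((\<zeta> s \<omega> - \<theta> s \<omega>)\<^sup>2)"
      using ennreal_square_add_le[of "\<eta> s \<omega> - \<zeta> s \<omega>" "\<zeta> s \<omega> - \<theta> s \<omega>"] by simp
    then show "ennreal ((\<eta> s \<omega> - \<theta> s \<omega>)\<^sup>2) * indicator {0..T} s \<le> 2 * (ennreal ((\<eta> s \<omega> - \<zeta> s \<omega>)\<^sup>2) * indicator {0..T} s) + 2 * (ennreal ((\<zeta> s \<omega> - \<theta> s \<omega>)\<^sup>2) * indicator {0..T} s)"
      by (auto simp: indicator_def)
  qed
  also have "\<dots> = 2 * sq_dist Q T \<eta> \<zeta> \<omega> + 2 * sq_dist Q T \<zeta> \<theta> \<omega>"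
    unfolding sq_dist_def by (subst nn_integral_add) (simp_all add: nn_integral_cmult)
  finally show ?thesis .
qed

lemma sq_dist_le_const:
  assumes "\<And>s. \<bar>\<eta> s \<omega> - \<zeta> s \<omega>\<bar> \<le> c" "0 \<le> T"
  shows "sq_dist Q T \<eta> \<zeta> \<omega> \<le> ennreal (c\<^sup>2) * ennreal (Q T \<omega>)"
proof -
  have "sq_dist Q T \<eta> \<zeta> \<omega> \<le> (\<integral>\<^sup>+s. ennreal (c\<^sup>2) * indicator {0..T} s \<partial>dQ Q \<omega>)"
    unfolding sq_dist_def using assms(1)
    by (intro nn_integral_mono mult_right_mono ennreal_leI) (auto simp: abs_le_square_iff[symmetric] intro: order_trans[OF _ abs_ge_self])
  also have "\<dots> = ennreal (c\<^sup>2) * ennreal (Q T \<omega>)"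
    using assms(2) by (subst nn_integral_cmult_indicator) (auto simp: emeasure_dQ_Icc Q_0)
  finally show ?thesis .
qed

end

context quadratic_variation_law
begin

lemma nn_sq_dist_triangle:
  assumes "jointly_measurable \<eta>" "jointly_measurable \<zeta>" "jointly_measurable \<theta>" "0 \<le> T"
  shows "(\<integral>\<^sup>+\<omega>. sq_dist Q T \<eta> \<theta> \<omega> \<partial>P) \<le> 2 * (\<integral>\<^sup>+\<omega>. sq_dist Q T \<eta> \<zeta> \<omega> \<partial>P) + 2 * (\<integral>\<^sup>+\<omega>. sq_dist Q T \<zeta> \<theta> \<omega> \<partial>P)"
proof -
  note [measurable] = measurable_sq_dist[OF assms(1,2,4)] measurable_sq_dist[OF assms(2,3,4)]
  have "(\<integral>\<^sup>+\<omega>. sq_dist Q T \<eta> \<theta> \<omega> \<partial>P) \<le> (\<integral>\<^sup>+\<omega>. 2 * sq_dist Q T \<eta> \<zeta> \<omega> + 2 * sq_dist Q T \<zeta> \<theta> \<omega> \<partial>P)"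
    by (intro nn_integral_mono sq_dist_triangle assms)
  also have "\<dots> = 2 * (\<integral>\<^sup>+\<omega>. sq_dist Q T \<eta> \<zeta> \<omega> \<partial>P) + 2 * (\<integral>\<^sup>+\<omega>. sq_dist Q T \<zeta> \<theta> \<omega> \<partial>P)"
    by (simp add: nn_integral_add nn_integral_cmult)
  finally show ?thesis .
qed

lemma nn_sq_dist_le_const:
  assumes "\<And>s \<omega>. \<bar>\<eta> s \<omega> - \<zeta> s \<omega>\<bar> \<le> c" "0 \<le> T"
  shows "(\<integral>\<^sup>+\<omega>. sq_dist Q T \<eta> \<zeta> \<omega> \<partial>P) \<le> ennreal (c\<^sup>2 * (V * T))"
proof -
  have "(\<integral>\<^sup>+\<omega>. sq_dist Q T \<eta> \<zeta> \<omega> \<partial>P) \<le> (\<integral>\<^sup>+\<omega>. ennreal (c\<^sup>2) * ennreal (Q T \<omega>) \<partial>P)"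
    by (intro nn_integral_mono sq_dist_le_const assms)
  also have "\<dots> = ennreal (c\<^sup>2) * (\<integral>\<^sup>+\<omega>. ennreal (Q T \<omega>) \<partial>P)"
    by (rule nn_integral_cmult) simp
  also have "\<dots> \<le> ennreal (c\<^sup>2) * ennreal (V * T)"
    by (intro mult_left_mono Q_mean_le assms) simp
  also have "\<dots> = ennreal (c\<^sup>2 * (V * T))" by (simp add: ennreal_mult')
  finally show ?thesis .
qed

text \<open>Indexed by the disjoint union of both partitions, with the second family of coefficients
  negated, the difference is a single family of possibly overlapping intervals.\<close>

lemma simple_diff_isometry:
  assumes "simple_data T n \<tau> \<xi>" "simple_data T m \<rho> \<zeta>"
  shows "(\<integral>\<^sup>+\<omega>. ennreal ((simple_integral n \<tau> \<xi> \<omega> - simple_integral m \<rho> \<zeta> \<omega>)\<^sup>2) \<partial>P)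
    = (\<integral>\<^sup>+\<omega>. sq_dist Q T (simple_process n \<tau> \<xi>) (simple_process m \<rho> \<zeta>) \<omega> \<partial>P)"
proof -
  define u where "u = case_sum \<tau> \<rho>"
  define v where "v = case_sum (\<lambda>j. \<tau> (Suc j)) (\<lambda>j. \<rho> (Suc j))"
  define X where "X = case_sum \<xi> (\<lambda>j \<omega>. - \<zeta> j \<omega>)"
  have neg: "(\<lambda>\<omega>. - Y \<omega>) \<in> L_b s" if "Y \<in> L_b s" for Y s
    using that adapted_compose[of s Y uminus] by (auto simp: L_b_iff bounded_iff)
  have "(\<integral>\<^sup>+\<omega>. ennreal ((\<Sum>i\<in>{..<n} <+> {..<m}. X i \<omega> * (B (v i) \<omega> - B (u i) \<omega>))\<^sup>2) \<partial>P)
     = (\<integral>\<^sup>+\<omega>. (\<integral>\<^sup>+s\<in>{0..T}. ennreal ((\<Sum>i\<in>{..<n} <+> {..<m}. X i \<omega> * indicator {u i..<v i} s)\<^sup>2) \<partial>dQ Q \<omega>) \<partial>P)"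
    by (rule simple_isometry)
      (use simple_data_bounds[OF assms(1)] simple_data_bounds[OF assms(2)] neg in \<open>auto simp: u_def v_def X_def\<close>)
  then show ?thesis
    by (simp add: sum.Plus u_def v_def X_def sq_dist_def simple_integral_def simple_process_def sum_negf
          del: sum_mult_indicator)
qed

text \<open>Identifies f(B_T) - f(0) minus half the integral of g(B) as the stochastic integral of
  h(B), purely by its distance to simple integrals. The bound is free of K, C and H, which allows
  the Lipschitz constant of g to blow up later; the factor 2 is that of the triangle inequality for
  squares.\<close>

lemma Ito_isometry:
  assumes f: "\<And>x. (f has_real_derivative h x) (at x)" and h: "\<And>x. (h has_real_derivative g x) (at x)"
    and T: "0 < T" and K: "0 \<le> K" and g: "\<And>x y. \<bar>g x - g y\<bar> \<le> K * \<bar>x - y\<bar>"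
    and C: "\<And>x. \<bar>g x\<bar> \<le> C" and gm: "g \<in> borel_measurable borel" and H: "\<And>x. \<bar>h x\<bar> \<le> H"
    and S: "simple_data T n \<tau> \<xi>"
  shows "(\<integral>\<^sup>+\<omega>. ennreal ((f (B T \<omega>) - f 0 - 1 / 2 * (LINT s:{0..T}|dQ Q \<omega>. g (B s \<omega>)) - simple_integral n \<tau> \<xi> \<omega>)\<^sup>2) \<partial>P)
    \<le> 2 * (\<integral>\<^sup>+\<omega>. sq_dist Q T (\<lambda>s \<omega>. h (B s \<omega>)) (simple_process n \<tau> \<xi>) \<omega> \<partial>P)"
proof -
  obtain N where N: "\<And>k. k < N k" and lim: "AE \<omega> in P. (\<lambda>k. simple_integral (N k) (grid T (N k)) (\<lambda>i \<omega>. h (B (grid T (N k) i) \<omega>)) \<omega>)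
        \<longlonglongrightarrow> f (B T \<omega>) - f 0 - 1 / 2 * (LINT s:{0..T}|dQ Q \<omega>. g (B s \<omega>))"
    using Ito_limit[OF f h T K g C gm] by blast
  have hm [measurable]: "h \<in> borel_measurable borel"
    using h by (intro borel_measurable_continuous_onI DERIV_continuous_on[of UNIV h g]) (auto intro: has_field_derivative_at_within)
  have C0: "0 \<le> C" using C[of 0] by simp
  \<comment> \<open>The bound \<open>C\<close> on \<open>g\<close> makes \<open>h\<close> Lipschitz,
    as the grid approximation requires.\<close>
  have hL: "\<bar>h x - h y\<bar> \<le> C * \<bar>x - y\<bar>" for x y
    using field_differentiable_bound[of UNIV h g C x y] h C by (auto simp: has_field_derivative_at_within)
  let ?S = "\<lambda>k. simple_integral (N k) (grid T (N k)) (\<lambda>i \<omega>. h (B (grid T (N k) i) \<omega>))"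
  let ?sp = "\<lambda>k. simple_process (N k) (grid T (N k)) (\<lambda>i \<omega>. h (B (grid T (N k) i) \<omega>))"
  let ?\<eta> = "\<lambda>s \<omega>. h (B s \<omega>)" and ?\<zeta> = "simple_process n \<tau> \<xi>"
  have N0: "0 < N k" for k using N[of k] by simp
  have Sk: "simple_data T (N k) (grid T (N k)) (\<lambda>i \<omega>. h (B (grid T (N k) i) \<omega>))" for k
    by (rule simple_data_grid[OF T N0 hm H])
  note [measurable] = measurable_simple_integral[OF Sk] measurable_simple_integral[OF S]
  note jm = jointly_measurable_simple[OF Sk] jointly_measurable_B[OF hm] jointly_measurable_simple[OF S]
  define c where "c = C\<^sup>2 * V\<^sup>2 * T\<^sup>2"
  show ?thesis
  proof (rule nn_integral_le_LIMSEQ)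
    show "(\<lambda>\<omega>. ennreal ((?S k \<omega> - simple_integral n \<tau> \<xi> \<omega>)\<^sup>2)) \<in> borel_measurable P" for k by simp
    show "AE \<omega> in P. (\<lambda>k. ennreal ((?S k \<omega> - simple_integral n \<tau> \<xi> \<omega>)\<^sup>2)) \<longlonglongrightarrow>
       ennreal ((f (B T \<omega>) - f 0 - 1 / 2 * (LINT s:{0..T}|dQ Q \<omega>. g (B s \<omega>)) - simple_integral n \<tau> \<xi> \<omega>)\<^sup>2)"
      using lim by eventually_elim (intro tendsto_ennrealI tendsto_power tendsto_diff tendsto_const)
    show "(\<integral>\<^sup>+\<omega>. ennreal ((?S k \<omega> - simple_integral n \<tau> \<xi> \<omega>)\<^sup>2) \<partial>P) \<le> 2 * ennreal (c / real (N k)) + 2 * (\<integral>\<^sup>+\<omega>. sq_dist Q T ?\<eta> ?\<zeta> \<omega> \<partial>P)" for k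
    proof -
      have "(\<integral>\<^sup>+\<omega>. ennreal ((?S k \<omega> - simple_integral n \<tau> \<xi> \<omega>)\<^sup>2) \<partial>P) = (\<integral>\<^sup>+\<omega>. sq_dist Q T (?sp k) ?\<zeta> \<omega> \<partial>P)"
        by (rule simple_diff_isometry[OF Sk S])
      also have "\<dots> \<le> 2 * (\<integral>\<^sup>+\<omega>. sq_dist Q T (?sp k) ?\<eta> \<omega> \<partial>P) + 2 * (\<integral>\<^sup>+\<omega>. sq_dist Q T ?\<eta> ?\<zeta> \<omega> \<partial>P)"
        by (rule nn_sq_dist_triangle) (use jm T in auto)
      also have "(\<integral>\<^sup>+\<omega>. sq_dist Q T (?sp k) ?\<eta> \<omega> \<partial>P) \<le> ennreal (c / real (N k))"
        using grid_approximation[OF T N0[of k] C0 hL hm] by (simp add: sq_dist_def c_def grid_def[abs_def])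
      finally show ?thesis by (simp add: mult_left_mono add_right_mono)
    qed
    have "(\<lambda>k. c / real (N k)) \<longlonglongrightarrow> 0"
    proof (rule real_tendsto_sandwich[OF _ _ tendsto_const])
      show "\<forall>\<^sub>F k in sequentially. 0 \<le> c / real (N k)" by (simp add: c_def)
      show "\<forall>\<^sub>F k in sequentially. c / real (N k) \<le> c / real (Suc k)"
      proof (intro always_eventually allI divide_left_mono)
        show "real (Suc k) \<le> real (N k)" "0 \<le> c" "0 < real (N k) * real (Suc k)" for k
          using N[of k] by (auto simp: c_def)
      qed
      show "(\<lambda>k. c / real (Suc k)) \<longlonglongrightarrow> 0" using LIMSEQ_Suc[OF lim_const_over_n[of c]] by simp
    qed
    from tendsto_ennrealI[OF this] have "(\<lambda>k. 2 * ennreal (c / real (N k)) + 2 * (\<integral>\<^sup>+\<omega>. sq_dist Q T ?\<eta> ?\<zeta> \<omega> \<partial>P)) \<longlonglongrightarrow> 2 * ennreal 0 + 2 * (\<integral>\<^sup>+\<omega>. sq_dist Q T ?\<eta> ?\<zeta> \<omega> \<partial>P)"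
      by (intro tendsto_add ennreal_tendsto_cmult tendsto_const) auto
    then show "(\<lambda>k. 2 * ennreal (c / real (N k)) + 2 * (\<integral>\<^sup>+\<omega>. sq_dist Q T ?\<eta> ?\<zeta> \<omega> \<partial>P)) \<longlonglongrightarrow> 2 * (\<integral>\<^sup>+\<omega>. sq_dist Q T ?\<eta> ?\<zeta> \<omega> \<partial>P)"
      by simp
  qed
qed

end

section \<open>Tanaka's formula for smoothed absolute values\<close>

definition pos_pow2 :: "real \<Rightarrow> real" where "pos_pow2 x = (max 0 x)\<^sup>2 / 2"
definition pos_pow3 :: "real \<Rightarrow> real" where "pos_pow3 x = (max 0 x) ^ 3 / 6"

lemma has_derivative_max_power:
  "((\<lambda>x::real. (max 0 x) ^ Suc (Suc n)) has_real_derivative real (Suc (Suc n)) * (max 0 x) ^ Suc n) (at x)"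
proof -
  consider "x > 0" | "x < 0" | "x = 0" by linarith
  then show ?thesis
  proof cases
    case 1
    have "((\<lambda>x. x ^ Suc (Suc n)) has_real_derivative real (Suc (Suc n)) * x ^ Suc n) (at x)"
      using DERIV_pow[of "Suc (Suc n)" x UNIV] by simp
    then show ?thesis
      by (rule has_field_derivative_transform_within_open[of _ _ _ "{0<..}", THEN DERIV_cong]) (use 1 in auto)
  next
    case 2
    have "((\<lambda>x::real. 0) has_real_derivative 0) (at x)" by simp
    then show ?thesis
      by (rule has_field_derivative_transform_within_open[of _ _ _ "{..<0}", THEN DERIV_cong]) (use 2 in auto)
  next
    case 3
    have "(\<lambda>h::real. (max 0 h) ^ Suc n) \<midarrow>0\<rightarrow> (max 0 0) ^ Suc n"
      by (intro tendsto_intros)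
    moreover have "(max 0 (0 + h) ^ Suc (Suc n) - max 0 0 ^ Suc (Suc n)) / h = (max 0 h) ^ Suc n" if "h \<noteq> 0" for h :: real
      using that by (auto simp: max_def)
    ultimately have "(\<lambda>h::real. (max 0 (0 + h) ^ Suc (Suc n) - max 0 0 ^ Suc (Suc n)) / h) \<midarrow>0\<rightarrow> 0"
      by (subst LIM_equal[where g="\<lambda>h. (max 0 h) ^ Suc n"]) auto
    then show ?thesis using 3 by (simp add: DERIV_def)
  qed
qed

lemma pos_pow2_deriv: "(pos_pow2 has_real_derivative max 0 x) (at x)"
  using DERIV_cdivide[OF has_derivative_max_power[of 0 x], of 2]
  by (simp add: pos_pow2_def[abs_def] numeral_2_eq_2 power_Suc)

lemma pos_pow3_deriv: "(pos_pow3 has_real_derivative pos_pow2 x) (at x)"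
  using DERIV_cdivide[OF has_derivative_max_power[of 1 x], of 6]
  by (simp add: pos_pow2_def[abs_def] pos_pow3_def[abs_def] numeral_3_eq_3 numeral_2_eq_2 power_Suc)

text \<open>The derivative max 0 is Lipschitz with constant 1, which bounds the remainder of the
  first order expansion; the sign cases make this explicit.\<close>

lemma pos_pow2_approx: "\<bar>pos_pow2 w - pos_pow2 z - max 0 z * (w - z)\<bar> \<le> (w - z)\<^sup>2 / 2"
proof -
  consider "z \<ge> 0" "w \<ge> 0" | "z \<ge> 0" "w < 0" | "z < 0" "w \<ge> 0" | "z < 0" "w < 0" by linarith
  then show ?thesis
  proof cases
    case 1
    then have "pos_pow2 w - pos_pow2 z - max 0 z * (w - z) = (w - z)\<^sup>2 / 2"
      by (simp add: pos_pow2_def power2_eq_square field_simps)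
    then show ?thesis by (simp only:) simp
  next
    case 2
    have zw: "z * w \<le> 0" using 2 by (simp add: mult_nonneg_nonpos)
    have eq: "pos_pow2 w - pos_pow2 z - max 0 z * (w - z) = z\<^sup>2 / 2 - z * w"
      using 2 by (simp add: pos_pow2_def power2_eq_square algebra_simps)
    have "(w - z)\<^sup>2 / 2 = w\<^sup>2 / 2 + (z\<^sup>2 / 2 - z * w)" by (simp add: power2_eq_square field_simps)
    moreover have "0 \<le> w\<^sup>2 / 2" "0 \<le> z\<^sup>2 / 2" by simp_all
    ultimately show ?thesis unfolding eq using zw by linarith
  next
    case 3
    have zw: "z * w \<le> 0" using 3 by (simp add: mult_nonpos_nonneg)
    have eq: "pos_pow2 w - pos_pow2 z - max 0 z * (w - z) = w\<^sup>2 / 2"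
      using 3 by (simp add: pos_pow2_def)
    have "(w - z)\<^sup>2 / 2 = w\<^sup>2 / 2 + (z\<^sup>2 / 2 - z * w)" by (simp add: power2_eq_square field_simps)
    moreover have "0 \<le> w\<^sup>2 / 2" "0 \<le> z\<^sup>2 / 2" by simp_all
    ultimately show ?thesis unfolding eq using zw by linarith
  next
    case 4 then show ?thesis by (simp add: pos_pow2_def)
  qed
qed

text \<open>Equals \<bar>x - a\<bar> outside (a - \<epsilon>, a + \<epsilon>) and (x - a)^2 / (2
  \<epsilon>) + \<epsilon> / 2 inside. Writing it with positive parts yields its derivative without
  gluing.\<close>

definition smooth_abs :: "real \<Rightarrow> real \<Rightarrow> real \<Rightarrow> real" where
  "smooth_abs a \<epsilon> x = - (x - a) + (pos_pow2 (x - a + \<epsilon>) - pos_pow2 (x - a - \<epsilon>)) / \<epsilon>"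

text \<open>This is (x - a) / \<epsilon> cut off at -1 and 1.\<close>

definition smooth_sgn :: "real \<Rightarrow> real \<Rightarrow> real \<Rightarrow> real" where
  "smooth_sgn a \<epsilon> x = - 1 + (max 0 (x - a + \<epsilon>) - max 0 (x - a - \<epsilon>)) / \<epsilon>"

text \<open>Smoothing once more, at scale \<open>\<delta>\<close> and towards the inside of the interval
  \<open>{a - \<epsilon><..<a + \<epsilon>}\<close>, makes the second derivative Lipschitz and convergent everywhere to the
  normalized indicator of the open interval.\<close>

definition smoother_abs :: "real \<Rightarrow> real \<Rightarrow> real \<Rightarrow> real \<Rightarrow> real" where
  "smoother_abs a \<epsilon> \<delta> x = - (x - a) +
     (pos_pow3 (x - a + \<epsilon>) - pos_pow3 (x - a + \<epsilon> - \<delta>) - pos_pow3 (x - a - \<epsilon> + \<delta>) + pos_pow3 (x - a - \<epsilon>)) / (\<epsilon> * \<delta>)"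

definition smoother_sgn :: "real \<Rightarrow> real \<Rightarrow> real \<Rightarrow> real \<Rightarrow> real" where
  "smoother_sgn a \<epsilon> \<delta> x = - 1 +
     (pos_pow2 (x - a + \<epsilon>) - pos_pow2 (x - a + \<epsilon> - \<delta>) - pos_pow2 (x - a - \<epsilon> + \<delta>) + pos_pow2 (x - a - \<epsilon>)) / (\<epsilon> * \<delta>)"

text \<open>For \<delta> \<le> \<epsilon> a function with maximum 1 / \<epsilon> and linear ramps of
  width \<delta> inside the interval; it is 0 at and beyond the end points.\<close>

definition trapezoid :: "real \<Rightarrow> real \<Rightarrow> real \<Rightarrow> real \<Rightarrow> real" where
  "trapezoid a \<epsilon> \<delta> x =
     (max 0 (x - a + \<epsilon>) - max 0 (x - a + \<epsilon> - \<delta>) - max 0 (x - a - \<epsilon> + \<delta>) + max 0 (x - a - \<epsilon>)) / (\<epsilon> * \<delta>)"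

lemma smoother_abs_deriv: "0 < \<epsilon> \<Longrightarrow> 0 < \<delta> \<Longrightarrow> (smoother_abs a \<epsilon> \<delta> has_real_derivative smoother_sgn a \<epsilon> \<delta> x) (at x)"
  unfolding smoother_abs_def[abs_def] smoother_sgn_def
  by (auto intro!: derivative_eq_intros DERIV_chain2[OF pos_pow3_deriv])

lemma smoother_sgn_deriv: "0 < \<epsilon> \<Longrightarrow> 0 < \<delta> \<Longrightarrow> (smoother_sgn a \<epsilon> \<delta> has_real_derivative trapezoid a \<epsilon> \<delta> x) (at x)"
  unfolding smoother_sgn_def[abs_def] trapezoid_def
  by (auto intro!: derivative_eq_intros DERIV_chain2[OF pos_pow2_deriv])

text \<open>The four kinks are estimated separately. The constant may be crude and may blow up as
  \<delta> tends to 0, since it leaves no trace in the isometry bound.\<close>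

lemma trapezoid_Lipschitz:
  assumes "0 < \<epsilon>" "0 < \<delta>" shows "\<bar>trapezoid a \<epsilon> \<delta> x - trapezoid a \<epsilon> \<delta> y\<bar> \<le> 4 / (\<epsilon> * \<delta>) * \<bar>x - y\<bar>"
proof -
  have m: "\<bar>max 0 (x - a + \<epsilon>) - max 0 (y - a + \<epsilon>)\<bar> \<le> \<bar>x - y\<bar>"
      "\<bar>max 0 (x - a + \<epsilon> - \<delta>) - max 0 (y - a + \<epsilon> - \<delta>)\<bar> \<le> \<bar>x - y\<bar>"
      "\<bar>max 0 (x - a - \<epsilon> + \<delta>) - max 0 (y - a - \<epsilon> + \<delta>)\<bar> \<le> \<bar>x - y\<bar>"
      "\<bar>max 0 (x - a - \<epsilon>) - max 0 (y - a - \<epsilon>)\<bar> \<le> \<bar>x - y\<bar>" by auto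
  have "\<bar>trapezoid a \<epsilon> \<delta> x - trapezoid a \<epsilon> \<delta> y\<bar> = \<bar>(max 0 (x - a + \<epsilon>) - max 0 (y - a + \<epsilon>)) - (max 0 (x - a + \<epsilon> - \<delta>) - max 0 (y - a + \<epsilon> - \<delta>))
     - (max 0 (x - a - \<epsilon> + \<delta>) - max 0 (y - a - \<epsilon> + \<delta>)) + (max 0 (x - a - \<epsilon>) - max 0 (y - a - \<epsilon>))\<bar> / (\<epsilon> * \<delta>)"
    using assms unfolding trapezoid_def by (simp add: abs_mult algebra_simps flip: diff_divide_distrib)
  also have "\<dots> \<le> (4 * \<bar>x - y\<bar>) / (\<epsilon> * \<delta>)"
  proof (rule divide_right_mono)
    have "\<bar>p - q - r + s\<bar> \<le> 4 * d" if "\<bar>p\<bar> \<le> d" "\<bar>q\<bar> \<le> d" "\<bar>r\<bar> \<le> d" "\<bar>s\<bar> \<le> d" for p q r s d :: real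
      using that by linarith
    from this[OF m] show "\<bar>(max 0 (x - a + \<epsilon>) - max 0 (y - a + \<epsilon>)) - (max 0 (x - a + \<epsilon> - \<delta>) - max 0 (y - a + \<epsilon> - \<delta>))
     - (max 0 (x - a - \<epsilon> + \<delta>) - max 0 (y - a - \<epsilon> + \<delta>)) + (max 0 (x - a - \<epsilon>) - max 0 (y - a - \<epsilon>))\<bar> \<le> 4 * \<bar>x - y\<bar>" .
  qed (use assms in simp)
  finally show ?thesis by simp
qed

lemma trapezoid_bound:
  assumes "0 < \<epsilon>" "0 < \<delta>" shows "\<bar>trapezoid a \<epsilon> \<delta> x\<bar> \<le> 2 / \<epsilon>"
proof -
  have "\<bar>max 0 (x - a + \<epsilon>) - max 0 (x - a + \<epsilon> - \<delta>) - max 0 (x - a - \<epsilon> + \<delta>) + max 0 (x - a - \<epsilon>)\<bar> \<le> 2 * \<delta>"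
    using assms by (auto simp: max_def)
  then have "\<bar>max 0 (x - a + \<epsilon>) - max 0 (x - a + \<epsilon> - \<delta>) - max 0 (x - a - \<epsilon> + \<delta>) + max 0 (x - a - \<epsilon>)\<bar> / (\<epsilon> * \<delta>) \<le> 2 * \<delta> / (\<epsilon> * \<delta>)"
    by (rule divide_right_mono) (use assms in simp)
  then have "\<bar>trapezoid a \<epsilon> \<delta> x\<bar> \<le> 2 * \<delta> / (\<epsilon> * \<delta>)"
    using assms unfolding trapezoid_def by (simp add: abs_mult)
  then show ?thesis using assms by simp
qed

lemma measurable_trapezoid [measurable]: "trapezoid a \<epsilon> \<delta> \<in> borel_measurable borel"
  unfolding trapezoid_def[abs_def] by measurable

lemma measurable_smooth_sgn [measurable]: "smooth_sgn a \<epsilon> \<in> borel_measurable borel"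
  unfolding smooth_sgn_def[abs_def] by measurable

text \<open>Near either end point a difference of \<open>pos_pow2\<close> with step \<delta>
  replaces \<delta> times its derivative, with error at most \<delta>^2 / 2; two such errors divided
  by \<epsilon> \<delta> give \<delta> / \<epsilon>.\<close>

lemma smoother_sgn_close:
  assumes "0 < \<epsilon>" "0 < \<delta>" shows "\<bar>smoother_sgn a \<epsilon> \<delta> x - smooth_sgn a \<epsilon> x\<bar> \<le> \<delta> / \<epsilon>"
proof -
  let ?z = "x - a + \<epsilon>" and ?w = "x - a - \<epsilon>"
  have 1: "\<bar>pos_pow2 (?z - \<delta>) - pos_pow2 ?z + max 0 ?z * \<delta>\<bar> \<le> \<delta>\<^sup>2 / 2"
    using pos_pow2_approx[of "?z - \<delta>" ?z] by simp
  have 2: "\<bar>pos_pow2 (?w + \<delta>) - pos_pow2 ?w - max 0 ?w * \<delta>\<bar> \<le> \<delta>\<^sup>2 / 2"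
    using pos_pow2_approx[of "?w + \<delta>" ?w] by simp
  have "smoother_sgn a \<epsilon> \<delta> x - smooth_sgn a \<epsilon> x
     = (- (pos_pow2 (?z - \<delta>) - pos_pow2 ?z + max 0 ?z * \<delta>) - (pos_pow2 (?w + \<delta>) - pos_pow2 ?w - max 0 ?w * \<delta>)) / (\<epsilon> * \<delta>)"
    using assms unfolding smoother_sgn_def smooth_sgn_def by (simp add: field_simps)
  then have "\<bar>smoother_sgn a \<epsilon> \<delta> x - smooth_sgn a \<epsilon> x\<bar>
     = \<bar>- (pos_pow2 (?z - \<delta>) - pos_pow2 ?z + max 0 ?z * \<delta>) - (pos_pow2 (?w + \<delta>) - pos_pow2 ?w - max 0 ?w * \<delta>)\<bar> / (\<epsilon> * \<delta>)"
    using assms by (simp only: abs_divide) simp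
  also have "\<dots> \<le> \<delta>\<^sup>2 / (\<epsilon> * \<delta>)"
  proof (rule divide_right_mono)
    show "\<bar>- (pos_pow2 (?z - \<delta>) - pos_pow2 ?z + max 0 ?z * \<delta>) - (pos_pow2 (?w + \<delta>) - pos_pow2 ?w - max 0 ?w * \<delta>)\<bar> \<le> \<delta>\<^sup>2"
      using 1 2 by linarith
  qed (use assms in simp)
  also have "\<dots> = \<delta> / \<epsilon>" using assms by (simp add: power2_eq_square)
  finally show ?thesis .
qed

lemma smooth_sgn_bound: "0 < \<epsilon> \<Longrightarrow> \<bar>smooth_sgn a \<epsilon> x\<bar> \<le> 1"
  by (auto simp: smooth_sgn_def max_def field_simps)

lemma smooth_sgn_Lipschitz:
  assumes "0 < \<epsilon>" shows "\<bar>smooth_sgn a \<epsilon> x - smooth_sgn a \<epsilon> y\<bar> \<le> 1 / \<epsilon> * \<bar>x - y\<bar>"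
proof -
  have "smooth_sgn a \<epsilon> x - smooth_sgn a \<epsilon> y = ((max 0 (x - a + \<epsilon>) - max 0 (x - a - \<epsilon>)) - (max 0 (y - a + \<epsilon>) - max 0 (y - a - \<epsilon>))) / \<epsilon>"
    by (simp add: smooth_sgn_def diff_divide_distrib)
  moreover have "\<bar>(max 0 (x - a + \<epsilon>) - max 0 (x - a - \<epsilon>)) - (max 0 (y - a + \<epsilon>) - max 0 (y - a - \<epsilon>))\<bar> \<le> \<bar>x - y\<bar>"
    using assms by (auto simp: max_def)
  ultimately show ?thesis using assms by (simp add: abs_divide divide_right_mono)
qed

lemma smooth_abs_eq: "0 < \<epsilon> \<Longrightarrow> \<bar>smooth_abs a \<epsilon> x - \<bar>x - a\<bar>\<bar> \<le> \<epsilon> / 2"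
proof -
  assume \<epsilon>: "0 < \<epsilon>"
  define y where "y = x - a"
  consider "y \<ge> \<epsilon>" | "y \<le> - \<epsilon>" | "0 \<le> y" "y < \<epsilon>" | "y < 0" "- \<epsilon> < y" by linarith
  then have "\<bar>smooth_abs a \<epsilon> x - \<bar>y\<bar>\<bar> \<le> \<epsilon> / 2"
  proof cases
    case 1
    then have "smooth_abs a \<epsilon> x = y" using \<epsilon> unfolding smooth_abs_def y_def[symmetric] pos_pow2_def
      by (simp add: field_simps power2_eq_square)
    then show ?thesis using 1 \<epsilon> by simp
  next
    case 2
    then have "smooth_abs a \<epsilon> x = - y" using \<epsilon> unfolding smooth_abs_def y_def[symmetric] pos_pow2_def
      by (simp add: max_def)
    then show ?thesis using 2 \<epsilon> by simp
  next
    case 3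
    then have eq: "smooth_abs a \<epsilon> x - \<bar>y\<bar> = (\<epsilon> - y)\<^sup>2 / (2 * \<epsilon>)" using \<epsilon> unfolding smooth_abs_def y_def[symmetric] pos_pow2_def
      by (simp add: max_def field_simps power2_eq_square)
    have "(\<epsilon> - y)\<^sup>2 \<le> \<epsilon>\<^sup>2" using 3 by (intro power_mono) auto
    then have "(\<epsilon> - y)\<^sup>2 / (2 * \<epsilon>) \<le> \<epsilon>\<^sup>2 / (2 * \<epsilon>)" using \<epsilon> by (intro divide_right_mono) auto
    also have "\<dots> = \<epsilon> / 2" by (simp add: power2_eq_square)
    finally show ?thesis unfolding eq using \<epsilon> by simp
  next
    case 4
    then have eq: "smooth_abs a \<epsilon> x - \<bar>y\<bar> = (\<epsilon> + y)\<^sup>2 / (2 * \<epsilon>)" using \<epsilon> unfolding smooth_abs_def y_def[symmetric] pos_pow2_def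
      by (simp add: max_def field_simps power2_eq_square)
    have "(\<epsilon> + y)\<^sup>2 \<le> \<epsilon>\<^sup>2" using 4 by (intro power_mono) auto
    then have "(\<epsilon> + y)\<^sup>2 / (2 * \<epsilon>) \<le> \<epsilon>\<^sup>2 / (2 * \<epsilon>)" using \<epsilon> by (intro divide_right_mono) auto
    also have "\<dots> = \<epsilon> / 2" by (simp add: power2_eq_square)
    finally show ?thesis unfolding eq using \<epsilon> by simp
  qed
  then show ?thesis by (simp add: y_def)
qed

text \<open>At x = a both functions vanish by the convention sgn 0 = 0, and they agree outside the
  open interval; inside, the sloping line stays within 1 of the sign.\<close>

lemma smooth_sgn_sgn:
  assumes "0 < \<epsilon>" shows "\<bar>smooth_sgn a \<epsilon> x - sgn (x - a)\<bar> \<le> indicator {a - \<epsilon><..<a + \<epsilon>} x"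
  using assms by (auto simp: smooth_sgn_def max_def sgn_if indicator_def field_simps)

text \<open>The bracket consists of two difference quotients of \<open>pos_pow3\<close>, with steps
  -\<delta> at the left and \<delta> at the right end point, and these converge to its derivative
  \<open>pos_pow2\<close>.\<close>

lemma smoother_abs_tendsto:
  assumes \<epsilon>: "0 < \<epsilon>"
  shows "(\<lambda>m. smoother_abs a \<epsilon> (1 / real (Suc m)) x) \<longlonglongrightarrow> smooth_abs a \<epsilon> x"
proof -
  have \<delta>: "(\<lambda>m. 1 / real (Suc m)) \<longlonglongrightarrow> 0" using LIMSEQ_Suc[OF lim_1_over_n] by simp
  have q: "(\<lambda>m. (pos_pow3 (z + e * (1 / real (Suc m))) - pos_pow3 z) / (e * (1 / real (Suc m)))) \<longlonglongrightarrow> pos_pow2 z" if "e \<noteq> 0" for z e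
  proof -
    have "(\<lambda>m. e * (1 / real (Suc m))) \<longlonglongrightarrow> e * 0" by (intro tendsto_mult tendsto_const \<delta>)
    then have "filterlim (\<lambda>m. e * (1 / real (Suc m))) (at 0) sequentially"
      unfolding filterlim_at using that by auto
    from filterlim_compose[OF pos_pow3_deriv[unfolded DERIV_def] this] show ?thesis .
  qed
  have "smoother_abs a \<epsilon> (1 / real (Suc m)) x = - (x - a) +
      ((pos_pow3 (x - a + \<epsilon> + (- 1) * (1 / real (Suc m))) - pos_pow3 (x - a + \<epsilon>)) / ((- 1) * (1 / real (Suc m)))
      - (pos_pow3 (x - a - \<epsilon> + 1 * (1 / real (Suc m))) - pos_pow3 (x - a - \<epsilon>)) / (1 * (1 / real (Suc m)))) / \<epsilon>" for m
    using \<epsilon> unfolding smoother_abs_def by (simp add: field_simps)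
  moreover have "(\<lambda>m. - (x - a) +
      ((pos_pow3 (x - a + \<epsilon> + (- 1) * (1 / real (Suc m))) - pos_pow3 (x - a + \<epsilon>)) / ((- 1) * (1 / real (Suc m)))
      - (pos_pow3 (x - a - \<epsilon> + 1 * (1 / real (Suc m))) - pos_pow3 (x - a - \<epsilon>)) / (1 * (1 / real (Suc m)))) / \<epsilon>)
      \<longlonglongrightarrow> - (x - a) + (pos_pow2 (x - a + \<epsilon>) - pos_pow2 (x - a - \<epsilon>)) / \<epsilon>"
    using \<epsilon> by (intro tendsto_add tendsto_const tendsto_divide tendsto_diff q) auto
  ultimately show ?thesis by (simp add: smooth_abs_def)
qed

lemma trapezoid_tendsto:
  assumes \<epsilon>: "0 < \<epsilon>"
  shows "(\<lambda>m. trapezoid a \<epsilon> (1 / real (Suc m)) x) \<longlonglongrightarrow> 1 / \<epsilon> * indicator {a - \<epsilon><..<a + \<epsilon>} x"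
proof (rule tendsto_eventually)
  define y where "y = x - a"
  have \<delta>: "(\<lambda>m. 1 / real (Suc m)) \<longlonglongrightarrow> 0" using LIMSEQ_Suc[OF lim_1_over_n] by simp
  have ev: "\<forall>\<^sub>F m in sequentially. 1 / real (Suc m) < z" if "0 < z" for z
    using order_tendstoD(2)[OF \<delta> that] .
  \<comment> \<open>\<open>z\<close> is the size of \<delta> below which the trapezoid has its limit
    value at \<open>x\<close>: inside the interval the distance to the nearer end point, outside 2
    \<epsilon>, which keeps the kinks in order.\<close>
  define z where "z = (if \<bar>y\<bar> < \<epsilon> then min (\<epsilon> - y) (\<epsilon> + y) else 2 * \<epsilon>)"
  have "0 < z" using \<epsilon> by (auto simp: z_def)
  from ev[OF this] show "\<forall>\<^sub>F m in sequentially. trapezoid a \<epsilon> (1 / real (Suc m)) x = 1 / \<epsilon> * indicator {a - \<epsilon><..<a + \<epsilon>} x"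
  proof eventually_elim
    case (elim m)
    define d where "d = 1 / real (Suc m)"
    have d: "0 < d" "d < z" using elim by (auto simp: d_def)
    consider "\<bar>y\<bar> < \<epsilon>" | "y \<ge> \<epsilon>" | "y \<le> - \<epsilon>" by linarith
    then have "trapezoid a \<epsilon> d x = 1 / \<epsilon> * indicator {a - \<epsilon><..<a + \<epsilon>} x"
    proof cases
      case 1
      then have "d < \<epsilon> - y" "d < \<epsilon> + y" using d by (auto simp: z_def)
      moreover have "x \<in> {a - \<epsilon><..<a + \<epsilon>}" using 1 by (auto simp: y_def)
      ultimately show ?thesis using d \<epsilon> 1 by (simp add: trapezoid_def flip: y_def)
    next
      case 2
      moreover have "x \<notin> {a - \<epsilon><..<a + \<epsilon>}" using 2 by (auto simp: y_def)
      moreover have "d < 2 * \<epsilon>" using d 2 \<epsilon> by (simp add: z_def)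
      ultimately show ?thesis using d \<epsilon> by (auto simp: trapezoid_def max_def simp flip: y_def)
    next
      case 3
      moreover have "x \<notin> {a - \<epsilon><..<a + \<epsilon>}" using 3 by (auto simp: y_def)
      moreover have "d < 2 * \<epsilon>" using d 3 \<epsilon> by (simp add: z_def)
      ultimately show ?thesis using d \<epsilon> by (auto simp: trapezoid_def max_def simp flip: y_def)
    qed
    then show ?case by (simp add: d_def)
  qed
qed

section \<open>Occupation times, the martingale part and the local time\<close>

definition occupation :: "(real \<Rightarrow> cpath \<Rightarrow> real) \<Rightarrow> real \<Rightarrow> real \<Rightarrow> real \<Rightarrow> cpath \<Rightarrow> real" where
  "occupation Q a t \<epsilon> \<omega> = (LINT s:{0..t}|dQ Q \<omega>. indicator {a - \<epsilon><..<a + \<epsilon>} (B s \<omega>))"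

definition approx_local_time :: "(real \<Rightarrow> cpath \<Rightarrow> real) \<Rightarrow> real \<Rightarrow> real \<Rightarrow> real \<Rightarrow> cpath \<Rightarrow> real" where
  "approx_local_time Q a t \<epsilon> \<omega> = 1 / (2 * \<epsilon>) * occupation Q a t \<epsilon> \<omega>"

text \<open>Defined as what Ito's formula for \<open>smooth_abs\<close> leaves, hence a stand-in for
  the stochastic integral of \<open>smooth_sgn\<close>: half of the second derivative, 1 / (2
  \<epsilon>) on the open interval, integrates to \<open>approx_local_time\<close>.\<close>

definition smooth_mart :: "(real \<Rightarrow> cpath \<Rightarrow> real) \<Rightarrow> real \<Rightarrow> real \<Rightarrow> real \<Rightarrow> cpath \<Rightarrow> real" where
  "smooth_mart Q a t \<epsilon> \<omega> = smooth_abs a \<epsilon> (B t \<omega>) - smooth_abs a \<epsilon> 0 - approx_local_time Q a t \<epsilon> \<omega>"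

text \<open>The limit superior along a fixed sequence inherits monotonicity in \<open>t\<close> from the
  occupation times, for all \<open>t\<close> simultaneously.\<close>

definition local_time :: "(real \<Rightarrow> cpath \<Rightarrow> real) \<Rightarrow> real \<Rightarrow> real \<Rightarrow> cpath \<Rightarrow> real" where
  "local_time Q a t \<omega> = real_of_ereal (limsup (\<lambda>k. ereal (approx_local_time Q a t ((1 / 16) ^ k) \<omega>)))"

lemma ennreal_numeral_mult: "numeral w * ennreal x = ennreal (numeral w * x)"
  using ennreal_mult'[of "numeral w" x] by simp

lemma smooth_abs_Lipschitz:
  assumes "0 < \<epsilon>" shows "\<bar>smooth_abs a \<epsilon> x - smooth_abs a \<epsilon> y\<bar> \<le> \<bar>x - y\<bar>"
proof -
  have "(smooth_abs a \<epsilon> has_real_derivative smooth_sgn a \<epsilon> x) (at x)" for x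
    unfolding smooth_abs_def[abs_def] smooth_sgn_def
    using assms by (auto intro!: derivative_eq_intros DERIV_chain2[OF pos_pow2_deriv])
  then show ?thesis
    using field_differentiable_bound[of UNIV "smooth_abs a \<epsilon>" "smooth_sgn a \<epsilon>" 1 x y] smooth_sgn_bound[OF assms]
    by (auto simp: has_field_derivative_at_within)
qed

lemma measurable_smooth_abs [measurable]: "smooth_abs a \<epsilon> \<in> borel_measurable borel"
  unfolding smooth_abs_def[abs_def] pos_pow2_def by measurable

context increasing_process
begin

lemma occupation_nn:
  assumes "0 \<le> t"
  shows "(\<integral>\<^sup>+s\<in>{0..t}. indicator {a - \<epsilon><..<a + \<epsilon>} (B s \<omega>) \<partial>dQ Q \<omega>) = ennreal (occupation Q a t \<epsilon> \<omega>)"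
    and "0 \<le> occupation Q a t \<epsilon> \<omega>"
proof -
  have "integrable (dQ Q \<omega>) (\<lambda>s. indicator {0..t} s * indicator {a - \<epsilon><..<a + \<epsilon>} (B s \<omega>) :: real)"
    by (rule integrable_dQ[of _ 1]) (use assms in auto)
  then have "(\<integral>\<^sup>+s. ennreal (indicator {0..t} s * indicator {a - \<epsilon><..<a + \<epsilon>} (B s \<omega>)) \<partial>dQ Q \<omega>) = ennreal (occupation Q a t \<epsilon> \<omega>)"
    unfolding occupation_def set_lebesgue_integral_def
    by (subst nn_integral_eq_integral) auto
  moreover have "ennreal (indicator {0..t} s * indicator {a - \<epsilon><..<a + \<epsilon>} (B s \<omega>)) = indicator {a - \<epsilon><..<a + \<epsilon>} (B s \<omega>) * indicator {0..t} s" for s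
    by (auto simp: indicator_def)
  ultimately show "(\<integral>\<^sup>+s\<in>{0..t}. indicator {a - \<epsilon><..<a + \<epsilon>} (B s \<omega>) \<partial>dQ Q \<omega>) = ennreal (occupation Q a t \<epsilon> \<omega>)"
    by simp
  show "0 \<le> occupation Q a t \<epsilon> \<omega>"
    unfolding occupation_def set_lebesgue_integral_def by (rule Bochner_Integration.integral_nonneg) auto
qed

lemma occupation_mono:
  assumes "0 \<le> s" "s \<le> t" shows "occupation Q a s \<epsilon> \<omega> \<le> occupation Q a t \<epsilon> \<omega>"
proof -
  have "ennreal (occupation Q a s \<epsilon> \<omega>) \<le> ennreal (occupation Q a t \<epsilon> \<omega>)"
    using assms unfolding occupation_nn(1)[of s, OF assms(1), symmetric] occupation_nn(1)[of t, OF order_trans[OF assms], symmetric]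
    by (intro nn_integral_mono mult_left_mono) (auto simp: indicator_def)
  then show ?thesis using assms occupation_nn(2)[of t] by (simp add: ennreal_le_iff)
qed

lemma measurable_occupation:
  assumes "0 \<le> t" shows "occupation Q a t \<epsilon> \<in> borel_measurable borel"
proof -
  have "(\<lambda>(\<omega>, s). indicator {a - \<epsilon><..<a + \<epsilon>} (B s \<omega>) :: ennreal) \<in> borel_measurable (borel \<Otimes>\<^sub>M borel)"
    unfolding split_beta by (intro measurable_compose[OF measurable_B_pair']) auto
  from measurable_nn_integral_dQ[OF this assms] have "(\<lambda>\<omega>. ennreal (occupation Q a t \<epsilon> \<omega>)) \<in> borel_measurable borel"
    unfolding occupation_nn(1)[OF assms] .
  then have "(\<lambda>\<omega>. enn2real (ennreal (occupation Q a t \<epsilon> \<omega>))) \<in> borel_measurable borel" by measurable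
  then show ?thesis using occupation_nn(2)[OF assms] by simp
qed

lemma measurable_smooth_mart: "0 \<le> t \<Longrightarrow> smooth_mart Q a t \<epsilon> \<in> borel_measurable borel"
  using measurable_occupation[of t a \<epsilon>] unfolding smooth_mart_def[abs_def] approx_local_time_def by measurable

lemma sq_dist_smooth_sgn_le:
  assumes "0 < \<epsilon>" "0 \<le> t"
  shows "sq_dist Q t (\<lambda>s \<omega>. smooth_sgn a \<epsilon> (B s \<omega>)) (\<lambda>s \<omega>. sgn (B s \<omega> - a)) \<omega> \<le> ennreal (occupation Q a t \<epsilon> \<omega>)"
  unfolding occupation_nn(1)[OF assms(2), symmetric] sq_dist_def
proof (intro nn_integral_mono mult_right_mono)
  fix s
  have "(smooth_sgn a \<epsilon> (B s \<omega>) - sgn (B s \<omega> - a))\<^sup>2 \<le> (indicator {a - \<epsilon><..<a + \<epsilon>} (B s \<omega>))\<^sup>2"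
    using order_trans[OF smooth_sgn_sgn[OF assms(1), of a "B s \<omega>"] abs_ge_self] by (simp only: abs_le_square_iff)
  also have "\<dots> = indicator {a - \<epsilon><..<a + \<epsilon>} (B s \<omega>)" by (simp add: indicator_def)
  finally have "ennreal ((smooth_sgn a \<epsilon> (B s \<omega>) - sgn (B s \<omega> - a))\<^sup>2) \<le> ennreal (indicator {a - \<epsilon><..<a + \<epsilon>} (B s \<omega>))"
    by (rule ennreal_leI)
  then show "ennreal ((smooth_sgn a \<epsilon> (B s \<omega>) - sgn (B s \<omega> - a))\<^sup>2) \<le> indicator {a - \<epsilon><..<a + \<epsilon>} (B s \<omega>)"
    by (simp only: ennreal_indicator)
qed simp

end

text \<open>Partitions are strictly increasing, so [0, 0] has only the partition without cells; the
  number of cells therefore depends on \<open>T\<close>.\<close>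

lemma simple_data_zero: "0 \<le> T \<Longrightarrow> simple_data T (if T = 0 then 0 else 1) (\<lambda>j. T * real j) (\<lambda>_ _. 0)"
  by (auto simp: simple_data_def partition_of_def intro!: L_bI[of _ _ 0] adapted_const)

lemma simple_data_0: "simple_data 0 n \<tau> \<xi> \<Longrightarrow> n = 0"
  using partition_of_mono[of 0 n \<tau> 1 n] unfolding simple_data_def partition_of_def
  by (metis One_nat_def Suc_leI gr0I order.refl not_less)

context quadratic_variation_law
begin

lemma jointly_measurable_sgn: "jointly_measurable (\<lambda>s \<omega>. sgn (B s \<omega> - a))"
  by (rule jointly_measurable_B[of "\<lambda>x. sgn (x - a)"]) measurable

text \<open>The isometry for the smoother functions, as \<delta> tends to 0: their martingale parts
  converge on every path and their derivatives converge uniformly at the rate \<delta> / \<epsilon>.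
  Two triangle inequalities for squares, one in the isometry and one here, make the factor
  4.\<close>

lemma tanaka_isometry_pos:
  assumes \<epsilon>: "0 < \<epsilon>" and T: "0 < T" and S: "simple_data T n \<tau> \<xi>"
  shows "(\<integral>\<^sup>+\<omega>. ennreal ((smooth_mart Q a T \<epsilon> \<omega> - simple_integral n \<tau> \<xi> \<omega>)\<^sup>2) \<partial>P)
     \<le> 4 * (\<integral>\<^sup>+\<omega>. sq_dist Q T (\<lambda>s \<omega>. smooth_sgn a \<epsilon> (B s \<omega>)) (simple_process n \<tau> \<xi>) \<omega> \<partial>P)"
proof -
  define \<delta> where "\<delta> m = 1 / real (Suc m)" for m
  have \<delta>0: "0 < \<delta> m" for m by (simp add: \<delta>_def)
  have \<delta>1: "\<delta> \<longlonglongrightarrow> 0" using LIMSEQ_Suc[OF lim_1_over_n] by (simp add: \<delta>_def[abs_def])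
  have T0: "0 \<le> T" using T by simp
  let ?M = "\<lambda>m \<omega>. smoother_abs a \<epsilon> (\<delta> m) (B T \<omega>) - smoother_abs a \<epsilon> (\<delta> m) 0 - 1 / 2 * (LINT s:{0..T}|dQ Q \<omega>. trapezoid a \<epsilon> (\<delta> m) (B s \<omega>))"
  let ?J = "simple_integral n \<tau> \<xi>" and ?\<zeta> = "simple_process n \<tau> \<xi>"
  let ?\<eta> = "\<lambda>s \<omega>. smooth_sgn a \<epsilon> (B s \<omega>)"
  let ?D = "\<integral>\<^sup>+\<omega>. sq_dist Q T ?\<eta> ?\<zeta> \<omega> \<partial>P"
  have sm [measurable]: "smoother_sgn a \<epsilon> d \<in> borel_measurable borel" for d
    unfolding smoother_sgn_def[abs_def] pos_pow2_def by measurable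
  have sb: "\<bar>smoother_sgn a \<epsilon> (\<delta> m) x\<bar> \<le> 1 + \<delta> m / \<epsilon>" for m x
    using smoother_sgn_close[OF \<epsilon> \<delta>0, of a m x] smooth_sgn_bound[OF \<epsilon>, of a x] by linarith
  \<comment> \<open>Convergence at every point, including a - \<epsilon> and a + \<epsilon>, matters
    here: \<open>dQ\<close> could a priori charge the times that the path spends at these
    levels.\<close>
  have int_lim: "(\<lambda>m. LINT s:{0..T}|dQ Q \<omega>. trapezoid a \<epsilon> (\<delta> m) (B s \<omega>)) \<longlonglongrightarrow> 1 / \<epsilon> * occupation Q a T \<epsilon> \<omega>" for \<omega>
  proof -
    have "(\<lambda>m. \<integral>s. indicator {0..T} s * trapezoid a \<epsilon> (\<delta> m) (B s \<omega>) \<partial>dQ Q \<omega>) \<longlonglongrightarrow> (\<integral>s. indicator {0..T} s * (1 / \<epsilon> * indicator {a - \<epsilon><..<a + \<epsilon>} (B s \<omega>)) \<partial>dQ Q \<omega>)"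
    proof (rule integral_dominated_convergence[where w="\<lambda>s. indicator {0..T} s * (2 / \<epsilon>)"])
      show "integrable (dQ Q \<omega>) (\<lambda>s. indicator {0..T} s * (2 / \<epsilon>))"
        by (rule integrable_dQ[of _ "2 / \<epsilon>"]) (use T \<epsilon> in auto)
      show "AE s in dQ Q \<omega>. (\<lambda>m. indicator {0..T} s * trapezoid a \<epsilon> (\<delta> m) (B s \<omega>)) \<longlonglongrightarrow> indicator {0..T} s * (1 / \<epsilon> * indicator {a - \<epsilon><..<a + \<epsilon>} (B s \<omega>))"
        unfolding \<delta>_def by (intro AE_I2 tendsto_mult tendsto_const trapezoid_tendsto \<epsilon>)
      show "AE s in dQ Q \<omega>. norm (indicator {0..T} s * trapezoid a \<epsilon> (\<delta> m) (B s \<omega>)) \<le> indicator {0..T} s * (2 / \<epsilon>)" for m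
        unfolding real_norm_def abs_mult abs_indicator
        by (intro AE_I2 mult_left_mono trapezoid_bound \<epsilon> \<delta>0) simp
    qed simp_all
    moreover have "(\<integral>s. indicator {0..T} s * (1 / \<epsilon> * indicator {a - \<epsilon><..<a + \<epsilon>} (B s \<omega>)) \<partial>dQ Q \<omega>) = 1 / \<epsilon> * occupation Q a T \<epsilon> \<omega>"
      unfolding occupation_def set_lebesgue_integral_def
      by (subst integral_mult_right_zero[symmetric]) (simp add: mult_ac)
    ultimately show ?thesis by (simp only: set_lebesgue_integral_def real_scaleR_def)
  qed
  have M_lim: "(\<lambda>m. ?M m \<omega>) \<longlonglongrightarrow> smooth_mart Q a T \<epsilon> \<omega>" for \<omega>
  proof -
    have "(\<lambda>m. ?M m \<omega>) \<longlonglongrightarrow> smooth_abs a \<epsilon> (B T \<omega>) - smooth_abs a \<epsilon> 0 - 1 / 2 * (1 / \<epsilon> * occupation Q a T \<epsilon> \<omega>)"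
      using smoother_abs_tendsto[OF \<epsilon>, of a] unfolding \<delta>_def[symmetric]
      by (intro tendsto_diff tendsto_mult tendsto_const int_lim)
    then show ?thesis by (simp add: smooth_mart_def approx_local_time_def)
  qed
  \<comment> \<open>Path integrals of signed functions are measurable as differences of the
    integrals of their positive and negative parts.\<close>
  have M_meas: "?M m \<in> borel_measurable borel" for m
  proof -
    have "(\<lambda>\<omega>. LINT s:{0..T}|dQ Q \<omega>. trapezoid a \<epsilon> (\<delta> m) (B s \<omega>)) \<in> borel_measurable borel"
    proof -
      have I: "integrable (dQ Q \<omega>) (\<lambda>s. indicator {0..T} s * trapezoid a \<epsilon> (\<delta> m) (B s \<omega>))" for \<omega>
        by (rule integrable_dQ[OF _ trapezoid_bound[OF \<epsilon> \<delta>0] T0]) simp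
      have N: "(\<lambda>\<omega>. \<integral>\<^sup>+s\<in>{0..T}. ennreal (e * trapezoid a \<epsilon> (\<delta> m) (B s \<omega>)) \<partial>dQ Q \<omega>) \<in> borel_measurable borel" for e
        by (rule measurable_nn_integral_dQ[OF _ T0], unfold split_beta, rule measurable_compose[OF measurable_B_pair']) auto
      have E: "ennreal (e * (indicator {0..T} s * y)) = ennreal (e * y) * indicator {0..T} s" for e s y :: real
        by (simp add: indicator_def)
      have "(LINT s:{0..T}|dQ Q \<omega>. trapezoid a \<epsilon> (\<delta> m) (B s \<omega>)) =
          enn2real (\<integral>\<^sup>+s\<in>{0..T}. ennreal (1 * trapezoid a \<epsilon> (\<delta> m) (B s \<omega>)) \<partial>dQ Q \<omega>)
          - enn2real (\<integral>\<^sup>+s\<in>{0..T}. ennreal (- 1 * trapezoid a \<epsilon> (\<delta> m) (B s \<omega>)) \<partial>dQ Q \<omega>)" for \<omega>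
        using real_lebesgue_integral_def[OF I[of \<omega>]] unfolding set_lebesgue_integral_def E[symmetric] by simp
      then show ?thesis using N[of 1] N[of "- 1"] by simp
    qed
    moreover have "smoother_abs a \<epsilon> (\<delta> m) \<in> borel_measurable borel"
      unfolding smoother_abs_def[abs_def] pos_pow3_def by measurable
    ultimately show ?thesis by measurable
  qed
  note [measurable] = M_meas measurable_simple_integral[OF S]
  note jm = jointly_measurable_B[OF sm] jointly_measurable_B[OF measurable_smooth_sgn] jointly_measurable_simple[OF S]
  show ?thesis
  proof (rule nn_integral_le_LIMSEQ)
    show "(\<lambda>\<omega>. ennreal ((?M m \<omega> - ?J \<omega>)\<^sup>2)) \<in> borel_measurable P" for m unfolding measurable_P by measurable
    show "AE \<omega> in P. (\<lambda>m. ennreal ((?M m \<omega> - ?J \<omega>)\<^sup>2)) \<longlonglongrightarrow> ennreal ((smooth_mart Q a T \<epsilon> \<omega> - ?J \<omega>)\<^sup>2)"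
      by (intro AE_I2 tendsto_ennrealI tendsto_power tendsto_diff tendsto_const M_lim)
    show "(\<integral>\<^sup>+\<omega>. ennreal ((?M m \<omega> - ?J \<omega>)\<^sup>2) \<partial>P) \<le> 4 * ennreal ((\<delta> m / \<epsilon>)\<^sup>2 * (V * T)) + 4 * ?D" for m
    proof -
      have "(\<integral>\<^sup>+\<omega>. ennreal ((?M m \<omega> - ?J \<omega>)\<^sup>2) \<partial>P) \<le> 2 * (\<integral>\<^sup>+\<omega>. sq_dist Q T (\<lambda>s \<omega>. smoother_sgn a \<epsilon> (\<delta> m) (B s \<omega>)) ?\<zeta> \<omega> \<partial>P)"
        using \<epsilon> \<delta>0[of m]
        by (intro Ito_isometry[OF smoother_abs_deriv[OF \<epsilon> \<delta>0] smoother_sgn_deriv[OF \<epsilon> \<delta>0] T _ trapezoid_Lipschitz[OF \<epsilon> \<delta>0] trapezoid_bound[OF \<epsilon> \<delta>0] measurable_trapezoid sb S]) auto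
      also have "\<dots> \<le> 2 * (2 * ennreal ((\<delta> m / \<epsilon>)\<^sup>2 * (V * T)) + 2 * ?D)"
      proof (rule mult_left_mono)
        have "(\<integral>\<^sup>+\<omega>. sq_dist Q T (\<lambda>s \<omega>. smoother_sgn a \<epsilon> (\<delta> m) (B s \<omega>)) ?\<zeta> \<omega> \<partial>P)
          \<le> 2 * (\<integral>\<^sup>+\<omega>. sq_dist Q T (\<lambda>s \<omega>. smoother_sgn a \<epsilon> (\<delta> m) (B s \<omega>)) ?\<eta> \<omega> \<partial>P) + 2 * ?D"
          by (rule nn_sq_dist_triangle) (use jm T in auto)
        also have "\<dots> \<le> 2 * ennreal ((\<delta> m / \<epsilon>)\<^sup>2 * (V * T)) + 2 * ?D"
          by (intro add_right_mono mult_left_mono nn_sq_dist_le_const smoother_sgn_close \<epsilon> \<delta>0 T0) simp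
        finally show "(\<integral>\<^sup>+\<omega>. sq_dist Q T (\<lambda>s \<omega>. smoother_sgn a \<epsilon> (\<delta> m) (B s \<omega>)) ?\<zeta> \<omega> \<partial>P) \<le> 2 * ennreal ((\<delta> m / \<epsilon>)\<^sup>2 * (V * T)) + 2 * ?D" .
      qed simp
      also have "\<dots> = 4 * ennreal ((\<delta> m / \<epsilon>)\<^sup>2 * (V * T)) + 4 * ?D"
        by (simp add: distrib_left flip: mult.assoc)
      finally show ?thesis .
    qed
    have "(\<lambda>m. (\<delta> m / \<epsilon>)\<^sup>2 * (V * T)) \<longlonglongrightarrow> (0 / \<epsilon>)\<^sup>2 * (V * T)"
      using \<epsilon> by (intro tendsto_mult tendsto_const tendsto_power tendsto_divide \<delta>1) auto
    from tendsto_ennrealI[OF this] have "(\<lambda>m. 4 * ennreal ((\<delta> m / \<epsilon>)\<^sup>2 * (V * T)) + 4 * ?D) \<longlonglongrightarrow> 4 * ennreal ((0 / \<epsilon>)\<^sup>2 * (V * T)) + 4 * ?D"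
      by (intro tendsto_add ennreal_tendsto_cmult tendsto_const) auto
    then show "(\<lambda>m. 4 * ennreal ((\<delta> m / \<epsilon>)\<^sup>2 * (V * T)) + 4 * ?D) \<longlonglongrightarrow> 4 * ?D" by simp
  qed
qed

lemma tanaka_isometry:
  assumes \<epsilon>: "0 < \<epsilon>" and T: "0 \<le> T" and S: "simple_data T n \<tau> \<xi>"
  shows "(\<integral>\<^sup>+\<omega>. ennreal ((smooth_mart Q a T \<epsilon> \<omega> - simple_integral n \<tau> \<xi> \<omega>)\<^sup>2) \<partial>P)
     \<le> 4 * (\<integral>\<^sup>+\<omega>. sq_dist Q T (\<lambda>s \<omega>. smooth_sgn a \<epsilon> (B s \<omega>)) (simple_process n \<tau> \<xi>) \<omega> \<partial>P)"
proof (cases "T = 0")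
  case True
  \<comment> \<open>For T = 0 everything vanishes, the occupation time because \<open>dQ\<close> has
    no atom at 0.\<close>
  have "ennreal (occupation Q a 0 \<epsilon> \<omega>) \<le> emeasure (dQ Q \<omega>) {0..0}" for \<omega>
    unfolding occupation_nn(1)[OF order_refl, symmetric]
    by (subst nn_integral_indicator[symmetric], simp, intro nn_integral_mono) (auto simp: indicator_def)
  then have "occupation Q a 0 \<epsilon> \<omega> \<le> 0" for \<omega>
    unfolding emeasure_dQ_Icc[OF order_refl order_refl] by (simp add: ennreal_eq_0_iff)
  then have "occupation Q a 0 \<epsilon> \<omega> = 0" for \<omega>
    using occupation_nn(2)[OF order_refl, of a \<epsilon> \<omega>] by (rule antisym)
  moreover have "n = 0" using S True simple_data_0 by blast
  ultimately have "smooth_mart Q a T \<epsilon> \<omega> - simple_integral n \<tau> \<xi> \<omega> = 0" for \<omega>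
    using True by (simp add: smooth_mart_def approx_local_time_def simple_integral_def B_nonpos)
  then show ?thesis by simp
qed (use tanaka_isometry_pos[OF \<epsilon> _ S] T in simp)

text \<open>The isometry against the zero process, together with the bound 1 on
  \<open>smooth_sgn\<close>; the factor 4 is that of the isometry.\<close>

lemma smooth_mart_sq_le:
  assumes \<epsilon>: "0 < \<epsilon>" and T: "0 \<le> T"
  shows "(\<integral>\<^sup>+\<omega>. ennreal ((smooth_mart Q a T \<epsilon> \<omega>)\<^sup>2) \<partial>P) \<le> ennreal (4 * (V * T))"
proof -
  note Z = simple_data_zero[OF T]
  have "(\<integral>\<^sup>+\<omega>. ennreal ((smooth_mart Q a T \<epsilon> \<omega>)\<^sup>2) \<partial>P) \<le> 4 * (\<integral>\<^sup>+\<omega>. sq_dist Q T (\<lambda>s \<omega>. smooth_sgn a \<epsilon> (B s \<omega>)) (simple_process (if T = 0 then 0 else 1) (\<lambda>j. T * real j) (\<lambda>_ _. 0)) \<omega> \<partial>P)"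
    using tanaka_isometry[OF \<epsilon> T Z, of a] by (simp add: simple_integral_def)
  also have "\<dots> \<le> 4 * ennreal (1\<^sup>2 * (V * T))"
    using smooth_sgn_bound[OF \<epsilon>] by (intro mult_left_mono nn_sq_dist_le_const T) (auto simp: simple_process_def)
  also have "\<dots> = ennreal (4 * (V * T))" using V_nonneg T by (simp add: ennreal_mult')
  finally show ?thesis .
qed

lemma B_sq_le: "0 \<le> T \<Longrightarrow> (\<integral>\<^sup>+\<omega>. ennreal ((B T \<omega>)\<^sup>2) \<partial>P) \<le> ennreal (V * T)"
  using second_moment[of 0 T] by (simp add: B_nonpos)

text \<open>Read backwards, the definition of \<open>smooth_mart\<close> bounds occupation / (2
  \<epsilon>) by the absolute values of B_T and of the martingale part. Applying \<bar>x\<bar> \<le>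
  1 + x^2 to both, the second moments V T and 4 V T lead to 2 + 5 V T, uniformly in
  \<epsilon>.\<close>

lemma occupation_mean_le:
  assumes \<epsilon>: "0 < \<epsilon>" and T: "0 \<le> T"
  shows "(\<integral>\<^sup>+\<omega>. ennreal (occupation Q a T \<epsilon> \<omega>) \<partial>P) \<le> ennreal (2 * \<epsilon> * (2 + 5 * (V * T)))"
proof -
  note [measurable] = measurable_smooth_mart[OF T, of a \<epsilon>]
  have VT: "0 \<le> V * T" using V_nonneg T by simp
  have sq: "\<bar>x\<bar> \<le> 1 + x\<^sup>2" for x :: real
  proof -
    have "2 * \<bar>x\<bar> \<le> 1 + x\<^sup>2" using sum_squares_bound[of 1 "\<bar>x\<bar>"] by simp
    then show ?thesis using abs_ge_zero[of x] by linarith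
  qed
  have "ennreal (occupation Q a T \<epsilon> \<omega>) \<le> ennreal (2 * \<epsilon>) * (2 + ennreal ((B T \<omega>)\<^sup>2) + ennreal ((smooth_mart Q a T \<epsilon> \<omega>)\<^sup>2))" for \<omega>
  proof -
    have "1 / (2 * \<epsilon>) * occupation Q a T \<epsilon> \<omega> = (smooth_abs a \<epsilon> (B T \<omega>) - smooth_abs a \<epsilon> 0) - smooth_mart Q a T \<epsilon> \<omega>"
      by (simp add: smooth_mart_def approx_local_time_def)
    also have "\<dots> \<le> \<bar>B T \<omega>\<bar> + \<bar>smooth_mart Q a T \<epsilon> \<omega>\<bar>"
      using smooth_abs_Lipschitz[OF \<epsilon>, of a "B T \<omega>" 0] by (simp add: abs_le_iff) linarith
    also have "\<dots> \<le> 2 + (B T \<omega>)\<^sup>2 + (smooth_mart Q a T \<epsilon> \<omega>)\<^sup>2"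
      using sq[of "B T \<omega>"] sq[of "smooth_mart Q a T \<epsilon> \<omega>"] by simp
    finally have "occupation Q a T \<epsilon> \<omega> \<le> 2 * \<epsilon> * (2 + (B T \<omega>)\<^sup>2 + (smooth_mart Q a T \<epsilon> \<omega>)\<^sup>2)"
      using \<epsilon> by (simp add: field_simps)
    then have "ennreal (occupation Q a T \<epsilon> \<omega>) \<le> ennreal (2 * \<epsilon> * (2 + (B T \<omega>)\<^sup>2 + (smooth_mart Q a T \<epsilon> \<omega>)\<^sup>2))" by (rule ennreal_leI)
    also have "\<dots> = ennreal (2 * \<epsilon>) * (2 + ennreal ((B T \<omega>)\<^sup>2) + ennreal ((smooth_mart Q a T \<epsilon> \<omega>)\<^sup>2))"
      using \<epsilon> by (subst ennreal_mult') auto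
    finally show ?thesis .
  qed
  then have "(\<integral>\<^sup>+\<omega>. ennreal (occupation Q a T \<epsilon> \<omega>) \<partial>P) \<le> (\<integral>\<^sup>+\<omega>. ennreal (2 * \<epsilon>) * (2 + ennreal ((B T \<omega>)\<^sup>2) + ennreal ((smooth_mart Q a T \<epsilon> \<omega>)\<^sup>2)) \<partial>P)"
    by (rule nn_integral_mono)
  also have "\<dots> = ennreal (2 * \<epsilon>) * (2 + (\<integral>\<^sup>+\<omega>. ennreal ((B T \<omega>)\<^sup>2) \<partial>P) + (\<integral>\<^sup>+\<omega>. ennreal ((smooth_mart Q a T \<epsilon> \<omega>)\<^sup>2) \<partial>P))"
    by (simp add: nn_integral_cmult nn_integral_add emeasure_space_1)
  also have "\<dots> \<le> ennreal (2 * \<epsilon>) * (2 + ennreal (V * T) + ennreal (4 * (V * T)))"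
    by (intro mult_left_mono add_mono order_refl B_sq_le smooth_mart_sq_le \<epsilon> T) simp
  also have "\<dots> = ennreal (2 * \<epsilon>) * ennreal (2 + 5 * (V * T))"
  proof -
    have n: "0 \<le> 2 + V * T" "0 \<le> 4 * (V * T)" "0 \<le> (2 :: real)" using VT by auto
    have "ennreal (2 + V * T + 4 * (V * T)) = 2 + ennreal (V * T) + ennreal (4 * (V * T))"
      by (simp only: ennreal_plus[OF n(1,2)] ennreal_plus[OF n(3) VT] ennreal_numeral)
    moreover have "2 + V * T + 4 * (V * T) = 2 + 5 * (V * T)" by simp
    ultimately show ?thesis by (simp only:)
  qed
  also have "\<dots> = ennreal (2 * \<epsilon> * (2 + 5 * (V * T)))"
    using \<epsilon> by (simp add: ennreal_mult')
  finally show ?thesis .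
qed

definition occupation_const :: "real \<Rightarrow> real" where "occupation_const T = 2 + 5 * (V * T)"

lemma occupation_const_pos: "0 \<le> T \<Longrightarrow> 0 < occupation_const T"
  using V_nonneg by (simp add: occupation_const_def add_pos_nonneg)

lemma smooth_sgn_dist_le:
  assumes \<epsilon>: "0 < \<epsilon>" and T: "0 \<le> T"
  shows "(\<integral>\<^sup>+\<omega>. sq_dist Q T (\<lambda>s \<omega>. smooth_sgn a \<epsilon> (B s \<omega>)) (\<lambda>s \<omega>. sgn (B s \<omega> - a)) \<omega> \<partial>P) \<le> ennreal (2 * \<epsilon> * occupation_const T)"
  unfolding occupation_const_def
  by (rule order_trans[OF nn_integral_mono[OF sq_dist_smooth_sgn_le[OF \<epsilon> T]] occupation_mean_le[OF \<epsilon> T]])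

end

text \<open>The scales are coupled so that the discretization error of order \<open>1 / (\<epsilon>\<^sup>2 N)\<close> and the
  smoothing error of order \<open>\<epsilon>\<close> balance.\<close>

definition sgn_steps :: "real \<Rightarrow> nat \<Rightarrow> nat" where
  "sgn_steps T k = (if T = 0 then 0 else (Suc k) ^ 3)"

definition sgn_grid :: "real \<Rightarrow> nat \<Rightarrow> nat \<Rightarrow> real" where
  "sgn_grid T k = grid T (sgn_steps T k)"

definition sgn_coeff :: "real \<Rightarrow> real \<Rightarrow> nat \<Rightarrow> nat \<Rightarrow> cpath \<Rightarrow> real" where
  "sgn_coeff a T k i \<omega> = smooth_sgn a (1 / real (Suc k)) (B (sgn_grid T k i) \<omega>)"

lemma simple_data_sgn:
  assumes "0 \<le> T" shows "simple_data T (sgn_steps T k) (sgn_grid T k) (sgn_coeff a T k)"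
proof (cases "T = 0")
  case True
  then show ?thesis by (simp add: simple_data_def partition_of_def sgn_steps_def sgn_grid_def grid_def)
next
  case False
  then have "0 < T" "0 < sgn_steps T k" using assms by (auto simp: sgn_steps_def)
  from simple_data_grid[OF this measurable_smooth_sgn smooth_sgn_bound] show ?thesis
    by (simp add: sgn_grid_def sgn_coeff_def[abs_def])
qed

context quadratic_variation_law
begin

text \<open>Shows that the sign process belongs to the completion. The rate involves the measure
  only through V, so it persists for the supremum over the family.\<close>

lemma sgn_approximation:
  assumes T: "0 \<le> T"
  shows "(\<integral>\<^sup>+\<omega>. sq_dist Q T (simple_process (sgn_steps T k) (sgn_grid T k) (sgn_coeff a T k)) (\<lambda>s \<omega>. sgn (B s \<omega> - a)) \<omega> \<partial>P)
     \<le> ennreal ((2 * V\<^sup>2 * T\<^sup>2 + 4 * occupation_const T) / real (Suc k))"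
proof (cases "T = 0")
  case True
  have "sq_dist Q 0 \<eta> \<zeta> \<omega> = 0" for \<eta> \<zeta> \<omega>
  proof -
    have "AE s in dQ Q \<omega>. s \<noteq> 0" by (rule AE_dQ_neq) simp
    then have "sq_dist Q 0 \<eta> \<zeta> \<omega> = (\<integral>\<^sup>+s. 0 \<partial>dQ Q \<omega>)"
      unfolding sq_dist_def by (intro nn_integral_cong_AE, eventually_elim) (auto simp: indicator_def)
    then show ?thesis by simp
  qed
  then show ?thesis using True by simp
next
  case False
  then have T': "0 < T" using T by simp
  define \<epsilon> where "\<epsilon> = 1 / real (Suc k)"
  have \<epsilon>: "0 < \<epsilon>" by (simp add: \<epsilon>_def)
  define N where "N = sgn_steps T k"
  have N: "N = (Suc k) ^ 3" "0 < N" using False by (auto simp: N_def sgn_steps_def)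
  let ?\<zeta> = "simple_process (sgn_steps T k) (sgn_grid T k) (sgn_coeff a T k)"
  let ?\<eta> = "\<lambda>s \<omega>. smooth_sgn a \<epsilon> (B s \<omega>)" and ?\<theta> = "\<lambda>s \<omega>. sgn (B s \<omega> - a)"
  have "(\<integral>\<^sup>+\<omega>. sq_dist Q T ?\<zeta> ?\<theta> \<omega> \<partial>P) \<le> 2 * (\<integral>\<^sup>+\<omega>. sq_dist Q T ?\<zeta> ?\<eta> \<omega> \<partial>P) + 2 * (\<integral>\<^sup>+\<omega>. sq_dist Q T ?\<eta> ?\<theta> \<omega> \<partial>P)"
    by (intro nn_sq_dist_triangle jointly_measurable_simple[OF simple_data_sgn] jointly_measurable_B[OF measurable_smooth_sgn] jointly_measurable_sgn T)
  also have "\<dots> \<le> 2 * ennreal ((1 / \<epsilon>)\<^sup>2 * V\<^sup>2 * T\<^sup>2 / real N) + 2 * ennreal (2 * \<epsilon> * occupation_const T)"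
  proof (intro add_mono mult_left_mono smooth_sgn_dist_le \<epsilon> T)
    show "(\<integral>\<^sup>+\<omega>. sq_dist Q T ?\<zeta> ?\<eta> \<omega> \<partial>P) \<le> ennreal ((1 / \<epsilon>)\<^sup>2 * V\<^sup>2 * T\<^sup>2 / real N)"
      using grid_approximation[OF T' N(2) _ smooth_sgn_Lipschitz[OF \<epsilon>] measurable_smooth_sgn] \<epsilon>
      unfolding sq_dist_def sgn_coeff_def[abs_def] sgn_grid_def \<epsilon>_def[symmetric] N_def[symmetric] grid_def[abs_def] by simp
  qed auto
  also have "\<dots> = ennreal (2 * ((1 / \<epsilon>)\<^sup>2 * V\<^sup>2 * T\<^sup>2 / real N) + 2 * (2 * \<epsilon> * occupation_const T))"
  proof -
    have n: "0 \<le> 2 * ((1 / \<epsilon>)\<^sup>2 * V\<^sup>2 * T\<^sup>2 / real N)" "0 \<le> 2 * (2 * \<epsilon> * occupation_const T)" using \<epsilon> occupation_const_pos[OF T] by auto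
    show ?thesis by (simp only: ennreal_numeral_mult ennreal_plus[OF n])
  qed
  also have "2 * ((1 / \<epsilon>)\<^sup>2 * V\<^sup>2 * T\<^sup>2 / real N) + 2 * (2 * \<epsilon> * occupation_const T) = (2 * V\<^sup>2 * T\<^sup>2 + 4 * occupation_const T) / real (Suc k)"
  proof -
    define r where "r = real (Suc k)"
    have r: "r > 0" "real N = r ^ 3" "\<epsilon> = 1 / r" by (simp_all only: r_def N(1) \<epsilon>_def of_nat_power)
    show ?thesis unfolding r_def[symmetric] r(2,3)
      using r(1) by (simp add: field_simps power2_eq_square power3_eq_cube)
  qed
  finally show ?thesis .
qed

text \<open>The isometry leads to \<open>smooth_sgn\<close>, and the occupation bound from there to
  the sign; the constants are 8 = 4 * 2 and 16 = 8 * 2.\<close>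

lemma smooth_mart_simple_le:
  assumes \<epsilon>: "0 < \<epsilon>" and T: "0 \<le> T" and S: "simple_data T n \<tau> \<xi>"
  shows "(\<integral>\<^sup>+\<omega>. ennreal ((smooth_mart Q a T \<epsilon> \<omega> - simple_integral n \<tau> \<xi> \<omega>)\<^sup>2) \<partial>P)
     \<le> ennreal (16 * \<epsilon> * occupation_const T) + 8 * (\<integral>\<^sup>+\<omega>. sq_dist Q T (simple_process n \<tau> \<xi>) (\<lambda>s \<omega>. sgn (B s \<omega> - a)) \<omega> \<partial>P)"
proof -
  let ?\<zeta> = "simple_process n \<tau> \<xi>"
  let ?\<eta> = "\<lambda>s \<omega>. smooth_sgn a \<epsilon> (B s \<omega>)" and ?\<theta> = "\<lambda>s \<omega>. sgn (B s \<omega> - a)"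
  have "(\<integral>\<^sup>+\<omega>. ennreal ((smooth_mart Q a T \<epsilon> \<omega> - simple_integral n \<tau> \<xi> \<omega>)\<^sup>2) \<partial>P) \<le> 4 * (\<integral>\<^sup>+\<omega>. sq_dist Q T ?\<eta> ?\<zeta> \<omega> \<partial>P)"
    by (rule tanaka_isometry[OF \<epsilon> T S])
  also have "\<dots> \<le> 4 * (2 * (\<integral>\<^sup>+\<omega>. sq_dist Q T ?\<eta> ?\<theta> \<omega> \<partial>P) + 2 * (\<integral>\<^sup>+\<omega>. sq_dist Q T ?\<theta> ?\<zeta> \<omega> \<partial>P))"
    by (intro mult_left_mono nn_sq_dist_triangle jointly_measurable_simple[OF S] jointly_measurable_B[OF measurable_smooth_sgn] jointly_measurable_sgn T) simp
  also have "\<dots> \<le> 4 * (2 * ennreal (2 * \<epsilon> * occupation_const T) + 2 * (\<integral>\<^sup>+\<omega>. sq_dist Q T ?\<theta> ?\<zeta> \<omega> \<partial>P))"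
    by (intro mult_left_mono add_mono smooth_sgn_dist_le \<epsilon> T order_refl) auto
  also have "\<dots> = 8 * ennreal (2 * \<epsilon> * occupation_const T) + 8 * (\<integral>\<^sup>+\<omega>. sq_dist Q T ?\<zeta> ?\<theta> \<omega> \<partial>P)"
    by (simp add: distrib_left sq_dist_commute[of Q T ?\<theta>] flip: mult.assoc)
  also have "8 * ennreal (2 * \<epsilon> * occupation_const T) = ennreal (16 * \<epsilon> * occupation_const T)"
    by (simp add: ennreal_numeral_mult mult.assoc)
  finally show ?thesis .
qed

text \<open>Both martingale parts are compared with the same simple integrals, which stand in for
  the stochastic integral of the sign; the dependence on their index disappears in the
  limit.\<close>

lemma smooth_mart_Cauchy:
  assumes \<epsilon>: "0 < \<epsilon>" and \<delta>: "0 < \<delta>" and T: "0 \<le> T"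
  shows "(\<integral>\<^sup>+\<omega>. ennreal ((smooth_mart Q a T \<epsilon> \<omega> - smooth_mart Q a T \<delta> \<omega>)\<^sup>2) \<partial>P) \<le> ennreal (32 * occupation_const T * (\<epsilon> + \<delta>))"
proof -
  define c where "c = 2 * V\<^sup>2 * T\<^sup>2 + 4 * occupation_const T"
  have c: "0 \<le> c" using occupation_const_pos[OF T] by (simp add: c_def)
  let ?S = "\<lambda>k. simple_integral (sgn_steps T k) (sgn_grid T k) (sgn_coeff a T k)"
  note [measurable] = measurable_smooth_mart[OF T] measurable_simple_integral[OF simple_data_sgn[OF T]]
  have 1: "(\<integral>\<^sup>+\<omega>. ennreal ((smooth_mart Q a T e \<omega> - ?S k \<omega>)\<^sup>2) \<partial>P) \<le> ennreal (16 * e * occupation_const T + 8 * (c / real (Suc k)))" if e: "0 < e" for e k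
  proof -
    have "(\<integral>\<^sup>+\<omega>. ennreal ((smooth_mart Q a T e \<omega> - ?S k \<omega>)\<^sup>2) \<partial>P) \<le> ennreal (16 * e * occupation_const T) + 8 * ennreal (c / real (Suc k))"
      unfolding c_def
      by (rule order_trans[OF smooth_mart_simple_le[OF e T simple_data_sgn[OF T]]]) (intro add_left_mono mult_left_mono sgn_approximation T, simp)
    also have "\<dots> = ennreal (16 * e * occupation_const T + 8 * (c / real (Suc k)))"
    proof -
      have "0 \<le> 16 * e * occupation_const T" "0 \<le> 8 * (c / real (Suc k))" using occupation_const_pos[OF T] e c by auto
      then show ?thesis by (simp only: ennreal_numeral_mult ennreal_plus)
    qed
    finally show ?thesis .
  qed
  have le: "(\<integral>\<^sup>+\<omega>. ennreal ((smooth_mart Q a T \<epsilon> \<omega> - smooth_mart Q a T \<delta> \<omega>)\<^sup>2) \<partial>P) \<le> ennreal (32 * occupation_const T * (\<epsilon> + \<delta>) + 32 * c * (1 / real (Suc k)))" for k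
  proof -
    have "(\<integral>\<^sup>+\<omega>. ennreal ((smooth_mart Q a T \<epsilon> \<omega> - smooth_mart Q a T \<delta> \<omega>)\<^sup>2) \<partial>P)
        = (\<integral>\<^sup>+\<omega>. ennreal (((smooth_mart Q a T \<epsilon> \<omega> - ?S k \<omega>) + (?S k \<omega> - smooth_mart Q a T \<delta> \<omega>))\<^sup>2) \<partial>P)"
      by simp
    also have "\<dots> \<le> 2 * (\<integral>\<^sup>+\<omega>. ennreal ((smooth_mart Q a T \<epsilon> \<omega> - ?S k \<omega>)\<^sup>2) \<partial>P) + 2 * (\<integral>\<^sup>+\<omega>. ennreal ((?S k \<omega> - smooth_mart Q a T \<delta> \<omega>)\<^sup>2) \<partial>P)"
      by (rule nn_integral_square_add_le) simp_all
    also have "\<dots> \<le> 2 * ennreal (16 * \<epsilon> * occupation_const T + 8 * (c / real (Suc k))) + 2 * ennreal (16 * \<delta> * occupation_const T + 8 * (c / real (Suc k)))"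
      using 1[OF \<epsilon>] 1[OF \<delta>] by (intro add_mono mult_left_mono) (auto simp: power2_commute[of "?S _ _"])
    also have "\<dots> = ennreal (2 * (16 * \<epsilon> * occupation_const T + 8 * (c / real (Suc k))) + 2 * (16 * \<delta> * occupation_const T + 8 * (c / real (Suc k))))"
    proof -
      have n: "0 \<le> 2 * (16 * \<epsilon> * occupation_const T + 8 * (c / real (Suc k)))" "0 \<le> 2 * (16 * \<delta> * occupation_const T + 8 * (c / real (Suc k)))"
        using \<epsilon> \<delta> c occupation_const_pos[OF T] by auto
      show ?thesis by (simp only: ennreal_numeral_mult ennreal_plus[OF n])
    qed
    also have "2 * (16 * \<epsilon> * occupation_const T + 8 * (c / real (Suc k))) + 2 * (16 * \<delta> * occupation_const T + 8 * (c / real (Suc k))) = 32 * occupation_const T * (\<epsilon> + \<delta>) + 32 * c * (1 / real (Suc k))"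
      by (simp add: algebra_simps)
    finally show ?thesis .
  qed
  have "(\<lambda>k. 32 * occupation_const T * (\<epsilon> + \<delta>) + 32 * c * (1 / real (Suc k))) \<longlonglongrightarrow> 32 * occupation_const T * (\<epsilon> + \<delta>) + 32 * c * 0"
    using LIMSEQ_Suc[OF lim_1_over_n] by (intro tendsto_add tendsto_mult tendsto_const) auto
  from LIMSEQ_le_const[OF tendsto_ennrealI[OF this]] le show ?thesis by auto
qed

text \<open>The 4 accounts for the difference of the smoothed absolute values, 64 = 2 * 32 for that
  of the martingale parts.\<close>

definition Cauchy_const :: "real \<Rightarrow> real" where "Cauchy_const T = 4 + 64 * occupation_const T"

lemma Cauchy_const_pos: "0 \<le> T \<Longrightarrow> 0 < Cauchy_const T"
  using occupation_const_pos[of T] by (simp add: Cauchy_const_def)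

lemma measurable_approx_local_time: "0 \<le> t \<Longrightarrow> approx_local_time Q a t \<epsilon> \<in> borel_measurable borel"
  using measurable_occupation[of t a \<epsilon>] unfolding approx_local_time_def[abs_def] by measurable

lemma approx_local_time_Cauchy:
  assumes \<epsilon>: "0 < \<epsilon>" "\<epsilon> \<le> 1" and \<delta>: "0 < \<delta>" "\<delta> \<le> 1" and T: "0 \<le> T"
  shows "(\<integral>\<^sup>+\<omega>. ennreal ((approx_local_time Q a T \<epsilon> \<omega> - approx_local_time Q a T \<delta> \<omega>)\<^sup>2) \<partial>P) \<le> ennreal (Cauchy_const T * (\<epsilon> + \<delta>))"
proof -
  note [measurable] = measurable_smooth_mart[OF T]
  let ?d = "\<lambda>\<omega>. (smooth_abs a \<epsilon> (B T \<omega>) - smooth_abs a \<delta> (B T \<omega>)) - (smooth_abs a \<epsilon> 0 - smooth_abs a \<delta> 0)"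
  have d: "(?d \<omega>)\<^sup>2 \<le> 2 * (\<epsilon> + \<delta>)" for \<omega>
  proof -
    have 1: "\<bar>smooth_abs a \<epsilon> x - smooth_abs a \<delta> x\<bar> \<le> \<epsilon> / 2 + \<delta> / 2" for x
      using smooth_abs_eq[OF \<epsilon>(1), of a x] smooth_abs_eq[OF \<delta>(1), of a x] by linarith
    have "\<bar>?d \<omega>\<bar> \<le> \<bar>\<epsilon> + \<delta>\<bar>" using 1[of "B T \<omega>"] 1[of 0] by linarith
    then have "(?d \<omega>)\<^sup>2 \<le> (\<epsilon> + \<delta>)\<^sup>2" by (simp only: abs_le_square_iff)
    \<comment> \<open>Scales at most 1 allow the square to be bounded linearly, in line with the
      martingale part.\<close>
    also have "\<dots> \<le> 2 * (\<epsilon> + \<delta>)" unfolding power2_eq_square using \<epsilon> \<delta> by (intro mult_right_mono) auto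
    finally show ?thesis .
  qed
  have "(\<integral>\<^sup>+\<omega>. ennreal ((approx_local_time Q a T \<epsilon> \<omega> - approx_local_time Q a T \<delta> \<omega>)\<^sup>2) \<partial>P)
    = (\<integral>\<^sup>+\<omega>. ennreal ((?d \<omega> + (smooth_mart Q a T \<delta> \<omega> - smooth_mart Q a T \<epsilon> \<omega>))\<^sup>2) \<partial>P)"
    by (simp add: smooth_mart_def)
  also have "\<dots> \<le> 2 * (\<integral>\<^sup>+\<omega>. ennreal ((?d \<omega>)\<^sup>2) \<partial>P) + 2 * (\<integral>\<^sup>+\<omega>. ennreal ((smooth_mart Q a T \<delta> \<omega> - smooth_mart Q a T \<epsilon> \<omega>)\<^sup>2) \<partial>P)"
    by (rule nn_integral_square_add_le) simp_all
  also have "\<dots> \<le> 2 * ennreal (2 * (\<epsilon> + \<delta>)) + 2 * ennreal (32 * occupation_const T * (\<delta> + \<epsilon>))"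
  proof (intro add_mono mult_left_mono smooth_mart_Cauchy \<epsilon> \<delta> T)
    have "(\<integral>\<^sup>+\<omega>. ennreal ((?d \<omega>)\<^sup>2) \<partial>P) \<le> (\<integral>\<^sup>+\<omega>. ennreal (2 * (\<epsilon> + \<delta>)) \<partial>P)"
      by (intro nn_integral_mono ennreal_leI d)
    then show "(\<integral>\<^sup>+\<omega>. ennreal ((?d \<omega>)\<^sup>2) \<partial>P) \<le> ennreal (2 * (\<epsilon> + \<delta>))"
      by (simp add: emeasure_space_1)
  qed auto
  also have "\<dots> = ennreal (Cauchy_const T * (\<epsilon> + \<delta>))"
  proof -
    have n: "0 \<le> 2 * (2 * (\<epsilon> + \<delta>))" "0 \<le> 2 * (32 * occupation_const T * (\<delta> + \<epsilon>))" using \<epsilon> \<delta> occupation_const_pos[OF T] by auto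
    have "2 * (2 * (\<epsilon> + \<delta>)) + 2 * (32 * occupation_const T * (\<delta> + \<epsilon>)) = Cauchy_const T * (\<epsilon> + \<delta>)"
      by (simp add: Cauchy_const_def algebra_simps)
    then show ?thesis by (simp only: ennreal_numeral_mult ennreal_plus[OF n, symmetric])
  qed
  finally show ?thesis .
qed

text \<open>Gives membership in L2 at every scale: 10 = 2 * (1 + 4) collects V T from the path and 4
  V T from the martingale part.\<close>

lemma approx_local_time_sq_le:
  assumes \<epsilon>: "0 < \<epsilon>" and T: "0 \<le> T"
  shows "(\<integral>\<^sup>+\<omega>. ennreal ((approx_local_time Q a T \<epsilon> \<omega>)\<^sup>2) \<partial>P) \<le> ennreal (10 * (V * T))"
proof -
  note [measurable] = measurable_smooth_mart[OF T]
  have "(\<integral>\<^sup>+\<omega>. ennreal ((approx_local_time Q a T \<epsilon> \<omega>)\<^sup>2) \<partial>P)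
     = (\<integral>\<^sup>+\<omega>. ennreal (((smooth_abs a \<epsilon> (B T \<omega>) - smooth_abs a \<epsilon> 0) + - smooth_mart Q a T \<epsilon> \<omega>)\<^sup>2) \<partial>P)"
    by (simp add: smooth_mart_def)
  also have "\<dots> \<le> 2 * (\<integral>\<^sup>+\<omega>. ennreal ((smooth_abs a \<epsilon> (B T \<omega>) - smooth_abs a \<epsilon> 0)\<^sup>2) \<partial>P) + 2 * (\<integral>\<^sup>+\<omega>. ennreal ((- smooth_mart Q a T \<epsilon> \<omega>)\<^sup>2) \<partial>P)"
    by (rule nn_integral_square_add_le) simp_all
  also have "\<dots> \<le> 2 * ennreal (V * T) + 2 * ennreal (4 * (V * T))"
  proof (intro add_mono mult_left_mono)
    have "(\<integral>\<^sup>+\<omega>. ennreal ((smooth_abs a \<epsilon> (B T \<omega>) - smooth_abs a \<epsilon> 0)\<^sup>2) \<partial>P) \<le> (\<integral>\<^sup>+\<omega>. ennreal ((B T \<omega>)\<^sup>2) \<partial>P)"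
      using smooth_abs_Lipschitz[OF \<epsilon>, of a _ 0]
      by (intro nn_integral_mono ennreal_leI) (simp add: abs_le_square_iff[symmetric])
    then show "(\<integral>\<^sup>+\<omega>. ennreal ((smooth_abs a \<epsilon> (B T \<omega>) - smooth_abs a \<epsilon> 0)\<^sup>2) \<partial>P) \<le> ennreal (V * T)"
      using B_sq_le[OF T] by (rule order_trans)
    show "(\<integral>\<^sup>+\<omega>. ennreal ((- smooth_mart Q a T \<epsilon> \<omega>)\<^sup>2) \<partial>P) \<le> ennreal (4 * (V * T))"
      using smooth_mart_sq_le[OF \<epsilon> T, of a] by simp
  qed auto
  also have "\<dots> = ennreal (10 * (V * T))"
  proof -
    have n: "0 \<le> 2 * (V * T)" "0 \<le> 2 * (4 * (V * T))" using V_nonneg T by auto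
    have "2 * (V * T) + 2 * (4 * (V * T)) = 10 * (V * T)" by simp
    then show ?thesis by (simp only: ennreal_numeral_mult ennreal_plus[OF n, symmetric])
  qed
  finally show ?thesis .
qed

text \<open>Along 16^-k the squared L2 distance of neighbours is of order 16^-k. The weight 4^-k
  balances the two terms of the weighted inequality, so the mean distances are summable and the
  sequence converges almost surely; its limit then equals the upper limit that defines
  \<open>local_time\<close>.\<close>

lemma local_time_AE:
  assumes T: "0 \<le> T"
  shows "AE \<omega> in P. (\<lambda>k. approx_local_time Q a T ((1 / 16) ^ k) \<omega>) \<longlonglongrightarrow> local_time Q a T \<omega>"
proof -
  let ?X = "\<lambda>k \<omega>. approx_local_time Q a T ((1 / 16) ^ k) \<omega>"
  let ?\<Delta> = "\<lambda>k \<omega>. ?X (Suc k) \<omega> - ?X k \<omega>"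
  note [measurable] = measurable_approx_local_time[OF T]
  have bound: "(\<integral>\<^sup>+\<omega>. ennreal \<bar>?\<Delta> k \<omega>\<bar> \<partial>P) \<le> ennreal ((1 + 2 * Cauchy_const T) * (1 / 4) ^ k)" for k
  proof -
    define d :: real where "d = (1 / 4) ^ k"
    have d: "0 < d" by (simp add: d_def)
    have dd: "(1 / 16 :: real) ^ k = d * d" by (simp add: d_def flip: power_mult_distrib)
    have "ennreal \<bar>?\<Delta> k \<omega>\<bar> \<le> ennreal d + ennreal (1 / d) * ennreal ((?\<Delta> k \<omega>)\<^sup>2)" for \<omega>
      by (rule ennreal_abs_le_square[OF d])
    then have "(\<integral>\<^sup>+\<omega>. ennreal \<bar>?\<Delta> k \<omega>\<bar> \<partial>P) \<le> (\<integral>\<^sup>+\<omega>. ennreal d + ennreal (1 / d) * ennreal ((?\<Delta> k \<omega>)\<^sup>2) \<partial>P)"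
      by (rule nn_integral_mono)
    also have "\<dots> = ennreal d + ennreal (1 / d) * (\<integral>\<^sup>+\<omega>. ennreal ((?\<Delta> k \<omega>)\<^sup>2) \<partial>P)"
      by (simp add: nn_integral_add nn_integral_cmult emeasure_space_1)
    also have "\<dots> \<le> ennreal d + ennreal (1 / d) * ennreal (Cauchy_const T * (2 * (d * d)))"
    proof (intro add_left_mono mult_left_mono)
      have "(\<integral>\<^sup>+\<omega>. ennreal ((?\<Delta> k \<omega>)\<^sup>2) \<partial>P) \<le> ennreal (Cauchy_const T * ((1 / 16) ^ Suc k + (1 / 16) ^ k))"
        by (rule approx_local_time_Cauchy) (auto simp: T power_le_one simp del: power_Suc)
      also have "\<dots> \<le> ennreal (Cauchy_const T * (2 * (d * d)))"
        using Cauchy_const_pos[OF T] d by (intro ennreal_leI mult_left_mono) (auto simp: dd)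
      finally show "(\<integral>\<^sup>+\<omega>. ennreal ((?\<Delta> k \<omega>)\<^sup>2) \<partial>P) \<le> ennreal (Cauchy_const T * (2 * (d * d)))" .
    qed simp
    also have "\<dots> = ennreal (d + 1 / d * (Cauchy_const T * (2 * (d * d))))"
    proof -
      have n: "0 \<le> 1 / d" "0 \<le> d" "0 \<le> 1 / d * (Cauchy_const T * (2 * (d * d)))" using d Cauchy_const_pos[OF T] by auto
      show ?thesis by (simp only: ennreal_mult'[OF n(1)] ennreal_plus[OF n(2,3)])
    qed
    also have "d + 1 / d * (Cauchy_const T * (2 * (d * d))) = (1 + 2 * Cauchy_const T) * d"
      using d by (simp add: field_simps)
    finally show ?thesis unfolding d_def .
  qed
  have "(\<integral>\<^sup>+\<omega>. (\<Sum>k. ennreal \<bar>?\<Delta> k \<omega>\<bar>) \<partial>P) = (\<Sum>k. \<integral>\<^sup>+\<omega>. ennreal \<bar>?\<Delta> k \<omega>\<bar> \<partial>P)"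
    by (rule nn_integral_suminf) simp
  also have "\<dots> \<le> (\<Sum>k. ennreal ((1 + 2 * Cauchy_const T) * (1 / 4) ^ k))"
    by (intro suminf_le bound) auto
  also have "\<dots> = ennreal (\<Sum>k. (1 + 2 * Cauchy_const T) * (1 / 4) ^ k)"
    using Cauchy_const_pos[OF T] by (intro suminf_ennreal2) (auto intro!: summable_mult summable_geometric)
  finally have "(\<integral>\<^sup>+\<omega>. (\<Sum>k. ennreal \<bar>?\<Delta> k \<omega>\<bar>) \<partial>P) \<noteq> \<infinity>" by (auto simp: top_unique)
  then have "AE \<omega> in P. (\<Sum>k. ennreal \<bar>?\<Delta> k \<omega>\<bar>) \<noteq> \<infinity>"
    by (intro nn_integral_PInf_AE) simp_all
  then show ?thesis
  proof eventually_elim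
    fix \<omega> assume "(\<Sum>k. ennreal \<bar>?\<Delta> k \<omega>\<bar>) \<noteq> \<infinity>"
    then have "summable (\<lambda>k. \<bar>?\<Delta> k \<omega>\<bar>)" by (intro summable_suminf_not_top) auto
    then have "summable (\<lambda>k. ?\<Delta> k \<omega>)" by (rule summable_rabs_cancel)
    then have "(\<lambda>n. \<Sum>k<n. ?\<Delta> k \<omega>) \<longlonglongrightarrow> (\<Sum>k. ?\<Delta> k \<omega>)" by (rule summable_LIMSEQ)
    then have "(\<lambda>n. ?X n \<omega> - ?X 0 \<omega>) \<longlonglongrightarrow> (\<Sum>k. ?\<Delta> k \<omega>)"
      by (simp only: sum_lessThan_telescope[of "\<lambda>k. ?X k \<omega>"])
    from tendsto_add[OF this tendsto_const[of "?X 0 \<omega>"]] obtain l where l: "(\<lambda>n. ?X n \<omega>) \<longlonglongrightarrow> l" by auto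
    then have "(\<lambda>n. ereal (?X n \<omega>)) \<longlonglongrightarrow> ereal l" by simp
    then have "limsup (\<lambda>n. ereal (?X n \<omega>)) = ereal l" by (intro lim_imp_Limsup) auto
    then show "(\<lambda>k. ?X k \<omega>) \<longlonglongrightarrow> local_time Q a T \<omega>" using l by (simp add: local_time_def)
  qed
qed

text \<open>Fatou's lemma applied to the Cauchy estimate, with the second scale 16^-k tending to
  0.\<close>

lemma local_time_L2:
  assumes \<epsilon>: "0 < \<epsilon>" "\<epsilon> \<le> 1" and T: "0 \<le> T"
  shows "(\<integral>\<^sup>+\<omega>. ennreal ((approx_local_time Q a T \<epsilon> \<omega> - local_time Q a T \<omega>)\<^sup>2) \<partial>P) \<le> ennreal (Cauchy_const T * \<epsilon>)"
proof (rule nn_integral_le_LIMSEQ)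
  note [measurable] = measurable_approx_local_time[OF T]
  let ?X = "\<lambda>k \<omega>. approx_local_time Q a T ((1 / 16) ^ k) \<omega>"
  show "(\<lambda>\<omega>. ennreal ((approx_local_time Q a T \<epsilon> \<omega> - ?X k \<omega>)\<^sup>2)) \<in> borel_measurable P" for k by simp
  show "AE \<omega> in P. (\<lambda>k. ennreal ((approx_local_time Q a T \<epsilon> \<omega> - ?X k \<omega>)\<^sup>2)) \<longlonglongrightarrow> ennreal ((approx_local_time Q a T \<epsilon> \<omega> - local_time Q a T \<omega>)\<^sup>2)"
    using local_time_AE[OF T, of a] by eventually_elim (intro tendsto_ennrealI tendsto_power tendsto_diff tendsto_const)
  show "(\<integral>\<^sup>+\<omega>. ennreal ((approx_local_time Q a T \<epsilon> \<omega> - ?X k \<omega>)\<^sup>2) \<partial>P) \<le> ennreal (Cauchy_const T * (\<epsilon> + (1 / 16) ^ k))" for k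
    by (rule approx_local_time_Cauchy[OF \<epsilon> _ _ T]) (auto simp: power_le_one)
  have "(\<lambda>k. Cauchy_const T * (\<epsilon> + (1 / 16) ^ k)) \<longlonglongrightarrow> Cauchy_const T * (\<epsilon> + 0)"
    by (intro tendsto_mult tendsto_add tendsto_const LIMSEQ_power_zero) simp
  then show "(\<lambda>k. ennreal (Cauchy_const T * (\<epsilon> + (1 / 16) ^ k))) \<longlonglongrightarrow> ennreal (Cauchy_const T * \<epsilon>)"
    by (intro tendsto_ennrealI) simp
qed

text \<open>Tanaka's formula in disguise: the difference of the absolute values minus the local time
  is as close to a simple integral as its integrand is to the sign, so it is the limit along every
  approximating sequence. The smoothing error 16 \<epsilon> vanishes in the limit.\<close>

lemma tanaka_L2:
  assumes T: "0 \<le> T" and S: "simple_data T n \<tau> \<xi>"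
  shows "(\<integral>\<^sup>+\<omega>. ennreal ((simple_integral n \<tau> \<xi> \<omega> - (\<bar>B T \<omega> - a\<bar> - \<bar>a\<bar> - local_time Q a T \<omega>))\<^sup>2) \<partial>P)
    \<le> 8 * (\<integral>\<^sup>+\<omega>. sq_dist Q T (simple_process n \<tau> \<xi>) (\<lambda>s \<omega>. sgn (B s \<omega> - a)) \<omega> \<partial>P)" (is "_ \<le> 8 * ?D")
proof (rule nn_integral_le_LIMSEQ)
  let ?e = "\<lambda>k::nat. (1 / 16 :: real) ^ k"
  note [measurable] = measurable_smooth_mart[OF T] measurable_simple_integral[OF S]
  show "(\<lambda>\<omega>. ennreal ((simple_integral n \<tau> \<xi> \<omega> - smooth_mart Q a T (?e k) \<omega>)\<^sup>2)) \<in> borel_measurable P" for k by simp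
  have e: "?e \<longlonglongrightarrow> 0" by (rule LIMSEQ_power_zero) simp
  have abs: "(\<lambda>k. smooth_abs a (?e k) x) \<longlonglongrightarrow> \<bar>x - a\<bar>" for x
  proof -
    have "(\<lambda>k. ?e k / 2) \<longlonglongrightarrow> 0" using tendsto_divide[OF e tendsto_const[of 2]] by simp
    then have "(\<lambda>k. smooth_abs a (?e k) x - \<bar>x - a\<bar>) \<longlonglongrightarrow> 0"
      by (rule Lim_null_comparison[rotated]) (use smooth_abs_eq[of "?e _" a x] in simp)
    then show ?thesis by (simp add: LIM_zero_iff)
  qed
  show "AE \<omega> in P. (\<lambda>k. ennreal ((simple_integral n \<tau> \<xi> \<omega> - smooth_mart Q a T (?e k) \<omega>)\<^sup>2)) \<longlonglongrightarrow>
     ennreal ((simple_integral n \<tau> \<xi> \<omega> - (\<bar>B T \<omega> - a\<bar> - \<bar>a\<bar> - local_time Q a T \<omega>))\<^sup>2)"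
    using local_time_AE[OF T, of a]
  proof eventually_elim
    fix \<omega> assume "(\<lambda>k. approx_local_time Q a T (?e k) \<omega>) \<longlonglongrightarrow> local_time Q a T \<omega>"
    then have "(\<lambda>k. smooth_mart Q a T (?e k) \<omega>) \<longlonglongrightarrow> \<bar>B T \<omega> - a\<bar> - \<bar>0 - a\<bar> - local_time Q a T \<omega>"
      unfolding smooth_mart_def by (intro tendsto_diff abs)
    then show "(\<lambda>k. ennreal ((simple_integral n \<tau> \<xi> \<omega> - smooth_mart Q a T (?e k) \<omega>)\<^sup>2)) \<longlonglongrightarrow>
       ennreal ((simple_integral n \<tau> \<xi> \<omega> - (\<bar>B T \<omega> - a\<bar> - \<bar>a\<bar> - local_time Q a T \<omega>))\<^sup>2)"
      by (intro tendsto_ennrealI tendsto_power tendsto_diff[OF tendsto_const]) simp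
  qed
  show "(\<integral>\<^sup>+\<omega>. ennreal ((simple_integral n \<tau> \<xi> \<omega> - smooth_mart Q a T (?e k) \<omega>)\<^sup>2) \<partial>P) \<le> ennreal (16 * ?e k * occupation_const T) + 8 * ?D" for k
    using smooth_mart_simple_le[of "?e k", OF _ T S] by (simp add: power2_commute[of "simple_integral _ _ _ _"])
  have "(\<lambda>k. ennreal (16 * ?e k * occupation_const T) + 8 * ?D) \<longlonglongrightarrow> ennreal (16 * 0 * occupation_const T) + 8 * ?D"
    by (intro tendsto_add tendsto_const tendsto_ennrealI tendsto_mult e)
  then show "(\<lambda>k. ennreal (16 * ?e k * occupation_const T) + 8 * ?D) \<longlonglongrightarrow> 8 * ?D" by simp
qed

end

section \<open>Quasi-sure statements\<close>

lemma polar_iff: "polar \<P> N \<longleftrightarrow> N \<in> sets borel \<and> (\<forall>P\<in>\<P>. emeasure P N = 0)"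
  unfolding polar_def by (auto simp: SUP_eq_iff bot_ennreal[symmetric] simp del: bot_ennreal)

lemma quasi_surely_mono: "quasi_surely \<P> \<Phi> \<Longrightarrow> (\<And>\<omega>. \<Phi> \<omega> \<Longrightarrow> \<Psi> \<omega>) \<Longrightarrow> quasi_surely \<P> \<Psi>"
  unfolding quasi_surely_def by blast

lemma quasi_surely_UNIV: "(\<And>\<omega>. \<Phi> \<omega>) \<Longrightarrow> quasi_surely \<P> \<Phi>"
  unfolding quasi_surely_def polar_iff by (intro exI[of _ "{}"]) auto

context
  fixes \<P> E assumes R: "represents \<P> E"
begin

lemma polar_UN:
  fixes N :: "'i :: countable \<Rightarrow> cpath set"
  assumes "\<And>i. polar \<P> (N i)" shows "polar \<P> (\<Union>i. N i)"
  unfolding polar_iff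
proof (intro conjI ballI)
  show m: "(\<Union>i. N i) \<in> sets borel" using assms by (auto simp: polar_iff)
  fix P assume P: "P \<in> \<P>"
  have "N i \<in> null_sets P" for i
    using assms[of i] P represents_prob(2)[OF R P] by (auto simp: polar_iff)
  then have "(\<Union>i. N i) \<in> null_sets P" by auto
  then show "emeasure P (\<Union>i. N i) = 0" by auto
qed

lemma quasi_surely_all_countable:
  fixes \<Phi> :: "'i :: countable \<Rightarrow> cpath \<Rightarrow> bool"
  assumes "\<And>i. quasi_surely \<P> (\<Phi> i)" shows "quasi_surely \<P> (\<lambda>\<omega>. \<forall>i. \<Phi> i \<omega>)"
proof -
  obtain N where "\<And>i. polar \<P> (N i)" "\<And>i \<omega>. \<omega> \<notin> N i \<Longrightarrow> \<Phi> i \<omega>"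
    using assms unfolding quasi_surely_def by metis
  then show ?thesis unfolding quasi_surely_def by (intro exI[of _ "\<Union>i. N i"]) (auto intro: polar_UN)
qed

lemma quasi_surely_conj:
  assumes "quasi_surely \<P> \<Phi>" "quasi_surely \<P> \<Psi>" shows "quasi_surely \<P> (\<lambda>\<omega>. \<Phi> \<omega> \<and> \<Psi> \<omega>)"
  using quasi_surely_all_countable[of "\<lambda>b. if b then \<Phi> else \<Psi>"] assms
  by (auto elim!: quasi_surely_mono simp: all_bool_eq)

lemma quasi_surely_AE:
  assumes "quasi_surely \<P> \<Phi>" "P \<in> \<P>" shows "AE \<omega> in P. \<Phi> \<omega>"
proof -
  obtain N where N: "polar \<P> N" "\<And>\<omega>. \<omega> \<notin> N \<Longrightarrow> \<Phi> \<omega>" using assms(1) unfolding quasi_surely_def by blast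
  then have "N \<in> null_sets P" using assms(2) represents_prob(2)[OF R assms(2)] by (auto simp: polar_iff)
  then show ?thesis by (rule AE_I'[where N=N]) (use N(2) in auto)
qed

text \<open>Null sets found under the separate measures do not combine into one polar set; the
  exceptional set itself, being Borel, serves for all measures.\<close>

lemma quasi_surelyI:
  assumes "{\<omega>. \<not> \<Phi> \<omega>} \<in> sets borel" "\<And>P. P \<in> \<P> \<Longrightarrow> AE \<omega> in P. \<Phi> \<omega>"
  shows "quasi_surely \<P> \<Phi>"
  unfolding quasi_surely_def
proof (intro exI conjI)
  show "polar \<P> {\<omega>. \<not> \<Phi> \<omega>}"
    unfolding polar_iff
  proof (intro conjI ballI assms)
    fix P assume P: "P \<in> \<P>"
    have "space P = UNIV" using sets_eq_imp_space_eq[OF represents_prob(2)[OF R P]] by simp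
    moreover have "{\<omega>. \<not> \<Phi> \<omega>} \<in> sets P" using assms(1) represents_prob(2)[OF R P] by simp
    ultimately show "emeasure P {\<omega>. \<not> \<Phi> \<omega>} = 0"
      using AE_iff_measurable[of "{\<omega>. \<not> \<Phi> \<omega>}" P \<Phi>] assms(2)[OF P] by simp
  qed
qed auto

lemma upper_expectation_le:
  "(\<And>P. P \<in> \<P> \<Longrightarrow> (\<integral>\<^sup>+\<omega>. X \<omega> \<partial>P) \<le> C) \<Longrightarrow> upper_expectation \<P> X \<le> C"
  unfolding upper_expectation_def by (rule SUP_least)

lemma le_upper_expectation: "P \<in> \<P> \<Longrightarrow> (\<integral>\<^sup>+\<omega>. X \<omega> \<partial>P) \<le> upper_expectation \<P> X"
  unfolding upper_expectation_def by (rule SUP_upper)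

lemma upper_expectation_cong:
  assumes "quasi_surely \<P> (\<lambda>\<omega>. X \<omega> = Y \<omega>)" shows "upper_expectation \<P> X = upper_expectation \<P> Y"
  unfolding upper_expectation_def
  by (intro SUP_cong refl nn_integral_cong_AE quasi_surely_AE[OF assms])

lemma L2_norm_sq_cong:
  assumes "quasi_surely \<P> (\<lambda>\<omega>. X \<omega> = Y \<omega>)" shows "L2_norm_sq \<P> X = L2_norm_sq \<P> Y"
  unfolding L2_norm_sq_def by (intro upper_expectation_cong quasi_surely_mono[OF assms]) simp

lemma measurable_law:
  assumes "P \<in> \<P>" shows "measurable P M = measurable borel M"
  by (rule measurable_cong_sets[OF represents_prob(2)[OF R assms] refl])

lemma L2_norm_sq_add_le:
  assumes X: "X \<in> borel_measurable borel" "Y \<in> borel_measurable borel"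
  shows "L2_norm_sq \<P> (\<lambda>\<omega>. X \<omega> + Y \<omega>) \<le> 2 * L2_norm_sq \<P> X + 2 * L2_norm_sq \<P> Y"
  unfolding L2_norm_sq_def
proof (rule upper_expectation_le)
  fix P assume P: "P \<in> \<P>"
  have "(\<integral>\<^sup>+\<omega>. ennreal (\<bar>X \<omega> + Y \<omega>\<bar>\<^sup>2) \<partial>P) \<le> 2 * (\<integral>\<^sup>+\<omega>. ennreal (\<bar>X \<omega>\<bar>\<^sup>2) \<partial>P) + 2 * (\<integral>\<^sup>+\<omega>. ennreal (\<bar>Y \<omega>\<bar>\<^sup>2) \<partial>P)"
    using nn_integral_square_add_le[of X P Y] X by (simp add: measurable_law[OF P])
  also have "\<dots> \<le> 2 * upper_expectation \<P> (\<lambda>\<omega>. ennreal (\<bar>X \<omega>\<bar>\<^sup>2)) + 2 * upper_expectation \<P> (\<lambda>\<omega>. ennreal (\<bar>Y \<omega>\<bar>\<^sup>2))"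
    by (intro add_mono mult_left_mono le_upper_expectation P) auto
  finally show "(\<integral>\<^sup>+\<omega>. ennreal (\<bar>X \<omega> + Y \<omega>\<bar>\<^sup>2) \<partial>P) \<le> 2 * upper_expectation \<P> (\<lambda>\<omega>. ennreal (\<bar>X \<omega>\<bar>\<^sup>2)) + 2 * upper_expectation \<P> (\<lambda>\<omega>. ennreal (\<bar>Y \<omega>\<bar>\<^sup>2))" .
qed

lemma L2_norm_sq_eq_0:
  assumes X: "X \<in> borel_measurable borel" and 0: "L2_norm_sq \<P> X = 0"
  shows "quasi_surely \<P> (\<lambda>\<omega>. X \<omega> = 0)"
proof (rule quasi_surelyI)
  show "{\<omega>. X \<omega> \<noteq> 0} \<in> sets borel" using X by measurable
  fix P assume P: "P \<in> \<P>"
  have "(\<integral>\<^sup>+\<omega>. ennreal (\<bar>X \<omega>\<bar>\<^sup>2) \<partial>P) = 0"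
    using le_upper_expectation[OF P, of "\<lambda>\<omega>. ennreal (\<bar>X \<omega>\<bar>\<^sup>2)"] 0 by (simp add: L2_norm_sq_def)
  then have "AE \<omega> in P. ennreal (\<bar>X \<omega>\<bar>\<^sup>2) = 0"
    by (subst (asm) nn_integral_0_iff_AE) (use X in \<open>simp_all add: measurable_law[OF P]\<close>)
  then show "AE \<omega> in P. X \<omega> = 0" by (auto elim!: eventually_mono)
qed

lemma L2_I:
  assumes "X \<in> borel_measurable borel" "L2_norm_sq \<P> X < \<infinity>" shows "X \<in> L2 \<P>"
  using assms unfolding L2_def by (auto intro!: bexI[of _ X] quasi_surely_UNIV)

lemma L2_cong:
  assumes "X \<in> L2 \<P>" "quasi_surely \<P> (\<lambda>\<omega>. Y \<omega> = X \<omega>)" shows "Y \<in> L2 \<P>"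
proof -
  obtain Z where Z: "Z \<in> borel_measurable borel" "quasi_surely \<P> (\<lambda>\<omega>. X \<omega> = Z \<omega>)" and f: "L2_norm_sq \<P> X < \<infinity>"
    using assms(1) unfolding L2_def by blast
  have "quasi_surely \<P> (\<lambda>\<omega>. Y \<omega> = Z \<omega>)"
    by (rule quasi_surely_mono[OF quasi_surely_conj[OF assms(2) Z(2)]]) simp
  then show ?thesis using Z(1) f L2_norm_sq_cong[OF assms(2)] unfolding L2_def by auto
qed

text \<open>Members of L2 are measurable only up to polar sets, so the triangle inequality is
  applied to measurable versions of both limits and of each approximant.\<close>

lemma L2_limit_unique:
  assumes X: "L2_tendsto \<P> S X sequentially" and Y: "L2_tendsto \<P> S Y sequentially"
  shows "quasi_surely \<P> (\<lambda>\<omega>. X \<omega> = Y \<omega>)"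
proof -
  obtain X' where X': "X' \<in> borel_measurable borel" "quasi_surely \<P> (\<lambda>\<omega>. X \<omega> = X' \<omega>)" using X unfolding L2_tendsto_def L2_def by blast
  obtain Y' where Y': "Y' \<in> borel_measurable borel" "quasi_surely \<P> (\<lambda>\<omega>. Y \<omega> = Y' \<omega>)" using Y unfolding L2_tendsto_def L2_def by blast
  have ev: "\<forall>\<^sub>F k in sequentially. L2_norm_sq \<P> (\<lambda>\<omega>. X' \<omega> - Y' \<omega>) \<le> 2 * L2_norm_sq \<P> (\<lambda>\<omega>. S k \<omega> - X \<omega>) + 2 * L2_norm_sq \<P> (\<lambda>\<omega>. S k \<omega> - Y \<omega>)"
  proof -
    have "\<forall>\<^sub>F k in sequentially. S k \<in> L2 \<P>" using X unfolding L2_tendsto_def by blast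
    then show ?thesis
    proof eventually_elim
      fix k assume "S k \<in> L2 \<P>"
      then obtain Z where Z: "Z \<in> borel_measurable borel" "quasi_surely \<P> (\<lambda>\<omega>. S k \<omega> = Z \<omega>)" unfolding L2_def by blast
      have "L2_norm_sq \<P> (\<lambda>\<omega>. X' \<omega> - Y' \<omega>) = L2_norm_sq \<P> (\<lambda>\<omega>. (X' \<omega> - Z \<omega>) + (Z \<omega> - Y' \<omega>))" by simp
      also have "\<dots> \<le> 2 * L2_norm_sq \<P> (\<lambda>\<omega>. X' \<omega> - Z \<omega>) + 2 * L2_norm_sq \<P> (\<lambda>\<omega>. Z \<omega> - Y' \<omega>)"
        by (rule L2_norm_sq_add_le) (use X' Y' Z in measurable)
      also have "L2_norm_sq \<P> (\<lambda>\<omega>. X' \<omega> - Z \<omega>) = L2_norm_sq \<P> (\<lambda>\<omega>. Z \<omega> - X' \<omega>)"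
        unfolding L2_norm_sq_def by (simp add: abs_minus_commute)
      also have "\<dots> = L2_norm_sq \<P> (\<lambda>\<omega>. S k \<omega> - X \<omega>)"
        by (intro L2_norm_sq_cong quasi_surely_mono[OF quasi_surely_conj[OF Z(2) X'(2)]]) simp
      also have "L2_norm_sq \<P> (\<lambda>\<omega>. Z \<omega> - Y' \<omega>) = L2_norm_sq \<P> (\<lambda>\<omega>. S k \<omega> - Y \<omega>)"
        by (intro L2_norm_sq_cong quasi_surely_mono[OF quasi_surely_conj[OF Z(2) Y'(2)]]) simp
      finally show "L2_norm_sq \<P> (\<lambda>\<omega>. X' \<omega> - Y' \<omega>) \<le> 2 * L2_norm_sq \<P> (\<lambda>\<omega>. S k \<omega> - X \<omega>) + 2 * L2_norm_sq \<P> (\<lambda>\<omega>. S k \<omega> - Y \<omega>)" .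
    qed
  qed
  have "(\<lambda>k. 2 * L2_norm_sq \<P> (\<lambda>\<omega>. S k \<omega> - X \<omega>) + 2 * L2_norm_sq \<P> (\<lambda>\<omega>. S k \<omega> - Y \<omega>)) \<longlonglongrightarrow> 2 * 0 + 2 * 0"
    using X Y unfolding L2_tendsto_def by (intro tendsto_add ennreal_tendsto_cmult) auto
  from tendsto_lowerbound[OF this ev] have "L2_norm_sq \<P> (\<lambda>\<omega>. X' \<omega> - Y' \<omega>) = 0" by simp
  then have "quasi_surely \<P> (\<lambda>\<omega>. X' \<omega> - Y' \<omega> = 0)"
    by (intro L2_norm_sq_eq_0) (use X' Y' in measurable)
  from quasi_surely_conj[OF this quasi_surely_conj[OF X'(2) Y'(2)]] show ?thesis
    by (rule quasi_surely_mono) simp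
qed

text \<open>Each \<open>Q t\<close> has a measurable version off a polar set that depends on t.
  Rational times involve only countably many such sets, and path continuity reaches the other times.
  On the collected polar set the new process is put equal to 0.\<close>

lemma nice_quadratic_variation:
  assumes Q: "quadratic_variation \<P> Q"
  shows "\<exists>Q'. increasing_process Q' \<and> quasi_surely \<P> (\<lambda>\<omega>. \<forall>t\<ge>0. Q t \<omega> = Q' t \<omega>)"
proof -
  have "\<forall>q::rat. \<exists>Y\<in>borel_measurable borel. 0 \<le> q \<longrightarrow> quasi_surely \<P> (\<lambda>\<omega>. Q (of_rat q) \<omega> = Y \<omega>)"
  proof
    fix q :: rat
    show "\<exists>Y\<in>borel_measurable borel. 0 \<le> q \<longrightarrow> quasi_surely \<P> (\<lambda>\<omega>. Q (of_rat q) \<omega> = Y \<omega>)"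
    proof (cases "0 \<le> q")
      case True
      then have "(0::real) \<le> of_rat q" by simp
      then have "Q (of_rat q) \<in> L2 \<P>" using Q unfolding quadratic_variation_def by blast
      then show ?thesis unfolding L2_def by blast
    next
      case False
      then show ?thesis by (intro bexI[of _ "\<lambda>_. 0"]) auto
    qed
  qed
  then obtain Y where Y: "\<And>q. Y q \<in> borel_measurable borel" "\<And>q. 0 \<le> q \<Longrightarrow> quasi_surely \<P> (\<lambda>\<omega>. Q (of_rat q) \<omega> = Y q \<omega>)"
    by metis
  have 1: "quasi_surely \<P> (\<lambda>\<omega>. \<forall>q. 0 \<le> q \<longrightarrow> Q (of_rat q) \<omega> = Y q \<omega>)"
  proof (rule quasi_surely_all_countable)
    fix q
    show "quasi_surely \<P> (\<lambda>\<omega>. 0 \<le> q \<longrightarrow> Q (of_rat q) \<omega> = Y q \<omega>)"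
    proof (cases "0 \<le> q")
      case True
      show ?thesis by (rule quasi_surely_mono[OF Y(2)[OF True]]) simp
    next
      case False
      then show ?thesis by (intro quasi_surely_UNIV) simp
    qed
  qed
  have 2: "quasi_surely \<P> (\<lambda>\<omega>. continuous_on {0..} (\<lambda>t. Q t \<omega>) \<and> mono_on {0..} (\<lambda>t. Q t \<omega>))"
    using Q unfolding quadratic_variation_def by blast
  \<comment> \<open>The partition of [0, 0] without cells has the empty sum 0, so the defining limit
    forces Q 0 = 0 quasi-surely.\<close>
  have small: "L2_norm_sq \<P> (Q 0) < e" if e: "0 < e" for e
  proof -
    obtain \<delta> where \<delta>: "\<And>n \<tau>. partition_of 0 n \<tau> \<and> (\<forall>j<n. \<tau> (Suc j) - \<tau> j < \<delta>) \<Longrightarrow>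
           L2_norm_sq \<P> (\<lambda>\<omega>. (\<Sum>j<n. (B (\<tau> (Suc j)) \<omega> - B (\<tau> j) \<omega>)\<^sup>2) - Q 0 \<omega>) < e"
      using Q e unfolding quadratic_variation_def by (meson order_refl)
    show ?thesis using \<delta>[of 0 "\<lambda>_. 0"] by (simp add: partition_of_def L2_norm_sq_def)
  qed
  have "L2_norm_sq \<P> (Q 0) = 0"
    using small[of "L2_norm_sq \<P> (Q 0)"] by (cases "L2_norm_sq \<P> (Q 0) = 0") (auto simp: zero_less_iff_neq_zero)
  moreover have "L2_norm_sq \<P> (Q 0) = L2_norm_sq \<P> (Y 0)"
    using Y(2)[of 0] by (intro L2_norm_sq_cong) simp
  ultimately have "quasi_surely \<P> (\<lambda>\<omega>. Y 0 \<omega> = 0)" by (intro L2_norm_sq_eq_0 Y) simp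
  from quasi_surely_conj[OF this quasi_surely_conj[OF 1 2]] obtain N where N: "polar \<P> N"
    and NQ: "\<And>\<omega> q. \<omega> \<notin> N \<Longrightarrow> 0 \<le> q \<Longrightarrow> Q (of_rat q) \<omega> = Y q \<omega>" "\<And>\<omega>. \<omega> \<notin> N \<Longrightarrow> Y 0 \<omega> = 0"
      "\<And>\<omega>. \<omega> \<notin> N \<Longrightarrow> continuous_on {0..} (\<lambda>t. Q t \<omega>)" "\<And>\<omega>. \<omega> \<notin> N \<Longrightarrow> mono_on {0..} (\<lambda>t. Q t \<omega>)"
    unfolding quasi_surely_def by blast
  have [measurable]: "N \<in> sets borel" using N by (simp add: polar_iff)
  define Q' where "Q' t \<omega> = (if \<omega> \<in> N then 0 else Q (max 0 t) \<omega>)" for t \<omega>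
  have cont: "continuous_on UNIV (\<lambda>t. Q' t \<omega>)" for \<omega>
  proof (cases "\<omega> \<in> N")
    case False
    have "continuous_on UNIV (\<lambda>t. Q (max 0 t) \<omega>)"
      by (rule continuous_on_compose2[OF NQ(3)[OF False]]) (auto intro!: continuous_intros)
    then show ?thesis using False by (simp add: Q'_def)
  qed (simp add: Q'_def)
  have rat: "Q' (of_rat q) \<in> borel_measurable borel" if "0 \<le> q" for q
  proof -
    have "Q' (of_rat q) = (\<lambda>\<omega>. if \<omega> \<in> N then 0 else Y q \<omega>)"
      using that NQ(1) by (auto simp: Q'_def fun_eq_iff)
    then show ?thesis using Y(1)[of q] by simp
  qed
  have "increasing_process Q'"
  proof
    fix t s :: real and \<omega>
    show "Q' t \<in> borel_measurable borel"
    proof (rule borel_measurable_LIMSEQ_real)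
      show "(\<lambda>n. Q' (of_int \<lfloor>of_nat (Suc n) * max 0 t\<rfloor> / of_nat (Suc n)) \<omega>) \<longlonglongrightarrow> Q' t \<omega>" for \<omega>
      proof -
        have "(\<lambda>n. Q' (of_int \<lfloor>of_nat (Suc n) * max 0 t\<rfloor> / of_nat (Suc n)) \<omega>) \<longlonglongrightarrow> Q' (max 0 t) \<omega>"
          by (rule continuous_on_tendsto_compose[OF cont floor_grid_tendsto]) auto
        moreover have "Q' (max 0 t) \<omega> = Q' t \<omega>" by (simp add: Q'_def)
        ultimately show ?thesis by simp
      qed
      fix n
      \<comment> \<open>The rounded times are nonnegative rationals, where measurability is already
        known.\<close>
      have "(of_int \<lfloor>of_nat (Suc n) * max 0 t\<rfloor> / of_nat (Suc n) :: real) = of_rat (of_int \<lfloor>real (Suc n) * max 0 t\<rfloor> / of_nat (Suc n))"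
        by (simp add: of_rat_divide of_rat_add)
      moreover have "(0::rat) \<le> of_int \<lfloor>real (Suc n) * max 0 t\<rfloor> / of_nat (Suc n)"
        by (intro divide_nonneg_nonneg) (auto simp: zero_le_mult_iff)
      ultimately show "Q' (of_int \<lfloor>of_nat (Suc n) * max 0 t\<rfloor> / of_nat (Suc n)) \<in> borel_measurable borel"
        using rat by (metis of_nat_Suc)
    qed
    have "Q' (max 0 u) \<omega> = Q' u \<omega>" for u by (simp add: Q'_def)
    then show "continuous_on UNIV (\<lambda>t. Q' (max 0 t) \<omega>)" by (simp add: cont)
    show "Q' s \<omega> \<le> Q' t \<omega>" if "0 \<le> s" "s \<le> t"
      using that NQ(4)[of \<omega>] by (auto simp: Q'_def mono_on_def)
    show "Q' 0 \<omega> = 0" using NQ(1)[of \<omega> 0] NQ(2)[of \<omega>] by (auto simp: Q'_def)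
  qed
  moreover have "quasi_surely \<P> (\<lambda>\<omega>. \<forall>t\<ge>0. Q t \<omega> = Q' t \<omega>)"
    unfolding quasi_surely_def using N by (intro exI[of _ N]) (auto simp: Q'_def)
  ultimately show ?thesis by blast
qed

lemma law_quadratic_variation:
  assumes G: "G_expectation \<sigma>l \<sigma>u E" and Q: "quadratic_variation \<P> Q" and P: "P \<in> \<P>"
    and Q': "increasing_process Q'" "quasi_surely \<P> (\<lambda>\<omega>. \<forall>t\<ge>0. Q t \<omega> = Q' t \<omega>)"
  shows "quadratic_variation_law P (\<sigma>u\<^sup>2) Q'"
proof -
  interpret martingale_law P "\<sigma>u\<^sup>2" by (rule represents_martingale_law[OF G R P])
  interpret increasing_process Q' by (rule Q')
  show ?thesis
  proof unfold_locales
    fix t :: real and e :: ennreal assume t: "0 \<le> t" and e: "0 < e"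
    obtain \<delta> where \<delta>: "\<delta> > 0" "\<And>n \<tau>. partition_of t n \<tau> \<Longrightarrow> (\<forall>j<n. \<tau> (Suc j) - \<tau> j < \<delta>) \<Longrightarrow>
           L2_norm_sq \<P> (\<lambda>\<omega>. (\<Sum>j<n. (B (\<tau> (Suc j)) \<omega> - B (\<tau> j) \<omega>)\<^sup>2) - Q t \<omega>) < e"
      using Q t e unfolding quadratic_variation_def by meson
    have "(\<integral>\<^sup>+\<omega>. ennreal ((S \<omega> - Q' t \<omega>)\<^sup>2) \<partial>P) \<le> L2_norm_sq \<P> (\<lambda>\<omega>. S \<omega> - Q t \<omega>)" for S
    proof -
      have "(\<integral>\<^sup>+\<omega>. ennreal ((S \<omega> - Q' t \<omega>)\<^sup>2) \<partial>P) = (\<integral>\<^sup>+\<omega>. ennreal (\<bar>S \<omega> - Q t \<omega>\<bar>\<^sup>2) \<partial>P)"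
        using quasi_surely_AE[OF Q'(2) P] t by (intro nn_integral_cong_AE) (auto elim!: eventually_mono)
      then show ?thesis using le_upper_expectation[OF P, of "\<lambda>\<omega>. ennreal (\<bar>S \<omega> - Q t \<omega>\<bar>\<^sup>2)"] by (simp add: L2_norm_sq_def)
    qed
    then show "\<exists>\<delta>>0. \<forall>n \<tau>. partition_of t n \<tau> \<and> (\<forall>j<n. \<tau> (Suc j) - \<tau> j < \<delta>) \<longrightarrow>
      (\<integral>\<^sup>+\<omega>. ennreal (((\<Sum>j<n. (B (\<tau> (Suc j)) \<omega> - B (\<tau> j) \<omega>)\<^sup>2) - Q' t \<omega>)\<^sup>2) \<partial>P) < e"
      using \<delta> by (meson order_le_less_trans)
  qed
qed

end

lemma dQ_cong: "(\<And>t. 0 \<le> t \<Longrightarrow> Q t \<omega> = Q' t \<omega>) \<Longrightarrow> dQ Q \<omega> = dQ Q' \<omega>"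
  unfolding dQ_def by (rule arg_cong[where f=interval_measure]) (simp add: fun_eq_iff)

lemma (in increasing_process) measurable_local_time:
  assumes "0 \<le> t" shows "local_time Q a t \<in> borel_measurable borel"
proof -
  have "approx_local_time Q a t \<epsilon> \<in> borel_measurable borel" for \<epsilon>
    using measurable_occupation[OF assms, of a \<epsilon>] unfolding approx_local_time_def[abs_def] by measurable
  then have "(\<lambda>\<omega>. limsup (\<lambda>k. ereal (approx_local_time Q a t ((1 / 16) ^ k) \<omega>))) \<in> borel_measurable borel"
    by (intro borel_measurable_limsup) simp
  then show ?thesis unfolding local_time_def[abs_def] by measurable
qed

text \<open>Monotonicity of the upper limits passes to the reals only where they are finite, since
  \<open>real_of_ereal\<close> sends infinity to 0. By monotonicity, finiteness at integer times is
  enough.\<close>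

lemma (in increasing_process) local_time_mono:
  assumes fin: "\<And>n::nat. limsup (\<lambda>k. ereal (approx_local_time Q a (real n) ((1 / 16) ^ k) \<omega>)) < \<infinity>"
  shows "mono_on {0..} (\<lambda>t. local_time Q a t \<omega>)"
proof (rule mono_onI)
  fix s t :: real assume st: "s \<in> {0..}" "t \<in> {0..}" "s \<le> t"
  let ?l = "\<lambda>t. limsup (\<lambda>k. ereal (approx_local_time Q a t ((1 / 16) ^ k) \<omega>))"
  have mono: "?l u \<le> ?l v" if "0 \<le> u" "u \<le> v" for u v
    using occupation_mono[OF that]
    by (intro Limsup_mono always_eventually) (auto simp: approx_local_time_def intro!: divide_right_mono mult_left_mono)
  have ge: "0 \<le> ?l u" if "0 \<le> u" for u
  proof -
    have "limsup (\<lambda>k::nat. 0 :: ereal) \<le> ?l u"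
      using occupation_nn(2)[OF that] by (intro Limsup_mono always_eventually) (auto simp: approx_local_time_def)
    then show ?thesis by (simp add: Limsup_const)
  qed
  obtain n where n: "t \<le> real n" using real_arch_simple by blast
  have "?l t < \<infinity>" using mono[OF _ n] st fin[of n] by (auto intro: le_less_trans)
  then have "\<bar>?l t\<bar> \<noteq> \<infinity>" using ge[of t] st by auto
  then show "local_time Q a s \<omega> \<le> local_time Q a t \<omega>"
    unfolding local_time_def using st ge[of s] mono[of s t] by (intro real_of_ereal_positive_mono) auto
qed

theorem theorem4p9:
  fixes \<sigma>l \<sigma>u a :: real
    and E :: "(cpath \<Rightarrow> real) \<Rightarrow> real"
    and \<P> :: "cpath measure set"
    and Q :: "real \<Rightarrow> cpath \<Rightarrow> real"
  assumes "0 \<le> \<sigma>l" and "\<sigma>l \<le> \<sigma>u"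
    and "G_expectation \<sigma>l \<sigma>u E"
    and "represents \<P> E"
    and "quadratic_variation \<P> Q"
  shows "\<exists>L :: real \<Rightarrow> cpath \<Rightarrow> real.
    (\<forall>t\<ge>0.
       L2_tendsto \<P>
         (\<lambda>\<epsilon> \<omega>. 1 / (2 * \<epsilon>) * (LINT s:{0..t}|dQ Q \<omega>. indicator {a - \<epsilon><..<a + \<epsilon>} (B s \<omega>)))
         (L t) (at_right 0) \<and>
       quasi_surely \<P>
         (\<lambda>\<omega>. \<bar>B t \<omega> - a\<bar> =
            \<bar>a\<bar> + stochastic_integral \<P> Q t (\<lambda>s \<omega>. sgn (B s \<omega> - a)) \<omega> + L t \<omega>)) \<and>
    quasi_surely \<P> (\<lambda>\<omega>. mono_on {0..} (\<lambda>t. L t \<omega>))"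
proof -
  note R = assms(4)
  obtain Q' where Q': "increasing_process Q'" "quasi_surely \<P> (\<lambda>\<omega>. \<forall>t\<ge>0. Q t \<omega> = Q' t \<omega>)"
    using nice_quadratic_variation[OF R assms(5)] by blast
  interpret increasing_process Q' by (rule Q')
  have law: "quadratic_variation_law P (\<sigma>u\<^sup>2) Q'" if "P \<in> \<P>" for P
    by (rule law_quadratic_variation[OF R assms(3,5) that Q'])
  have dQ: "quasi_surely \<P> (\<lambda>\<omega>. dQ Q \<omega> = dQ Q' \<omega>)"
    by (rule quasi_surely_mono[OF Q'(2)]) (auto intro: dQ_cong)
  define V where "V = \<sigma>u\<^sup>2"
  \<comment> \<open>The constant of the same name is formally attached to a single measure. Its
    value depends only on V and T, so one number bounds all members of the supremum.\<close>
  define Cauchy_const where "Cauchy_const T = 4 + 64 * (2 + 5 * (V * T))" for T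
  define L where "L t = local_time Q' a t" for t
  have Cauchy_const: "quadratic_variation_law.Cauchy_const V T = Cauchy_const T" if "P \<in> \<P>" for P T
    using law[OF that] by (simp add: Cauchy_const_def quadratic_variation_law.Cauchy_const_def quadratic_variation_law.occupation_const_def V_def)
  have main: "L2_tendsto \<P> (\<lambda>\<epsilon> \<omega>. 1 / (2 * \<epsilon>) * (LINT s:{0..t}|dQ Q \<omega>. indicator {a - \<epsilon><..<a + \<epsilon>} (B s \<omega>))) (L t) (at_right 0)"
     and SI: "quasi_surely \<P> (\<lambda>\<omega>. \<bar>B t \<omega> - a\<bar> = \<bar>a\<bar> + stochastic_integral \<P> Q t (\<lambda>s \<omega>. sgn (B s \<omega> - a)) \<omega> + L t \<omega>)"
    if t: "0 \<le> t" for t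
  proof -
    let ?X = "\<lambda>\<epsilon> \<omega>. 1 / (2 * \<epsilon>) * (LINT s:{0..t}|dQ Q \<omega>. indicator {a - \<epsilon><..<a + \<epsilon>} (B s \<omega>))"
    let ?Y = "approx_local_time Q' a t"
    have Xq: "quasi_surely \<P> (\<lambda>\<omega>. ?X \<epsilon> \<omega> = ?Y \<epsilon> \<omega>)" for \<epsilon>
      by (rule quasi_surely_mono[OF dQ]) (simp add: approx_local_time_def occupation_def)
    have [measurable]: "?Y \<epsilon> \<in> borel_measurable borel" for \<epsilon>
      using measurable_occupation[OF t, of a \<epsilon>] unfolding approx_local_time_def[abs_def] by measurable
    have [measurable]: "L t \<in> borel_measurable borel" unfolding L_def by (rule measurable_local_time[OF t])
    have YL: "L2_norm_sq \<P> (\<lambda>\<omega>. ?Y \<epsilon> \<omega> - L t \<omega>) \<le> ennreal (Cauchy_const t * \<epsilon>)" if \<epsilon>: "0 < \<epsilon>" "\<epsilon> \<le> 1" for \<epsilon>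
      unfolding L2_norm_sq_def L_def
      using quadratic_variation_law.local_time_L2[OF law \<epsilon> t, of _ a] Cauchy_const
      by (intro upper_expectation_le[OF R]) (simp add: V_def)
    have Y2: "L2_norm_sq \<P> (?Y \<epsilon>) \<le> ennreal (10 * (V * t))" if \<epsilon>: "0 < \<epsilon>" for \<epsilon>
      unfolding L2_norm_sq_def V_def
      using quadratic_variation_law.approx_local_time_sq_le[OF law \<epsilon> t, of _ a]
      by (intro upper_expectation_le[OF R]) simp
    \<comment> \<open>The limit has finite norm because it is at finite distance from the
      approximation at scale 1, the largest scale that the Cauchy estimate admits.\<close>
    have L2L: "L2_norm_sq \<P> (L t) < \<infinity>"
    proof -
      have "L2_norm_sq \<P> (L t) = L2_norm_sq \<P> (\<lambda>\<omega>. ?Y 1 \<omega> + (L t \<omega> - ?Y 1 \<omega>))" by (simp add: L2_norm_sq_def)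
      also have "\<dots> \<le> 2 * L2_norm_sq \<P> (?Y 1) + 2 * L2_norm_sq \<P> (\<lambda>\<omega>. L t \<omega> - ?Y 1 \<omega>)"
        by (rule L2_norm_sq_add_le[OF R]) measurable
      also have "L2_norm_sq \<P> (\<lambda>\<omega>. L t \<omega> - ?Y 1 \<omega>) = L2_norm_sq \<P> (\<lambda>\<omega>. ?Y 1 \<omega> - L t \<omega>)"
        by (simp add: L2_norm_sq_def abs_minus_commute)
      also have "2 * L2_norm_sq \<P> (?Y 1) + 2 * \<dots> \<le> 2 * ennreal (10 * (V * t)) + 2 * ennreal (Cauchy_const t * 1)"
        by (intro add_mono mult_left_mono YL Y2) auto
      also have "\<dots> < \<infinity>" by (simp add: ennreal_mult_less_top)
      finally show ?thesis .
    qed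
    have "((\<lambda>\<epsilon>. L2_norm_sq \<P> (\<lambda>\<omega>. ?X \<epsilon> \<omega> - L t \<omega>)) \<longlongrightarrow> 0) (at_right 0)"
    proof (rule tendsto_sandwich[OF _ _ tendsto_const])
      have "((\<lambda>\<epsilon>. Cauchy_const t * \<epsilon>) \<longlongrightarrow> Cauchy_const t * 0) (at_right 0)" by (intro tendsto_intros)
      from tendsto_ennrealI[OF this] show "((\<lambda>\<epsilon>. ennreal (Cauchy_const t * \<epsilon>)) \<longlongrightarrow> 0) (at_right 0)" by simp
      have "\<forall>\<^sub>F \<epsilon> in at_right (0::real). 0 < \<epsilon> \<and> \<epsilon> \<le> 1"
        by (rule eventually_at_rightI[of 0 1]) auto
      then show "\<forall>\<^sub>F \<epsilon> in at_right 0. L2_norm_sq \<P> (\<lambda>\<omega>. ?X \<epsilon> \<omega> - L t \<omega>) \<le> ennreal (Cauchy_const t * \<epsilon>)"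
      proof eventually_elim
        case (elim \<epsilon>)
        have "L2_norm_sq \<P> (\<lambda>\<omega>. ?X \<epsilon> \<omega> - L t \<omega>) = L2_norm_sq \<P> (\<lambda>\<omega>. ?Y \<epsilon> \<omega> - L t \<omega>)"
          by (intro L2_norm_sq_cong[OF R] quasi_surely_mono[OF Xq]) simp
        then show ?case using YL elim by simp
      qed
    qed simp
    moreover have "\<forall>\<^sub>F \<epsilon> in at_right 0. ?X \<epsilon> \<in> L2 \<P>"
    proof (rule eventually_at_rightI[of 0 1])
      fix \<epsilon> :: real assume "\<epsilon> \<in> {0<..<1}"
      then have "L2_norm_sq \<P> (?Y \<epsilon>) < \<infinity>" using Y2[of \<epsilon>] by (auto intro: le_less_trans)
      then have "?Y \<epsilon> \<in> L2 \<P>" by (intro L2_I[OF R]) measurable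
      then show "?X \<epsilon> \<in> L2 \<P>" by (rule L2_cong[OF R _ Xq])
    qed simp
    moreover have "L t \<in> L2 \<P>" by (rule L2_I[OF R _ L2L]) measurable
    ultimately show "L2_tendsto \<P> ?X (L t) (at_right 0)" unfolding L2_tendsto_def by blast
    \<comment> \<open>The candidate is Tanaka's formula solved for the stochastic integral.\<close>
    define I where "I \<omega> = \<bar>B t \<omega> - a\<bar> - \<bar>a\<bar> - L t \<omega>" for \<omega>
    have [measurable]: "I \<in> borel_measurable borel" unfolding I_def by measurable
    have I2: "L2_norm_sq \<P> I < \<infinity>"
    proof -
      have "L2_norm_sq \<P> I \<le> 2 * L2_norm_sq \<P> (\<lambda>\<omega>. \<bar>B t \<omega> - a\<bar> - \<bar>a\<bar>) + 2 * L2_norm_sq \<P> (\<lambda>\<omega>. - L t \<omega>)"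
        using L2_norm_sq_add_le[OF R, of "\<lambda>\<omega>. \<bar>B t \<omega> - a\<bar> - \<bar>a\<bar>" "\<lambda>\<omega>. - L t \<omega>"] by (simp add: I_def[abs_def])
      also have "\<dots> \<le> 2 * ennreal (V * t) + 2 * L2_norm_sq \<P> (L t)"
      proof (intro add_mono mult_left_mono)
        show "L2_norm_sq \<P> (\<lambda>\<omega>. \<bar>B t \<omega> - a\<bar> - \<bar>a\<bar>) \<le> ennreal (V * t)"
          unfolding L2_norm_sq_def
        proof (rule upper_expectation_le[OF R])
          fix P assume P: "P \<in> \<P>"
          interpret quadratic_variation_law P "\<sigma>u\<^sup>2" Q' by (rule law[OF P])
          have "(\<integral>\<^sup>+\<omega>. ennreal (\<bar>\<bar>B t \<omega> - a\<bar> - \<bar>a\<bar>\<bar>\<^sup>2) \<partial>P) \<le> (\<integral>\<^sup>+\<omega>. ennreal ((B t \<omega>)\<^sup>2) \<partial>P)"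
            by (intro nn_integral_mono ennreal_leI) (simp add: abs_le_square_iff[symmetric])
          also have "\<dots> \<le> ennreal (V * t)" using B_sq_le[OF t] by (simp add: V_def)
          finally show "(\<integral>\<^sup>+\<omega>. ennreal (\<bar>\<bar>B t \<omega> - a\<bar> - \<bar>a\<bar>\<bar>\<^sup>2) \<partial>P) \<le> ennreal (V * t)" .
        qed
      qed (auto simp: L2_norm_sq_def)
      also have "\<dots> < \<infinity>" using L2L by (simp add: ennreal_mult_less_top)
      finally show ?thesis .
    qed
    let ?sgn = "\<lambda>s \<omega>. sgn (B s \<omega> - a)"
    have M2: "M2_norm_sq \<P> Q t (\<lambda>s \<omega>. \<eta> s \<omega> - \<zeta> s \<omega>) = upper_expectation \<P> (sq_dist Q' t \<eta> \<zeta>)" for \<eta> \<zeta>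
      unfolding M2_norm_sq_def by (intro upper_expectation_cong[OF R] quasi_surely_mono[OF dQ]) (simp add: sq_dist_def)
    have SI2: "L2_norm_sq \<P> (\<lambda>\<omega>. simple_integral n \<tau> \<xi> \<omega> - I \<omega>) \<le> 8 * M2_norm_sq \<P> Q t (\<lambda>s \<omega>. simple_process n \<tau> \<xi> s \<omega> - ?sgn s \<omega>)"
      if S: "simple_data t n \<tau> \<xi>" for n \<tau> \<xi>
      unfolding L2_norm_sq_def
    proof (rule upper_expectation_le[OF R])
      fix P assume P: "P \<in> \<P>"
      have "(\<integral>\<^sup>+\<omega>. ennreal (\<bar>simple_integral n \<tau> \<xi> \<omega> - I \<omega>\<bar>\<^sup>2) \<partial>P) \<le> 8 * (\<integral>\<^sup>+\<omega>. sq_dist Q' t (simple_process n \<tau> \<xi>) ?sgn \<omega> \<partial>P)"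
        using quadratic_variation_law.tanaka_L2[OF law[OF P] t S, of a] by (simp add: I_def L_def)
      also have "\<dots> \<le> 8 * upper_expectation \<P> (sq_dist Q' t (simple_process n \<tau> \<xi>) ?sgn)"
        by (intro mult_left_mono le_upper_expectation[OF R] P) simp
      finally show "(\<integral>\<^sup>+\<omega>. ennreal (\<bar>simple_integral n \<tau> \<xi> \<omega> - I \<omega>\<bar>\<^sup>2) \<partial>P) \<le> 8 * M2_norm_sq \<P> Q t (\<lambda>s \<omega>. simple_process n \<tau> \<xi> s \<omega> - ?sgn s \<omega>)"
        by (simp add: M2)
    qed
    \<comment> \<open>The definition of the integral quantifies over all approximating sequences, so
      each of them has to lead to \<open>I\<close>.\<close>
    have lim: "L2_tendsto \<P> (\<lambda>k. simple_integral (n k) (\<tau> k) (\<xi> k)) I sequentially"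
      if ap: "approximates \<P> Q t ?sgn n \<tau> \<xi>" for n \<tau> \<xi>
    proof -
      have S: "simple_data t (n k) (\<tau> k) (\<xi> k)" for k using ap by (simp add: approximates_def)
      have "(\<lambda>k. M2_norm_sq \<P> Q t (\<lambda>s \<omega>. simple_process (n k) (\<tau> k) (\<xi> k) s \<omega> - ?sgn s \<omega>)) \<longlonglongrightarrow> 0"
        using ap by (simp add: approximates_def)
      then have "(\<lambda>k. 8 * M2_norm_sq \<P> Q t (\<lambda>s \<omega>. simple_process (n k) (\<tau> k) (\<xi> k) s \<omega> - ?sgn s \<omega>)) \<longlonglongrightarrow> 8 * 0"
        by (intro ennreal_tendsto_cmult) auto
      then have lim8: "(\<lambda>k. 8 * M2_norm_sq \<P> Q t (\<lambda>s \<omega>. simple_process (n k) (\<tau> k) (\<xi> k) s \<omega> - ?sgn s \<omega>)) \<longlonglongrightarrow> 0"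
        by simp
      have lim: "(\<lambda>k. L2_norm_sq \<P> (\<lambda>\<omega>. simple_integral (n k) (\<tau> k) (\<xi> k) \<omega> - I \<omega>)) \<longlonglongrightarrow> 0"
      proof (rule tendsto_sandwich[OF _ _ tendsto_const lim8])
        show "\<forall>\<^sub>F k in sequentially. L2_norm_sq \<P> (\<lambda>\<omega>. simple_integral (n k) (\<tau> k) (\<xi> k) \<omega> - I \<omega>)
          \<le> 8 * M2_norm_sq \<P> Q t (\<lambda>s \<omega>. simple_process (n k) (\<tau> k) (\<xi> k) s \<omega> - ?sgn s \<omega>)"
          by (intro always_eventually allI SI2 S)
      qed simp
      from order_tendstoD(2)[OF lim, of 1]
      have "\<forall>\<^sub>F k in sequentially. L2_norm_sq \<P> (\<lambda>\<omega>. simple_integral (n k) (\<tau> k) (\<xi> k) \<omega> - I \<omega>) < 1" by simp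
      then have "\<forall>\<^sub>F k in sequentially. simple_integral (n k) (\<tau> k) (\<xi> k) \<in> L2 \<P>"
      proof eventually_elim
        case (elim k)
        note [measurable] = measurable_simple_integral[OF S]
        have "L2_norm_sq \<P> (simple_integral (n k) (\<tau> k) (\<xi> k)) = L2_norm_sq \<P> (\<lambda>\<omega>. (simple_integral (n k) (\<tau> k) (\<xi> k) \<omega> - I \<omega>) + I \<omega>)"
          by (simp add: L2_norm_sq_def)
        also have "\<dots> \<le> 2 * L2_norm_sq \<P> (\<lambda>\<omega>. simple_integral (n k) (\<tau> k) (\<xi> k) \<omega> - I \<omega>) + 2 * L2_norm_sq \<P> I"
          by (rule L2_norm_sq_add_le[OF R]) measurable
        also have "\<dots> < \<infinity>" using elim I2 by (auto simp: ennreal_mult_less_top intro: less_trans)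
        finally show ?case by (intro L2_I[OF R]) measurable
      qed
      moreover have "I \<in> L2 \<P>" by (rule L2_I[OF R _ I2]) measurable
      ultimately show ?thesis using lim unfolding L2_tendsto_def by blast
    qed
    \<comment> \<open>An explicit approximating sequence shows membership in the completion, and
      along it the limits are compared below; without one, the condition over all sequences would be
      vacuous.\<close>
    have ap: "approximates \<P> Q t ?sgn (sgn_steps t) (sgn_grid t) (sgn_coeff a t)"
      unfolding approximates_def
    proof (intro conjI allI simple_data_sgn t)
      define c where "c = 2 * V\<^sup>2 * t\<^sup>2 + 4 * (2 + 5 * (V * t))"
      have "M2_norm_sq \<P> Q t (\<lambda>s \<omega>. simple_process (sgn_steps t k) (sgn_grid t k) (sgn_coeff a t k) s \<omega> - ?sgn s \<omega>) \<le> ennreal (c / real (Suc k))" for k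
        unfolding M2
      proof (rule upper_expectation_le[OF R])
        fix P assume P: "P \<in> \<P>"
        show "(\<integral>\<^sup>+\<omega>. sq_dist Q' t (simple_process (sgn_steps t k) (sgn_grid t k) (sgn_coeff a t k)) ?sgn \<omega> \<partial>P) \<le> ennreal (c / real (Suc k))"
          using quadratic_variation_law.sgn_approximation[OF law[OF P] t, of k a]
          by (simp add: c_def V_def quadratic_variation_law.occupation_const_def[OF law[OF P]])
      qed
      moreover have "(\<lambda>k. c / real (Suc k)) \<longlonglongrightarrow> 0" using LIMSEQ_Suc[OF lim_const_over_n[of c]] by simp
      from tendsto_ennrealI[OF this] have "(\<lambda>k. ennreal (c / real (Suc k))) \<longlonglongrightarrow> 0" by simp
      ultimately show "(\<lambda>k. M2_norm_sq \<P> Q t (\<lambda>s \<omega>. simple_process (sgn_steps t k) (sgn_grid t k) (sgn_coeff a t k) s \<omega> - ?sgn s \<omega>)) \<longlonglongrightarrow> 0"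
        by (intro tendsto_sandwich[OF _ _ tendsto_const \<open>(\<lambda>k. ennreal (c / real (Suc k))) \<longlonglongrightarrow> 0\<close>]) auto
    qed
    have "has_stochastic_integral \<P> Q t ?sgn I"
      unfolding has_stochastic_integral_def M2_star_def using ap lim by blast
    \<comment> \<open>\<open>stochastic_integral\<close> is an arbitrary choice. The existence of
      \<open>I\<close> makes the chosen variable a stochastic integral, and uniqueness of L2 limits
      identifies the two quasi-surely.\<close>
    then have "has_stochastic_integral \<P> Q t ?sgn (stochastic_integral \<P> Q t ?sgn)"
      unfolding stochastic_integral_def by (rule someI[of "has_stochastic_integral \<P> Q t ?sgn"])
    then have "L2_tendsto \<P> (\<lambda>k. simple_integral (sgn_steps t k) (sgn_grid t k) (sgn_coeff a t k)) (stochastic_integral \<P> Q t ?sgn) sequentially"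
      using ap unfolding has_stochastic_integral_def by blast
    from L2_limit_unique[OF R this lim[OF ap]] show "quasi_surely \<P> (\<lambda>\<omega>. \<bar>B t \<omega> - a\<bar> = \<bar>a\<bar> + stochastic_integral \<P> Q t ?sgn \<omega> + L t \<omega>)"
      by (rule quasi_surely_mono) (simp add: I_def)
  qed
  \<comment> \<open>Monotonicity has to hold for all times off a single polar set; finiteness at
    integer times is a countable condition that achieves this.\<close>
  have "quasi_surely \<P> (\<lambda>\<omega>. \<forall>n::nat. limsup (\<lambda>k. ereal (approx_local_time Q' a (real n) ((1 / 16) ^ k) \<omega>)) < \<infinity>)"
  proof (intro quasi_surely_all_countable[OF R] quasi_surelyI[OF R])
    fix n :: nat
    have [measurable]: "approx_local_time Q' a (real n) \<epsilon> \<in> borel_measurable borel" for \<epsilon>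
      using measurable_occupation[of "real n" a \<epsilon>] unfolding approx_local_time_def[abs_def] by measurable
    have "(\<lambda>\<omega>. limsup (\<lambda>k. ereal (approx_local_time Q' a (real n) ((1 / 16) ^ k) \<omega>))) \<in> borel_measurable borel"
      by (intro borel_measurable_limsup) simp
    then show "{\<omega>. \<not> limsup (\<lambda>k. ereal (approx_local_time Q' a (real n) ((1 / 16) ^ k) \<omega>)) < \<infinity>} \<in> sets borel"
      by measurable
    fix P assume P: "P \<in> \<P>"
    have "AE \<omega> in P. (\<lambda>k. approx_local_time Q' a (real n) ((1 / 16) ^ k) \<omega>) \<longlonglongrightarrow> local_time Q' a (real n) \<omega>"
      by (rule quadratic_variation_law.local_time_AE[OF law[OF P]]) simp
    then show "AE \<omega> in P. limsup (\<lambda>k. ereal (approx_local_time Q' a (real n) ((1 / 16) ^ k) \<omega>)) < \<infinity>"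
    proof eventually_elim
      case (elim \<omega>)
      then have "(\<lambda>k. ereal (approx_local_time Q' a (real n) ((1 / 16) ^ k) \<omega>)) \<longlonglongrightarrow> ereal (local_time Q' a (real n) \<omega>)" by simp
      from lim_imp_Limsup[OF sequentially_bot this] show ?case by simp
    qed
  qed
  then have "quasi_surely \<P> (\<lambda>\<omega>. mono_on {0..} (\<lambda>t. L t \<omega>))"
    by (rule quasi_surely_mono) (auto simp: L_def intro: local_time_mono)
  then show ?thesis using main SI by (intro exI[of _ L]) blast
qed

end
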